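(* Let $\alpha\in(0,1)$. Under the moment assumption stated in the context, when $\mathcal{H}_0:\ \bm{\Sigma}_x\bm{\Sigma}_y=\bm{\Sigma}_y\bm{\Sigma}_x$ is true, the test statistic $T$ defined in the context satisfies $$\mathrm{P}\left(T>\Phi^{-1}(1-\alpha)\right)\to\alpha$$ as $p\to\infty$ with $m,n\asymp p^\delta$, $0<\delta<1$, where $\Phi^{-1}$ is the quantile function of the standard normal distribution.
   Context: Let $p$ be a positive integer tending to infinity; for each $p$ let $m,n$ be positive integers and $\bm{\Sigma}_x,\bm{\Sigma}_y$ be $p\times p$ (symmetric) positive definite matrices, all depending on $p$. The notation $n\asymp p^\delta$ means that $n/p^\delta$ is bounded above and bounded away from zero by positive constants; $\delta\in(0,1)$ is fixed. Data: a random sample of size $M=4m$ from $N_p(\bm{\mu}_x,\bm{\Sigma}_x)$, randomly split into four subsamples of size $m$, and, independently, a random sample of size $N=4n$ from $N_p(\bm{\mu}_y,\bm{\Sigma}_y)$, split into four subsamples of size $n$. The scatter matrix of a sample $\bm{v}_1,\dots,\bm{v}_k$ is $\sum_{i=1}^k(\bm{v}_i-\bar{\bm{v}})(\bm{v}_i-\bar{\bm{v}})'$. Let $\bm{T}_{x1},\dots,\bm{T}_{x4}$ and $\bm{T}_{y1},\dots,\bm{T}_{y4}$ be the scatter matrices of the subsamples; they are independent with $\bm{T}_{xk}\sim W_p(m-1,\bm{\Sigma}_x)$ and $\bm{T}_{yk}\sim W_p(n-1,\bm{\Sigma}_y)$ (Wishart distributions). Let $\bm{S}_x$ and $\bm{S}_y$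 be the scatter matrices of the two whole samples (before splitting) divided by $M-1$ and $N-1$, respectively. Define $$\hat\theta=\frac{1}{(m-1)^2(n-1)^2p}\left\{\mathrm{tr}(\bm{T}_{x1}\bm{T}_{x2}\bm{T}_{y1}\bm{T}_{y2})-\mathrm{tr}(\bm{T}_{x3}\bm{T}_{y3}\bm{T}_{x4}\bm{T}_{y4})\right\},$$ $$\hat\sigma_{xx}=\frac{(M-1)^2}{p(M-2)(M+1)}\left[\mathrm{tr}(\bm{S}_x\bm{S}_x)-\frac{\{\mathrm{tr}(\bm{S}_x)\}^2}{M-1}\right],\quad \hat\sigma_{yy}=\frac{(N-1)^2}{p(N-2)(N+1)}\left[\mathrm{tr}(\bm{S}_y\bm{S}_y)-\frac{\{\mathrm{tr}(\bm{S}_y)\}^2}{N-1}\right],$$ $$\hat\sigma_{xy}=\frac1p\mathrm{tr}(\bm{S}_x\bm{S}_y),\qquad T=\frac{(m-1)(n-1)}{p}\,\frac{\hat\theta}{\sqrt{\hat\sigma_{xx}\hat\sigma_{yy}\hat\sigma_{xy}^2+\hat\sigma_{xy}^4}}.$$ Moment assumption: as $p\to\infty$ with $m,n\asymp p^\delta$, for every $k\in\{2,\dots,16\}$ and all $i_1,\dots,i_k\in\{x,y\}$ the limit $\sigma_{i_1\cdots i_k}=\lim_{p\to\infty}\mathrm{tr}(\bm{\Sigma}_{i_1}\cdots\bm{\Sigma}_{i_k})/p$ exists, with $\sigma_{i_1\cdots i_k}\in(0,\infty)$ for $2\le k\le5$ and $\sigma_{i_1\cdots i_k}\in(-\infty,\infty)$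 for $6\le k\le16$. *)

theory Defs
  imports
    "HOL-Probability.Probability"
    "Jordan_Normal_Form.Determinant"
    "Jordan_Normal_Form.Gauss_Jordan_Elimination"
begin

section \<open>Matrices of varying dimension\<close>

definition tr :: "real mat \<Rightarrow> real" where
  "tr A = (\<Sum>i<dim_row A. A $$ (i, i))"

definition pos_def :: "nat \<Rightarrow> real mat \<Rightarrow> bool" where
  "pos_def p A \<longleftrightarrow> A \<in> carrier_mat p p \<and> transpose_mat A = A \<and>
     (\<forall>v \<in> carrier_vec p. v \<noteq> 0\<^sub>v p \<longrightarrow> 0 < scalar_prod v (A *\<^sub>v v))"

datatype pop = PX | PY

definition word_mat :: "nat \<Rightarrow> (pop \<Rightarrow> real mat) \<Rightarrow> pop list \<Rightarrow> real mat" where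
  "word_mat p A w = foldr (\<lambda>i B. A i * B) w (1\<^sub>m p)"

definition pop_cov :: "real mat \<Rightarrow> real mat \<Rightarrow> pop \<Rightarrow> real mat" where
  "pop_cov Sx Sy i = (case i of PX \<Rightarrow> Sx | PY \<Rightarrow> Sy)"

section \<open>The normal distribution\<close>

text \<open>A vector in dimension \<open>p\<close> is carried by a function \<open>nat \<Rightarrow> real\<close> on the indices below \<open>p\<close>, so
  that the product measure is available; \<open>Matrix.vec p\<close> turns it into a vector of the matrix
  library. The density of \<open>N\<^sub>p(\<mu>, S)\<close> is meant for positive definite \<open>S\<close>, for which
  \<open>mat_inverse S\<close> is not \<open>None\<close>.\<close>

abbreviation vec_space :: "nat \<Rightarrow> (nat \<Rightarrow> real) measure" where
  "vec_space p \<equiv> \<Pi>\<^sub>M j\<in>{..<p}. (lborel :: real measure)"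

definition mvn_density :: "nat \<Rightarrow> real Matrix.vec \<Rightarrow> real mat \<Rightarrow> (nat \<Rightarrow> real) \<Rightarrow> real" where
  "mvn_density p \<mu> S x =
     (let d = Matrix.vec p x - \<mu> in
       exp (- scalar_prod d (the (mat_inverse S) *\<^sub>v d) / 2) / sqrt ((2 * pi) ^ p * Determinant.det S))"

definition std_normal_quantile :: "real \<Rightarrow> real" where
  "std_normal_quantile u = Inf {z. u \<le> cdf std_normal_distribution z}"

section \<open>Sampling and random splitting\<close>

text \<open>A split of the sample \<open>1, \<dots>, 4k\<close> into four subsamples of size \<open>k\<close> is encoded by the map that
  sends every observation to the label of its subsample.\<close>

definition splits :: "nat \<Rightarrow> (nat \<Rightarrow> nat) set" where
  "splits k = {c \<in> {1..4 * k} \<rightarrow>\<^sub>E {1..4}. \<forall>l\<in>{1..4}. card {i \<in> {1..4 * k}. c i = l} = k}"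

definition uniform_split :: "'a measure \<Rightarrow> nat \<Rightarrow> ('a \<Rightarrow> nat \<Rightarrow> nat) \<Rightarrow> bool" where
  "uniform_split M k c \<longleftrightarrow>
     c \<in> measurable M (count_space (splits k)) \<and>
     distr M (count_space (splits k)) c = uniform_count_measure (splits k)"

datatype source = XObs nat | YObs nat | XSplit | YSplit

text \<open>The random elements of the experiment have different types, so their joint independence is
  expressed through the \<open>\<sigma>\<close>-algebras they generate.\<close>

definition two_sample_experiment ::
  "'a measure \<Rightarrow> nat \<Rightarrow> nat \<Rightarrow> nat \<Rightarrow> real Matrix.vec \<Rightarrow> real mat \<Rightarrow> real Matrix.vec \<Rightarrow> real mat \<Rightarrow>
   (nat \<Rightarrow> 'a \<Rightarrow> nat \<Rightarrow> real) \<Rightarrow> (nat \<Rightarrow> 'a \<Rightarrow> nat \<Rightarrow> real) \<Rightarrow>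
   ('a \<Rightarrow> nat \<Rightarrow> nat) \<Rightarrow> ('a \<Rightarrow> nat \<Rightarrow> nat) \<Rightarrow> bool" where
  "two_sample_experiment M p m n \<mu>x Sx \<mu>y Sy X Y cx cy \<longleftrightarrow>
     prob_space M \<and>
     (\<forall>i\<in>{1..4 * m}. distributed M (vec_space p) (X i) (mvn_density p \<mu>x Sx)) \<and>
     (\<forall>i\<in>{1..4 * n}. distributed M (vec_space p) (Y i) (mvn_density p \<mu>y Sy)) \<and>
     uniform_split M m cx \<and> uniform_split M n cy \<and>
     prob_space.indep_sets M
       (\<lambda>s. case s of
              XObs i \<Rightarrow> sets (vimage_algebra (space M) (X i) (vec_space p))
            | YObs i \<Rightarrow> sets (vimage_algebra (space M) (Y i) (vec_space p))
            | XSplit \<Rightarrow> sets (vimage_algebra (space M) cx (count_space (splits m)))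
            | YSplit \<Rightarrow> sets (vimage_algebra (space M) cy (count_space (splits n))))
       (XObs ` {1..4 * m} \<union> YObs ` {1..4 * n} \<union> {XSplit, YSplit})"

section \<open>The test statistic\<close>

text \<open>Here \<open>v i j\<close> is the \<open>j\<close>-th coordinate of the \<open>i\<close>-th observation.\<close>

definition sample_mean :: "nat set \<Rightarrow> (nat \<Rightarrow> nat \<Rightarrow> real) \<Rightarrow> nat \<Rightarrow> real" where
  "sample_mean I v j = (\<Sum>i\<in>I. v i j) / card I"

definition scatter :: "nat \<Rightarrow> nat set \<Rightarrow> (nat \<Rightarrow> nat \<Rightarrow> real) \<Rightarrow> real mat" where
  "scatter p I v =
     Matrix.mat p p (\<lambda>(j, k). \<Sum>i\<in>I. (v i j - sample_mean I v j) * (v i k - sample_mean I v k))"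

definition sub_scatter :: "nat \<Rightarrow> nat \<Rightarrow> (nat \<Rightarrow> nat) \<Rightarrow> (nat \<Rightarrow> nat \<Rightarrow> real) \<Rightarrow> nat \<Rightarrow> real mat" where
  "sub_scatter p k c v l = scatter p {i \<in> {1..4 * k}. c i = l} v"

definition sample_cov :: "nat \<Rightarrow> nat \<Rightarrow> (nat \<Rightarrow> nat \<Rightarrow> real) \<Rightarrow> real mat" where
  "sample_cov p K v = (1 / (real K - 1)) \<cdot>\<^sub>m scatter p {1..K} v"

definition theta_hat ::
  "nat \<Rightarrow> nat \<Rightarrow> nat \<Rightarrow> (nat \<Rightarrow> nat) \<Rightarrow> (nat \<Rightarrow> nat) \<Rightarrow>
   (nat \<Rightarrow> nat \<Rightarrow> real) \<Rightarrow> (nat \<Rightarrow> nat \<Rightarrow> real) \<Rightarrow> real" where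
  "theta_hat p m n a b x y =
     (let Tx = sub_scatter p m a x; Ty = sub_scatter p n b y in
       (tr (Tx 1 * Tx 2 * Ty 1 * Ty 2) - tr (Tx 3 * Ty 3 * Tx 4 * Ty 4))
         / ((real m - 1)\<^sup>2 * (real n - 1)\<^sup>2 * real p))"

definition sigma_hat_same :: "nat \<Rightarrow> nat \<Rightarrow> (nat \<Rightarrow> nat \<Rightarrow> real) \<Rightarrow> real" where
  "sigma_hat_same p K v =
     (let S = sample_cov p K v in
       (real K - 1)\<^sup>2 / (real p * (real K - 2) * (real K + 1))
         * (tr (S * S) - (tr S)\<^sup>2 / (real K - 1)))"

definition sigma_hat_cross ::
  "nat \<Rightarrow> nat \<Rightarrow> nat \<Rightarrow> (nat \<Rightarrow> nat \<Rightarrow> real) \<Rightarrow> (nat \<Rightarrow> nat \<Rightarrow> real) \<Rightarrow> real" where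
  "sigma_hat_cross p K L x y = tr (sample_cov p K x * sample_cov p L y) / real p"

definition T_stat ::
  "nat \<Rightarrow> nat \<Rightarrow> nat \<Rightarrow> (nat \<Rightarrow> nat) \<Rightarrow> (nat \<Rightarrow> nat) \<Rightarrow>
   (nat \<Rightarrow> nat \<Rightarrow> real) \<Rightarrow> (nat \<Rightarrow> nat \<Rightarrow> real) \<Rightarrow> real" where
  "T_stat p m n a b x y =
     (let sxx = sigma_hat_same p (4 * m) x;
          syy = sigma_hat_same p (4 * n) y;
          sxy = sigma_hat_cross p (4 * m) (4 * n) x y
      in (real m - 1) * (real n - 1) / real p
           * (theta_hat p m n a b x y / sqrt (sxx * syy * sxy\<^sup>2 + sxy ^ 4)))"

end

theory Submission
  imports Defs
begin

text \<open>
  Subtracting sample means and rotating (Helmert) turns every scatter matrix into \<open>\<Sum>\<^sub>a w\<^sub>a w\<^sub>a'\<close> with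
  independent centred normal vectors \<open>w\<^sub>a\<close>, and for fixed splits the two traces in \<open>\<theta>\<close> become independent.
  Commutation of the covariance matrices makes their expectations equal. Conditionally on the first three
  factors, such a trace is a sum of independent centred quadratic forms plus a remainder that is
  negligible in mean; the conditional variance concentrates around a product of four traces
  because the subsample sizes are of smaller order than \<open>p\<close>. Gaussian vectors are used only through
  rotation invariance: it yields the fourth-moment bounds and hence an explicit estimate for the
  characteristic functions. The estimators in the denominator are consistent in mean, so Levy's continuity
  theorem and Slutsky's argument give the limit for fixed splits. The estimate is uniform in the splits, so
  averaging over the independent random splits preserves it.
\<close>

section \<open>Traces of finite matrices\<close>

text \<open>No norm or eigenvalue of the covariance matrices is controlled, only traces of words
  with two to sixteen letters, and not even the trace of a single covariance matrix. Every estimate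
  is therefore arranged to end in such traces, and every bound that is averaged over a random matrix
  later on is kept linear in that matrix. A trace of four scatter matrices is a sum over cycles of
  four columns, one from each factor, of products of four inner products. When the subsamples are
  small relative to \<open>p\<close>, different cycles are nearly uncorrelated, so the variance is
  about the number of cycles times the traces of the four cyclically adjacent pairs of covariances.
  The order x, x, y, y gives sxx syy sxy^2 and the order x, y, x, y gives sxy^4: these are the two
  terms under the root in \<open>T_stat\<close>. The relative errors are 1 / sqrt k, from averaging
  over k columns, and k / p, from correlations between cycles; they vanish because 0 < \<delta> and
  \<delta> < 1 respectively.\<close>

type_synonym fvec = "nat \<Rightarrow> real"
type_synonym fmat = "nat \<Rightarrow> nat \<Rightarrow> real"

text \<open>Matrices are total functions and only the sums stop at \<open>p\<close>. Associativity
  and transposition then hold as equations without side conditions, so words are normalised by the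
  simplifier; carriers reappear only where \<open>mat_fun\<close> translates from the matrix
  library.\<close>

locale findim = fixes p :: nat
begin

definition dot :: "fvec \<Rightarrow> fvec \<Rightarrow> real" where
  "dot u v = (\<Sum>i<p. u i * v i)"

definition mv :: "fmat \<Rightarrow> fvec \<Rightarrow> fvec" where
  "mv A x = (\<lambda>i. dot (A i) x)"

definition mm :: "fmat \<Rightarrow> fmat \<Rightarrow> fmat" (infixr "\<bowtie>" 70) where
  "A \<bowtie> B = (\<lambda>i j. \<Sum>k<p. A i k * B k j)"

definition mt :: "fmat \<Rightarrow> fmat" where "mt A = (\<lambda>i j. A j i)"

definition tra :: "fmat \<Rightarrow> real" where "tra A = (\<Sum>i<p. A i i)"

definition bil :: "fmat \<Rightarrow> fvec \<Rightarrow> fvec \<Rightarrow> real" where "bil A x y = dot x (mv A y)"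

definition gm :: "nat \<Rightarrow> (nat \<Rightarrow> fvec) \<Rightarrow> fmat" where
  "gm k w = (\<lambda>i j. \<Sum>a<k. w a i * w a j)"

text \<open>Positive semidefiniteness in the form used throughout, a finite sum of w w'. Covariances
  and scatter matrices are both of this form, it survives sandwiching, and Cauchy-Schwarz reduces to
  the inequality for finite sums.\<close>

definition gram :: "fmat \<Rightarrow> bool" where "gram Q \<longleftrightarrow> (\<exists>k w. Q = gm k w)"

lemma mm_assoc [simp]: "(A \<bowtie> B) \<bowtie> C = A \<bowtie> B \<bowtie> C"
proof (intro ext)
  fix i j
  have "((A \<bowtie> B) \<bowtie> C) i j = (\<Sum>k<p. \<Sum>l<p. A i l * B l k * C k j)"
    by (simp add: mm_def sum_distrib_right)
  also have "\<dots> = (\<Sum>l<p. \<Sum>k<p. A i l * B l k * C k j)"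
    by (rule sum.swap)
  also have "\<dots> = (A \<bowtie> B \<bowtie> C) i j"
    by (simp add: mm_def sum_distrib_left mult.assoc)
  finally show "((A \<bowtie> B) \<bowtie> C) i j = (A \<bowtie> B \<bowtie> C) i j" .
qed

lemma mt_mm [simp]: "mt (A \<bowtie> B) = mt B \<bowtie> mt A"
  by (simp add: mt_def mm_def mult.commute)

lemma mt_mt [simp]: "mt (mt A) = A"
  by (simp add: mt_def)

lemma tra_comm: "tra (A \<bowtie> B) = tra (B \<bowtie> A)"
proof -
  have "tra (A \<bowtie> B) = (\<Sum>k<p. \<Sum>i<p. A i k * B k i)"
    unfolding tra_def mm_def by (rule sum.swap)
  then show ?thesis by (simp add: tra_def mm_def mult.commute)
qed

lemma dot_comm: "dot u v = dot v u"
  by (simp add: dot_def mult.commute)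

lemma mv_mm: "mv (A \<bowtie> B) x = mv A (mv B x)"
proof
  fix i
  have "mv (A \<bowtie> B) x i = (\<Sum>j<p. \<Sum>k<p. A i k * B k j * x j)"
    by (simp add: mv_def mm_def dot_def sum_distrib_right)
  also have "\<dots> = (\<Sum>k<p. \<Sum>j<p. A i k * B k j * x j)"
    by (rule sum.swap)
  also have "\<dots> = mv A (mv B x) i"
    by (simp add: mv_def dot_def sum_distrib_left mult.assoc)
  finally show "mv (A \<bowtie> B) x i = mv A (mv B x) i" .
qed

lemma dot_mv: "dot x (mv A y) = dot (mv (mt A) x) y"
proof -
  have "dot x (mv A y) = (\<Sum>i<p. \<Sum>j<p. x i * A i j * y j)"
    by (simp add: dot_def mv_def sum_distrib_left mult.assoc)
  also have "\<dots> = (\<Sum>j<p. \<Sum>i<p. x i * A i j * y j)"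
    by (rule sum.swap)
  also have "\<dots> = dot (mv (mt A) x) y"
    by (simp add: dot_def mv_def mt_def sum_distrib_left sum_distrib_right mult_ac)
  finally show ?thesis .
qed

lemma bil_mt: "bil (mt A) x y = bil A y x"
  unfolding bil_def by (simp add: dot_mv[of x] dot_comm)

lemma bil_sum: "bil A x y = (\<Sum>i<p. \<Sum>j<p. A i j * (x i * y j))"
  by (simp add: bil_def dot_def mv_def sum_distrib_left mult_ac)

lemma mt_gm [simp]: "mt (gm k w) = gm k w"
  by (intro ext) (simp add: mt_def gm_def mult.commute)

lemma mt_gram: "gram Q \<Longrightarrow> mt Q = Q"
  by (auto simp: gram_def)

lemma gram_gm [intro, simp]: "gram (gm k w)"
  by (auto simp: gram_def)

lemma mv_gm: "mv (gm k w) x i = (\<Sum>a<k. w a i * dot (w a) x)"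
proof -
  have "mv (gm k w) x i = (\<Sum>j<p. \<Sum>a<k. w a i * w a j * x j)"
    by (simp add: mv_def gm_def dot_def sum_distrib_right)
  also have "\<dots> = (\<Sum>a<k. \<Sum>j<p. w a i * w a j * x j)" by (rule sum.swap)
  finally show ?thesis by (simp add: dot_def sum_distrib_left mult.assoc)
qed

lemma dot_sum_right: "dot x (\<lambda>i. \<Sum>a\<in>I. c a * v a i) = (\<Sum>a\<in>I. c a * dot x (v a))"
proof -
  have "dot x (\<lambda>i. \<Sum>a\<in>I. c a * v a i) = (\<Sum>i<p. \<Sum>a\<in>I. x i * (c a * v a i))"
    by (simp add: dot_def sum_distrib_left)
  also have "\<dots> = (\<Sum>a\<in>I. \<Sum>i<p. x i * (c a * v a i))" by (rule sum.swap)
  finally show ?thesis by (simp add: dot_def sum_distrib_left mult_ac)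
qed

lemma bil_gm: "bil (gm k w) x y = (\<Sum>a<k. dot (w a) x * dot (w a) y)"
proof -
  have "mv (gm k w) y = (\<lambda>i. \<Sum>a<k. dot (w a) y * w a i)"
    by (rule ext) (simp add: mv_gm mult.commute)
  then have "bil (gm k w) x y = (\<Sum>a<k. dot (w a) y * dot x (w a))"
    by (simp only: bil_def dot_sum_right)
  then show ?thesis
    by (simp add: dot_comm[of x] mult.commute)
qed

lemma tra_gm: "tra (gm k w \<bowtie> Q) = (\<Sum>a<k. bil Q (w a) (w a))"
proof -
  have "tra (gm k w \<bowtie> Q) = (\<Sum>i<p. \<Sum>j<p. \<Sum>a<k. w a i * w a j * Q j i)"
    by (simp add: tra_def mm_def gm_def sum_distrib_right)
  also have "\<dots> = (\<Sum>i<p. \<Sum>a<k. \<Sum>j<p. w a i * w a j * Q j i)"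
    by (rule sum.cong[OF refl], rule sum.swap)
  also have "\<dots> = (\<Sum>a<k. \<Sum>i<p. \<Sum>j<p. w a i * w a j * Q j i)"
    by (rule sum.swap)
  also have "\<dots> = (\<Sum>a<k. bil (mt Q) (w a) (w a))"
    by (simp add: bil_sum mt_def mult_ac)
  finally show ?thesis by (simp add: bil_mt)
qed

lemma bil_mm_gm: "bil (A \<bowtie> gm k w \<bowtie> B) x y = (\<Sum>b<k. bil A x (w b) * bil B (w b) y)"
proof -
  have "bil (A \<bowtie> gm k w \<bowtie> B) x y = bil (gm k w) (mv (mt A) x) (mv B y)"
    by (simp add: mv_mm bil_def dot_mv[of x])
  also have "\<dots> = (\<Sum>b<k. dot (mv (mt A) x) (w b) * dot (w b) (mv B y))"
    by (simp add: bil_gm dot_comm[of _ "mv (mt A) x"])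
  finally show ?thesis
    by (simp add: bil_def dot_mv[of x])
qed

text \<open>Turns such a trace into a double sum over columns, the shape in which diagonal and
  off-diagonal pairs can be separated.\<close>

lemma tra_gm_gm:
  "tra (gm k v \<bowtie> A \<bowtie> gm l w \<bowtie> B) = (\<Sum>a<k. \<Sum>b<l. bil A (v a) (w b) * bil B (w b) (v a))"
  by (simp add: tra_gm bil_mm_gm)

lemma sandwich_gm: "M \<bowtie> gm k w \<bowtie> mt M = gm k (\<lambda>a. mv M (w a))"
proof (intro ext)
  fix i j
  have "(M \<bowtie> gm k w \<bowtie> mt M) i j = (\<Sum>b<p. M i b * (\<Sum>c<p. (\<Sum>a<k. w a b * w a c) * M j c))"
    by (simp add: mm_def gm_def mt_def)
  also have "\<dots> = bil (gm k w) (M i) (M j)"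
    by (simp add: bil_def dot_def mv_def gm_def mult_ac)
  also have "\<dots> = gm k (\<lambda>a. mv M (w a)) i j"
    by (simp add: bil_gm, simp add: gm_def mv_def dot_comm)
  finally show "(M \<bowtie> gm k w \<bowtie> mt M) i j = gm k (\<lambda>a. mv M (w a)) i j" .
qed

lemma gram_sandwich: "gram Q \<Longrightarrow> gram (M \<bowtie> Q \<bowtie> mt M)"
  by (metis gram_def sandwich_gm)

lemma gram_sandwich_sym:
  "gram M \<Longrightarrow> gram Q \<Longrightarrow> gram (M \<bowtie> Q \<bowtie> M)"
  using gram_sandwich[of Q M] by (simp add: mt_gram)

lemma gram_quad_nonneg: "gram Q \<Longrightarrow> 0 \<le> bil Q x x"
  by (auto simp: gram_def bil_gm intro!: sum_nonneg)

lemma gram_cauchy_schwarz: "gram Q \<Longrightarrow> (bil Q x y)\<^sup>2 \<le> bil Q x x * bil Q y y"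
  unfolding gram_def using Cauchy_Schwarz_ineq_sum
  by (auto simp: bil_gm power2_eq_square[symmetric])

lemma tra_gram_nonneg: "gram A \<Longrightarrow> gram B \<Longrightarrow> 0 \<le> tra (A \<bowtie> B)"
  by (auto simp: gram_def[of A] tra_gm intro!: sum_nonneg gram_quad_nonneg)

text \<open>In terms of the columns of \<open>R\<close> the left side is a sum of squared entries.
  Cauchy-Schwarz for the form \<open>S\<close> bounds each by a product of diagonal entries, and
  these sum to the square of the trace.\<close>

lemma tra_sq_gram_le:
  assumes "gram R" "gram S"
  shows "tra (R \<bowtie> S \<bowtie> R \<bowtie> S) \<le> (tra (R \<bowtie> S))\<^sup>2"
proof -
  obtain k w where R: "R = gm k w" using assms by (auto simp: gram_def)
  have "tra (R \<bowtie> S \<bowtie> R \<bowtie> S) = (\<Sum>a<k. \<Sum>b<k. (bil S (w a) (w b))\<^sup>2)"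
    using bil_mt[of S] by (simp add: R tra_gm_gm power2_eq_square mt_gram[OF assms(2)])
  also have "\<dots> \<le> (\<Sum>a<k. \<Sum>b<k. bil S (w a) (w a) * bil S (w b) (w b))"
    by (intro sum_mono gram_cauchy_schwarz assms)
  also have "\<dots> = (tra (R \<bowtie> S))\<^sup>2"
    by (simp add: R tra_gm power2_eq_square sum_product)
  finally show ?thesis .
qed

text \<open>A product of transposed entries is at most the mean of their squares. Thus a trace in
  which a nonsymmetric matrix occurs twice the same way is bounded by its nonnegative
  counterpart.\<close>

lemma abs_tra_square_le:
  assumes "gram S"
  shows "\<bar>tra (Q \<bowtie> S \<bowtie> Q \<bowtie> S)\<bar> \<le> tra (Q \<bowtie> S \<bowtie> mt Q \<bowtie> S)"
proof -
  obtain k w where S: "S = gm k w" using assms by (auto simp: gram_def)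
  let ?f = "\<lambda>a b. bil Q (w a) (w b)"
  have 1: "tra (Q \<bowtie> S \<bowtie> Q \<bowtie> S) = (\<Sum>a<k. \<Sum>b<k. ?f a b * ?f b a)"
    using tra_comm[of "Q \<bowtie> S \<bowtie> Q" S] by (simp add: S tra_gm_gm)
  have 2: "tra (Q \<bowtie> S \<bowtie> mt Q \<bowtie> S) = (\<Sum>a<k. \<Sum>b<k. (?f a b)\<^sup>2)"
    using tra_comm[of "Q \<bowtie> S \<bowtie> mt Q" S] by (simp add: S tra_gm_gm bil_mt power2_eq_square)
  have sw: "(\<Sum>a<k. \<Sum>b<k. (?f b a)\<^sup>2) = (\<Sum>a<k. \<Sum>b<k. (?f a b)\<^sup>2)"
    by (rule sum.swap)
  have "\<bar>\<Sum>a<k. \<Sum>b<k. ?f a b * ?f b a\<bar> \<le> (\<Sum>a<k. \<Sum>b<k. \<bar>?f a b * ?f b a\<bar>)"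
    by (intro order_trans[OF sum_abs] sum_mono sum_abs)
  also have "\<dots> \<le> (\<Sum>a<k. \<Sum>b<k. ((?f a b)\<^sup>2 + (?f b a)\<^sup>2) / 2)"
  proof (intro sum_mono)
    fix a b
    show "\<bar>?f a b * ?f b a\<bar> \<le> ((?f a b)\<^sup>2 + (?f b a)\<^sup>2) / 2"
      using sum_squares_bound[of "\<bar>?f a b\<bar>" "\<bar>?f b a\<bar>"] by (simp add: abs_mult)
  qed
  also have "\<dots> = (\<Sum>a<k. \<Sum>b<k. (?f a b)\<^sup>2)"
    using sw by (simp add: sum.distrib flip: sum_divide_distrib)
  finally show ?thesis using 1 2 by simp
qed

text \<open>Cauchy-Schwarz for the form \<open>R\<close>, with \<open>A\<close> moved to the vector
  \<open>x\<close>. In the bound \<open>R\<close> occurs once in each factor, which keeps later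
  estimates of first degree in a random \<open>R\<close>.\<close>

lemma bil_mm_gram_le:
  assumes "gram R"
  shows "(bil (A \<bowtie> R) x y)\<^sup>2 \<le> bil (A \<bowtie> R \<bowtie> mt A) x x * bil R y y"
proof -
  have 1: "bil (A \<bowtie> R) x y = bil R (mv (mt A) x) y"
    by (simp add: bil_def mv_mm dot_mv[of x A])
  have 2: "bil (A \<bowtie> R \<bowtie> mt A) x x = bil R (mv (mt A) x) (mv (mt A) x)"
    by (simp add: bil_def mv_mm dot_mv[of x A])
  show ?thesis unfolding 1 2 by (rule gram_cauchy_schwarz[OF assms])
qed

end

section \<open>Moments and averages over product measures\<close>

text \<open>Closed under sums and products, unlike integrability, so the integrability of any
  polynomial in the coordinates follows from introduction rules alone.\<close>

definition all_moments :: "'a measure \<Rightarrow> ('a \<Rightarrow> real) \<Rightarrow> bool" where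
  "all_moments M f \<longleftrightarrow> f \<in> borel_measurable M \<and> (\<forall>k. integrable M (\<lambda>x. \<bar>f x\<bar> ^ k))"

lemma all_moments_measurable: "all_moments M f \<Longrightarrow> f \<in> borel_measurable M"
  by (simp add: all_moments_def)

lemma all_moments_integrable: "all_moments M f \<Longrightarrow> integrable M f"
  unfolding all_moments_def
  by (metis (no_types, lifting) Bochner_Integration.integrable_cong integrable_abs_cancel power_one_right)

lemma all_moments_abs: "all_moments M f \<Longrightarrow> all_moments M (\<lambda>x. \<bar>f x\<bar>)"
  by (auto simp: all_moments_def)

lemma all_moments_add:
  assumes "all_moments M f" "all_moments M g"
  shows "all_moments M (\<lambda>x. f x + g x)"
  unfolding all_moments_def
proof (intro conjI allI)
  note [measurable] = all_moments_measurable[OF assms(1)] all_moments_measurable[OF assms(2)]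
  show "(\<lambda>x. f x + g x) \<in> borel_measurable M" by simp
  fix k
  show "integrable M (\<lambda>x. \<bar>f x + g x\<bar> ^ k)"
  proof (rule Bochner_Integration.integrable_bound)
    show "integrable M (\<lambda>x. 2 ^ k * (\<bar>f x\<bar> ^ k + \<bar>g x\<bar> ^ k))"
      using assms by (auto simp: all_moments_def)
    show "AE x in M. norm (\<bar>f x + g x\<bar> ^ k) \<le> norm (2 ^ k * (\<bar>f x\<bar> ^ k + \<bar>g x\<bar> ^ k))"
    proof (rule AE_I2)
      fix x
      have "\<bar>f x + g x\<bar> \<le> 2 * max \<bar>f x\<bar> \<bar>g x\<bar>" by linarith
      then have "\<bar>f x + g x\<bar> ^ k \<le> (2 * max \<bar>f x\<bar> \<bar>g x\<bar>) ^ k"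
        by (intro power_mono) auto
      also have "\<dots> \<le> 2 ^ k * (\<bar>f x\<bar> ^ k + \<bar>g x\<bar> ^ k)"
        by (auto simp: power_mult_distrib max_def)
      finally show "norm (\<bar>f x + g x\<bar> ^ k) \<le> norm (2 ^ k * (\<bar>f x\<bar> ^ k + \<bar>g x\<bar> ^ k))"
        by simp
    qed
  qed simp
qed

lemma all_moments_mult:
  assumes "all_moments M f" "all_moments M g"
  shows "all_moments M (\<lambda>x. f x * g x)"
  unfolding all_moments_def
proof (intro conjI allI)
  note [measurable] = all_moments_measurable[OF assms(1)] all_moments_measurable[OF assms(2)]
  show "(\<lambda>x. f x * g x) \<in> borel_measurable M" by simp
  fix k
  show "integrable M (\<lambda>x. \<bar>f x * g x\<bar> ^ k)"
  proof (rule Bochner_Integration.integrable_bound)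
    show "integrable M (\<lambda>x. \<bar>f x\<bar> ^ (2 * k) + \<bar>g x\<bar> ^ (2 * k))"
      using assms by (auto simp: all_moments_def)
    show "AE x in M. norm (\<bar>f x * g x\<bar> ^ k) \<le> norm (\<bar>f x\<bar> ^ (2 * k) + \<bar>g x\<bar> ^ (2 * k))"
    proof (rule AE_I2)
      fix x
      have "\<bar>f x\<bar> ^ k * \<bar>g x\<bar> ^ k \<le> (\<bar>f x\<bar> ^ k)\<^sup>2 + (\<bar>g x\<bar> ^ k)\<^sup>2"
        using sum_squares_bound[of "\<bar>f x\<bar> ^ k" "\<bar>g x\<bar> ^ k"]
          mult_nonneg_nonneg[of "\<bar>f x\<bar> ^ k" "\<bar>g x\<bar> ^ k"] by (simp del: mult_nonneg_nonneg)
      then show "norm (\<bar>f x * g x\<bar> ^ k) \<le> norm (\<bar>f x\<bar> ^ (2 * k) + \<bar>g x\<bar> ^ (2 * k))"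
        by (simp add: abs_mult power_mult_distrib power_even_eq)
    qed
  qed simp
qed

lemma (in prob_space) all_moments_const [intro, simp]: "all_moments M (\<lambda>_. c)"
  by (simp add: all_moments_def)

lemma (in prob_space) all_moments_sum:
  "(\<And>i. i \<in> I \<Longrightarrow> all_moments M (f i)) \<Longrightarrow> all_moments M (\<lambda>x. \<Sum>i\<in>I. f i x)"
  by (induction I rule: infinite_finite_induct) (auto intro: all_moments_add)

lemma (in prob_space) all_moments_power:
  "all_moments M f \<Longrightarrow> all_moments M (\<lambda>x. f x ^ n)"
  by (induction n) (auto intro: all_moments_mult)

lemma (in prob_space) all_moments_diff:
  assumes "all_moments M f" "all_moments M g"
  shows "all_moments M (\<lambda>x. f x - g x)"
proof -
  have "all_moments M (\<lambda>x. f x + (-1) * g x)"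
    by (intro all_moments_add all_moments_mult assms all_moments_const)
  then show ?thesis by simp
qed

lemma all_moments_distr:
  assumes "f \<in> measurable M N" "all_moments (distr M N f) g"
  shows "all_moments M (\<lambda>x. g (f x))"
  using assms measurable_compose[OF assms(1), of g borel]
  by (auto simp: all_moments_def integrable_distr_eq)

lemma all_moments_PiM:
  assumes "\<And>i. i \<in> I \<Longrightarrow> prob_space (M i)" "i \<in> I" "all_moments (M i) f"
  shows "all_moments (PiM I M) (\<lambda>w. f (w i))"
  using assms distr_PiM_component[of I M i]
  by (intro all_moments_distr[where N = "M i" and f = "\<lambda>w. w i"]) auto

lemma all_moments_fst:
  assumes "prob_space M" "prob_space N" "all_moments M f"
  shows "all_moments (M \<Otimes>\<^sub>M N) (\<lambda>w. f (fst w))"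
proof -
  have "distr (M \<Otimes>\<^sub>M N) M fst = M"
    using assms(2) by (rule prob_space.distr_pair_fst)
  then show ?thesis
    using assms(3) by (intro all_moments_distr[where N = M and f = fst]) auto
qed

lemma all_moments_snd:
  assumes "prob_space M" "prob_space N" "all_moments N f"
  shows "all_moments (M \<Otimes>\<^sub>M N) (\<lambda>w. f (snd w))"
proof -
  interpret N: prob_space N by fact
  interpret M: prob_space M by fact
  interpret pair_sigma_finite M N by unfold_locales
  have "distr (M \<Otimes>\<^sub>M N) N snd = distr (N \<Otimes>\<^sub>M M) N fst"
    by (subst distr_pair_swap) (simp add: distr_distr comp_def split_def)
  also have "\<dots> = N"
    by (rule M.distr_pair_fst)
  finally have "distr (M \<Otimes>\<^sub>M N) N snd = N" .
  then show ?thesis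
    using assms(3) by (intro all_moments_distr[where N = N and f = snd]) auto
qed

text \<open>The substitute for conditional expectation: overwriting one coordinate by a fresh
  independent copy does not change the law, so integrating over the copy conditions on all other
  coordinates without splitting the index set.\<close>

lemma distr_PiM_update:
  assumes I: "finite I" "j \<in> I" and M: "\<And>i. prob_space (M i)"
  shows "distr (PiM I M \<Otimes>\<^sub>M M j) (PiM I M) (\<lambda>(w, y). w(j := y)) = PiM I M"
proof -
  interpret product_prob_space M I
    using M by (rule product_prob_spaceI)
  interpret fp: finite_product_sigma_finite M I by standard fact
  have meas: "(\<lambda>(w, y). w(j := y)) \<in> measurable (PiM I M \<Otimes>\<^sub>M M j) (PiM I M)"
    unfolding split_def
    by (rule measurable_fun_upd[where J = I]) (use I in auto)
  show ?thesis
  proof (rule PiM_eqI)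
    fix A assume A: "\<And>i. i \<in> I \<Longrightarrow> A i \<in> sets (M i)"
    \<comment> \<open>The old \<open>j\<close>-th coordinate is overwritten, so its factor is
      unrestricted and contributes mass one.\<close>
    let ?B = "\<lambda>i. if i = j then space (M j) else A i"
    have *: "(\<lambda>(w, y). w(j := y)) -` Pi\<^sub>E I A \<inter> space (PiM I M \<Otimes>\<^sub>M M j) = Pi\<^sub>E I ?B \<times> A j"
      using A[THEN sets.sets_into_space] I(2)
      by (auto simp: space_PiM space_pair_measure PiE_def Pi_def extensional_def split: if_splits)
    have B: "Pi\<^sub>E I ?B \<in> sets (PiM I M)"
      using A I by (intro sets_PiM_I_finite) auto
    have "emeasure (distr (PiM I M \<Otimes>\<^sub>M M j) (PiM I M) (\<lambda>(w, y). w(j := y))) (Pi\<^sub>E I A)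
        = emeasure (PiM I M \<Otimes>\<^sub>M M j) (Pi\<^sub>E I ?B \<times> A j)"
      using A I by (subst emeasure_distr[OF meas]) (auto simp: * intro!: sets_PiM_I_finite)
    also have "\<dots> = emeasure (PiM I M) (Pi\<^sub>E I ?B) * emeasure (M j) (A j)"
      using A I B by (intro M.emeasure_pair_measure_Times) auto
    also have "emeasure (PiM I M) (Pi\<^sub>E I ?B) = (\<Prod>i\<in>I. emeasure (M i) (?B i))"
      using A by (intro fp.measure_times) auto
    also have "\<dots> = emeasure (M j) (space (M j)) * (\<Prod>i\<in>I - {j}. emeasure (M i) (A i))"
      using I by (subst prod.remove[of I j]) (auto intro!: prod.cong)
    also have "\<dots> * emeasure (M j) (A j) = (\<Prod>i\<in>I. emeasure (M i) (A i))"
      using I by (simp add: M.emeasure_space_1 prod.remove[of I j] mult.commute)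
    finally show "emeasure (distr (PiM I M \<Otimes>\<^sub>M M j) (PiM I M) (\<lambda>(w, y). w(j := y))) (Pi\<^sub>E I A) = (\<Prod>i\<in>I. emeasure (M i) (A i))" .
  qed (use I in auto)
qed

lemma
  fixes f :: "_ \<Rightarrow> 'b :: {banach, second_countable_topology}"
  assumes I: "finite I" "j \<in> I" and M: "\<And>i. prob_space (M i)"
    and f: "integrable (PiM I M) f"
  shows integrable_PiM_average: "integrable (PiM I M) (\<lambda>w. \<integral>y. f (w(j := y)) \<partial>M j)"
    and integral_PiM_average: "(\<integral>w. \<integral>y. f (w(j := y)) \<partial>M j \<partial>PiM I M) = (\<integral>w. f w \<partial>PiM I M)"
proof -
  interpret j: prob_space "M j" by (rule M)
  interpret P: prob_space "PiM I M" by (intro prob_space_PiM M)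
  interpret pair_sigma_finite "PiM I M" "M j" by unfold_locales
  have meas: "(\<lambda>(w, y). w(j := y)) \<in> measurable (PiM I M \<Otimes>\<^sub>M M j) (PiM I M)"
    unfolding split_def
    by (rule measurable_fun_upd[where J = I]) (use I in auto)
  have "integrable (distr (PiM I M \<Otimes>\<^sub>M M j) (PiM I M) (\<lambda>(w, y). w(j := y))) f"
    using f by (subst distr_PiM_update[OF I M])
  then have int: "integrable (PiM I M \<Otimes>\<^sub>M M j) (\<lambda>x. f (case x of (w, y) \<Rightarrow> w(j := y)))"
    by (subst (asm) integrable_distr_eq[OF meas]) (use f in auto)
  show "integrable (PiM I M) (\<lambda>w. \<integral>y. f (w(j := y)) \<partial>M j)"
    using integrable_fst'[OF int] by simp
  have "(\<integral>w. f w \<partial>PiM I M) = (\<integral>x. f (case x of (w, y) \<Rightarrow> w(j := y)) \<partial>(PiM I M \<Otimes>\<^sub>M M j))"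
    by (subst distr_PiM_update[OF I M, symmetric], subst integral_distr[OF meas]) (use f in auto)
  also have "\<dots> = (\<integral>w. \<integral>y. f (w(j := y)) \<partial>M j \<partial>PiM I M)"
    using integral_fst'[OF int] by simp
  finally show "(\<integral>w. \<integral>y. f (w(j := y)) \<partial>M j \<partial>PiM I M) = (\<integral>w. f w \<partial>PiM I M)" by simp
qed

text \<open>The device by which blocks are integrated out in turn: the bound \<open>g\<close> no
  longer involves the block just averaged and becomes the next integrand.\<close>

lemma integral_PiM_average_le:
  fixes f g :: "_ \<Rightarrow> real"
  assumes "finite I" "j \<in> I" "\<And>i. prob_space (M i)"
    and "integrable (PiM I M) f" "integrable (PiM I M) g"
    and "\<And>w. w \<in> space (PiM I M) \<Longrightarrow> (\<integral>y. f (w(j := y)) \<partial>M j) \<le> g w"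
  shows "(\<integral>w. f w \<partial>PiM I M) \<le> (\<integral>w. g w \<partial>PiM I M)"
  using integral_mono[OF integrable_PiM_average[OF assms(1-4)] assms(5,6)]
    integral_PiM_average[OF assms(1-4)] by simp

lemma integral_PiM_average_eq:
  fixes f g :: "_ \<Rightarrow> real"
  assumes "finite I" "j \<in> I" "\<And>i. prob_space (M i)"
    and "integrable (PiM I M) f"
    and "\<And>w. w \<in> space (PiM I M) \<Longrightarrow> (\<integral>y. f (w(j := y)) \<partial>M j) = g w"
  shows "(\<integral>w. f w \<partial>PiM I M) = (\<integral>w. g w \<partial>PiM I M)"
  using integral_PiM_average[OF assms(1-4)] assms(5)
  by (metis (mono_tags, lifting) Bochner_Integration.integral_cong)

lemma integral_PiM_component:
  fixes f :: "_ \<Rightarrow> real"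
  assumes "\<And>i. i \<in> I \<Longrightarrow> prob_space (M i)" "i \<in> I" "f \<in> borel_measurable (M i)"
  shows "(\<integral>w. f (w i) \<partial>PiM I M) = (\<integral>x. f x \<partial>M i)"
proof -
  have "(\<integral>x. f x \<partial>M i) = (\<integral>x. f x \<partial>distr (PiM I M) (M i) (\<lambda>w. w i))"
    using assms by (subst distr_PiM_component) auto
  also have "\<dots> = (\<integral>w. f (w i) \<partial>PiM I M)"
    using assms by (intro integral_distr) auto
  finally show ?thesis by simp
qed

section \<open>Second-moment inequalities\<close>

context prob_space
begin

lemma cauchy_schwarz:
  assumes "all_moments M f" "all_moments M g"
  shows "(\<integral>x. f x * g x \<partial>M)\<^sup>2 \<le> (\<integral>x. (f x)\<^sup>2 \<partial>M) * (\<integral>x. (g x)\<^sup>2 \<partial>M)"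
proof -
  note i = all_moments_integrable[OF all_moments_mult[OF assms]]
    all_moments_integrable[OF all_moments_power[OF assms(1)]]
    all_moments_integrable[OF all_moments_power[OF assms(2)]]
  let ?a = "\<integral>x. (f x)\<^sup>2 \<partial>M" and ?b = "\<integral>x. f x * g x \<partial>M" and ?c = "\<integral>x. (g x)\<^sup>2 \<partial>M"
  have q: "0 \<le> s\<^sup>2 * ?a + 2 * s * t * ?b + t\<^sup>2 * ?c" for s t :: real
  proof -
    have "0 \<le> (\<integral>x. (s * f x + t * g x)\<^sup>2 \<partial>M)" by simp
    also have "\<dots> = (\<integral>x. s\<^sup>2 * (f x)\<^sup>2 + 2 * s * t * (f x * g x) + t\<^sup>2 * (g x)\<^sup>2 \<partial>M)"
      by (intro Bochner_Integration.integral_cong) (auto simp: power2_eq_square algebra_simps)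
    also have "\<dots> = s\<^sup>2 * ?a + 2 * s * t * ?b + t\<^sup>2 * ?c"
      using i by simp
    finally show ?thesis .
  qed
  have a: "0 \<le> ?a" "0 \<le> ?c" by simp_all
  show ?thesis
  proof (cases "?a = 0")
    case False
    \<comment> \<open>The quadratic form at s = \<open>?b\<close>, t = \<open>- ?a\<close>, where it
      factors.\<close>
    have "0 \<le> ?b\<^sup>2 * ?a + 2 * ?b * (- ?a) * ?b + (- ?a)\<^sup>2 * ?c" by (rule q)
    also have "\<dots> = ?a * (?a * ?c - ?b\<^sup>2)" by (simp add: power2_eq_square algebra_simps)
    finally show ?thesis using False a by (simp add: zero_le_mult_iff)
  next
    case True
    have "?b = 0"
    proof (rule ccontr)
      assume b: "?b \<noteq> 0"
      \<comment> \<open>With \<open>?a = 0\<close> the form is affine in s, and this s makes it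
        equal to -1.\<close>
      have "0 \<le> 2 * (- (?c + 1) / (2 * ?b)) * ?b + ?c"
        using q[of "- (?c + 1) / (2 * ?b)" 1] True by simp
      also have "\<dots> = -1" using b by (simp add: field_simps)
      finally show False by simp
    qed
    then show ?thesis using True by simp
  qed
qed

lemma cauchy_schwarz_le:
  assumes "all_moments M f" "all_moments M g"
    and "(\<integral>x. (f x)\<^sup>2 \<partial>M) \<le> a\<^sup>2" "(\<integral>x. (g x)\<^sup>2 \<partial>M) \<le> b\<^sup>2" "0 \<le> a" "0 \<le> b"
  shows "(\<integral>x. f x * g x \<partial>M) \<le> a * b"
proof (rule power2_le_imp_le)
  have "(\<integral>x. f x * g x \<partial>M)\<^sup>2 \<le> (\<integral>x. (f x)\<^sup>2 \<partial>M) * (\<integral>x. (g x)\<^sup>2 \<partial>M)"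
    by (rule cauchy_schwarz) fact+
  also have "\<dots> \<le> a\<^sup>2 * b\<^sup>2" using assms by (intro mult_mono) auto
  finally show "(\<integral>x. f x * g x \<partial>M)\<^sup>2 \<le> (a * b)\<^sup>2" by (simp add: power_mult_distrib)
qed (use assms in simp)

lemma abs_integral_le_sqrt:
  assumes "all_moments M f" "(\<integral>x. (f x)\<^sup>2 \<partial>M) \<le> a"
  shows "(\<integral>x. \<bar>f x\<bar> \<partial>M) \<le> sqrt a"
proof -
  have "0 \<le> a" using assms(2) by (rule order_trans[rotated]) simp
  then show ?thesis
    using cauchy_schwarz_le[of "\<lambda>x. \<bar>f x\<bar>" "\<lambda>_. 1" "sqrt a" 1] assms
    by (simp add: all_moments_abs prob_space)
qed

text \<open>The triangle inequality in L2, squared. Independence plays no part in it, so moment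
  bounds for single linear forms pass to quadratic forms written as sums of squares.\<close>

lemma minkowski_sq:
  assumes "finite I" "\<And>i. i \<in> I \<Longrightarrow> all_moments M (Y i)"
    and "\<And>i. i \<in> I \<Longrightarrow> (\<integral>x. (Y i x)\<^sup>2 \<partial>M) \<le> (c i)\<^sup>2" "\<And>i. i \<in> I \<Longrightarrow> 0 \<le> c i"
  shows "(\<integral>x. (\<Sum>i\<in>I. Y i x)\<^sup>2 \<partial>M) \<le> (\<Sum>i\<in>I. c i)\<^sup>2"
proof -
  have int: "integrable M (\<lambda>x. Y i x * Y j x)" if "i \<in> I" "j \<in> I" for i j
    using that by (intro all_moments_integrable all_moments_mult assms)
  have "(\<integral>x. (\<Sum>i\<in>I. Y i x)\<^sup>2 \<partial>M) = (\<integral>x. (\<Sum>i\<in>I. \<Sum>j\<in>I. Y i x * Y j x) \<partial>M)"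
    by (simp add: power2_eq_square sum_product)
  also have "\<dots> = (\<Sum>i\<in>I. \<Sum>j\<in>I. \<integral>x. Y i x * Y j x \<partial>M)"
    using int by (simp add: Bochner_Integration.integral_sum)
  also have "\<dots> \<le> (\<Sum>i\<in>I. \<Sum>j\<in>I. c i * c j)"
    by (intro sum_mono cauchy_schwarz_le assms)
  also have "\<dots> = (\<Sum>i\<in>I. c i)\<^sup>2"
    by (simp add: power2_eq_square sum_product)
  finally show ?thesis .
qed

end

text \<open>Second moment of a U-statistic with kernel \<open>g\<close>: \<open>h\<close> is its projection to one variable.\<close>

lemma second_moment_offdiag:
  fixes g :: "'x \<Rightarrow> 'x \<Rightarrow> real"
  defines "P k \<nu> \<equiv> PiM {..<k::nat} (\<lambda>_. \<nu>)"
  assumes \<nu>: "prob_space \<nu>"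
    and g: "\<And>i j. i < k \<Longrightarrow> j < k \<Longrightarrow> all_moments (P k \<nu>) (\<lambda>w. g (w i) (w j))"
    and sym: "\<And>x y. g x y = g y x"
    and h: "all_moments \<nu> h"
    and gh: "\<And>x. x \<in> space \<nu> \<Longrightarrow> (\<integral>y. g x y \<partial>\<nu>) = h x"
    and t: "(\<integral>x. h x \<partial>\<nu>) = t" and H: "(\<integral>x. (h x)\<^sup>2 \<partial>\<nu>) \<le> H"
    and G: "\<And>i j. i < k \<Longrightarrow> j < k \<Longrightarrow> i \<noteq> j \<Longrightarrow> (\<integral>w. (g (w i) (w j))\<^sup>2 \<partial>P k \<nu>) \<le> G"
    and G0: "0 \<le> G"
  shows "(\<integral>w. (\<Sum>i<k. \<Sum>j\<in>{..<k} - {i}. g (w i) (w j))\<^sup>2 \<partial>P k \<nu>)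
    \<le> real k ^ 4 * t\<^sup>2 + 4 * real k ^ 3 * H + 2 * real k ^ 2 * G"
proof -
  interpret \<nu>: prob_space \<nu> by fact
  interpret P: prob_space "P k \<nu>" unfolding P_def by (intro prob_space_PiM \<nu>)
  have H0: "0 \<le> H" using H by (rule order_trans[rotated]) simp
  have hP: "all_moments (P k \<nu>) (\<lambda>w. h (w i))" if "i < k" for i
    unfolding P_def using that by (intro all_moments_PiM \<nu> h) auto
  let ?g = "\<lambda>i j w. g (w i) (w j)"
  have int: "integrable (P k \<nu>) (\<lambda>w. ?g i j w * ?g l q w)" if "i < k" "j < k" "l < k" "q < k" for i j l q
    using that by (intro all_moments_integrable all_moments_mult g)
  have inth: "integrable (P k \<nu>) (\<lambda>w. h (w i) * ?g l q w)" if "i < k" "l < k" "q < k" for i l q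
    using that by (intro all_moments_integrable all_moments_mult g hP)
  have inthh: "integrable (P k \<nu>) (\<lambda>w. h (w i) * h (w l))" if "i < k" "l < k" for i l
    using that by (intro all_moments_integrable all_moments_mult g hP)
  have spc: "w i \<in> space \<nu>" if "w \<in> space (P k \<nu>)" "i < k" for w i
    using that by (auto simp: P_def space_PiM PiE_def)
  \<comment> \<open>An index that occurs only once is averaged out first, which replaces its kernel
    by the projection \<open>h\<close>.\<close>
  have av1: "(\<integral>w. ?g i j w * ?g l q w \<partial>P k \<nu>) = (\<integral>w. h (w i) * ?g l q w \<partial>P k \<nu>)"
    if "i < k" "j < k" "l < k" "q < k" "j \<noteq> i" "j \<noteq> l" "j \<noteq> q" for i j l q
    unfolding P_def
    by (rule integral_PiM_average_eq[where j = j])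
       (use that int[of i j l q] \<nu> gh spc in \<open>auto simp: P_def\<close>)
  have av2: "(\<integral>w. h (w i) * ?g l q w \<partial>P k \<nu>) = (\<integral>w. h (w i) * h (w l) \<partial>P k \<nu>)"
    if "i < k" "l < k" "q < k" "q \<noteq> i" "q \<noteq> l" for i l q
    unfolding P_def
    by (rule integral_PiM_average_eq[where j = q])
       (use that inth[of i l q] \<nu> gh spc in \<open>auto simp: P_def\<close>)
  have hm: "h \<in> borel_measurable \<nu>" using h by (rule all_moments_measurable)
  have av3: "(\<integral>w. h (w i) * h (w l) \<partial>P k \<nu>) = t\<^sup>2" if "i < k" "l < k" "i \<noteq> l" for i l
  proof -
    have "(\<integral>w. h (w i) * h (w l) \<partial>P k \<nu>) = (\<integral>w. h (w i) * t \<partial>P k \<nu>)"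
      unfolding P_def
      by (rule integral_PiM_average_eq[where j = l])
         (use that inthh[of i l] \<nu> t in \<open>auto simp: P_def\<close>)
    also have "\<dots> = t * t"
      using that t integral_PiM_component[of "{..<k}" "\<lambda>_. \<nu>" i h] \<nu> hm
      by (simp add: P_def)
    finally show ?thesis by (simp add: power2_eq_square)
  qed
  have av4: "(\<integral>w. h (w i) * h (w i) \<partial>P k \<nu>) \<le> H" if "i < k" for i
    using that H integral_PiM_component[of "{..<k}" "\<lambda>_. \<nu>" i "\<lambda>x. h x * h x"] \<nu> hm
    by (simp add: P_def power2_eq_square)
  have shared: "(\<integral>w. ?g i j w * ?g i q w \<partial>P k \<nu>) \<le> H"
    if "i < k" "j < k" "q < k" "j \<noteq> i" "q \<noteq> i" "j \<noteq> q" for i j q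
    using av1[of i j i q] av2[of i i q] av4[of i] that by simp
  define s where "s = t\<^sup>2"
  have t0: "0 \<le> s" by (simp add: s_def)
  \<comment> \<open>One majorant for all patterns of coincidence: each of the four ways to share one
    index pays \<open>H\<close>, each of the two ways to share both pays \<open>G\<close>. Where
    several terms fire, the surplus is nonnegative.\<close>
  let ?b = "\<lambda>i j l q. s + (of_bool (i = l) + of_bool (i = q) + of_bool (j = l) + of_bool (j = q)) * H
      + (of_bool (i = l \<and> j = q) + of_bool (i = q \<and> j = l)) * G"
  have bound: "(\<integral>w. ?g i j w * ?g l q w \<partial>P k \<nu>) \<le> ?b i j l q"
    if ij: "i < k" "j < k" "l < k" "q < k" "j \<noteq> i" "q \<noteq> l" for i j l q
  proof -
    consider "i = l" "j = q" | "i = q" "j = l" | "i = l" "j \<noteq> q" | "i = q" "j \<noteq> l"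
      | "j = l" "i \<noteq> q" | "j = q" "i \<noteq> l" | "i \<noteq> l" "i \<noteq> q" "j \<noteq> l" "j \<noteq> q" by blast
    then show ?thesis
    proof cases
      case 1
      then show ?thesis using G[of i j] ij H0 G0 t0 by (simp add: power2_eq_square)
    next
      case 2
      then show ?thesis using G[of i j] ij H0 G0 t0 sym[of "_ j" "_ i"] by (simp add: power2_eq_square)
    next
      case 3
      then show ?thesis using shared[of i j q] ij H0 G0 t0 by simp
    next
      case 4
      then show ?thesis using shared[of i j l] ij H0 G0 t0 sym[of "_ l" "_ i"] by simp
    next
      case 5
      then show ?thesis using shared[of j i q] ij H0 G0 t0 sym[of "_ i" "_ j"] by simp
    next
      case 6
      then show ?thesis using shared[of j i l] ij H0 G0 t0 sym[of "_ i" "_ j"] sym[of "_ l" "_ j"] by simp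
    next
      case 7
      then show ?thesis using av1[of i j l q] av2[of i l q] av3[of i l] ij by (simp add: s_def)
    qed
  qed
  have isum: "(\<integral>w. (\<Sum>i\<in>I. f i w) \<partial>P k \<nu>) = (\<Sum>i\<in>I. \<integral>w. f i w \<partial>P k \<nu>)"
    if "\<And>i. i \<in> I \<Longrightarrow> integrable (P k \<nu>) (f i)" for I :: "nat set" and f :: "nat \<Rightarrow> (nat \<Rightarrow> 'x) \<Rightarrow> real"
    using that by (rule Bochner_Integration.integral_sum)
  have bn: "0 \<le> ?b i j l q" for i j l q
    by (intro add_nonneg_nonneg mult_nonneg_nonneg H0 G0 t0) simp_all
  have "(\<integral>w. (\<Sum>i<k. \<Sum>j\<in>{..<k} - {i}. ?g i j w)\<^sup>2 \<partial>P k \<nu>)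
    = (\<integral>w. (\<Sum>i<k. \<Sum>l<k. \<Sum>j\<in>{..<k} - {i}. \<Sum>q\<in>{..<k} - {l}. ?g i j w * ?g l q w) \<partial>P k \<nu>)"
    by (simp add: power2_eq_square sum_product)
  also have "\<dots> = (\<Sum>i<k. \<Sum>l<k. \<Sum>j\<in>{..<k} - {i}. \<Sum>q\<in>{..<k} - {l}. \<integral>w. ?g i j w * ?g l q w \<partial>P k \<nu>)"
    by (intro isum[THEN trans] sum.cong refl Bochner_Integration.integrable_sum int) auto
  also have "\<dots> \<le> (\<Sum>i<k. \<Sum>l<k. \<Sum>j\<in>{..<k} - {i}. \<Sum>q\<in>{..<k} - {l}. ?b i j l q)"
    by (intro sum_mono bound) auto
  \<comment> \<open>The excluded diagonals are added back, so that coincidences can be counted over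
    full ranges: k^3 quadruples for a single one, k^2 for a double one.\<close>
  also have "\<dots> \<le> (\<Sum>i<k. \<Sum>l<k. \<Sum>j<k. \<Sum>q<k. ?b i j l q)"
  proof (intro sum_mono)
    fix i l
    have "(\<Sum>j\<in>{..<k} - {i}. \<Sum>q\<in>{..<k} - {l}. ?b i j l q) \<le> (\<Sum>j\<in>{..<k} - {i}. \<Sum>q<k. ?b i j l q)"
      by (intro sum_mono sum_mono2 bn) auto
    also have "\<dots> \<le> (\<Sum>j<k. \<Sum>q<k. ?b i j l q)"
      by (intro sum_mono2 sum_nonneg bn) auto
    finally show "(\<Sum>j\<in>{..<k} - {i}. \<Sum>q\<in>{..<k} - {l}. ?b i j l q) \<le> (\<Sum>j<k. \<Sum>q<k. ?b i j l q)" .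
  qed
  also have "\<dots> = real k ^ 4 * t\<^sup>2 + 4 * real k ^ 3 * H + 2 * real k ^ 2 * G"
  proof -
    have d1: "(\<Sum>j<k. of_bool (i = j) * c) = c" if "i < k" for i and c :: real
      using that by (simp add: of_bool_def sum.delta if_distrib[of "\<lambda>x. x * c"] cong: if_cong)
    have d2: "(\<Sum>i<k. \<Sum>l<k. of_bool (i = l) * c) = real k * c" for c :: real
      by (simp add: d1)
    have e1: "(\<Sum>i<k. \<Sum>l<k. \<Sum>j<k. \<Sum>q<k. of_bool (i = l) * H) = real k ^ 3 * H"
      using d2[of "real k * (real k * H)"]
      by (simp add: power3_eq_cube mult_ac)
    have e2: "(\<Sum>i<k. \<Sum>l<k. \<Sum>j<k. \<Sum>q<k. of_bool (i = q) * H) = real k ^ 3 * H"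
      by (simp add: d1 power3_eq_cube)
    have e3: "(\<Sum>i<k. \<Sum>l<k. \<Sum>j<k. \<Sum>q<k. of_bool (j = l) * H) = real k ^ 3 * H"
    proof -
      have "(\<Sum>l<k. \<Sum>j<k. \<Sum>q<k. of_bool (j = l) * H) = (\<Sum>l<k. \<Sum>j<k. of_bool (l = j) * (real k * H))"
        by (intro sum.cong refl) (auto simp: of_bool_def)
      then show ?thesis by (simp add: d2 power3_eq_cube)
    qed
    have e4: "(\<Sum>i<k. \<Sum>l<k. \<Sum>j<k. \<Sum>q<k. of_bool (j = q) * H) = real k ^ 3 * H"
      by (simp add: d2 power3_eq_cube)
    have e5: "(\<Sum>i<k. \<Sum>l<k. \<Sum>j<k. \<Sum>q<k. of_bool (i = l \<and> j = q) * G) = real k ^ 2 * G"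
    proof -
      have eq: "(\<Sum>j<k. \<Sum>q<k. of_bool (i = l \<and> j = q) * G) = of_bool (i = l) * (real k * G)" for i l :: nat
        using d2[of G] by (cases "i = l") auto
      then have "(\<Sum>i<k. \<Sum>l<k. \<Sum>j<k. \<Sum>q<k. of_bool (i = l \<and> j = q) * G)
          = (\<Sum>i<k. \<Sum>l<k. of_bool (i = l) * (real k * G))" by (intro sum.cong refl eq)
      then show ?thesis using d2[of "real k * G"] by (simp only: power2_eq_square mult.assoc)
    qed
    have e6: "(\<Sum>i<k. \<Sum>l<k. \<Sum>j<k. \<Sum>q<k. of_bool (i = q \<and> j = l) * G) = real k ^ 2 * G"
    proof -
      have "(\<Sum>j<k. \<Sum>q<k. of_bool (i = q \<and> j = l) * G) = G" if "i < k" "l < k" for i l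
      proof -
        have "(\<Sum>q<k. of_bool (i = q \<and> j = l) * G) = of_bool (l = j) * G" for j
          using d1[OF that(1), of G] by (cases "l = j") auto
        then have "(\<Sum>j<k. \<Sum>q<k. of_bool (i = q \<and> j = l) * G) = (\<Sum>j<k. of_bool (l = j) * G)"
          by (simp only:)
        then show ?thesis using d1[OF that(2), of G] by (simp only:)
      qed
      then have "(\<Sum>i<k. \<Sum>l<k. \<Sum>j<k. \<Sum>q<k. of_bool (i = q \<and> j = l) * G) = (\<Sum>i<k. \<Sum>l<k. G)"
        by (intro sum.cong refl) auto
      then show ?thesis by (simp add: power2_eq_square)
    qed
    have "(\<Sum>i<k. \<Sum>l<k. \<Sum>j<k. \<Sum>q<k. ?b i j l q) = real k ^ 4 * s
        + ((\<Sum>i<k. \<Sum>l<k. \<Sum>j<k. \<Sum>q<k. of_bool (i = l) * H)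
        + (\<Sum>i<k. \<Sum>l<k. \<Sum>j<k. \<Sum>q<k. of_bool (i = q) * H)
        + (\<Sum>i<k. \<Sum>l<k. \<Sum>j<k. \<Sum>q<k. of_bool (j = l) * H)
        + (\<Sum>i<k. \<Sum>l<k. \<Sum>j<k. \<Sum>q<k. of_bool (j = q) * H))
        + ((\<Sum>i<k. \<Sum>l<k. \<Sum>j<k. \<Sum>q<k. of_bool (i = l \<and> j = q) * G)
        + (\<Sum>i<k. \<Sum>l<k. \<Sum>j<k. \<Sum>q<k. of_bool (i = q \<and> j = l) * G))"
      by (simp only: distrib_right sum.distrib) (simp only: sum_constant card_lessThan power4_eq_xxxx mult.assoc)
    then show ?thesis
      unfolding e1 e2 e3 e4 e5 e6 by (simp add: s_def)
  qed
  finally show ?thesis .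
qed

section \<open>Quadratic forms in rotation-invariant vectors\<close>

context findim
begin

lemma bil_sandwich: "bil S (mv (mt A) x) (mv (mt B) y) = bil (A \<bowtie> S \<bowtie> mt B) x y"
  by (simp add: bil_def mv_mm dot_mv[of x A])

lemma bil_eq_dot1: "bil A x y = dot (mv A y) x"
  by (simp add: bil_def dot_comm)

lemma bil_eq_dot2: "bil A x y = dot (mv (mt A) x) y"
  by (simp add: bil_def dot_mv[of x])

lemma all_moments_dot:
  assumes "prob_space M" "\<And>i. i < p \<Longrightarrow> all_moments M (\<lambda>w. f w i)" "\<And>i. i < p \<Longrightarrow> all_moments M (\<lambda>w. g w i)"
  shows "all_moments M (\<lambda>w. dot (f w) (g w))"
  unfolding dot_def by (intro prob_space.all_moments_sum all_moments_mult assms) auto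

lemma all_moments_bil:
  assumes "prob_space M" "\<And>i j. i < p \<Longrightarrow> j < p \<Longrightarrow> all_moments M (\<lambda>w. A w i j)"
    "\<And>i. i < p \<Longrightarrow> all_moments M (\<lambda>w. f w i)" "\<And>i. i < p \<Longrightarrow> all_moments M (\<lambda>w. g w i)"
  shows "all_moments M (\<lambda>w. bil (A w) (f w) (g w))"
  unfolding bil_sum by (intro prob_space.all_moments_sum all_moments_mult assms) auto

lemma all_moments_mm:
  assumes "prob_space M" "\<And>k. k < p \<Longrightarrow> all_moments M (\<lambda>w. A w i k)" "\<And>k. k < p \<Longrightarrow> all_moments M (\<lambda>w. B w k j)"
  shows "all_moments M (\<lambda>w. (A w \<bowtie> B w) i j)"
  unfolding mm_def by (intro prob_space.all_moments_sum all_moments_mult assms) auto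

lemma all_moments_tra:
  assumes "prob_space M" "\<And>i. i < p \<Longrightarrow> all_moments M (\<lambda>w. A w i i)"
  shows "all_moments M (\<lambda>w. tra (A w))"
  unfolding tra_def by (intro prob_space.all_moments_sum assms) auto

lemma all_moments_gm:
  assumes "prob_space M" "\<And>a. a < k \<Longrightarrow> all_moments M (\<lambda>w. f w a i)" "\<And>a. a < k \<Longrightarrow> all_moments M (\<lambda>w. f w a j)"
  shows "all_moments M (\<lambda>w. gm k (f w) i j)"
  unfolding gm_def by (intro prob_space.all_moments_sum all_moments_mult assms) auto

lemmas all_moments_intros =
  all_moments_add all_moments_mult all_moments_abs prob_space.all_moments_const
  prob_space.all_moments_sum prob_space.all_moments_diff prob_space.all_moments_power
  all_moments_dot all_moments_bil all_moments_mm all_moments_tra all_moments_gm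

text \<open>Restricted to the index set, because points of the product measure are undefined outside
  it.\<close>

definition rotl :: "real \<Rightarrow> real \<Rightarrow> fvec \<Rightarrow> fvec \<Rightarrow> fvec" where
  "rotl c s x y = (\<lambda>j\<in>{..<p}. c * x j + s * y j)"

lemma dot_rotl: "dot v (rotl c s x y) = c * dot v x + s * dot v y"
  by (simp add: dot_def rotl_def sum_distrib_left sum.distrib algebra_simps)

lemma bil_rotl: "bil A (rotl c s x y) (rotl c' s' x y) =
   c * c' * bil A x x + c * s' * bil A x y + s * c' * bil A y x + s * s' * bil A y y"
  by (simp add: bil_sum rotl_def sum_distrib_left sum.distrib algebra_simps)

end

text \<open>Centred Gaussian vectors enter only through their covariance and the rotation invariance of
  two independent copies: the latter determines all moments of linear forms and decouples
  quadratic forms.\<close>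

locale gauss = findim p + prob_space \<nu> for p and \<nu> :: "fvec measure" +
  fixes S :: fmat
  assumes sets_nu: "sets \<nu> = sets (vec_space p)"
    and moments: "j < p \<Longrightarrow> all_moments \<nu> (\<lambda>x. x j)"
    and cov: "i < p \<Longrightarrow> j < p \<Longrightarrow> (\<integral>x. x i * x j \<partial>\<nu>) = S i j"
    and rot: "c\<^sup>2 + s\<^sup>2 = 1 \<Longrightarrow>
      distr (\<nu> \<Otimes>\<^sub>M \<nu>) (\<nu> \<Otimes>\<^sub>M \<nu>) (\<lambda>x. (rotl c s (fst x) (snd x), rotl (- s) c (fst x) (snd x))) = \<nu> \<Otimes>\<^sub>M \<nu>"
    and gram_S: "gram S"
begin

lemma mt_S [simp]: "mt S = S"
  by (rule mt_gram[OF gram_S])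

lemma am_dot: "all_moments \<nu> (\<lambda>x. dot v x)"
  by (intro all_moments_intros prob_space_axioms moments) auto

lemma am_bil: "all_moments \<nu> (\<lambda>x. bil A x x)" "all_moments \<nu> (\<lambda>x. bil A x y)" "all_moments \<nu> (\<lambda>x. bil A y x)"
  by (intro all_moments_intros prob_space_axioms moments; simp)+

lemma pair_prob: "prob_space (\<nu> \<Otimes>\<^sub>M \<nu>)"
  by (intro prob_space_pair prob_space_axioms)

lemma am_fst: "all_moments \<nu> f \<Longrightarrow> all_moments (\<nu> \<Otimes>\<^sub>M \<nu>) (\<lambda>x. f (fst x))"
  by (intro all_moments_fst prob_space_axioms)

lemma am_snd: "all_moments \<nu> f \<Longrightarrow> all_moments (\<nu> \<Otimes>\<^sub>M \<nu>) (\<lambda>x. f (snd x))"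
  by (intro all_moments_snd prob_space_axioms)

lemma am_bil2: "all_moments (\<nu> \<Otimes>\<^sub>M \<nu>) (\<lambda>x. bil A (fst x) (snd x))" "all_moments (\<nu> \<Otimes>\<^sub>M \<nu>) (\<lambda>x. bil A (snd x) (fst x))"
  by (intro all_moments_intros pair_prob am_fst am_snd moments; simp)+

lemma pair_iter:
  fixes f :: "fvec \<times> fvec \<Rightarrow> real"
  shows "all_moments (\<nu> \<Otimes>\<^sub>M \<nu>) f \<Longrightarrow> (\<integral>x. f x \<partial>(\<nu> \<Otimes>\<^sub>M \<nu>)) = (\<integral>x. \<integral>y. f (x, y) \<partial>\<nu> \<partial>\<nu>)"
proof -
  interpret pair_sigma_finite \<nu> \<nu> by unfold_locales
  assume "all_moments (\<nu> \<Otimes>\<^sub>M \<nu>) f"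
  then show ?thesis using integral_fst'[OF all_moments_integrable] by simp
qed

lemma pair_product:
  assumes "all_moments \<nu> f" "all_moments \<nu> g"
  shows "(\<integral>x. f (fst x) * g (snd x) \<partial>(\<nu> \<Otimes>\<^sub>M \<nu>)) = (\<integral>x. f x \<partial>\<nu>) * (\<integral>x. g x \<partial>\<nu>)"
  by (subst pair_iter) (auto intro!: all_moments_mult am_fst am_snd assms)

lemma rot_integral:
  assumes "c\<^sup>2 + s\<^sup>2 = 1" "f \<in> borel_measurable (\<nu> \<Otimes>\<^sub>M \<nu>)"
  shows "(\<integral>x. f (rotl c s (fst x) (snd x), rotl (- s) c (fst x) (snd x)) \<partial>(\<nu> \<Otimes>\<^sub>M \<nu>)) = (\<integral>x. f x \<partial>(\<nu> \<Otimes>\<^sub>M \<nu>) :: real)"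
proof -
  have [measurable_cong]: "sets \<nu> = sets (vec_space p)" by (rule sets_nu)
  have [measurable]: "(\<lambda>x. (rotl c s (fst x) (snd x), rotl (- s) c (fst x) (snd x))) \<in> \<nu> \<Otimes>\<^sub>M \<nu> \<rightarrow>\<^sub>M \<nu> \<Otimes>\<^sub>M \<nu>"
    unfolding rotl_def by measurable
  show ?thesis
    by (subst (2) rot[OF assms(1), symmetric], subst integral_distr) (use assms in auto)
qed

lemma E_dot_dot: "(\<integral>x. dot v x * dot w x \<partial>\<nu>) = bil S v w"
proof -
  have i: "integrable \<nu> (\<lambda>x. x i * x j)" if "i < p" "j < p" for i j
    using that by (intro all_moments_integrable all_moments_mult moments)
  have "(\<integral>x. dot v x * dot w x \<partial>\<nu>) = (\<integral>x. (\<Sum>i<p. \<Sum>j<p. (v i * w j) * (x i * x j)) \<partial>\<nu>)"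
    by (simp add: dot_def sum_product mult_ac)
  also have "\<dots> = (\<Sum>i<p. \<Sum>j<p. (v i * w j) * S i j)"
    by (intro Bochner_Integration.integral_sum[THEN trans] sum.cong refl Bochner_Integration.integrable_sum
        integrable_mult_right i) (auto simp: cov)
  finally show ?thesis by (simp add: bil_sum mult_ac)
qed

lemma E_quad: "(\<integral>x. bil Q x x \<partial>\<nu>) = tra (Q \<bowtie> S)"
proof -
  have i: "integrable \<nu> (\<lambda>x. x i * x j)" if "i < p" "j < p" for i j
    using that by (intro all_moments_integrable all_moments_mult moments)
  have "(\<integral>x. bil Q x x \<partial>\<nu>) = (\<Sum>i<p. \<Sum>j<p. Q i j * S i j)"
    unfolding bil_sum
    by (intro Bochner_Integration.integral_sum[THEN trans] sum.cong refl Bochner_Integration.integrable_sum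
        integrable_mult_right i) (auto simp: cov)
  also have "\<dots> = tra (Q \<bowtie> mt S)"
    by (simp add: tra_def mm_def mt_def del: mt_S)
  finally show ?thesis by simp
qed

lemma E_bil_bil:
  shows "(\<integral>y. bil A x y * bil B x y \<partial>\<nu>) = bil (A \<bowtie> S \<bowtie> mt B) x x"
    and "(\<integral>y. bil A x y * bil B y x \<partial>\<nu>) = bil (A \<bowtie> S \<bowtie> B) x x"
    and "(\<integral>y. bil A y x * bil B y x \<partial>\<nu>) = bil (mt A \<bowtie> S \<bowtie> B) x x"
  using E_dot_dot[of "mv (mt A) x" "mv (mt B) x"] E_dot_dot[of "mv (mt A) x" "mv (mt (mt B)) x"]
    E_dot_dot[of "mv (mt (mt A)) x" "mv (mt (mt B)) x"]
  by (simp_all add: bil_sandwich bil_eq_dot2[of _ x] bil_eq_dot1[of _ _ x] del: mt_mt)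
    (simp_all add: bil_sandwich)

abbreviation "mom v k \<equiv> \<integral>x. dot v x ^ k \<partial>\<nu>"

lemma am_dot_power: "all_moments \<nu> (\<lambda>x. dot v x ^ k)"
  by (intro all_moments_power am_dot)

text \<open>The half turn \<open>c = -1\<close>, \<open>s = 0\<close> shows that a linear form and
  its negative have the same law.\<close>

lemma odd_moment: "odd k \<Longrightarrow> mom v k = 0"
proof -
  assume k: "odd k"
  have m: "(\<lambda>x. dot v (fst x) ^ k) \<in> borel_measurable (\<nu> \<Otimes>\<^sub>M \<nu>)"
    by (intro all_moments_measurable am_fst am_dot_power)
  have e: "(\<integral>x. dot v (fst x) ^ k \<partial>(\<nu> \<Otimes>\<^sub>M \<nu>)) = mom v k"
    using pair_product[OF am_dot_power[of v k] all_moments_const[of 1]] by (simp add: prob_space)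
  from rot_integral[OF _ m, of "-1" 0] k e have "- mom v k = mom v k"
    by (simp add: dot_rotl)
  then show ?thesis by simp
qed

text \<open>By rotation through 45 degrees a linear form has the law of the sum of two independent
  copies divided by sqrt 2; the rest is the binomial theorem. The terms k = 0 and k = 2n contain the
  unknown moment itself, so for n \<ge> 2 the factor 2^n - 2 can be divided out. This yields the
  constants 3, 15 and 105 below without any density.\<close>

lemma moment_recursion: "mom v (2 * n) * 2 ^ n = (\<Sum>k\<le>2 * n. real (2 * n choose k) * (mom v k * mom v (2 * n - k)))"
proof -
  let ?c = "1 / sqrt 2"
  have m: "(\<lambda>x. dot v (fst x) ^ (2 * n)) \<in> borel_measurable (\<nu> \<Otimes>\<^sub>M \<nu>)"
    by (intro all_moments_measurable am_fst am_dot_power)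
  have e: "(\<integral>x. dot v (fst x) ^ (2 * n) \<partial>(\<nu> \<Otimes>\<^sub>M \<nu>)) = mom v (2 * n)"
    using pair_product[OF am_dot_power[of v "2 * n"] all_moments_const[of 1]] by (simp add: prob_space)
  have c: "?c\<^sup>2 + ?c\<^sup>2 = 1" by (simp add: power_divide)
  have "mom v (2 * n) = (\<integral>x. (?c * dot v (fst x) + ?c * dot v (snd x)) ^ (2 * n) \<partial>(\<nu> \<Otimes>\<^sub>M \<nu>))"
    using rot_integral[OF c m] e by (simp add: dot_rotl)
  also have "\<dots> = (\<integral>x. (1 / 2 ^ n) * (dot v (fst x) + dot v (snd x)) ^ (2 * n) \<partial>(\<nu> \<Otimes>\<^sub>M \<nu>))"
  proof (intro Bochner_Integration.integral_cong refl)
    fix x :: "fvec \<times> fvec"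
    have "?c * dot v (fst x) + ?c * dot v (snd x) = ?c * (dot v (fst x) + dot v (snd x))"
      by (simp add: algebra_simps)
    then have "(?c * dot v (fst x) + ?c * dot v (snd x)) ^ (2 * n)
        = (?c\<^sup>2) ^ n * (dot v (fst x) + dot v (snd x)) ^ (2 * n)"
      by (simp only: power_mult_distrib power_mult)
    also have "?c\<^sup>2 = 1 / 2" by (simp add: power_divide)
    finally show "(?c * dot v (fst x) + ?c * dot v (snd x)) ^ (2 * n)
        = (1 / 2 ^ n) * (dot v (fst x) + dot v (snd x)) ^ (2 * n)" by (simp add: power_divide)
  qed
  also have "\<dots> = (1 / 2 ^ n) * (\<integral>x. (\<Sum>k\<le>2 * n. real (2 * n choose k) * (dot v (fst x) ^ k * dot v (snd x) ^ (2 * n - k))) \<partial>(\<nu> \<Otimes>\<^sub>M \<nu>))"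
    by (simp add: binomial_ring mult.assoc)
  also have "(\<integral>x. (\<Sum>k\<le>2 * n. real (2 * n choose k) * (dot v (fst x) ^ k * dot v (snd x) ^ (2 * n - k))) \<partial>(\<nu> \<Otimes>\<^sub>M \<nu>))
    = (\<Sum>k\<le>2 * n. real (2 * n choose k) * (mom v k * mom v (2 * n - k)))"
    by (subst Bochner_Integration.integral_sum)
      (auto simp: pair_product[OF am_dot_power am_dot_power]
        intro!: integrable_mult_right all_moments_integrable all_moments_mult am_fst am_snd am_dot_power)
  finally show ?thesis by (simp add: field_simps)
qed

lemma moment_2: "mom v 2 = bil S v v"
  using E_dot_dot[of v v] by (simp add: power2_eq_square)

lemma moment_4: "mom v 4 = 3 * (bil S v v)\<^sup>2"
proof -
  define m where "m k = mom v k" for k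
  have rec: "m (2 * n) * 2 ^ n = (\<Sum>k\<le>2 * n. real (2 * n choose k) * (m k * m (2 * n - k)))" for n
    unfolding m_def by (rule moment_recursion)
  have m: "m 0 = 1" "m 2 = bil S v v" "m 1 = 0" "m 3 = 0" "m 5 = 0" "m 7 = 0"
    unfolding m_def by (simp add: prob_space, rule moment_2, (rule odd_moment, simp)+)
  have "m 4 * 4 = 2 * m 4 + 6 * (m 2)\<^sup>2"
    using rec[of 2] m by (simp add: eval_nat_numeral)
  then show ?thesis using m by (simp flip: m_def)
qed

lemma moment_6: "mom v 6 = 15 * (bil S v v) ^ 3"
proof -
  define m where "m k = mom v k" for k
  have rec: "m (2 * n) * 2 ^ n = (\<Sum>k\<le>2 * n. real (2 * n choose k) * (m k * m (2 * n - k)))" for n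
    unfolding m_def by (rule moment_recursion)
  have m: "m 0 = 1" "m 2 = bil S v v" "m 1 = 0" "m 3 = 0" "m 5 = 0" "m 7 = 0"
    unfolding m_def by (simp add: prob_space, rule moment_2, (rule odd_moment, simp)+)
  have "m 4 = 3 * (bil S v v)\<^sup>2" unfolding m_def by (rule moment_4)
  moreover have "m 6 * 8 = 2 * m 6 + 30 * (m 2 * m 4)"
    using rec[of 3] m by (simp add: eval_nat_numeral)
  ultimately have "m 6 = 15 * (bil S v v) ^ 3" using m by (simp add: power3_eq_cube power2_eq_square)
  then show ?thesis by (simp add: m_def)
qed

lemma moment_8: "mom v 8 = 105 * (bil S v v) ^ 4"
proof -
  define m where "m k = mom v k" for k
  have rec: "m (2 * n) * 2 ^ n = (\<Sum>k\<le>2 * n. real (2 * n choose k) * (m k * m (2 * n - k)))" for n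
    unfolding m_def by (rule moment_recursion)
  have m: "m 0 = 1" "m 2 = bil S v v" "m 1 = 0" "m 3 = 0" "m 5 = 0" "m 7 = 0"
    unfolding m_def by (simp add: prob_space, rule moment_2, (rule odd_moment, simp)+)
  have "m 4 = 3 * (bil S v v)\<^sup>2" "m 6 = 15 * (bil S v v) ^ 3"
    unfolding m_def by (rule moment_4 moment_6)+
  moreover have "m 8 * 16 = 2 * m 8 + 56 * (m 2 * m 6) + 70 * (m 4)\<^sup>2"
    using rec[of 4] m by (simp add: eval_nat_numeral)
  ultimately have "m 8 = 105 * (bil S v v) ^ 4" using m by (simp add: power4_eq_xxxx power3_eq_cube power2_eq_square)
  then show ?thesis by (simp add: m_def)
qed

lemma S_nonneg: "0 \<le> bil S v v"
  by (rule gram_quad_nonneg[OF gram_S])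

lemma tra_S_nonneg: "gram Q \<Longrightarrow> 0 \<le> tra (Q \<bowtie> S)"
  by (rule tra_gram_nonneg[OF _ gram_S])

text \<open>The form is a sum of squares of linear forms, each square having L2 norm sqrt 3 times
  the variance of the linear form; these variances add up to the trace.\<close>

lemma quad_second_moment_le:
  assumes "gram Q"
  shows "(\<integral>x. (bil Q x x)\<^sup>2 \<partial>\<nu>) \<le> 3 * (tra (Q \<bowtie> S))\<^sup>2"
proof -
  obtain k w where Q: "Q = gm k w" using assms by (auto simp: gram_def)
  have "(\<integral>x. (\<Sum>a<k. (dot (w a) x)\<^sup>2)\<^sup>2 \<partial>\<nu>) \<le> (\<Sum>a<k. sqrt 3 * bil S (w a) (w a))\<^sup>2"
  proof (rule minkowski_sq)
    fix a
    show "(\<integral>x. ((dot (w a) x)\<^sup>2)\<^sup>2 \<partial>\<nu>) \<le> (sqrt 3 * bil S (w a) (w a))\<^sup>2"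
      using moment_4[of "w a"] by (simp add: power_mult_distrib flip: power_mult)
  qed (auto intro!: am_dot_power mult_nonneg_nonneg S_nonneg)
  also have "(\<Sum>a<k. sqrt 3 * bil S (w a) (w a)) = sqrt 3 * tra (Q \<bowtie> S)"
    by (simp add: Q tra_gm sum_distrib_left)
  finally show ?thesis
    by (simp add: Q bil_gm power2_eq_square[of "dot _ _"] power_mult_distrib)
qed

text \<open>The square of the form is a sum over pairs of products of squared linear forms.
  Cauchy-Schwarz and the eighth moment give each product an L2 norm of at most sqrt 105 times the
  two variances.\<close>

lemma quad_fourth_moment_le:
  assumes "gram Q"
  shows "(\<integral>x. (bil Q x x) ^ 4 \<partial>\<nu>) \<le> 105 * (tra (Q \<bowtie> S)) ^ 4"
proof -
  obtain k w where Q: "Q = gm k w" using assms by (auto simp: gram_def)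
  let ?s = "\<lambda>a. bil S (w a) (w a)"
  have *: "(\<integral>x. (\<Sum>c\<in>{..<k} \<times> {..<k}. (dot (w (fst c)) x)\<^sup>2 * (dot (w (snd c)) x)\<^sup>2)\<^sup>2 \<partial>\<nu>)
      \<le> (\<Sum>c\<in>{..<k} \<times> {..<k}. sqrt 105 * (?s (fst c) * ?s (snd c)))\<^sup>2"
  proof (rule minkowski_sq)
    fix c :: "nat \<times> nat"
    have m8: "(\<integral>x. (dot v x ^ 4)\<^sup>2 \<partial>\<nu>) \<le> (sqrt 105 * (bil S v v)\<^sup>2)\<^sup>2" for v
      using moment_8[of v] by (simp add: power_mult_distrib flip: power_mult)
    have "(\<integral>x. dot (w (fst c)) x ^ 4 * dot (w (snd c)) x ^ 4 \<partial>\<nu>)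
        \<le> (sqrt 105 * (?s (fst c))\<^sup>2) * (sqrt 105 * (?s (snd c))\<^sup>2)"
      by (intro cauchy_schwarz_le am_dot_power m8) auto
    then show "(\<integral>x. ((dot (w (fst c)) x)\<^sup>2 * (dot (w (snd c)) x)\<^sup>2)\<^sup>2 \<partial>\<nu>) \<le> (sqrt 105 * (?s (fst c) * ?s (snd c)))\<^sup>2"
    proof -
      have "(a\<^sup>2 * b\<^sup>2)\<^sup>2 = a ^ 4 * b ^ 4" "(sqrt 105 * (a * b))\<^sup>2 = (sqrt 105 * a\<^sup>2) * (sqrt 105 * b\<^sup>2)" for a b :: real
        by (simp add: power_mult_distrib flip: power_mult) (simp only: power2_eq_square mult_ac)
      then show ?thesis
        using \<open>(\<integral>x. dot (w (fst c)) x ^ 4 * dot (w (snd c)) x ^ 4 \<partial>\<nu>) \<le> _\<close> by (simp only:)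
    qed
  qed (auto intro!: am_dot_power all_moments_mult mult_nonneg_nonneg S_nonneg)
  have 1: "(\<Sum>c\<in>{..<k} \<times> {..<k}. sqrt 105 * (?s (fst c) * ?s (snd c))) = sqrt 105 * (tra (Q \<bowtie> S))\<^sup>2"
  proof -
    have "(\<Sum>c\<in>{..<k} \<times> {..<k}. ?s (fst c) * ?s (snd c)) = (\<Sum>a<k. ?s a) * (\<Sum>a<k. ?s a)"
      unfolding sum_product sum.cartesian_product by (simp add: split_def)
    then show ?thesis by (simp add: Q tra_gm power2_eq_square flip: sum_distrib_left)
  qed
  have 2: "(\<Sum>c\<in>{..<k} \<times> {..<k}. (dot (w (fst c)) x)\<^sup>2 * (dot (w (snd c)) x)\<^sup>2) = (bil Q x x)\<^sup>2" for x
    by (simp add: Q bil_gm power2_eq_square sum_product sum.cartesian_product split_def)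
  from * show ?thesis
    unfolding 1 2 by (simp add: power_mult_distrib flip: power_mult)
qed

text \<open>Rotating the pair by 45 degrees turns the difference of two quadratic forms into a
  bilinear one, which is linear in either vector when the other is held fixed. Both central moments
  below rest on this.\<close>

lemma decouple:
  assumes "(\<lambda>x. G (bil Q (fst x) (fst x) - bil Q (snd x) (snd x)) :: real) \<in> borel_measurable (\<nu> \<Otimes>\<^sub>M \<nu>)"
  shows "(\<integral>x. G (bil Q (fst x) (fst x) - bil Q (snd x) (snd x)) \<partial>(\<nu> \<Otimes>\<^sub>M \<nu>)) =
         (\<integral>x. G (bil Q (fst x) (snd x) + bil Q (snd x) (fst x)) \<partial>(\<nu> \<Otimes>\<^sub>M \<nu>))"
proof -
  let ?c = "1 / sqrt 2"
  have c: "?c\<^sup>2 + ?c\<^sup>2 = 1" "?c * ?c = 1 / 2" by (simp_all add: power_divide)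
  have "bil Q (rotl ?c ?c x y) (rotl ?c ?c x y) - bil Q (rotl (- ?c) ?c x y) (rotl (- ?c) ?c x y)
      = bil Q x y + bil Q y x" for x y
    by (simp add: bil_rotl field_simps)
  then show ?thesis
    using rot_integral[OF c(1) assms] by simp
qed

text \<open>The variance is half the second moment of the difference of two copies, which decouples.
  \<open>Q\<close> is not symmetric in general, hence two different traces; they become
  \<open>U\<close> and \<open>V\<close> later.\<close>

lemma quad_variance:
  "(\<integral>x. (bil Q x x - tra (Q \<bowtie> S))\<^sup>2 \<partial>\<nu>) = tra (Q \<bowtie> S \<bowtie> mt Q \<bowtie> S) + tra (Q \<bowtie> S \<bowtie> Q \<bowtie> S)"
proof -
  define q where "q = (\<lambda>x. bil Q x x - tra (Q \<bowtie> S))"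
  have q: "all_moments \<nu> q" unfolding q_def by (intro all_moments_diff am_bil all_moments_const)
  have q0: "(\<integral>x. q x \<partial>\<nu>) = 0"
    unfolding q_def using all_moments_integrable[OF am_bil(1)[of Q]] by (simp add: E_quad prob_space)
  have m: "(\<lambda>x. (bil Q (fst x) (fst x) - bil Q (snd x) (snd x))\<^sup>2) \<in> borel_measurable (\<nu> \<Otimes>\<^sub>M \<nu>)"
    by (intro all_moments_measurable all_moments_intros pair_prob am_fst am_snd moments; simp)
  have 1: "(\<integral>x. (bil Q (fst x) (fst x) - bil Q (snd x) (snd x))\<^sup>2 \<partial>(\<nu> \<Otimes>\<^sub>M \<nu>)) = 2 * (\<integral>x. (q x)\<^sup>2 \<partial>\<nu>)"
  proof -
    have "(\<integral>x. (bil Q (fst x) (fst x) - bil Q (snd x) (snd x))\<^sup>2 \<partial>(\<nu> \<Otimes>\<^sub>M \<nu>))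
      = (\<integral>x. (q (fst x))\<^sup>2 * 1 + (-2) * (q (fst x) * q (snd x)) + 1 * (q (snd x))\<^sup>2 \<partial>(\<nu> \<Otimes>\<^sub>M \<nu>))"
      by (intro Bochner_Integration.integral_cong) (auto simp: q_def power2_eq_square algebra_simps)
    also have "\<dots> = (\<integral>x. (q (fst x))\<^sup>2 * 1 \<partial>(\<nu> \<Otimes>\<^sub>M \<nu>)) + (-2) * (\<integral>x. q (fst x) * q (snd x) \<partial>(\<nu> \<Otimes>\<^sub>M \<nu>))
        + (\<integral>x. 1 * (q (snd x))\<^sup>2 \<partial>(\<nu> \<Otimes>\<^sub>M \<nu>))"
      using all_moments_integrable[OF am_fst[OF all_moments_power[OF q, of 2]]]
        all_moments_integrable[OF am_snd[OF all_moments_power[OF q, of 2]]]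
        all_moments_integrable[OF all_moments_mult[OF am_fst[OF q] am_snd[OF q]]] by simp
    also have "\<dots> = 2 * (\<integral>x. (q x)\<^sup>2 \<partial>\<nu>)"
      using pair_product[OF all_moments_power[OF q, of 2] all_moments_const[of 1]]
        pair_product[OF all_moments_const[of 1] all_moments_power[OF q, of 2]] pair_product[OF q q] q0
      by (simp add: prob_space)
    finally show ?thesis .
  qed
  have "(\<integral>x. (bil Q (fst x) (snd x) + bil Q (snd x) (fst x))\<^sup>2 \<partial>(\<nu> \<Otimes>\<^sub>M \<nu>))
     = (\<integral>x. \<integral>y. (bil Q x y + bil Q y x)\<^sup>2 \<partial>\<nu> \<partial>\<nu>)"
    by (subst pair_iter) (auto intro!: all_moments_intros am_bil2 pair_prob prob_space.all_moments_power)
  also have "\<dots> = (\<integral>x. bil (Q \<bowtie> S \<bowtie> mt Q) x x + 2 * bil (Q \<bowtie> S \<bowtie> Q) x x + bil (mt Q \<bowtie> S \<bowtie> Q) x x \<partial>\<nu>)"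
  proof (intro Bochner_Integration.integral_cong refl)
    fix x
    have "(\<integral>y. (bil Q x y + bil Q y x)\<^sup>2 \<partial>\<nu>)
       = (\<integral>y. bil Q x y * bil Q x y + 2 * (bil Q x y * bil Q y x) + bil Q y x * bil Q y x \<partial>\<nu>)"
      by (simp add: power2_eq_square algebra_simps)
    also have "\<dots> = (\<integral>y. bil Q x y * bil Q x y \<partial>\<nu>) + 2 * (\<integral>y. bil Q x y * bil Q y x \<partial>\<nu>) + (\<integral>y. bil Q y x * bil Q y x \<partial>\<nu>)"
      by (subst Bochner_Integration.integral_add;
          (intro Bochner_Integration.integrable_add integrable_mult_right all_moments_integrable all_moments_mult am_bil)?)+ simp
    finally show "(\<integral>y. (bil Q x y + bil Q y x)\<^sup>2 \<partial>\<nu>) = bil (Q \<bowtie> S \<bowtie> mt Q) x x + 2 * bil (Q \<bowtie> S \<bowtie> Q) x x + bil (mt Q \<bowtie> S \<bowtie> Q) x x"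
      by (simp add: E_bil_bil)
  qed
  also have "\<dots> = tra (Q \<bowtie> S \<bowtie> mt Q \<bowtie> S) + 2 * tra (Q \<bowtie> S \<bowtie> Q \<bowtie> S) + tra (mt Q \<bowtie> S \<bowtie> Q \<bowtie> S)"
    using all_moments_integrable[OF am_bil(1)] by (simp add: E_quad)
  also have "tra (mt Q \<bowtie> S \<bowtie> Q \<bowtie> S) = tra (Q \<bowtie> S \<bowtie> mt Q \<bowtie> S)"
    using tra_comm[of "mt Q \<bowtie> S" "Q \<bowtie> S"] by simp
  finally show ?thesis
    using 1 decouple[OF m] by (simp add: q_def)
qed

lemma quad_variance_le:
  "(\<integral>x. (bil Q x x - tra (Q \<bowtie> S))\<^sup>2 \<partial>\<nu>) \<le> 2 * tra (Q \<bowtie> S \<bowtie> mt Q \<bowtie> S)"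
  unfolding quad_variance using abs_tra_square_le[OF gram_S, of Q] by simp

text \<open>For a fixed first argument the form is linear in the second, with a variance that is a
  quadratic form in the first. The constant is 3 from the fourth moment times 3 from
  \<open>quad_second_moment_le\<close>.\<close>

lemma bil_fourth_moment_le:
  "(\<integral>x. bil Q (fst x) (snd x) ^ 4 \<partial>(\<nu> \<Otimes>\<^sub>M \<nu>)) \<le> 9 * (tra (Q \<bowtie> S \<bowtie> mt Q \<bowtie> S))\<^sup>2"
proof -
  have "(\<integral>x. bil Q (fst x) (snd x) ^ 4 \<partial>(\<nu> \<Otimes>\<^sub>M \<nu>)) = (\<integral>x. \<integral>y. bil Q x y ^ 4 \<partial>\<nu> \<partial>\<nu>)"
    by (subst pair_iter) (auto intro!: prob_space.all_moments_power pair_prob am_bil2)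
  also have "\<dots> = (\<integral>x. 3 * (bil (Q \<bowtie> S \<bowtie> mt Q) x x)\<^sup>2 \<partial>\<nu>)"
    by (simp add: bil_eq_dot2[of Q] moment_4 bil_sandwich)
  also have "\<dots> \<le> 3 * (3 * (tra ((Q \<bowtie> S \<bowtie> mt Q) \<bowtie> S))\<^sup>2)"
    using quad_second_moment_le[OF gram_sandwich[OF gram_S, of Q]] by simp
  finally show ?thesis by simp
qed

text \<open>For independent copies the fourth moment of the difference is twice the wanted one plus
  six times the squared variance, which is dropped. After decoupling, (a + b)^4 \<le> 8 (a^4 + b^4)
  leads to 8 times 9 + 9, that is 144, which is then halved.\<close>

lemma quad_fourth_central_le:
  "(\<integral>x. (bil Q x x - tra (Q \<bowtie> S)) ^ 4 \<partial>\<nu>) \<le> 72 * (tra (Q \<bowtie> S \<bowtie> mt Q \<bowtie> S))\<^sup>2"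
proof -
  define q where "q = (\<lambda>x. bil Q x x - tra (Q \<bowtie> S))"
  have q: "all_moments \<nu> q" unfolding q_def by (intro all_moments_diff am_bil all_moments_const)
  have q0: "(\<integral>x. q x \<partial>\<nu>) = 0"
    unfolding q_def using all_moments_integrable[OF am_bil(1)[of Q]] by (simp add: E_quad prob_space)
  note qp = all_moments_power[OF q]
  have m: "(\<lambda>x. (bil Q (fst x) (fst x) - bil Q (snd x) (snd x)) ^ 4) \<in> borel_measurable (\<nu> \<Otimes>\<^sub>M \<nu>)"
    by (intro all_moments_measurable all_moments_intros pair_prob am_fst am_snd moments; simp)
  have i: "integrable (\<nu> \<Otimes>\<^sub>M \<nu>) (\<lambda>x. q (fst x) ^ k * q (snd x) ^ l)" for k l
    by (intro all_moments_integrable all_moments_mult am_fst am_snd qp)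
  have e: "(\<integral>x. q (fst x) ^ k * q (snd x) ^ l \<partial>(\<nu> \<Otimes>\<^sub>M \<nu>)) = (\<integral>x. q x ^ k \<partial>\<nu>) * (\<integral>x. q x ^ l \<partial>\<nu>)" for k l
    by (rule pair_product[OF qp qp])
  have "(\<integral>x. (bil Q (fst x) (fst x) - bil Q (snd x) (snd x)) ^ 4 \<partial>(\<nu> \<Otimes>\<^sub>M \<nu>))
      = (\<integral>x. q (fst x) ^ 4 * q (snd x) ^ 0 + ((-4) * (q (fst x) ^ 3 * q (snd x) ^ 1) + (6 * (q (fst x) ^ 2 * q (snd x) ^ 2)
         + ((-4) * (q (fst x) ^ 1 * q (snd x) ^ 3) + q (fst x) ^ 0 * q (snd x) ^ 4))) \<partial>(\<nu> \<Otimes>\<^sub>M \<nu>))"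
  proof (intro Bochner_Integration.integral_cong refl)
    fix x :: "fvec \<times> fvec"
    have "(a - b) ^ 4 = a ^ 4 * b ^ 0 + ((-4) * (a ^ 3 * b ^ 1) + (6 * (a ^ 2 * b ^ 2) + ((-4) * (a ^ 1 * b ^ 3) + a ^ 0 * b ^ 4)))" for a b :: real
      by (simp add: eval_nat_numeral algebra_simps)
    from this[of "q (fst x)" "q (snd x)"]
    show "(bil Q (fst x) (fst x) - bil Q (snd x) (snd x)) ^ 4 = q (fst x) ^ 4 * q (snd x) ^ 0 + ((-4) * (q (fst x) ^ 3 * q (snd x) ^ 1) + (6 * (q (fst x) ^ 2 * q (snd x) ^ 2)
         + ((-4) * (q (fst x) ^ 1 * q (snd x) ^ 3) + q (fst x) ^ 0 * q (snd x) ^ 4)))"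
      by (simp only: q_def) simp
  qed
  also have "\<dots> = 2 * (\<integral>x. q x ^ 4 \<partial>\<nu>) + 6 * (\<integral>x. q x ^ 2 \<partial>\<nu>)\<^sup>2"
    using q0 by (subst Bochner_Integration.integral_add; (intro Bochner_Integration.integrable_add integrable_mult_right i)?)+
      (simp only: Bochner_Integration.integral_mult_right_zero e, simp add: power2_eq_square prob_space)
  finally have 1: "2 * (\<integral>x. q x ^ 4 \<partial>\<nu>) \<le> (\<integral>x. (bil Q (fst x) (fst x) - bil Q (snd x) (snd x)) ^ 4 \<partial>(\<nu> \<Otimes>\<^sub>M \<nu>))"
    by simp
  also have "\<dots> = (\<integral>x. (bil Q (fst x) (snd x) + bil Q (snd x) (fst x)) ^ 4 \<partial>(\<nu> \<Otimes>\<^sub>M \<nu>))"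
    by (rule decouple[OF m])
  also have "\<dots> \<le> (\<integral>x. 8 * (bil Q (fst x) (snd x) ^ 4 + bil (mt Q) (fst x) (snd x) ^ 4) \<partial>(\<nu> \<Otimes>\<^sub>M \<nu>))"
  proof (intro integral_mono)
    show "integrable (\<nu> \<Otimes>\<^sub>M \<nu>) (\<lambda>x. (bil Q (fst x) (snd x) + bil Q (snd x) (fst x)) ^ 4)"
      by (intro all_moments_integrable prob_space.all_moments_power pair_prob all_moments_add am_bil2)
    show "integrable (\<nu> \<Otimes>\<^sub>M \<nu>) (\<lambda>x. 8 * (bil Q (fst x) (snd x) ^ 4 + bil (mt Q) (fst x) (snd x) ^ 4))"
      by (intro integrable_mult_right all_moments_integrable prob_space.all_moments_power pair_prob all_moments_add am_bil2)
    fix x :: "fvec \<times> fvec"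
    have sq: "(a + b)\<^sup>2 \<le> 2 * (a\<^sup>2 + b\<^sup>2)" for a b :: real
      using sum_squares_bound[of a b] by (simp add: power2_eq_square algebra_simps)
    have "(a + b) ^ 4 \<le> 8 * (a ^ 4 + b ^ 4)" for a b :: real
    proof -
      have "((a + b)\<^sup>2)\<^sup>2 \<le> (2 * (a\<^sup>2 + b\<^sup>2))\<^sup>2"
        by (intro power_mono sq) simp
      also have "\<dots> = 4 * (a\<^sup>2 + b\<^sup>2)\<^sup>2" by (simp only: power_mult_distrib) simp
      also have "\<dots> \<le> 4 * (2 * ((a\<^sup>2)\<^sup>2 + (b\<^sup>2)\<^sup>2))" by (intro mult_left_mono sq) simp
      finally show ?thesis by (simp flip: power_mult)
    qed
    then show "(bil Q (fst x) (snd x) + bil Q (snd x) (fst x)) ^ 4 \<le> 8 * (bil Q (fst x) (snd x) ^ 4 + bil (mt Q) (fst x) (snd x) ^ 4)"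
      by (simp only: bil_mt)
  qed
  also have "\<dots> = 8 * ((\<integral>x. bil Q (fst x) (snd x) ^ 4 \<partial>(\<nu> \<Otimes>\<^sub>M \<nu>)) + (\<integral>x. bil (mt Q) (fst x) (snd x) ^ 4 \<partial>(\<nu> \<Otimes>\<^sub>M \<nu>)))"
    by (simp only: integral_mult_right_zero, subst Bochner_Integration.integral_add)
      (auto intro!: all_moments_integrable prob_space.all_moments_power pair_prob am_bil2)
  also have "\<dots> \<le> 8 * (9 * (tra (Q \<bowtie> S \<bowtie> mt Q \<bowtie> S))\<^sup>2 + 9 * (tra (mt Q \<bowtie> S \<bowtie> mt (mt Q) \<bowtie> S))\<^sup>2)"
    by (intro mult_left_mono add_mono bil_fourth_moment_le) simp
  also have "tra (mt Q \<bowtie> S \<bowtie> mt (mt Q) \<bowtie> S) = tra (Q \<bowtie> S \<bowtie> mt Q \<bowtie> S)"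
    using tra_comm[of "mt Q \<bowtie> S" "Q \<bowtie> S"] by simp
  finally show ?thesis by (simp add: q_def)
qed

end

text \<open>The upper estimate inverts the quadratic Taylor bound for exp x, because (1 - x +
  x^2/2)(1 + x + x^2/2) = 1 + x^4/4.\<close>

lemma exp_minus_quadratic:
  fixes x :: real
  assumes "0 \<le> x"
  shows "\<bar>1 - x - exp (- x)\<bar> \<le> x\<^sup>2 / 2"
proof -
  have l: "1 - x \<le> exp (- x)" using exp_ge_add_one_self[of "- x"] by simp
  have e: "1 + x + x\<^sup>2 / 2 \<le> exp x" by (rule exp_lower_Taylor_quadratic[OF assms])
  have p: "0 < 1 + x + x\<^sup>2 / 2" using assms by (simp add: add_pos_nonneg)
  have "exp (- x) \<le> 1 / (1 + x + x\<^sup>2 / 2)"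
    using e p by (simp add: exp_minus field_simps)
  also have "\<dots> \<le> 1 - x + x\<^sup>2 / 2"
  proof -
    have "1 \<le> 1 + (x\<^sup>2 / 2)\<^sup>2" by simp
    also have "\<dots> = (1 - x + x\<^sup>2 / 2) * (1 + x + x\<^sup>2 / 2)"
      by (simp add: power2_eq_square algebra_simps)
    finally show ?thesis using p by (simp add: divide_le_eq)
  qed
  finally show ?thesis using l by simp
qed

section \<open>Gram matrices of independent Gaussian vectors\<close>

context gauss
begin

abbreviation W :: "nat \<Rightarrow> (nat \<Rightarrow> fvec) measure" where "W k \<equiv> PiM {..<k} (\<lambda>_. \<nu>)"

lemma W_prob: "prob_space (W k)"
  by (intro prob_space_PiM prob_space_axioms)

lemma am_W: "all_moments \<nu> f \<Longrightarrow> a < k \<Longrightarrow> all_moments (W k) (\<lambda>w. f (w a))"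
  by (rule all_moments_PiM) (auto intro: prob_space_axioms)

lemma am_W_coord: "a < k \<Longrightarrow> i < p \<Longrightarrow> all_moments (W k) (\<lambda>w. w a i)"
  using am_W[OF moments] by blast

lemma E_W: "all_moments \<nu> f \<Longrightarrow> a < k \<Longrightarrow> (\<integral>w. f (w a) \<partial>W k) = (\<integral>x. f x \<partial>\<nu>)"
  by (subst integral_PiM_component) (auto intro: prob_space_axioms all_moments_measurable)

lemma W_average:
  assumes "j < k" "integrable (W k) f"
    and "\<And>w. w \<in> space (W k) \<Longrightarrow> (\<integral>y. f (w(j := y)) \<partial>\<nu>) = g w"
  shows "(\<integral>w. f w \<partial>W k) = (\<integral>w. g w \<partial>W k :: real)"
  using assms by (intro integral_PiM_average_eq[where j = j]) (auto intro: prob_space_axioms)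

lemma am_W_bil: "a < k \<Longrightarrow> b < k \<Longrightarrow> all_moments (W k) (\<lambda>w. bil A (w a) (w b))"
  by (intro all_moments_intros W_prob am_W_coord; simp)

lemma am_W_tra:
  "all_moments (W k) (\<lambda>w. tra (gm k w \<bowtie> Q))"
  "all_moments (W k) (\<lambda>w. tra (gm k w \<bowtie> A \<bowtie> gm k w \<bowtie> B))"
  by (intro all_moments_intros W_prob am_W_coord; simp)+

lemma centred_sum_variance:
  assumes q: "all_moments \<nu> q" and q0: "(\<integral>x. q x \<partial>\<nu>) = 0"
  shows "(\<integral>w. (\<Sum>a<k. q (w a))\<^sup>2 \<partial>W k) = real k * (\<integral>x. (q x)\<^sup>2 \<partial>\<nu>)"
proof -
  have am: "all_moments (W k) (\<lambda>w. q (w a) * q (w b))" if "a < k" "b < k" for a b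
    using that by (intro all_moments_mult am_W q)
  have e: "(\<integral>w. q (w a) * q (w b) \<partial>W k) = (if a = b then \<integral>x. (q x)\<^sup>2 \<partial>\<nu> else 0)" if ab: "a < k" "b < k" for a b
  proof (cases "a = b")
    case True
    then show ?thesis using E_W[OF all_moments_power[OF q, of 2] ab(1)] by (simp add: power2_eq_square)
  next
    case False
    have "(\<integral>w. q (w a) * q (w b) \<partial>W k) = (\<integral>w. 0 \<partial>W k)"
      by (rule W_average[OF ab(2) all_moments_integrable[OF am[OF ab]]]) (use False q0 in auto)
    then show ?thesis using False by simp
  qed
  have "(\<integral>w. (\<Sum>a<k. q (w a))\<^sup>2 \<partial>W k) = (\<integral>w. (\<Sum>a<k. \<Sum>b<k. q (w a) * q (w b)) \<partial>W k)"
    by (simp add: power2_eq_square sum_product)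
  also have "\<dots> = (\<Sum>a<k. \<Sum>b<k. \<integral>w. q (w a) * q (w b) \<partial>W k)"
    by (intro Bochner_Integration.integral_sum[THEN trans] sum.cong refl Bochner_Integration.integrable_sum
        all_moments_integrable am) auto
  also have "\<dots> = (\<Sum>a<k. \<Sum>b<k. if a = b then \<integral>x. (q x)\<^sup>2 \<partial>\<nu> else 0)"
    by (intro sum.cong refl e) auto
  finally show ?thesis by simp
qed

lemma E_tra: "(\<integral>w. tra (gm k w \<bowtie> Q) \<partial>W k) = real k * tra (Q \<bowtie> S)"
proof -
  have "(\<integral>w. tra (gm k w \<bowtie> Q) \<partial>W k) = (\<Sum>a<k. \<integral>w. bil Q (w a) (w a) \<partial>W k)"
    unfolding tra_gm by (intro Bochner_Integration.integral_sum all_moments_integrable am_W_bil) auto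
  also have "\<dots> = (\<Sum>a<k. tra (Q \<bowtie> S))"
    by (intro sum.cong refl) (simp add: E_W[OF am_bil(1)] E_quad)
  finally show ?thesis by simp
qed

abbreviation "cquad Q x \<equiv> bil Q x x - tra (Q \<bowtie> S)"

lemma am_cquad: "all_moments \<nu> (\<lambda>x. cquad Q x)"
  by (intro all_moments_diff am_bil all_moments_const)

lemma E_cquad: "(\<integral>x. cquad Q x \<partial>\<nu>) = 0"
  using all_moments_integrable[OF am_bil(1)[of Q]] by (simp add: E_quad prob_space)

lemma tra_centred: "tra (gm k w \<bowtie> Q) - real k * tra (Q \<bowtie> S) = (\<Sum>a<k. cquad Q (w a))"
  by (simp add: tra_gm sum_subtractf)

lemma tra_variance_le:
  "(\<integral>w. (tra (gm k w \<bowtie> Q) - real k * tra (Q \<bowtie> S))\<^sup>2 \<partial>W k) \<le> 2 * real k * tra (Q \<bowtie> S \<bowtie> mt Q \<bowtie> S)"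
  unfolding tra_centred centred_sum_variance[OF am_cquad E_cquad]
  using mult_left_mono[OF quad_variance_le[of Q], of "real k"] by simp

lemma tra_QSQS_nonneg: "0 \<le> tra (Q \<bowtie> S \<bowtie> mt Q \<bowtie> S)"
  using tra_gram_nonneg[OF gram_sandwich[OF gram_S, of Q] gram_S] by simp

lemma tra_gram_SS_nonneg:
  "gram A \<Longrightarrow> gram R \<Longrightarrow> 0 \<le> tra (A \<bowtie> S \<bowtie> R \<bowtie> S)"
  using tra_gram_nonneg[OF _ gram_sandwich_sym[OF gram_S], of A R] by simp

lemma tra_sq_le: "gram R \<Longrightarrow> tra (R \<bowtie> S \<bowtie> R \<bowtie> S) \<le> (tra (R \<bowtie> S))\<^sup>2"
  by (rule tra_sq_gram_le[OF _ gram_S])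

lemma E_bil_bil_pair:
  assumes "a < k" "b < k" "a \<noteq> b"
  shows "(\<integral>w. bil A (w a) (w b) * bil R (w b) (w a) \<partial>W k) = tra (A \<bowtie> S \<bowtie> R \<bowtie> S)"
proof -
  have "(\<integral>w. bil A (w a) (w b) * bil R (w b) (w a) \<partial>W k) = (\<integral>w. bil (A \<bowtie> S \<bowtie> R) (w a) (w a) \<partial>W k)"
    by (rule W_average[where j = b])
      (use assms in \<open>auto simp: E_bil_bil intro!: all_moments_integrable all_moments_mult am_W_bil\<close>)
  also have "\<dots> = tra ((A \<bowtie> S \<bowtie> R) \<bowtie> S)"
    using E_W[OF am_bil(1) assms(1)] by (simp add: E_quad del: mm_assoc)
  finally show ?thesis by simp
qed

lemma E_bil4_pair:
  assumes "a < k" "b < k" "a \<noteq> b"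
  shows "(\<integral>w. bil A (w a) (w b) ^ 4 \<partial>W k) \<le> 9 * (tra (A \<bowtie> S \<bowtie> mt A \<bowtie> S))\<^sup>2"
proof -
  have "(\<integral>w. bil A (w a) (w b) ^ 4 \<partial>W k) = (\<integral>w. 3 * (bil (A \<bowtie> S \<bowtie> mt A) (w a) (w a))\<^sup>2 \<partial>W k)"
  proof (rule W_average[where j = b])
    show "integrable (W k) (\<lambda>w. bil A (w a) (w b) ^ 4)"
      by (intro all_moments_integrable prob_space.all_moments_power W_prob am_W_bil assms)
    show "(\<integral>y. bil A ((w(b := y)) a) ((w(b := y)) b) ^ 4 \<partial>\<nu>) = 3 * (bil (A \<bowtie> S \<bowtie> mt A) (w a) (w a))\<^sup>2" for w
      using assms by (simp add: bil_eq_dot2[of A] moment_4 bil_sandwich)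
  qed (rule assms)
  also have "\<dots> = 3 * (\<integral>x. (bil (A \<bowtie> S \<bowtie> mt A) x x)\<^sup>2 \<partial>\<nu>)"
    using E_W[OF all_moments_power[OF am_bil(1), of _ 2] assms(1)] by simp
  also have "\<dots> \<le> 3 * (3 * (tra ((A \<bowtie> S \<bowtie> mt A) \<bowtie> S))\<^sup>2)"
    using quad_second_moment_le[OF gram_sandwich[OF gram_S, of A]] by simp
  finally show ?thesis by simp
qed

lemma E_quad_quad_le:
  assumes "gram A" "gram R"
  shows "(\<integral>x. bil A x x * bil R x x \<partial>\<nu>) \<le> 3 * (tra (A \<bowtie> S) * tra (R \<bowtie> S))"
proof -
  have s: "(\<integral>x. (bil A x x)\<^sup>2 \<partial>\<nu>) \<le> (sqrt 3 * tra (A \<bowtie> S))\<^sup>2" if "gram A" for A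
    using quad_second_moment_le[OF that] by (simp add: power_mult_distrib)
  have "(\<integral>x. bil A x x * bil R x x \<partial>\<nu>) \<le> (sqrt 3 * tra (A \<bowtie> S)) * (sqrt 3 * tra (R \<bowtie> S))"
    by (intro cauchy_schwarz_le am_bil s assms mult_nonneg_nonneg tra_S_nonneg) simp_all
  also have "\<dots> = (sqrt 3 * sqrt 3) * (tra (A \<bowtie> S) * tra (R \<bowtie> S))" by (simp only: mult_ac)
  finally show ?thesis by simp
qed

lemma split_diag: "(\<Sum>a<k. \<Sum>b<k. f a b) = (\<Sum>a<k. f a a) + (\<Sum>a<k. \<Sum>b\<in>{..<k} - {a}. f a b)"
  for f :: "nat \<Rightarrow> nat \<Rightarrow> real"
proof -
  have "(\<Sum>a<k. \<Sum>b<k. f a b) = (\<Sum>a<k. f a a + (\<Sum>b\<in>{..<k} - {a}. f a b))"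
    by (intro sum.cong refl sum.remove) auto
  then show ?thesis by (simp add: sum.distrib)
qed

text \<open>Distinct columns contribute the first trace, at most k^2 times; equal columns contribute
  a product of two quadratic forms, controlled by Cauchy-Schwarz. With traces of order
  \<open>p\<close> and k well below \<open>p\<close> it is the equal columns that dominate.\<close>

lemma E_tra_tra_le:
  assumes "gram A" "gram R"
  shows "(\<integral>w. tra (gm k w \<bowtie> A \<bowtie> gm k w \<bowtie> R) \<partial>W k)
    \<le> (real k)\<^sup>2 * tra (A \<bowtie> S \<bowtie> R \<bowtie> S) + 3 * real k * (tra (A \<bowtie> S) * tra (R \<bowtie> S))"
proof -
  let ?g = "\<lambda>a b w. bil A (w a) (w b) * bil R (w b) (w a)"
  let ?t = "tra (A \<bowtie> S \<bowtie> R \<bowtie> S)"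
  have i: "integrable (W k) (?g a b)" if "a < k" "b < k" for a b
    using that by (intro all_moments_integrable all_moments_mult am_W_bil)
  have t0: "0 \<le> ?t" by (rule tra_gram_SS_nonneg[OF assms])
  have "(\<integral>w. tra (gm k w \<bowtie> A \<bowtie> gm k w \<bowtie> R) \<partial>W k) = (\<Sum>a<k. \<Sum>b<k. \<integral>w. ?g a b w \<partial>W k)"
    unfolding tra_gm_gm
    by (intro Bochner_Integration.integral_sum[THEN trans] sum.cong refl Bochner_Integration.integrable_sum i) auto
  also have "\<dots> = (\<Sum>a<k. \<integral>w. ?g a a w \<partial>W k) + (\<Sum>a<k. \<Sum>b\<in>{..<k} - {a}. \<integral>w. ?g a b w \<partial>W k)"
    by (rule split_diag)
  also have "\<dots> \<le> (\<Sum>a<k. 3 * (tra (A \<bowtie> S) * tra (R \<bowtie> S))) + (\<Sum>a<k. \<Sum>b<k. ?t)"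
  proof (intro add_mono sum_mono)
    fix a assume "a \<in> {..<k}"
    then show "(\<integral>w. ?g a a w \<partial>W k) \<le> 3 * (tra (A \<bowtie> S) * tra (R \<bowtie> S))"
      using E_quad_quad_le[OF assms] E_W[OF all_moments_mult[OF am_bil(1) am_bil(1)], of a k A R] by simp
    have "(\<Sum>b\<in>{..<k} - {a}. \<integral>w. ?g a b w \<partial>W k) = (\<Sum>b\<in>{..<k} - {a}. ?t)"
      using \<open>a \<in> {..<k}\<close> by (intro sum.cong refl E_bil_bil_pair) auto
    also have "\<dots> \<le> (\<Sum>b<k. ?t)" by (intro sum_mono2 t0) auto
    finally show "(\<Sum>b\<in>{..<k} - {a}. \<integral>w. ?g a b w \<partial>W k) \<le> (\<Sum>b<k. ?t)" .
  qed
  finally show ?thesis by (simp add: power2_eq_square)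
qed

text \<open>The projection of the kernel is the quadratic form of
  \<open>A \<bowtie> S \<bowtie> R\<close>. Its square is bounded with \<open>R\<close> as the inner
  form, so that each trace in the middle term contains \<open>R\<close> only once.\<close>

lemma offdiag_second_moment:
  assumes "gram A" "gram R"
  shows "(\<integral>w. (\<Sum>a<k. \<Sum>b\<in>{..<k} - {a}. bil A (w a) (w b) * bil R (w b) (w a))\<^sup>2 \<partial>W k)
    \<le> real k ^ 4 * (tra (A \<bowtie> S \<bowtie> R \<bowtie> S))\<^sup>2
      + 4 * real k ^ 3 * (3 * (tra (A \<bowtie> S \<bowtie> R \<bowtie> S \<bowtie> A \<bowtie> S) * tra (R \<bowtie> S)))
      + 2 * real k ^ 2 * (9 * (tra (A \<bowtie> S \<bowtie> A \<bowtie> S) * tra (R \<bowtie> S \<bowtie> R \<bowtie> S)))"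
proof (rule second_moment_offdiag[where g = "\<lambda>x y. bil A x y * bil R y x" and h = "\<lambda>x. bil (A \<bowtie> S \<bowtie> R) x x"])
  have mA: "mt A = A" and mR: "mt R = R" using assms by (simp_all add: mt_gram)
  show "prob_space \<nu>" by (rule prob_space_axioms)
  show "bil A x y * bil R y x = bil A y x * bil R x y" for x y
    using bil_mt[of A x y] bil_mt[of R x y] by (simp add: mA mR)
  show "all_moments \<nu> (\<lambda>x. bil (A \<bowtie> S \<bowtie> R) x x)" by (rule am_bil)
  show "(\<integral>y. bil A x y * bil R y x \<partial>\<nu>) = bil (A \<bowtie> S \<bowtie> R) x x" for x
    by (rule E_bil_bil)
  show "(\<integral>x. bil (A \<bowtie> S \<bowtie> R) x x \<partial>\<nu>) = tra (A \<bowtie> S \<bowtie> R \<bowtie> S)"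
    by (simp add: E_quad)
  show "all_moments (W k) (\<lambda>w. bil A (w i) (w j) * bil R (w j) (w i))" if "i < k" "j < k" for i j
    using that by (intro all_moments_mult am_W_bil)
  show "(\<integral>x. (bil (A \<bowtie> S \<bowtie> R) x x)\<^sup>2 \<partial>\<nu>) \<le> 3 * (tra (A \<bowtie> S \<bowtie> R \<bowtie> S \<bowtie> A \<bowtie> S) * tra (R \<bowtie> S))"
  proof -
    have "(bil (A \<bowtie> S \<bowtie> R) x x)\<^sup>2 \<le> bil (A \<bowtie> S \<bowtie> R \<bowtie> S \<bowtie> A) x x * bil R x x" for x
      using bil_mm_gram_le[OF assms(2), of "A \<bowtie> S" x x] by (simp add: mA)
    then have "(\<integral>x. (bil (A \<bowtie> S \<bowtie> R) x x)\<^sup>2 \<partial>\<nu>) \<le> (\<integral>x. bil (A \<bowtie> S \<bowtie> R \<bowtie> S \<bowtie> A) x x * bil R x x \<partial>\<nu>)"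
      by (intro integral_mono all_moments_integrable all_moments_power all_moments_mult am_bil)
    also have "\<dots> \<le> 3 * (tra ((A \<bowtie> S \<bowtie> R \<bowtie> S \<bowtie> A) \<bowtie> S) * tra (R \<bowtie> S))"
      using gram_sandwich[OF assms(2), of "A \<bowtie> S"]
      by (intro E_quad_quad_le assms) (simp add: mA)
    finally show ?thesis by simp
  qed
  show "(\<integral>w. (bil A (w i) (w j) * bil R (w j) (w i))\<^sup>2 \<partial>W k) \<le> 9 * (tra (A \<bowtie> S \<bowtie> A \<bowtie> S) * tra (R \<bowtie> S \<bowtie> R \<bowtie> S))"
    if ij: "i < k" "j < k" "i \<noteq> j" for i j
  proof -
    have b4: "(\<integral>w. ((bil A (w i) (w j))\<^sup>2)\<^sup>2 \<partial>W k) \<le> (3 * tra (A \<bowtie> S \<bowtie> A \<bowtie> S))\<^sup>2" if "gram A" "i < k" "j < k" "i \<noteq> j" for A i j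
      using E_bil4_pair[OF that(2-4), of A] mt_gram[OF that(1)] by (simp add: power_mult_distrib flip: power_mult)
    have "(\<integral>w. (bil A (w i) (w j))\<^sup>2 * (bil R (w j) (w i))\<^sup>2 \<partial>W k)
        \<le> (3 * tra (A \<bowtie> S \<bowtie> A \<bowtie> S)) * (3 * tra (R \<bowtie> S \<bowtie> R \<bowtie> S))"
      using ij assms
      by (intro prob_space.cauchy_schwarz_le W_prob prob_space.all_moments_power am_W_bil b4)
        (auto intro!: tra_gram_SS_nonneg)
    then show ?thesis by (simp add: power_mult_distrib)
  qed
  show "0 \<le> 9 * (tra (A \<bowtie> S \<bowtie> A \<bowtie> S) * tra (R \<bowtie> S \<bowtie> R \<bowtie> S))"
    using tra_gram_SS_nonneg assms by simp
qed

text \<open>The centring is the part that dominates for k small against \<open>p\<close>: the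
  diagonal, with its mean replaced by a product of means. The error consists of the fluctuation
  \<open>D\<close> of the diagonal, its bias, which is a covariance of two quadratic forms, and the
  off-diagonal part \<open>Q\<close>. Every term on the right is linear in \<open>R\<close>, so the
  bound can be averaged when \<open>R\<close> is itself random.\<close>

lemma tra_tra_concentration:
  assumes gr: "gram A" "gram R"
  shows "(\<integral>w. \<bar>tra (gm k w \<bowtie> A \<bowtie> gm k w \<bowtie> R) - real k * (tra (A \<bowtie> S) * tra (R \<bowtie> S))\<bar> \<partial>W k)
    \<le> (11 * sqrt k * tra (A \<bowtie> S) + 7 * real k * sqrt (tra (A \<bowtie> S \<bowtie> A \<bowtie> S)) + 2 * real k * sqrt k) * tra (R \<bowtie> S)
      + (real k)\<^sup>2 * tra (A \<bowtie> S \<bowtie> R \<bowtie> S) + 2 * real k * sqrt k * tra (A \<bowtie> S \<bowtie> R \<bowtie> S \<bowtie> A \<bowtie> S)"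
proof -
  have mA: "mt A = A" and mR: "mt R = R" using gr by (simp_all add: mt_gram)
  define tA tR u t \<tau> where d: "tA = tra (A \<bowtie> S)" "tR = tra (R \<bowtie> S)" "u = tra (A \<bowtie> S \<bowtie> A \<bowtie> S)"
    "t = tra (A \<bowtie> S \<bowtie> R \<bowtie> S)" "\<tau> = tra (A \<bowtie> S \<bowtie> R \<bowtie> S \<bowtie> A \<bowtie> S)"
  have nn: "0 \<le> tA" "0 \<le> tR" "0 \<le> u" "0 \<le> t"
    unfolding d by (intro tra_S_nonneg tra_gram_SS_nonneg gr)+
  have nt: "0 \<le> \<tau>"
    using tra_S_nonneg[OF gram_sandwich[OF gr(2), of "A \<bowtie> S"]] by (simp add: d mA)
  have v: "tra (R \<bowtie> S \<bowtie> R \<bowtie> S) \<le> tR\<^sup>2" unfolding d by (rule tra_sq_le[OF gr(2)])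
  define f where "f = (\<lambda>x. bil A x x * bil R x x)"
  define c where "c = (\<integral>x. f x \<partial>\<nu>)"
  define D where "D = (\<lambda>w. \<Sum>a<k. f (w a) - c)"
  define Q where "Q = (\<lambda>w. \<Sum>a<k. \<Sum>b\<in>{..<k} - {a}. bil A (w a) (w b) * bil R (w b) (w a))"
  have amf: "all_moments \<nu> f" unfolding f_def by (intro all_moments_mult am_bil)
  have amc: "all_moments \<nu> (\<lambda>x. f x - c)" by (intro all_moments_diff amf all_moments_const)
  have amD: "all_moments (W k) D"
    unfolding D_def by (intro prob_space.all_moments_sum W_prob am_W[OF amc]) auto
  have amQ: "all_moments (W k) Q"
    unfolding Q_def by (intro prob_space.all_moments_sum W_prob all_moments_mult am_W_bil) auto
  have eq: "tra (gm k w \<bowtie> A \<bowtie> gm k w \<bowtie> R) - real k * (tA * tR) = D w + real k * (c - tA * tR) + Q w" for w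
    unfolding tra_gm_gm split_diag D_def Q_def f_def by (simp add: sum_subtractf algebra_simps)
  have c1: "\<bar>c - tA * tR\<bar> \<le> 2 * sqrt u * tR"
  proof -
    have i: "integrable \<nu> (\<lambda>x. bil A x x * bil R x x)" "integrable \<nu> (\<lambda>x. bil A x x)" "integrable \<nu> (\<lambda>x. bil R x x)"
      by (intro all_moments_integrable all_moments_mult am_bil)+
    have "(\<integral>x. cquad A x * cquad R x \<partial>\<nu>) = (\<integral>x. bil A x x * bil R x x - (tR * bil A x x + (tA * bil R x x - tA * tR)) \<partial>\<nu>)"
      by (simp add: d algebra_simps)
    also have "\<dots> = c - (tR * tA + (tA * tR - tA * tR))"
      using i by (simp add: c_def f_def E_quad prob_space d)
    finally have cov: "(\<integral>x. cquad A x * cquad R x \<partial>\<nu>) = c - tA * tR" by simp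
    have va: "(\<integral>x. (cquad A x)\<^sup>2 \<partial>\<nu>) \<le> (sqrt 2 * sqrt u)\<^sup>2"
      using quad_variance_le[of A] nn by (simp add: mA d power_mult_distrib)
    have vr: "(\<integral>x. (cquad R x)\<^sup>2 \<partial>\<nu>) \<le> (sqrt 2 * tR)\<^sup>2"
      using quad_variance_le[of R] v by (simp add: mR d power_mult_distrib)
    have "\<bar>\<integral>x. cquad A x * cquad R x \<partial>\<nu>\<bar> \<le> (\<integral>x. \<bar>cquad A x\<bar> * \<bar>cquad R x\<bar> \<partial>\<nu>)"
      using integral_abs_bound[of \<nu> "\<lambda>x. cquad A x * cquad R x"] by (simp add: abs_mult)
    also have "\<dots> \<le> (sqrt 2 * sqrt u) * (sqrt 2 * tR)"
      by (intro cauchy_schwarz_le all_moments_abs am_cquad) (use va vr nn in simp_all)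
    also have "\<dots> = (sqrt 2 * sqrt 2) * sqrt u * tR" by (simp only: mult_ac)
    finally show ?thesis using cov by simp
  qed
  have D1: "(\<integral>w. \<bar>D w\<bar> \<partial>W k) \<le> 11 * sqrt k * tA * tR"
  proof -
    have vf: "(\<integral>x. (f x - c)\<^sup>2 \<partial>\<nu>) \<le> (\<integral>x. (f x)\<^sup>2 \<partial>\<nu>)"
      using variance_eq[OF all_moments_integrable[OF amf] all_moments_integrable[OF all_moments_power[OF amf]]]
      by (simp add: c_def)
    \<comment> \<open>121 is the first square above 105; its root 11 is the constant of the diagonal
      term.\<close>
    have f4: "(\<integral>x. ((bil A x x)\<^sup>2)\<^sup>2 \<partial>\<nu>) \<le> (11 * (tra (A \<bowtie> S))\<^sup>2)\<^sup>2" if "gram A" for A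
    proof -
      have "(\<integral>x. ((bil A x x)\<^sup>2)\<^sup>2 \<partial>\<nu>) \<le> 105 * tra (A \<bowtie> S) ^ 4"
        using quad_fourth_moment_le[OF that] by (simp flip: power_mult)
      also have "\<dots> \<le> 121 * tra (A \<bowtie> S) ^ 4" by (intro mult_right_mono) auto
      finally show ?thesis by (simp add: power_mult_distrib flip: power_mult)
    qed
    have "(\<integral>x. (bil A x x)\<^sup>2 * (bil R x x)\<^sup>2 \<partial>\<nu>) \<le> (11 * tA\<^sup>2) * (11 * tR\<^sup>2)"
      unfolding d by (intro cauchy_schwarz_le all_moments_power am_bil f4 gr) auto
    then have "(\<integral>x. (f x)\<^sup>2 \<partial>\<nu>) \<le> (11 * tA * tR)\<^sup>2"
      by (simp add: f_def power_mult_distrib)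
    then have "(\<integral>x. (f x - c)\<^sup>2 \<partial>\<nu>) \<le> (11 * tA * tR)\<^sup>2" using vf by simp
    moreover have "(\<integral>x. f x - c \<partial>\<nu>) = 0"
      using all_moments_integrable[OF amf] by (simp add: c_def prob_space)
    ultimately have "(\<integral>w. (D w)\<^sup>2 \<partial>W k) \<le> real k * (11 * tA * tR)\<^sup>2"
      unfolding D_def by (simp add: centred_sum_variance[OF amc] mult_left_mono)
    from prob_space.abs_integral_le_sqrt[OF W_prob amD this] nn
    show ?thesis by (simp add: real_sqrt_mult mult_ac)
  qed
  have Q1: "(\<integral>w. \<bar>Q w\<bar> \<partial>W k) \<le> (real k)\<^sup>2 * t + 2 * real k * sqrt k * (\<tau> + tR) + 5 * real k * sqrt u * tR"
  proof -
    have "(\<integral>w. (Q w)\<^sup>2 \<partial>W k) \<le> real k ^ 4 * t\<^sup>2 + 4 * real k ^ 3 * (3 * (\<tau> * tR)) + 2 * real k ^ 2 * (9 * (u * tra (R \<bowtie> S \<bowtie> R \<bowtie> S)))"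
      unfolding Q_def d by (rule offdiag_second_moment[OF gr])
    also have "\<dots> \<le> real k ^ 4 * t\<^sup>2 + 4 * real k ^ 3 * (3 * (\<tau> * tR)) + 2 * real k ^ 2 * (9 * (u * tR\<^sup>2))"
      using v nn by (intro add_left_mono mult_left_mono) auto
    also have "\<dots> \<le> ((real k)\<^sup>2 * t)\<^sup>2 + (2 * real k * sqrt k * (\<tau> + tR))\<^sup>2 + (5 * real k * sqrt u * tR)\<^sup>2"
    proof (intro add_mono)
      show "real k ^ 4 * t\<^sup>2 \<le> ((real k)\<^sup>2 * t)\<^sup>2" by (simp add: power_mult_distrib flip: power_mult)
      \<comment> \<open>The geometric mean of \<tau> and \<open>tR\<close> would not be linear in
        \<open>R\<close>; the arithmetic mean is.\<close>
      have am: "4 * (\<tau> * tR) \<le> (\<tau> + tR)\<^sup>2"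
        using sum_squares_ge_zero[of "\<tau> - tR" 0] by (simp add: power2_eq_square algebra_simps)
      have "4 * real k ^ 3 * (3 * (\<tau> * tR)) \<le> 4 * real k ^ 3 * (\<tau> + tR)\<^sup>2"
        using am mult_nonneg_nonneg[OF nt nn(2)] by (intro mult_left_mono) (linarith, simp)
      also have "\<dots> = (2 * real k * sqrt k * (\<tau> + tR))\<^sup>2"
        by (simp add: power_mult_distrib power3_eq_cube power2_eq_square)
      finally show "4 * real k ^ 3 * (3 * (\<tau> * tR)) \<le> (2 * real k * sqrt k * (\<tau> + tR))\<^sup>2" .
      show "2 * real k ^ 2 * (9 * (u * tR\<^sup>2)) \<le> (5 * real k * sqrt u * tR)\<^sup>2"
        using nn mult_right_mono[of 18 25 "(real k)\<^sup>2 * (u * tR\<^sup>2)"] by (simp add: power_mult_distrib mult_ac)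
    qed
    also have "\<dots> \<le> ((real k)\<^sup>2 * t + 2 * real k * sqrt k * (\<tau> + tR) + 5 * real k * sqrt u * tR)\<^sup>2"
    proof -
      have "a\<^sup>2 + b\<^sup>2 + c\<^sup>2 \<le> (a + b + c)\<^sup>2" if "0 \<le> a" "0 \<le> b" "0 \<le> c" for a b c :: real
        using that by (simp add: power2_eq_square algebra_simps)
      then show ?thesis using nn nt by simp
    qed
    finally have "(\<integral>w. \<bar>Q w\<bar> \<partial>W k) \<le> sqrt (((real k)\<^sup>2 * t + 2 * real k * sqrt k * (\<tau> + tR) + 5 * real k * sqrt u * tR)\<^sup>2)"
      by (rule prob_space.abs_integral_le_sqrt[OF W_prob amQ])
    then show ?thesis using nn nt by simp
  qed
  have iD: "integrable (W k) (\<lambda>w. \<bar>D w\<bar>)" and iQ: "integrable (W k) (\<lambda>w. \<bar>Q w\<bar>)"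
    by (intro all_moments_integrable all_moments_abs amD amQ)+
  interpret W: prob_space "W k" by (rule W_prob)
  have "(\<integral>w. \<bar>tra (gm k w \<bowtie> A \<bowtie> gm k w \<bowtie> R) - real k * (tA * tR)\<bar> \<partial>W k)
      \<le> (\<integral>w. \<bar>D w\<bar> + (real k * \<bar>c - tA * tR\<bar> + \<bar>Q w\<bar>) \<partial>W k)"
  proof (intro integral_mono)
    show "integrable (W k) (\<lambda>w. \<bar>tra (gm k w \<bowtie> A \<bowtie> gm k w \<bowtie> R) - real k * (tA * tR)\<bar>)"
      by (intro all_moments_integrable all_moments_abs W.all_moments_diff am_W_tra W.all_moments_const)
    show "integrable (W k) (\<lambda>w. \<bar>D w\<bar> + (real k * \<bar>c - tA * tR\<bar> + \<bar>Q w\<bar>))"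
      using iD iQ by simp
    fix w
    have "\<bar>real k * (c - tA * tR)\<bar> = real k * \<bar>c - tA * tR\<bar>" by (simp add: abs_mult)
    then show "\<bar>tra (gm k w \<bowtie> A \<bowtie> gm k w \<bowtie> R) - real k * (tA * tR)\<bar> \<le> \<bar>D w\<bar> + (real k * \<bar>c - tA * tR\<bar> + \<bar>Q w\<bar>)"
      unfolding eq by linarith
  qed
  also have "\<dots> = (\<integral>w. \<bar>D w\<bar> \<partial>W k) + (real k * \<bar>c - tA * tR\<bar> + (\<integral>w. \<bar>Q w\<bar> \<partial>W k))"
    using iD iQ by (simp add: W.prob_space)
  also have "\<dots> \<le> 11 * sqrt k * tA * tR + (real k * (2 * sqrt u * tR)
      + ((real k)\<^sup>2 * t + 2 * real k * sqrt k * (\<tau> + tR) + 5 * real k * sqrt u * tR))"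
    by (intro add_mono mult_left_mono D1 c1 Q1) simp
  also have "\<dots> = (11 * sqrt k * tA + 7 * real k * sqrt u + 2 * real k * sqrt k) * tR + (real k)\<^sup>2 * t + 2 * real k * sqrt k * \<tau>"
    by (simp add: algebra_simps)
  finally show ?thesis unfolding d .
qed

text \<open>Berry--Esseen type bound for the characteristic function, linear in the variance proxy
  \<open>tra (Q \<bowtie> S \<bowtie> mt Q \<bowtie> S)\<close>, so that it can be averaged over a random \<open>Q\<close>.\<close>

lemma char_quad_sum:
  fixes s :: real and Q :: fmat
  assumes k: "0 < k"
  defines "v \<equiv> \<integral>x. (cquad Q x)\<^sup>2 \<partial>\<nu>" and "U \<equiv> tra (Q \<bowtie> S \<bowtie> mt Q \<bowtie> S)"
  shows "cmod ((\<integral>w. iexp (s * (\<Sum>a<k. cquad Q (w a))) \<partial>W k) - exp (- (s\<^sup>2 * real k * v / 2)))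
    \<le> 5 * (s\<^sup>2 * real k * U / sqrt (sqrt k))"
proof -
  define q where "q = (\<lambda>x. cquad Q x)"
  have am: "all_moments \<nu> q" and q0: "(\<integral>x. q x \<partial>\<nu>) = 0"
    unfolding q_def by (rule am_cquad E_cquad)+
  have vq: "v = (\<integral>x. (q x)\<^sup>2 \<partial>\<nu>)" by (simp add: v_def q_def)
  have U0: "0 \<le> U" unfolding U_def by (rule tra_QSQS_nonneg)
  have v0: "0 \<le> v" unfolding v_def by simp
  have vU: "v \<le> 2 * U" unfolding v_def U_def by (rule quad_variance_le)
  have m4: "(\<integral>x. q x ^ 4 \<partial>\<nu>) \<le> 72 * U\<^sup>2" unfolding U_def q_def by (rule quad_fourth_central_le)
  have qm: "q \<in> borel_measurable \<nu>" by (rule all_moments_measurable[OF am])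
  define \<phi> where "\<phi> = (\<integral>x. iexp (s * q x) \<partial>\<nu>)"
  \<comment> \<open>The weight between second and fourth moments in the bound for the third absolute
    moment. With 1 / sqrt k both contributions gain a factor 1 / sqrt k.\<close>
  define e where "e = 1 / sqrt k"
  have e0: "0 < e" unfolding e_def using k by simp
  have "product_prob_space (\<lambda>_::nat. \<nu>)" by (rule product_prob_spaceI) (rule prob_space_axioms)
  then interpret PP: product_prob_space "\<lambda>_::nat. \<nu>" UNIV .
  have ie: "integrable \<nu> (\<lambda>x. iexp (s * q x))"
    by (rule integrable_const_bound[where B = 1]) (use qm in auto)
  have pw: "(\<integral>w. iexp (s * (\<Sum>a<k. q (w a))) \<partial>W k) = \<phi> ^ k"
  proof -
    have "(\<integral>w. iexp (s * (\<Sum>a<k. q (w a))) \<partial>W k) = (\<integral>w. (\<Prod>a<k. iexp (s * q (w a))) \<partial>W k)"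
      by (simp add: sum_distrib_left exp_sum)
    also have "\<dots> = (\<Prod>a<k. \<phi>)"
      unfolding \<phi>_def by (rule PP.product_integral_prod) (use ie in auto)
    finally show ?thesis by simp
  qed
  have \<phi>1: "cmod \<phi> \<le> 1"
  proof -
    have "cmod \<phi> \<le> (\<integral>x. cmod (iexp (s * q x)) \<partial>\<nu>)"
      unfolding \<phi>_def by (rule integral_norm_bound)
    then show ?thesis by (simp add: prob_space)
  qed
  have a1: "cmod (\<phi> - (1 - s\<^sup>2 * v / 2)) \<le> (s\<^sup>2 / 6) * (\<integral>x. min (6 * (q x)\<^sup>2) (\<bar>s\<bar> * \<bar>q x\<bar> ^ 3) \<partial>\<nu>)"
  proof -
    have "cmod (char (distr \<nu> borel q) s - (1 - s\<^sup>2 * v / 2)) \<le> (s\<^sup>2 / 6) * (\<integral>x. min (6 * (q x)\<^sup>2) (\<bar>s\<bar> * \<bar>q x\<bar> ^ 3) \<partial>\<nu>)"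
      by (intro char_approx3' refl qm all_moments_integrable all_moments_power am q0) (simp add: q0 vq)
    moreover have "char (distr \<nu> borel q) s = \<phi>"
      unfolding char_def \<phi>_def by (subst integral_distr) (use qm in auto)
    ultimately show ?thesis by simp
  qed
  have a2: "(\<integral>x. min (6 * (q x)\<^sup>2) (\<bar>s\<bar> * \<bar>q x\<bar> ^ 3) \<partial>\<nu>) \<le> (e * v + s\<^sup>2 * (72 * U\<^sup>2) / e) / 2"
  proof -
    have i2: "integrable \<nu> (\<lambda>x. (q x)\<^sup>2)" and i4: "integrable \<nu> (\<lambda>x. q x ^ 4)"
      by (intro all_moments_integrable all_moments_power am)+
    have "(\<integral>x. min (6 * (q x)\<^sup>2) (\<bar>s\<bar> * \<bar>q x\<bar> ^ 3) \<partial>\<nu>) \<le> (\<integral>x. (e * (q x)\<^sup>2 + s\<^sup>2 / e * q x ^ 4) / 2 \<partial>\<nu>)"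
    proof (rule integral_mono)
      show "integrable \<nu> (\<lambda>x. min (6 * (q x)\<^sup>2) (\<bar>s\<bar> * \<bar>q x\<bar> ^ 3))"
        by (rule Bochner_Integration.integrable_bound[of _ "\<lambda>x. 6 * (q x)\<^sup>2"]) (use i2 qm in auto)
      show "integrable \<nu> (\<lambda>x. (e * (q x)\<^sup>2 + s\<^sup>2 / e * q x ^ 4) / 2)" using i2 i4 by simp
      fix x
      have "2 * (sqrt e * \<bar>q x\<bar>) * (\<bar>s\<bar> / sqrt e * (q x)\<^sup>2) \<le> (sqrt e * \<bar>q x\<bar>)\<^sup>2 + (\<bar>s\<bar> / sqrt e * (q x)\<^sup>2)\<^sup>2"
        by (rule sum_squares_bound)
      also have "2 * (sqrt e * \<bar>q x\<bar>) * (\<bar>s\<bar> / sqrt e * (q x)\<^sup>2) = 2 * (\<bar>s\<bar> * \<bar>q x\<bar> ^ 3)"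
        using e0 by (simp add: power3_eq_cube power2_eq_square abs_mult_self_eq)
      also have "(sqrt e * \<bar>q x\<bar>)\<^sup>2 + (\<bar>s\<bar> / sqrt e * (q x)\<^sup>2)\<^sup>2 = e * (q x)\<^sup>2 + s\<^sup>2 / e * q x ^ 4"
        using e0 by (simp add: power_mult_distrib power_divide flip: power_mult)
      finally show "min (6 * (q x)\<^sup>2) (\<bar>s\<bar> * \<bar>q x\<bar> ^ 3) \<le> (e * (q x)\<^sup>2 + s\<^sup>2 / e * q x ^ 4) / 2"
        by (intro min.coboundedI2) simp
    qed
    also have "\<dots> = (e * v + s\<^sup>2 / e * (\<integral>x. q x ^ 4 \<partial>\<nu>)) / 2"
      using i2 i4 by (simp add: vq)
    also have "\<dots> \<le> (e * v + s\<^sup>2 / e * (72 * U\<^sup>2)) / 2"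
      using m4 e0 by (intro divide_right_mono add_left_mono mult_left_mono) auto
    finally show ?thesis by simp
  qed
  let ?x = "s\<^sup>2 * v / 2"
  have x0: "0 \<le> ?x" using v0 by simp
  have a3: "cmod (\<phi> - exp (- ?x)) \<le> (s\<^sup>2 / 6) * ((e * v + s\<^sup>2 * (72 * U\<^sup>2) / e) / 2) + ?x\<^sup>2 / 2"
  proof -
    define z1 z2 where "z1 = complex_of_real (1 - ?x)" and "z2 = complex_of_real (exp (- ?x))"
    have "cmod (z1 - z2) = \<bar>(1 - ?x) - exp (- ?x)\<bar>"
      unfolding z1_def z2_def of_real_diff[symmetric] by (rule norm_of_real)
    then have b: "cmod (z1 - z2) \<le> ?x\<^sup>2 / 2" using exp_minus_quadratic[OF x0] by simp
    have "cmod (\<phi> - z1) \<le> (s\<^sup>2 / 6) * ((e * v + s\<^sup>2 * (72 * U\<^sup>2) / e) / 2)"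
      using a1 mult_left_mono[OF a2, of "s\<^sup>2 / 6"] by (simp add: z1_def)
    moreover have "cmod (\<phi> - z2) \<le> cmod (\<phi> - z1) + cmod (z1 - z2)"
      using norm_triangle_ineq[of "\<phi> - z1" "z1 - z2"] by simp
    ultimately have "cmod (\<phi> - z2) \<le> (s\<^sup>2 / 6) * ((e * v + s\<^sup>2 * (72 * U\<^sup>2) / e) / 2) + ?x\<^sup>2 / 2"
      using b by linarith
    then show ?thesis by (simp add: z2_def)
  qed
  have ex: "exp (- (s\<^sup>2 * real k * v / 2)) = exp (- ?x) ^ k"
    by (simp flip: exp_of_nat_mult)
  have a4: "cmod (\<phi> ^ k - exp (- (s\<^sup>2 * real k * v / 2))) \<le> real k * ((s\<^sup>2 / 6) * ((e * v + s\<^sup>2 * (72 * U\<^sup>2) / e) / 2) + ?x\<^sup>2 / 2)"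
  proof -
    have "cmod (\<phi> ^ k - complex_of_real (exp (- ?x)) ^ k) \<le> real k * cmod (\<phi> - complex_of_real (exp (- ?x)))"
      by (rule norm_power_diff[OF \<phi>1]) (use x0 in simp)
    also have "\<dots> \<le> real k * ((s\<^sup>2 / 6) * ((e * v + s\<^sup>2 * (72 * U\<^sup>2) / e) / 2) + ?x\<^sup>2 / 2)"
      by (intro mult_left_mono a3) simp
    finally show ?thesis unfolding ex by simp
  qed
  have a5: "cmod (\<phi> ^ k - exp (- (s\<^sup>2 * real k * v / 2))) \<le> 2"
  proof -
    have "cmod (\<phi> ^ k - exp (- (s\<^sup>2 * real k * v / 2))) \<le> cmod (\<phi> ^ k) + cmod (exp (- (s\<^sup>2 * real k * v / 2)))"
      by (rule norm_triangle_ineq4)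
    also have "\<dots> \<le> 1 + 1"
      using \<phi>1 v0 by (intro add_mono) (auto simp: norm_power power_le_one)
    finally show ?thesis by simp
  qed
  define r where "r = sqrt k"
  have r1: "1 \<le> r" and rk: "real k = r * r" unfolding r_def using k by auto
  define l where "l = s\<^sup>2 * real k * U"
  \<comment> \<open>With \<open>r\<close> = sqrt k, half of the rate is given up so that the
    quadratic error l^2 / r is exactly y^2.\<close>
  define y where "y = l / sqrt r"
  have l0: "0 \<le> l" unfolding l_def using U0 by simp
  have y0: "0 \<le> y" unfolding y_def using l0 r1 by simp
  have "real k * ((s\<^sup>2 / 6) * ((e * v + s\<^sup>2 * (72 * U\<^sup>2) / e) / 2) + ?x\<^sup>2 / 2)
     \<le> real k * ((s\<^sup>2 / 6) * ((e * (2 * U) + s\<^sup>2 * (72 * U\<^sup>2) / e) / 2) + (s\<^sup>2 * (2 * U) / 2)\<^sup>2 / 2)"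
    using vU v0 e0
    by (intro mult_left_mono add_mono divide_right_mono power_mono) auto
  also have "\<dots> = l / (6 * r) + 6 * (l\<^sup>2 / r) + l\<^sup>2 / (2 * r\<^sup>2)"
    unfolding l_def e_def r_def[symmetric] rk using r1 by (simp add: field_simps power2_eq_square)
  also have "\<dots> \<le> y + 6 * y\<^sup>2 + y\<^sup>2"
  proof (intro add_mono mult_left_mono)
    have sr: "sqrt r \<le> r" "0 < sqrt r" "(sqrt r)\<^sup>2 = r" using r1 by (auto intro: real_le_lsqrt simp: power2_eq_square mult_le_cancel_left1)
    show "l / (6 * r) \<le> y" unfolding y_def using l0 r1 sr
      by (intro divide_left_mono) auto
    show "l\<^sup>2 / r \<le> y\<^sup>2" unfolding y_def using sr by (simp add: power_divide)
    have "l\<^sup>2 / (2 * r\<^sup>2) \<le> l\<^sup>2 / r"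
    proof (rule divide_left_mono)
      have "r * 1 \<le> r * (2 * r)" using r1 by (intro mult_left_mono) auto
      then show "r \<le> 2 * r\<^sup>2" by (simp add: power2_eq_square)
    qed (use r1 in auto)
    then show "l\<^sup>2 / (2 * r\<^sup>2) \<le> y\<^sup>2" unfolding y_def using sr by (simp add: power_divide)
  qed simp
  finally have a6: "cmod (\<phi> ^ k - exp (- (s\<^sup>2 * real k * v / 2))) \<le> y + 7 * y\<^sup>2" using a4 by simp
  \<comment> \<open>Large \<open>y\<close> is covered by the trivial bound 2. Otherwise y^2 is at
    most 2 y / 5 and y + 7 y^2 at most 3.8 y. The bound is thus linear in \<open>U\<close> in all
    cases.\<close>
  have "cmod (\<phi> ^ k - exp (- (s\<^sup>2 * real k * v / 2))) \<le> 5 * y"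
  proof (cases "2 \<le> 5 * y")
    case True
    then show ?thesis using a5 by linarith
  next
    case False
    then have "y * y \<le> y * (2 / 5)" using y0 by (intro mult_left_mono) auto
    then show ?thesis using a6 y0 by (simp add: power2_eq_square)
  qed
  then show ?thesis using pw unfolding q_def y_def l_def r_def by simp
qed

end

section \<open>Characteristic function of the trace of a product\<close>

context gauss
begin

text \<open>The version for an \<open>H\<close> that need not be a Gram matrix. The diagonal pairs
  then call for the full second moment of a quadratic form: its variance plus the square of a trace
  of either sign.\<close>

lemma E_tra_tra_mt_le:
  "(\<integral>w. tra (gm k w \<bowtie> H \<bowtie> gm k w \<bowtie> mt H) \<partial>W k)
    \<le> 3 * (real k)\<^sup>2 * tra (H \<bowtie> S \<bowtie> mt H \<bowtie> S) + real k * (tra (H \<bowtie> S))\<^sup>2"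
proof -
  let ?t = "tra (H \<bowtie> S \<bowtie> mt H \<bowtie> S)"
  let ?g = "\<lambda>a b w. bil H (w a) (w b) * bil (mt H) (w b) (w a)"
  have t0: "0 \<le> ?t" by (rule tra_QSQS_nonneg)
  have i: "integrable (W k) (?g a b)" if "a < k" "b < k" for a b
    using that by (intro all_moments_integrable all_moments_mult am_W_bil)
  have d: "(\<integral>x. (bil H x x)\<^sup>2 \<partial>\<nu>) \<le> 2 * ?t + (tra (H \<bowtie> S))\<^sup>2"
  proof -
    have "(\<integral>x. (cquad H x)\<^sup>2 \<partial>\<nu>) = (\<integral>x. (bil H x x)\<^sup>2 \<partial>\<nu>) - (tra (H \<bowtie> S))\<^sup>2"
      using variance_eq[OF all_moments_integrable[OF am_bil(1)[of H]] all_moments_integrable[OF all_moments_power[OF am_bil(1)[of H]]]]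
      by (simp add: E_quad)
    then show ?thesis using quad_variance_le[of H] by simp
  qed
  have "(\<integral>w. tra (gm k w \<bowtie> H \<bowtie> gm k w \<bowtie> mt H) \<partial>W k) = (\<Sum>a<k. \<Sum>b<k. \<integral>w. ?g a b w \<partial>W k)"
    unfolding tra_gm_gm
    by (intro Bochner_Integration.integral_sum[THEN trans] sum.cong refl Bochner_Integration.integrable_sum i) auto
  also have "\<dots> = (\<Sum>a<k. \<integral>w. ?g a a w \<partial>W k) + (\<Sum>a<k. \<Sum>b\<in>{..<k} - {a}. \<integral>w. ?g a b w \<partial>W k)"
    by (rule split_diag)
  also have "\<dots> \<le> (\<Sum>a<k. 2 * ?t + (tra (H \<bowtie> S))\<^sup>2) + (\<Sum>a<k. \<Sum>b<k. ?t)"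
  proof (intro add_mono sum_mono)
    fix a assume a: "a \<in> {..<k}"
    have "(\<integral>w. ?g a a w \<partial>W k) = (\<integral>x. bil H x x * bil (mt H) x x \<partial>\<nu>)"
      using E_W[OF all_moments_mult[OF am_bil(1) am_bil(1)], of a k H "mt H"] a by simp
    then show "(\<integral>w. ?g a a w \<partial>W k) \<le> 2 * ?t + (tra (H \<bowtie> S))\<^sup>2"
      using d by (simp add: bil_mt power2_eq_square)
    have "(\<Sum>b\<in>{..<k} - {a}. \<integral>w. ?g a b w \<partial>W k) = (\<Sum>b\<in>{..<k} - {a}. ?t)"
      using a by (intro sum.cong refl E_bil_bil_pair) auto
    also have "\<dots> \<le> (\<Sum>b<k. ?t)" by (intro sum_mono2 t0) auto
    finally show "(\<Sum>b\<in>{..<k} - {a}. \<integral>w. ?g a b w \<partial>W k) \<le> (\<Sum>b<k. ?t)" .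
  qed
  also have "\<dots> = ((real k)\<^sup>2 + 2 * real k) * ?t + real k * (tra (H \<bowtie> S))\<^sup>2"
    by (simp add: power2_eq_square algebra_simps)
  also have "\<dots> \<le> 3 * (real k)\<^sup>2 * ?t + real k * (tra (H \<bowtie> S))\<^sup>2"
  proof (intro add_right_mono mult_right_mono t0)
    have "real k \<le> (real k)\<^sup>2" by (cases k) (auto simp: power2_eq_square)
    then show "(real k)\<^sup>2 + 2 * real k \<le> 3 * (real k)\<^sup>2" by simp
  qed
  finally show ?thesis .
qed

lemma E_tra_sq_le:
  "(\<integral>w. (tra (gm k w \<bowtie> Q))\<^sup>2 \<partial>W k) \<le> 2 * real k * tra (Q \<bowtie> S \<bowtie> mt Q \<bowtie> S) + (real k * tra (Q \<bowtie> S))\<^sup>2"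
proof -
  interpret W: prob_space "W k" by (rule W_prob)
  have "(\<integral>w. (tra (gm k w \<bowtie> Q) - real k * tra (Q \<bowtie> S))\<^sup>2 \<partial>W k)
      = (\<integral>w. (tra (gm k w \<bowtie> Q))\<^sup>2 \<partial>W k) - (real k * tra (Q \<bowtie> S))\<^sup>2"
    using W.variance_eq[OF all_moments_integrable[OF am_W_tra(1)[of k Q]] all_moments_integrable[OF W.all_moments_power[OF am_W_tra(1)[of k Q]]]]
    by (simp add: E_tra)
  then show ?thesis using tra_variance_le[of k Q] by simp
qed

lemma E_abs_tra_le:
  "(\<integral>w. \<bar>tra (gm k w \<bowtie> Q) - real k * tra (Q \<bowtie> S)\<bar> \<partial>W k) \<le> sqrt (2 * real k * tra (Q \<bowtie> S \<bowtie> mt Q \<bowtie> S))"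
  by (intro prob_space.abs_integral_le_sqrt W_prob prob_space.all_moments_diff am_W_tra prob_space.all_moments_const tra_variance_le)

end

text \<open>Starting from single letters avoids an identity matrix: \<open>\<bowtie>\<close> has no
  unit among functions with arbitrary values beyond \<open>p\<close>. The value at the empty word is
  a default.\<close>

fun (in findim) wmat :: "(nat \<Rightarrow> fmat) \<Rightarrow> nat list \<Rightarrow> fmat" where
  "wmat S [] = (\<lambda>_ _. 0)"
| "wmat S [a] = S a"
| "wmat S (a # b # w) = S a \<bowtie> wmat S (b # w)"

text \<open>One fixed dimension and one constant \<open>C\<close>: all conclusions are explicit
  inequalities and hence uniform in the choice of the subsamples. The inequality
  \<open>k b \<le> p\<close> is what absorbs off-diagonal orders such as k^2 p into the diagonal
  order k p^2.\<close>

locale blocks = findim p for p +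
  fixes N :: "nat \<Rightarrow> fvec measure" and S :: "nat \<Rightarrow> fmat" and k :: "nat \<Rightarrow> nat" and C :: real
  assumes G: "\<And>b. gauss p (N b) (S b)"
    and p0: "0 < p" and k0: "\<And>b. 0 < k b" and kp: "\<And>b. k b \<le> p" and C1: "1 \<le> C"
    and traces: "\<And>w. 2 \<le> length w \<Longrightarrow> length w \<le> 16 \<Longrightarrow> \<bar>tra (wmat S w)\<bar> \<le> C * real p"
begin

sublocale g: gauss p "N b" "S b" for b by (rule G)

abbreviation "Wb b \<equiv> PiM {..<k b} (\<lambda>_. N b)"
abbreviation "Om \<equiv> PiM {..<4::nat} (\<lambda>b. Wb b)"

definition T :: "nat \<Rightarrow> (nat \<Rightarrow> nat \<Rightarrow> fvec) \<Rightarrow> fmat" where "T b w = gm (k b) (w b)"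

abbreviation P :: real where "P \<equiv> real p"
abbreviation K :: "nat \<Rightarrow> real" where "K b \<equiv> real (k b)"

lemma T_upd [simp]: "T b (w(b := y)) = gm (k b) y" "c \<noteq> b \<Longrightarrow> T c (w(b := y)) = T c w"
  by (simp_all add: T_def)

lemma gram_T [simp]: "gram (T b w)" and gram_S [simp]: "gram (S b)" and mt_T [simp]: "mt (T b w) = T b w"
  and mt_Sb [simp]: "mt (S b) = S b"
  by (simp_all add: T_def g.gram_S)

lemma Om_prob: "prob_space Om"
  by (intro prob_space_PiM g.W_prob)

lemma am_T: "b < 4 \<Longrightarrow> i < p \<Longrightarrow> j < p \<Longrightarrow> all_moments Om (\<lambda>w. T b w i j)"
  unfolding T_def
  by (intro all_moments_gm Om_prob all_moments_PiM[where f = "\<lambda>w. w _ _" and M = Wb] g.W_prob g.am_W_coord; simp)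

lemma am_tra_word:
  assumes "\<And>i j. i < p \<Longrightarrow> j < p \<Longrightarrow> all_moments Om (\<lambda>w. A w i j)"
  shows "all_moments Om (\<lambda>w. tra (A w))"
  using assms by (intro all_moments_tra Om_prob) auto

lemma am_mm:
  assumes "\<And>i j. i < p \<Longrightarrow> j < p \<Longrightarrow> all_moments Om (\<lambda>w. A w i j)"
    "\<And>i j. i < p \<Longrightarrow> j < p \<Longrightarrow> all_moments Om (\<lambda>w. B w i j)" "i < p" "j < p"
  shows "all_moments Om (\<lambda>w. (A w \<bowtie> B w) i j)"
  using assms by (intro all_moments_mm Om_prob) auto

lemma am_S: "all_moments Om (\<lambda>w. S b i j)"
  by (intro prob_space.all_moments_const Om_prob)

lemmas am_word = am_tra_word am_mm am_T am_S

lemma Om_le: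
  assumes "b < 4" "all_moments Om f" "all_moments Om h"
    and "\<And>w. (\<integral>y. f (w(b := y)) \<partial>Wb b) \<le> h w"
  shows "(\<integral>w. f w \<partial>Om) \<le> (\<integral>w. h w \<partial>Om)"
  using assms by (intro integral_PiM_average_le[where j = b] all_moments_integrable g.W_prob) auto

lemma Om_le_const:
  assumes "b < 4" "all_moments Om f" "\<And>w. (\<integral>y. f (w(b := y)) \<partial>Wb b) \<le> c"
  shows "(\<integral>w. f w \<partial>Om) \<le> c"
proof -
  interpret prob_space Om by (rule Om_prob)
  show ?thesis using Om_le[of b f "\<lambda>_. c"] assms by (simp add: prob_space)
qed

lemma P_ge: "1 \<le> P" "0 < P" using p0 by auto
lemma K_ge: "1 \<le> K b" "0 < K b" using k0[of b] by auto
lemma K_le: "K b \<le> P" using kp[of b] by auto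
lemma C0: "0 < C" "0 \<le> C" using C1 by auto

lemma CP0: "0 \<le> C * P" using C0 P_ge by simp

lemma traces_le: "2 \<le> length w \<Longrightarrow> length w \<le> 16 \<Longrightarrow> tra (wmat S w) \<le> C * P"
  using traces[of w] by simp

text \<open>The off-diagonal K^2 C P is absorbed into the diagonal order K P^2 by K \<le> P. Of the
  constant 4 one part comes from there and three from the diagonal term of
  \<open>E_tra_tra_le\<close>.\<close>

lemma E_TATR_const_le:
  assumes "gram A" "gram R" "b < 4"
    and "tra (A \<bowtie> S b \<bowtie> R \<bowtie> S b) \<le> C * P" "tra (A \<bowtie> S b) \<le> C * P" "tra (R \<bowtie> S b) \<le> C * P"
    and "\<And>i j. i < p \<Longrightarrow> j < p \<Longrightarrow> all_moments Om (\<lambda>w. A i j)"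
  shows "(\<integral>w. tra (T b w \<bowtie> A \<bowtie> T b w \<bowtie> R) \<partial>Om) \<le> 4 * C\<^sup>2 * K b * P\<^sup>2"
proof (rule Om_le_const[OF assms(3)])
  show "all_moments Om (\<lambda>w. tra (T b w \<bowtie> A \<bowtie> T b w \<bowtie> R))"
    using assms by (intro am_word prob_space.all_moments_const Om_prob) auto
  fix w
  have nn: "0 \<le> tra (A \<bowtie> S b)" "0 \<le> tra (R \<bowtie> S b)"
    using assms by (auto intro: tra_gram_nonneg)
  have "(\<integral>y. tra (gm (k b) y \<bowtie> A \<bowtie> gm (k b) y \<bowtie> R) \<partial>Wb b)
      \<le> (K b)\<^sup>2 * tra (A \<bowtie> S b \<bowtie> R \<bowtie> S b) + 3 * K b * (tra (A \<bowtie> S b) * tra (R \<bowtie> S b))"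
    by (rule g.E_tra_tra_le[OF assms(1,2)])
  also have "\<dots> \<le> (K b)\<^sup>2 * (C * P) + 3 * K b * ((C * P) * (C * P))"
    using assms nn CP0 by (intro add_mono mult_left_mono mult_mono) auto
  also have "\<dots> \<le> (K b * P) * (C\<^sup>2 * P) + 3 * K b * ((C * P) * (C * P))"
  proof (rule add_right_mono, rule mult_mono)
    show "(K b)\<^sup>2 \<le> K b * P" using K_le K_ge by (simp add: power2_eq_square)
    show "C * P \<le> C\<^sup>2 * P" using C1 P_ge by (simp add: power2_eq_square)
  qed (use CP0 in auto)
  also have "\<dots> = 4 * C\<^sup>2 * K b * P\<^sup>2" by (simp add: power2_eq_square algebra_simps)
  finally show "(\<integral>y. tra (T b (w(b := y)) \<bowtie> A \<bowtie> T b (w(b := y)) \<bowtie> R) \<partial>Wb b) \<le> 4 * C\<^sup>2 * K b * P\<^sup>2" by simp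
qed

text \<open>Here \<open>Q\<close> is random but does not involve block \<open>b\<close>, so this
  block can be integrated out first; what remains are traces linear in \<open>Q\<close>.\<close>

lemma E_TATQ_le:
  assumes A: "gram A" and Q: "\<And>w. gram (Q w)" "\<And>w y. Q (w(b := y)) = Q w" and b: "b < 4"
    and tA: "tra (A \<bowtie> S b) \<le> C * P"
    and q: "(\<integral>w. tra (Q w \<bowtie> S b \<bowtie> A \<bowtie> S b) \<partial>Om) \<le> c" "(\<integral>w. tra (Q w \<bowtie> S b) \<partial>Om) \<le> c"
    and am: "\<And>i j. i < p \<Longrightarrow> j < p \<Longrightarrow> all_moments Om (\<lambda>w. Q w i j)"
  shows "(\<integral>w. tra (T b w \<bowtie> A \<bowtie> T b w \<bowtie> Q w) \<partial>Om) \<le> 4 * C * K b * P * c"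
proof -
  interpret O: prob_space Om by (rule Om_prob)
  have amA: "all_moments Om (\<lambda>w. A i j)" for i j by (rule O.all_moments_const)
  have am1: "all_moments Om (\<lambda>w. tra (Q w \<bowtie> S b \<bowtie> A \<bowtie> S b))" "all_moments Om (\<lambda>w. tra (Q w \<bowtie> S b))"
    by (intro am_word am amA; assumption)+
  have nn: "0 \<le> tra (A \<bowtie> S b)" "0 \<le> tra (Q w \<bowtie> S b)" for w
    using assms by (auto intro: tra_gram_nonneg)
  have c0: "0 \<le> c" using q(2) by (rule order_trans[rotated]) (intro Bochner_Integration.integral_nonneg nn)
  have "(\<integral>w. tra (T b w \<bowtie> A \<bowtie> T b w \<bowtie> Q w) \<partial>Om)
     \<le> (\<integral>w. (K b)\<^sup>2 * tra (Q w \<bowtie> S b \<bowtie> A \<bowtie> S b) + 3 * K b * (tra (A \<bowtie> S b) * tra (Q w \<bowtie> S b)) \<partial>Om)"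
  proof (rule Om_le[OF b])
    show "all_moments Om (\<lambda>w. tra (T b w \<bowtie> A \<bowtie> T b w \<bowtie> Q w))"
      using b by (intro am_word am amA; assumption?)
    show "all_moments Om (\<lambda>w. (K b)\<^sup>2 * tra (Q w \<bowtie> S b \<bowtie> A \<bowtie> S b) + 3 * K b * (tra (A \<bowtie> S b) * tra (Q w \<bowtie> S b)))"
      by (intro all_moments_add all_moments_mult O.all_moments_const am1)
    fix w
    have "tra (A \<bowtie> S b \<bowtie> Q w \<bowtie> S b) = tra (Q w \<bowtie> S b \<bowtie> A \<bowtie> S b)"
      using tra_comm[of "A \<bowtie> S b" "Q w \<bowtie> S b"] by simp
    then show "(\<integral>y. tra (T b (w(b := y)) \<bowtie> A \<bowtie> T b (w(b := y)) \<bowtie> Q (w(b := y))) \<partial>Wb b)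
      \<le> (K b)\<^sup>2 * tra (Q w \<bowtie> S b \<bowtie> A \<bowtie> S b) + 3 * K b * (tra (A \<bowtie> S b) * tra (Q w \<bowtie> S b))"
      using g.E_tra_tra_le[OF A Q(1), of "k b" b w] by (simp add: Q)
  qed
  also have "\<dots> = (K b)\<^sup>2 * (\<integral>w. tra (Q w \<bowtie> S b \<bowtie> A \<bowtie> S b) \<partial>Om) + 3 * K b * (tra (A \<bowtie> S b) * (\<integral>w. tra (Q w \<bowtie> S b) \<partial>Om))"
    using am1[THEN all_moments_integrable] by simp
  also have "\<dots> \<le> (K b * P) * (C * c) + (3 * K b) * ((C * P) * c)"
  proof (rule add_mono; (rule mult_mono)?)
    show "tra (A \<bowtie> S b) * (\<integral>w. tra (Q w \<bowtie> S b) \<partial>Om) \<le> (C * P) * c"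
      using tA q(2) CP0 nn by (intro mult_mono Bochner_Integration.integral_nonneg) auto
    show "(K b)\<^sup>2 \<le> K b * P" using K_le K_ge by (simp add: power2_eq_square)
    show "(\<integral>w. tra (Q w \<bowtie> S b \<bowtie> A \<bowtie> S b) \<partial>Om) \<le> C * c"
      using q(1) mult_right_mono[OF C1 c0] by simp
    have "0 \<le> tra (Q w \<bowtie> S b \<bowtie> A \<bowtie> S b)" for w
      using tra_gram_nonneg[OF Q(1) gram_sandwich_sym[OF _ A], of "S b" w] by simp
    then show "0 \<le> (\<integral>w. tra (Q w \<bowtie> S b \<bowtie> A \<bowtie> S b) \<partial>Om)" by (intro Bochner_Integration.integral_nonneg)
    have "0 \<le> (\<integral>w. tra (Q w \<bowtie> S b) \<partial>Om)" by (intro Bochner_Integration.integral_nonneg nn)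
    then show "0 \<le> tra (A \<bowtie> S b) * (\<integral>w. tra (Q w \<bowtie> S b) \<partial>Om)" using nn by simp
  qed (use CP0 tA q nn c0 in auto)
  also have "\<dots> = 4 * C * K b * P * c" by (simp add: algebra_simps)
  finally show ?thesis .
qed

text \<open>Block \<open>b\<close> is integrated out first, with everything made from block
  \<open>c\<close> in the role of \<open>Q\<close>, then block \<open>c\<close> between
  deterministic neighbours. The hypotheses are the traces that these two rounds leave
  behind.\<close>

lemma E_TAT_TBT_le:
  assumes A: "gram A" and B: "gram B" and b: "b < 4" "c < 4" "b \<noteq> c"
    and t: "tra (A \<bowtie> S b) \<le> C * P" "tra (B \<bowtie> S c) \<le> C * P"
      "tra (B \<bowtie> S c \<bowtie> S b \<bowtie> A \<bowtie> S b \<bowtie> S c) \<le> C * P" "tra (S b \<bowtie> A \<bowtie> S b \<bowtie> S c) \<le> C * P"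
      "tra (B \<bowtie> S c \<bowtie> S b \<bowtie> S c) \<le> C * P" "tra (S b \<bowtie> S c) \<le> C * P"
  shows "(\<integral>w. tra (T b w \<bowtie> A \<bowtie> T b w \<bowtie> T c w \<bowtie> B \<bowtie> T c w) \<partial>Om) \<le> 16 * C ^ 3 * K b * K c * P ^ 3"
proof -
  interpret O: prob_space Om by (rule Om_prob)
  have amc: "all_moments Om (\<lambda>w. Z i j)" for Z :: fmat and i j by (rule O.all_moments_const)
  have "(\<integral>w. tra (T b w \<bowtie> A \<bowtie> T b w \<bowtie> T c w \<bowtie> B \<bowtie> T c w) \<partial>Om) \<le> 4 * C * K b * P * (4 * C\<^sup>2 * K c * P\<^sup>2)"
  proof (rule E_TATQ_le[OF A _ _ b(1) t(1)])
    show "gram (T c w \<bowtie> B \<bowtie> T c w)" for w by (rule gram_sandwich_sym) (simp_all add: B)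
    show "T c (w(b := y)) \<bowtie> B \<bowtie> T c (w(b := y)) = T c w \<bowtie> B \<bowtie> T c w" for w y
      using b by simp
    show "(\<integral>w. tra ((T c w \<bowtie> B \<bowtie> T c w) \<bowtie> S b \<bowtie> A \<bowtie> S b) \<partial>Om) \<le> 4 * C\<^sup>2 * K c * P\<^sup>2"
      using E_TATR_const_le[OF B gram_sandwich_sym[OF _ A] b(2), of "S b"] t by (simp add: amc)
    show "(\<integral>w. tra ((T c w \<bowtie> B \<bowtie> T c w) \<bowtie> S b) \<partial>Om) \<le> 4 * C\<^sup>2 * K c * P\<^sup>2"
      using E_TATR_const_le[OF B gram_S b(2), of b] t by (simp add: amc)
    show "all_moments Om (\<lambda>w. (T c w \<bowtie> B \<bowtie> T c w) i j)" if "i < p" "j < p" for i j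
      using that b by (intro am_word amc; assumption?)
  qed
  then show ?thesis by (simp add: power2_eq_square power3_eq_cube mult_ac)
qed

text \<open>The two relative errors of replacing a trace with a repeated block by its diagonal mean:
  averaging over K columns, and the weight of off-diagonal against diagonal pairs.\<close>

definition err :: "nat \<Rightarrow> real" where "err b = 1 / sqrt (K b) + K b / P"

lemma err_nonneg: "0 \<le> err b"
  using K_ge[of b] P_ge by (simp add: err_def)

text \<open>In terms of x = sqrt K \<le> y = sqrt P the right side is 18 C (x y^2 + x^4). The first
  two terms go into x y^2, whence 18 = 11 + 7, the others into x^4.\<close>

lemma bracket_le:
  "11 * sqrt (K b) * (C * P) + 7 * K b * sqrt (C * P) + 4 * K b * sqrt (K b) + (K b)\<^sup>2 \<le> 18 * C * K b * P * err b"
proof -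
  define x where "x = sqrt (K b)"
  have x: "1 \<le> x" "K b = x * x" using K_ge[of b] by (auto simp: x_def)
  have xp: "x \<le> sqrt P" unfolding x_def using K_le by simp
  define y where "y = sqrt P"
  have y: "x \<le> y" "P = y * y" "1 \<le> y" using xp P_ge by (auto simp: y_def)
  have sC: "sqrt C \<le> C" using C1 by (intro real_le_lsqrt) (auto simp: power2_eq_square)
  have 1: "7 * (x * x) * (sqrt C * y) \<le> 7 * (x * y) * (C * y)"
    using x y sC C1 by (intro mult_mono) auto
  have 2: "4 * (x * x) * x \<le> 4 * (x * x) * (x * x)"
    using x by (intro mult_left_mono) auto
  have 3: "5 * ((x * x) * (x * x)) \<le> 18 * C * ((x * x) * (x * x))"
    using C1 by (intro mult_right_mono) auto
  have "18 * C * K b * P * err b = 18 * C * x * (y * y) + 18 * C * ((x * x) * (x * x))"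
    unfolding err_def x_def[symmetric] x(2) y(2) using x y by (simp add: field_simps)
  moreover have "11 * sqrt (K b) * (C * P) + 7 * K b * sqrt (C * P) + 4 * K b * sqrt (K b) + (K b)\<^sup>2
     = 11 * x * (C * (y * y)) + 7 * (x * x) * (sqrt C * y) + 4 * (x * x) * x + (x * x) * (x * x)"
    unfolding x_def[symmetric] x(2) y(2) using x(1) y(1,3) abs_of_nonneg[of x] by (simp add: real_sqrt_mult power2_eq_square)
  ultimately show ?thesis using 1 2 3 by (simp add: algebra_simps)
qed

text \<open>\<open>tra_tra_concentration\<close> averaged over the remaining blocks, which is
  possible because that bound is linear in \<open>R\<close>. A single \<open>c\<close> has to
  dominate the three traces that occur in it.\<close>

lemma E_concentration_le:
  assumes A: "gram A" and Q: "\<And>w. gram (Q w)" "\<And>w y. Q (w(b := y)) = Q w" and b: "b < 4"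
    and tA: "tra (A \<bowtie> S b) \<le> C * P" "tra (A \<bowtie> S b \<bowtie> A \<bowtie> S b) \<le> C * P"
    and q: "(\<integral>w. tra (Q w \<bowtie> S b) \<partial>Om) \<le> c" "(\<integral>w. tra (Q w \<bowtie> S b \<bowtie> A \<bowtie> S b) \<partial>Om) \<le> c"
      "(\<integral>w. tra (Q w \<bowtie> S b \<bowtie> A \<bowtie> S b \<bowtie> A \<bowtie> S b) \<partial>Om) \<le> c"
    and am: "\<And>i j. i < p \<Longrightarrow> j < p \<Longrightarrow> all_moments Om (\<lambda>w. Q w i j)"
  shows "(\<integral>w. \<bar>tra (T b w \<bowtie> A \<bowtie> T b w \<bowtie> Q w) - K b * (tra (A \<bowtie> S b) * tra (Q w \<bowtie> S b))\<bar> \<partial>Om)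
    \<le> 18 * C * K b * P * err b * c"
proof -
  interpret O: prob_space Om by (rule Om_prob)
  have amA: "all_moments Om (\<lambda>w. A i j)" for i j by (rule O.all_moments_const)
  let ?q1 = "\<lambda>w. tra (Q w \<bowtie> S b)" and ?q2 = "\<lambda>w. tra (Q w \<bowtie> S b \<bowtie> A \<bowtie> S b)"
    and ?q3 = "\<lambda>w. tra (Q w \<bowtie> S b \<bowtie> A \<bowtie> S b \<bowtie> A \<bowtie> S b)"
  have am1: "all_moments Om ?q1" "all_moments Om ?q2" "all_moments Om ?q3"
    by (intro am_word am amA; assumption)+
  note i1 = am1[THEN all_moments_integrable]
  have nA: "0 \<le> tra (A \<bowtie> S b)" using A by (auto intro: tra_gram_nonneg)
  have nq: "0 \<le> ?q1 w" for w using Q by (auto intro: tra_gram_nonneg)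
  have c0: "0 \<le> c" using q(1) by (rule order_trans[rotated]) (intro Bochner_Integration.integral_nonneg nq)
  define u where "u = 11 * sqrt (K b) * tra (A \<bowtie> S b) + 7 * K b * sqrt (tra (A \<bowtie> S b \<bowtie> A \<bowtie> S b)) + 2 * K b * sqrt (K b)"
  have "(\<integral>w. \<bar>tra (T b w \<bowtie> A \<bowtie> T b w \<bowtie> Q w) - K b * (tra (A \<bowtie> S b) * tra (Q w \<bowtie> S b))\<bar> \<partial>Om)
     \<le> (\<integral>w. u * ?q1 w + (K b)\<^sup>2 * ?q2 w + 2 * K b * sqrt (K b) * ?q3 w \<partial>Om)"
  proof (rule Om_le[OF b])
    show "all_moments Om (\<lambda>w. \<bar>tra (T b w \<bowtie> A \<bowtie> T b w \<bowtie> Q w) - K b * (tra (A \<bowtie> S b) * tra (Q w \<bowtie> S b))\<bar>)"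
      using b by (intro all_moments_abs O.all_moments_diff all_moments_mult O.all_moments_const am_word am amA; assumption?)
    show "all_moments Om (\<lambda>w. u * ?q1 w + (K b)\<^sup>2 * ?q2 w + 2 * K b * sqrt (K b) * ?q3 w)"
      by (intro all_moments_add all_moments_mult O.all_moments_const am1)
    fix w
    have e: "tra (A \<bowtie> S b \<bowtie> Q w \<bowtie> S b) = ?q2 w"
      using tra_comm[of "A \<bowtie> S b" "Q w \<bowtie> S b"] by simp
    have e2: "tra (A \<bowtie> S b \<bowtie> Q w \<bowtie> S b \<bowtie> A \<bowtie> S b) = ?q3 w"
      using tra_comm[of "A \<bowtie> S b" "Q w \<bowtie> S b \<bowtie> A \<bowtie> S b"] by simp
    show "(\<integral>y. \<bar>tra (T b (w(b := y)) \<bowtie> A \<bowtie> T b (w(b := y)) \<bowtie> Q (w(b := y)))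
         - K b * (tra (A \<bowtie> S b) * tra (Q (w(b := y)) \<bowtie> S b))\<bar> \<partial>Wb b)
      \<le> u * ?q1 w + (K b)\<^sup>2 * ?q2 w + 2 * K b * sqrt (K b) * ?q3 w"
      using g.tra_tra_concentration[OF A Q(1), of "k b" b w] unfolding Q(2) T_upd e e2 u_def .
  qed
  also have "\<dots> = u * (\<integral>w. ?q1 w \<partial>Om) + (K b)\<^sup>2 * (\<integral>w. ?q2 w \<partial>Om) + 2 * K b * sqrt (K b) * (\<integral>w. ?q3 w \<partial>Om)"
    using i1 by simp
  also have "\<dots> \<le> u * c + (K b)\<^sup>2 * c + 2 * K b * sqrt (K b) * c"
    using q nA g.tra_gram_SS_nonneg[OF A A, of b]
    by (intro add_mono mult_left_mono) (auto simp: u_def)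
  also have "\<dots> = (u + (K b)\<^sup>2 + 2 * K b * sqrt (K b)) * c" by (simp add: algebra_simps)
  also have "\<dots> \<le> (18 * C * K b * P * err b) * c"
  proof (rule mult_right_mono[OF _ c0])
    have "u \<le> 11 * sqrt (K b) * (C * P) + 7 * K b * sqrt (C * P) + 2 * K b * sqrt (K b)"
      unfolding u_def using tA by (intro add_mono mult_left_mono) auto
    then show "u + (K b)\<^sup>2 + 2 * K b * sqrt (K b) \<le> 18 * C * K b * P * err b"
      using bracket_le[of b] by simp
  qed
  finally show ?thesis .
qed

end

section \<open>Conditional mean and variance given three blocks\<close>

context blocks
begin

lemma tw:
  shows "tra (S a \<bowtie> S b) \<le> C * P"
    and "tra (S a \<bowtie> S b \<bowtie> S c) \<le> C * P"
    and "tra (S a \<bowtie> S b \<bowtie> S c \<bowtie> S d) \<le> C * P"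
    and "tra (S a \<bowtie> S b \<bowtie> S c \<bowtie> S d \<bowtie> S e) \<le> C * P"
    and "tra (S a \<bowtie> S b \<bowtie> S c \<bowtie> S d \<bowtie> S e \<bowtie> S f) \<le> C * P"
    and "tra (S a \<bowtie> S b \<bowtie> S c \<bowtie> S d \<bowtie> S e \<bowtie> S f \<bowtie> S h) \<le> C * P"
    and "tra (S a \<bowtie> S b \<bowtie> S c \<bowtie> S d \<bowtie> S e \<bowtie> S f \<bowtie> S h \<bowtie> S i) \<le> C * P"
    and "tra (S a \<bowtie> S b \<bowtie> S c \<bowtie> S d \<bowtie> S e \<bowtie> S f \<bowtie> S h \<bowtie> S i \<bowtie> S j) \<le> C * P"
    and "tra (S a \<bowtie> S b \<bowtie> S c \<bowtie> S d \<bowtie> S e \<bowtie> S f \<bowtie> S h \<bowtie> S i \<bowtie> S j \<bowtie> S l) \<le> C * P"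
    and "tra (S a \<bowtie> S b \<bowtie> S c \<bowtie> S d \<bowtie> S e \<bowtie> S f \<bowtie> S h \<bowtie> S i \<bowtie> S j \<bowtie> S l \<bowtie> S q) \<le> C * P"
    and "tra (S a \<bowtie> S b \<bowtie> S c \<bowtie> S d \<bowtie> S e \<bowtie> S f \<bowtie> S h \<bowtie> S i \<bowtie> S j \<bowtie> S l \<bowtie> S q \<bowtie> S r) \<le> C * P"
  using traces_le[of "[a, b]"]
    traces_le[of "[a, b, c]"]
    traces_le[of "[a, b, c, d]"]
    traces_le[of "[a, b, c, d, e]"]
    traces_le[of "[a, b, c, d, e, f]"]
    traces_le[of "[a, b, c, d, e, f, h]"]
    traces_le[of "[a, b, c, d, e, f, h, i]"]
    traces_le[of "[a, b, c, d, e, f, h, i, j]"]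
    traces_le[of "[a, b, c, d, e, f, h, i, j, l]"]
    traces_le[of "[a, b, c, d, e, f, h, i, j, l, q]"]
    traces_le[of "[a, b, c, d, e, f, h, i, j, l, q, r]"]
  by simp_all

lemma gram_words [simp]:
  "gram (S a \<bowtie> S b \<bowtie> S a)" "gram (S a \<bowtie> S b \<bowtie> S a \<bowtie> S b \<bowtie> S a)"
proof -
  show *: "gram (S a \<bowtie> S b \<bowtie> S a)" for a b by (rule gram_sandwich_sym) simp_all
  have "gram (S a \<bowtie> (S b \<bowtie> S a \<bowtie> S b) \<bowtie> S a)" by (rule gram_sandwich_sym) (simp_all add: *)
  then show "gram (S a \<bowtie> S b \<bowtie> S a \<bowtie> S b \<bowtie> S a)" by simp
qed

lemma am_const_mat: "all_moments Om (\<lambda>w. A i j)"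
  by (intro prob_space.all_moments_const Om_prob)

text \<open>Given the first three blocks, the trace of all four is a sum over the columns of block 3
  of quadratic forms with matrix \<open>Mt w\<close>. Each has variance \<open>U w + V w\<close>,
  and \<open>H w\<close> is the deviation of its mean; \<open>U\<close> has the order
  \<open>D\<close>, while \<open>V\<close> and \<open>H\<close> will turn out to be
  negligible.\<close>

definition Mt :: "(nat \<Rightarrow> nat \<Rightarrow> fvec) \<Rightarrow> fmat" where "Mt w = T 0 w \<bowtie> T 1 w \<bowtie> T 2 w"
definition U :: "(nat \<Rightarrow> nat \<Rightarrow> fvec) \<Rightarrow> real" where "U w = tra (Mt w \<bowtie> S 3 \<bowtie> mt (Mt w) \<bowtie> S 3)"
definition V :: "(nat \<Rightarrow> nat \<Rightarrow> fvec) \<Rightarrow> real" where "V w = tra (Mt w \<bowtie> S 3 \<bowtie> Mt w \<bowtie> S 3)"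
definition H :: "(nat \<Rightarrow> nat \<Rightarrow> fvec) \<Rightarrow> real" where
  "H w = tra (Mt w \<bowtie> S 3) - K 0 * K 1 * K 2 * tra (S 0 \<bowtie> S 1 \<bowtie> S 2 \<bowtie> S 3)"
definition D :: real where "D = K 0 * K 1 * K 2 * P ^ 4"
definition \<eta> :: real where "\<eta> = err 0 + err 1 + err 2 + err 3"
text \<open>\<open>U w\<close> is close to this product times \<open>K 0 * K 1 * K 2\<close>; the
  factors belong to the cyclically adjacent pairs of blocks 3-2, 3-0, 2-1 and 0-1.\<close>

definition sg :: real where "sg = tra (S 3 \<bowtie> S 2) * tra (S 3 \<bowtie> S 0) * tra (S 2 \<bowtie> S 1) * tra (S 0 \<bowtie> S 1)"

lemma D0: "0 < D" using K_ge P_ge by (simp add: D_def)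

lemma \<eta>_ge: "0 \<le> \<eta>" "err 0 \<le> \<eta>" "err 1 \<le> \<eta>" "err 2 \<le> \<eta>" "err 3 \<le> \<eta>"
  using err_nonneg[of 0] err_nonneg[of 1] err_nonneg[of 2] err_nonneg[of 3] by (auto simp: \<eta>_def)

lemma tra2_nonneg: "0 \<le> tra (S a \<bowtie> S b)"
  by (rule tra_gram_nonneg) simp_all

lemma am_U: "all_moments Om U" and am_V: "all_moments Om V" and am_H: "all_moments Om H"
proof -
  have m: "all_moments Om (\<lambda>w. Mt w i j)" "all_moments Om (\<lambda>w. mt (Mt w) i j)" if "i < p" "j < p" for i j
    using that unfolding Mt_def mt_mm mt_T by (intro am_mm am_T; simp)+
  show "all_moments Om U" unfolding U_def by (intro am_tra_word am_mm m am_S; assumption)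
  show "all_moments Om V" unfolding V_def by (intro am_tra_word am_mm m am_S; assumption)
  show "all_moments Om H" unfolding H_def
    by (intro prob_space.all_moments_diff Om_prob prob_space.all_moments_const am_tra_word am_mm m am_S; assumption)
qed

text \<open>Three applications of concentration peel off the blocks in the order 2, 0, 1. Each time
  a block occurs twice around a known matrix, and the trace falls apart into a known trace and a
  shorter random one. The moments of what is left give the constants 288 = 18 * 16, 72 = 18 * 4 and
  18.\<close>

lemma E_U: "(\<integral>w. \<bar>U w - K 0 * K 1 * K 2 * sg\<bar> \<partial>Om) \<le> 288 * C ^ 4 * D * \<eta>"
proof -
  interpret O: prob_space Om by (rule Om_prob)
  define R where "R = (\<lambda>w. T 1 w \<bowtie> T 0 w \<bowtie> S 3 \<bowtie> T 0 w \<bowtie> T 1 w)"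
  define R' where "R' = (\<lambda>w. T 1 w \<bowtie> S 2 \<bowtie> T 1 w)"
  \<comment> \<open>Cyclic rotation puts the two occurrences of block 2 around \<open>S 3\<close>
    and packs the rest into the Gram matrix \<open>R\<close>.\<close>
  have UR: "U w = tra (T 2 w \<bowtie> S 3 \<bowtie> T 2 w \<bowtie> R w)" for w
    using tra_comm[of "T 0 w \<bowtie> T 1 w" "T 2 w \<bowtie> S 3 \<bowtie> T 2 w \<bowtie> T 1 w \<bowtie> T 0 w \<bowtie> S 3"]
      tra_comm[of "T 2 w \<bowtie> S 3 \<bowtie> T 2 w \<bowtie> T 1 w \<bowtie> T 0 w \<bowtie> S 3" "T 0 w \<bowtie> T 1 w"]
    by (simp add: U_def Mt_def R_def)
  have gR: "gram (R w)" for w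
    using gram_sandwich_sym[of "T 1 w" "T 0 w \<bowtie> S 3 \<bowtie> T 0 w"] gram_sandwich_sym[of "T 0 w" "S 3"] by (simp add: R_def)
  have gR': "gram (R' w)" for w
    using gram_sandwich_sym[of "T 1 w" "S 2"] by (simp add: R'_def)
  have amR: "all_moments Om (\<lambda>w. R w i j)" "all_moments Om (\<lambda>w. R' w i j)" if "i < p" "j < p" for i j
    using that unfolding R_def R'_def by (intro am_mm am_T am_S; simp)+
  have RB: "tra (R w \<bowtie> B) = tra (T 0 w \<bowtie> S 3 \<bowtie> T 0 w \<bowtie> T 1 w \<bowtie> B \<bowtie> T 1 w)" for B w
    using tra_comm[of "T 1 w" "T 0 w \<bowtie> S 3 \<bowtie> T 0 w \<bowtie> T 1 w \<bowtie> B"] by (simp add: R_def)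
  have R'B: "tra (R' w \<bowtie> B) = tra (T 1 w \<bowtie> S 2 \<bowtie> T 1 w \<bowtie> B)" for B w
    by (simp add: R'_def)
  have s1: "(\<integral>w. \<bar>U w - K 2 * (tra (S 3 \<bowtie> S 2) * tra (R w \<bowtie> S 2))\<bar> \<partial>Om)
      \<le> 18 * C * K 2 * P * err 2 * (16 * C ^ 3 * K 0 * K 1 * P ^ 3)"
    unfolding UR
  proof (rule E_concentration_le)
    show "R (w(2 := y)) = R w" for w y by (simp add: R_def)
    show "(\<integral>w. tra (R w \<bowtie> S 2) \<partial>Om) \<le> 16 * C ^ 3 * K 0 * K 1 * P ^ 3"
      unfolding RB by (rule E_TAT_TBT_le; simp add: tw)
    have "(\<integral>w. tra (R w \<bowtie> (S 2 \<bowtie> S 3 \<bowtie> S 2)) \<partial>Om) \<le> 16 * C ^ 3 * K 0 * K 1 * P ^ 3"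
      unfolding RB by (rule E_TAT_TBT_le; simp add: tw)
    then show "(\<integral>w. tra (R w \<bowtie> S 2 \<bowtie> S 3 \<bowtie> S 2) \<partial>Om) \<le> 16 * C ^ 3 * K 0 * K 1 * P ^ 3" .
    have "(\<integral>w. tra (R w \<bowtie> (S 2 \<bowtie> S 3 \<bowtie> S 2 \<bowtie> S 3 \<bowtie> S 2)) \<partial>Om) \<le> 16 * C ^ 3 * K 0 * K 1 * P ^ 3"
      unfolding RB by (rule E_TAT_TBT_le; simp add: tw)
    then show "(\<integral>w. tra (R w \<bowtie> S 2 \<bowtie> S 3 \<bowtie> S 2 \<bowtie> S 3 \<bowtie> S 2) \<partial>Om) \<le> 16 * C ^ 3 * K 0 * K 1 * P ^ 3" .
  qed (simp_all add: gR tw amR)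
  have s2: "(\<integral>w. \<bar>tra (R w \<bowtie> S 2) - K 0 * (tra (S 3 \<bowtie> S 0) * tra (R' w \<bowtie> S 0))\<bar> \<partial>Om)
      \<le> 18 * C * K 0 * P * err 0 * (4 * C\<^sup>2 * K 1 * P\<^sup>2)"
  proof -
    have "tra (R w \<bowtie> S 2) = tra (T 0 w \<bowtie> S 3 \<bowtie> T 0 w \<bowtie> R' w)" for w
      unfolding RB R'_def ..
    moreover have "(\<integral>w. \<bar>tra (T 0 w \<bowtie> S 3 \<bowtie> T 0 w \<bowtie> R' w) - K 0 * (tra (S 3 \<bowtie> S 0) * tra (R' w \<bowtie> S 0))\<bar> \<partial>Om)
      \<le> 18 * C * K 0 * P * err 0 * (4 * C\<^sup>2 * K 1 * P\<^sup>2)"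
    proof (rule E_concentration_le)
      show "R' (w(0 := y)) = R' w" for w y by (simp add: R'_def)
      show "(\<integral>w. tra (R' w \<bowtie> S 0) \<partial>Om) \<le> 4 * C\<^sup>2 * K 1 * P\<^sup>2"
        unfolding R'B by (rule E_TATR_const_le; simp add: tw am_const_mat)
      have "(\<integral>w. tra (R' w \<bowtie> (S 0 \<bowtie> S 3 \<bowtie> S 0)) \<partial>Om) \<le> 4 * C\<^sup>2 * K 1 * P\<^sup>2"
        unfolding R'B by (rule E_TATR_const_le; simp add: tw am_const_mat)
      then show "(\<integral>w. tra (R' w \<bowtie> S 0 \<bowtie> S 3 \<bowtie> S 0) \<partial>Om) \<le> 4 * C\<^sup>2 * K 1 * P\<^sup>2" .
      have "(\<integral>w. tra (R' w \<bowtie> (S 0 \<bowtie> S 3 \<bowtie> S 0 \<bowtie> S 3 \<bowtie> S 0)) \<partial>Om) \<le> 4 * C\<^sup>2 * K 1 * P\<^sup>2"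
        unfolding R'B by (rule E_TATR_const_le; simp add: tw am_const_mat)
      then show "(\<integral>w. tra (R' w \<bowtie> S 0 \<bowtie> S 3 \<bowtie> S 0 \<bowtie> S 3 \<bowtie> S 0) \<partial>Om) \<le> 4 * C\<^sup>2 * K 1 * P\<^sup>2" .
    qed (simp_all add: gR' tw amR)
    ultimately show ?thesis by simp
  qed
  have s3: "(\<integral>w. \<bar>tra (R' w \<bowtie> S 0) - K 1 * (tra (S 2 \<bowtie> S 1) * tra (S 0 \<bowtie> S 1))\<bar> \<partial>Om)
      \<le> 18 * C * K 1 * P * err 1 * (C * P)"
    unfolding R'B by (rule E_concentration_le) (simp_all add: tw am_S O.prob_space)
  have am1: "all_moments Om (\<lambda>w. tra (R w \<bowtie> S 2))" "all_moments Om (\<lambda>w. tra (R' w \<bowtie> S 0))"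
    by (intro am_tra_word am_mm amR am_S; assumption)+
  define t32 t30 t21 t01 where t: "t32 = tra (S 3 \<bowtie> S 2)" "t30 = tra (S 3 \<bowtie> S 0)" "t21 = tra (S 2 \<bowtie> S 1)" "t01 = tra (S 0 \<bowtie> S 1)"
  have tb: "0 \<le> t32" "0 \<le> t30" "t32 \<le> C * P" "t30 \<le> C * P"
    unfolding t by (intro tra2_nonneg tw)+
  let ?a = "\<lambda>w. \<bar>U w - K 2 * (t32 * tra (R w \<bowtie> S 2))\<bar>"
  let ?b = "\<lambda>w. \<bar>tra (R w \<bowtie> S 2) - K 0 * (t30 * tra (R' w \<bowtie> S 0))\<bar>"
  let ?c = "\<lambda>w. \<bar>tra (R' w \<bowtie> S 0) - K 1 * (t21 * t01)\<bar>"
  have i: "integrable Om ?a" "integrable Om ?b" "integrable Om ?c"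
    by (intro all_moments_integrable all_moments_abs O.all_moments_diff all_moments_mult O.all_moments_const am1 am_U)+
  have "(\<integral>w. \<bar>U w - K 0 * K 1 * K 2 * sg\<bar> \<partial>Om) \<le> (\<integral>w. ?a w + (K 2 * t32) * ?b w + (K 2 * t32 * K 0 * t30) * ?c w \<partial>Om)"
  proof (intro integral_mono)
    show "integrable Om (\<lambda>w. \<bar>U w - K 0 * K 1 * K 2 * sg\<bar>)"
      by (intro all_moments_integrable all_moments_abs O.all_moments_diff O.all_moments_const am_U)
    show "integrable Om (\<lambda>w. ?a w + (K 2 * t32) * ?b w + (K 2 * t32 * K 0 * t30) * ?c w)"
      using i by simp
    fix w
    define b c where "b = tra (R w \<bowtie> S 2) - K 0 * (t30 * tra (R' w \<bowtie> S 0))" and "c = tra (R' w \<bowtie> S 0) - K 1 * (t21 * t01)"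
    \<comment> \<open>A telescoping sum: the error of a later round carries the factors already
      split off.\<close>
    have e: "U w - K 0 * K 1 * K 2 * sg = (U w - K 2 * (t32 * tra (R w \<bowtie> S 2))) + (K 2 * t32) * b + (K 2 * t32 * K 0 * t30) * c"
      unfolding b_def c_def sg_def t[symmetric] by (simp add: algebra_simps)
    have "\<bar>(K 2 * t32) * b\<bar> = (K 2 * t32) * \<bar>b\<bar>" "\<bar>(K 2 * t32 * K 0 * t30) * c\<bar> = (K 2 * t32 * K 0 * t30) * \<bar>c\<bar>"
      using tb by (simp_all add: abs_mult)
    then show "\<bar>U w - K 0 * K 1 * K 2 * sg\<bar> \<le> ?a w + (K 2 * t32) * ?b w + (K 2 * t32 * K 0 * t30) * ?c w"
      unfolding e b_def[symmetric] c_def[symmetric] by linarith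
  qed
  also have "\<dots> = (\<integral>w. ?a w \<partial>Om) + (K 2 * t32) * (\<integral>w. ?b w \<partial>Om) + (K 2 * t32 * K 0 * t30) * (\<integral>w. ?c w \<partial>Om)"
    using i by simp
  also have "\<dots> \<le> 18 * C * K 2 * P * err 2 * (16 * C ^ 3 * K 0 * K 1 * P ^ 3)
      + (K 2 * (C * P)) * (18 * C * K 0 * P * err 0 * (4 * C\<^sup>2 * K 1 * P\<^sup>2))
      + (K 2 * (C * P) * K 0 * (C * P)) * (18 * C * K 1 * P * err 1 * (C * P))"
    using s1 s2 s3 tb CP0
    by (intro add_mono mult_mono) (auto simp: t intro!: Bochner_Integration.integral_nonneg mult_nonneg_nonneg)
  also have "\<dots> = (C ^ 4 * D) * (288 * err 2 + 72 * err 0 + 18 * err 1)"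
    by (simp add: D_def power2_eq_square power3_eq_cube power4_eq_xxxx algebra_simps)
  also have "\<dots> \<le> (C ^ 4 * D) * (288 * \<eta>)"
    using D0 C0 err_nonneg[of 0] err_nonneg[of 1] err_nonneg[of 2] err_nonneg[of 3]
    by (intro mult_left_mono) (auto simp: \<eta>_def)
  finally show ?thesis by (simp add: mult_ac)
qed

lemma K_over_P: "K b / P \<le> err b" "1 / sqrt (K b) \<le> err b"
  using K_ge[of b] P_ge by (simp_all add: err_def)

text \<open>\<open>abs_tra_square_le\<close> removes the absolute value at the price of a transpose,
  after which block 1 and then blocks 0 and 2 can be integrated out. Without nesting of the repeated
  blocks no power P^4 builds up: every term falls short of \<open>D\<close> by a factor K / P or
  smaller.\<close>

lemma E_V: "(\<integral>w. \<bar>V w\<bar> \<partial>Om) \<le> 59 * C ^ 3 * D * \<eta>"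
proof -
  interpret O: prob_space Om by (rule Om_prob)
  define X where "X = (\<lambda>w. T 2 w \<bowtie> S 3 \<bowtie> T 0 w)"
  have mX: "mt (X w) = T 0 w \<bowtie> S 3 \<bowtie> T 2 w" for w by (simp add: X_def)
  have X_upd: "X (w(1 := y)) = X w" for w y by (simp add: X_def)
  have amX: "all_moments Om (\<lambda>w. X w i j)" "all_moments Om (\<lambda>w. mt (X w) i j)" if "i < p" "j < p" for i j
    using that unfolding mX unfolding X_def by (intro am_mm am_T am_S; simp)+
  have VX: "\<bar>V w\<bar> \<le> tra (T 1 w \<bowtie> X w \<bowtie> T 1 w \<bowtie> mt (X w))" for w
  proof -
    have "V w = tra (X w \<bowtie> T 1 w \<bowtie> X w \<bowtie> T 1 w)"
      using tra_comm[of "T 0 w \<bowtie> T 1 w" "T 2 w \<bowtie> S 3 \<bowtie> T 0 w \<bowtie> T 1 w \<bowtie> T 2 w \<bowtie> S 3"]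
      by (simp add: V_def Mt_def X_def)
    moreover have "tra (X w \<bowtie> T 1 w \<bowtie> mt (X w) \<bowtie> T 1 w) = tra (T 1 w \<bowtie> X w \<bowtie> T 1 w \<bowtie> mt (X w))"
      using tra_comm[of "X w \<bowtie> T 1 w \<bowtie> mt (X w)" "T 1 w"] by simp
    ultimately show ?thesis using abs_tra_square_le[OF gram_T, of "X w" 1 w] by simp
  qed
  have amA: "all_moments Om (\<lambda>w. tra (X w \<bowtie> S 1 \<bowtie> mt (X w) \<bowtie> S 1))" "all_moments Om (\<lambda>w. tra (X w \<bowtie> S 1))"
    by (intro am_tra_word am_mm amX am_S; assumption)+
  have Ea: "(\<integral>w. tra (X w \<bowtie> S 1 \<bowtie> mt (X w) \<bowtie> S 1) \<partial>Om) \<le> 4 * C * K 0 * P * (4 * C\<^sup>2 * K 2 * P\<^sup>2)"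
  proof -
    define Q where "Q = (\<lambda>w. S 3 \<bowtie> T 2 w \<bowtie> S 1 \<bowtie> T 2 w \<bowtie> S 3)"
    have e: "tra (X w \<bowtie> S 1 \<bowtie> mt (X w) \<bowtie> S 1) = tra (T 0 w \<bowtie> S 1 \<bowtie> T 0 w \<bowtie> Q w)" for w
      using tra_comm[of "T 2 w \<bowtie> S 3" "T 0 w \<bowtie> S 1 \<bowtie> T 0 w \<bowtie> S 3 \<bowtie> T 2 w \<bowtie> S 1"]
      by (simp add: mX) (simp add: X_def Q_def)
    have QB: "tra (Q w \<bowtie> B) = tra (T 2 w \<bowtie> S 1 \<bowtie> T 2 w \<bowtie> S 3 \<bowtie> B \<bowtie> S 3)" for w B
      using tra_comm[of "S 3" "T 2 w \<bowtie> S 1 \<bowtie> T 2 w \<bowtie> S 3 \<bowtie> B"] by (simp add: Q_def)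
    show ?thesis unfolding e
    proof (rule E_TATQ_le)
      show "gram (Q w)" for w
        using gram_sandwich_sym[of "S 3" "T 2 w \<bowtie> S 1 \<bowtie> T 2 w"] gram_sandwich_sym[of "T 2 w" "S 1"] by (simp add: Q_def)
      show "Q (w(0 := y)) = Q w" for w y by (simp add: Q_def)
      show "(\<integral>w. tra (Q w \<bowtie> S 0) \<partial>Om) \<le> 4 * C\<^sup>2 * K 2 * P\<^sup>2"
        unfolding QB by (rule E_TATR_const_le; simp add: tw am_const_mat)
      have g5: "gram (S 3 \<bowtie> (S 0 \<bowtie> S 1 \<bowtie> S 0) \<bowtie> S 3)" by (rule gram_sandwich_sym) simp_all
      show "(\<integral>w. tra (Q w \<bowtie> S 0 \<bowtie> S 1 \<bowtie> S 0) \<partial>Om) \<le> 4 * C\<^sup>2 * K 2 * P\<^sup>2"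
        unfolding QB by (rule E_TATR_const_le; (use g5 in \<open>simp add: tw am_const_mat\<close>))
      show "all_moments Om (\<lambda>w. Q w i j)" if "i < p" "j < p" for i j
        using that unfolding Q_def by (intro am_mm am_T am_S; simp)
    qed (simp_all add: tw)
  qed
  have Ec: "(\<integral>w. (tra (T 0 w \<bowtie> S 1 \<bowtie> S 2 \<bowtie> S 3))\<^sup>2 \<partial>Om) \<le> 3 * C\<^sup>2 * (K 0)\<^sup>2 * P\<^sup>2"
  proof (rule Om_le_const[where b = 0])
    show "all_moments Om (\<lambda>w. (tra (T 0 w \<bowtie> S 1 \<bowtie> S 2 \<bowtie> S 3))\<^sup>2)"
      by (intro O.all_moments_power am_tra_word am_mm am_T am_S; simp)
    fix w
    let ?Q = "S 1 \<bowtie> S 2 \<bowtie> S 3"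
    have "(\<integral>y. (tra (gm (k 0) y \<bowtie> ?Q))\<^sup>2 \<partial>Wb 0) \<le> 2 * K 0 * tra (?Q \<bowtie> S 0 \<bowtie> mt ?Q \<bowtie> S 0) + (K 0 * tra (?Q \<bowtie> S 0))\<^sup>2"
      by (rule g.E_tra_sq_le)
    also have "\<dots> \<le> 2 * K 0 * (C * P) + (K 0 * (C * P))\<^sup>2"
    proof (intro add_mono mult_left_mono)
      show "tra (?Q \<bowtie> S 0 \<bowtie> mt ?Q \<bowtie> S 0) \<le> C * P" by (simp add: tw)
      have "\<bar>tra (?Q \<bowtie> S 0)\<bar> \<le> C * P" using traces[of "[1,2,3,0]"] by simp
      then have "(tra (?Q \<bowtie> S 0))\<^sup>2 \<le> (C * P)\<^sup>2" using CP0 by (simp add: abs_le_square_iff[symmetric])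
      then show "(K 0 * tra (?Q \<bowtie> S 0))\<^sup>2 \<le> (K 0 * (C * P))\<^sup>2"
        unfolding power_mult_distrib[of "K 0"] by (rule mult_left_mono) simp
    qed simp
    \<comment> \<open>\<open>C\<close>, \<open>P\<close> and \<open>K 0\<close> are at least 1, so
      the variance term is absorbed into the squared mean.\<close>
    also have "\<dots> \<le> 2 * (K 0 * (C * P))\<^sup>2 + (K 0 * (C * P))\<^sup>2"
    proof -
      have "1 * 1 \<le> C * P" using C1 P_ge by (intro mult_mono) auto
      then have "1 * 1 \<le> K 0 * (C * P)" using K_ge by (intro mult_mono) auto
      then have "K 0 * (C * P) \<le> (K 0 * (C * P))\<^sup>2" unfolding power2_eq_square
        using mult_left_mono[of 1 "K 0 * (C * P)" "K 0 * (C * P)"] by simp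
      then show ?thesis by simp
    qed
    also have "\<dots> = 3 * C\<^sup>2 * (K 0)\<^sup>2 * P\<^sup>2" by (simp add: power_mult_distrib)
    finally show "(\<integral>y. (tra (T 0 (w(0 := y)) \<bowtie> ?Q))\<^sup>2 \<partial>Wb 0) \<le> 3 * C\<^sup>2 * (K 0)\<^sup>2 * P\<^sup>2" by simp
  qed simp
  have Eb: "(\<integral>w. (tra (X w \<bowtie> S 1))\<^sup>2 \<partial>Om) \<le> 2 * K 2 * (4 * C\<^sup>2 * K 0 * P\<^sup>2) + (K 2)\<^sup>2 * (3 * C\<^sup>2 * (K 0)\<^sup>2 * P\<^sup>2)"
  proof -
    let ?A = "\<lambda>w. tra (T 0 w \<bowtie> (S 1 \<bowtie> S 2 \<bowtie> S 1) \<bowtie> T 0 w \<bowtie> (S 3 \<bowtie> S 2 \<bowtie> S 3))"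
    let ?B = "\<lambda>w. tra (T 0 w \<bowtie> S 1 \<bowtie> S 2 \<bowtie> S 3)"
    have amB: "all_moments Om ?A" "all_moments Om ?B"
      by (intro am_tra_word am_mm am_T am_S; simp)+
    have "(\<integral>w. (tra (X w \<bowtie> S 1))\<^sup>2 \<partial>Om) \<le> (\<integral>w. 2 * K 2 * ?A w + (K 2)\<^sup>2 * (?B w)\<^sup>2 \<partial>Om)"
    proof (rule Om_le[where b = 2])
      show "all_moments Om (\<lambda>w. (tra (X w \<bowtie> S 1))\<^sup>2)" by (intro O.all_moments_power amA)
      show "all_moments Om (\<lambda>w. 2 * K 2 * ?A w + (K 2)\<^sup>2 * (?B w)\<^sup>2)"
        by (intro all_moments_add all_moments_mult O.all_moments_const O.all_moments_power amB)
      fix w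
      let ?Q = "S 3 \<bowtie> T 0 w \<bowtie> S 1"
      have e1: "tra (?Q \<bowtie> S 2 \<bowtie> mt ?Q \<bowtie> S 2) = ?A w"
        using tra_comm[of "S 3" "T 0 w \<bowtie> S 1 \<bowtie> S 2 \<bowtie> S 1 \<bowtie> T 0 w \<bowtie> S 3 \<bowtie> S 2"] by simp
      have e2: "tra (?Q \<bowtie> S 2) = ?B w" using tra_comm[of "S 3" "T 0 w \<bowtie> S 1 \<bowtie> S 2"] by simp
      show "(\<integral>y. (tra (X (w(2 := y)) \<bowtie> S 1))\<^sup>2 \<partial>Wb 2) \<le> 2 * K 2 * ?A w + (K 2)\<^sup>2 * (?B w)\<^sup>2"
        using g.E_tra_sq_le[where b = 2 and k = "k 2" and Q = ?Q] unfolding e1 e2 by (simp add: X_def power_mult_distrib)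
    qed simp
    also have "\<dots> = 2 * K 2 * (\<integral>w. ?A w \<partial>Om) + (K 2)\<^sup>2 * (\<integral>w. (?B w)\<^sup>2 \<partial>Om)"
      using amB[THEN all_moments_integrable] O.all_moments_power[OF amB(2), THEN all_moments_integrable] by simp
    also have "\<dots> \<le> 2 * K 2 * (4 * C\<^sup>2 * K 0 * P\<^sup>2) + (K 2)\<^sup>2 * (3 * C\<^sup>2 * (K 0)\<^sup>2 * P\<^sup>2)"
    proof (intro add_mono mult_left_mono Ec)
      show "(\<integral>w. ?A w \<partial>Om) \<le> 4 * C\<^sup>2 * K 0 * P\<^sup>2"
        by (rule E_TATR_const_le; simp add: tw am_const_mat)
    qed simp_all
    finally show ?thesis .
  qed
  have "(\<integral>w. \<bar>V w\<bar> \<partial>Om) \<le> (\<integral>w. tra (T 1 w \<bowtie> X w \<bowtie> T 1 w \<bowtie> mt (X w)) \<partial>Om)"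
    by (intro integral_mono all_moments_integrable all_moments_abs am_V VX am_tra_word am_mm amX am_T) auto
  also have "\<dots> \<le> (\<integral>w. 3 * (K 1)\<^sup>2 * tra (X w \<bowtie> S 1 \<bowtie> mt (X w) \<bowtie> S 1) + K 1 * (tra (X w \<bowtie> S 1))\<^sup>2 \<partial>Om)"
  proof (rule Om_le[where b = 1])
    show "all_moments Om (\<lambda>w. tra (T 1 w \<bowtie> X w \<bowtie> T 1 w \<bowtie> mt (X w)))"
      by (intro am_tra_word am_mm amX am_T; simp)
    show "all_moments Om (\<lambda>w. 3 * (K 1)\<^sup>2 * tra (X w \<bowtie> S 1 \<bowtie> mt (X w) \<bowtie> S 1) + K 1 * (tra (X w \<bowtie> S 1))\<^sup>2)"
      by (intro all_moments_add all_moments_mult O.all_moments_const O.all_moments_power amA)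
    show "(\<integral>y. tra (T 1 (w(1 := y)) \<bowtie> X (w(1 := y)) \<bowtie> T 1 (w(1 := y)) \<bowtie> mt (X (w(1 := y)))) \<partial>Wb 1)
        \<le> 3 * (K 1)\<^sup>2 * tra (X w \<bowtie> S 1 \<bowtie> mt (X w) \<bowtie> S 1) + K 1 * (tra (X w \<bowtie> S 1))\<^sup>2" for w
      unfolding X_upd T_upd by (rule g.E_tra_tra_mt_le)
  qed simp
  also have "\<dots> = 3 * (K 1)\<^sup>2 * (\<integral>w. tra (X w \<bowtie> S 1 \<bowtie> mt (X w) \<bowtie> S 1) \<partial>Om) + K 1 * (\<integral>w. (tra (X w \<bowtie> S 1))\<^sup>2 \<partial>Om)"
    using amA[THEN all_moments_integrable] O.all_moments_power[OF amA(2), THEN all_moments_integrable] by simp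
  also have "\<dots> \<le> 3 * (K 1)\<^sup>2 * (4 * C * K 0 * P * (4 * C\<^sup>2 * K 2 * P\<^sup>2))
      + K 1 * (2 * K 2 * (4 * C\<^sup>2 * K 0 * P\<^sup>2) + (K 2)\<^sup>2 * (3 * C\<^sup>2 * (K 0)\<^sup>2 * P\<^sup>2))"
    by (intro add_mono mult_left_mono Ea Eb) auto
  \<comment> \<open>The summands in units of \<open>D\<close>. The coefficients 48 = 3 * 4 * 4, 8 =
    2 * 4 and 3 add up to 59.\<close>
  also have "\<dots> = D * (C ^ 3 * (48 * (K 1 / P)) + C\<^sup>2 * (8 * (1 / P) * (1 / P) + 3 * (K 0 / P) * (K 2 / P)))"
    using P_ge by (simp add: D_def field_simps eval_nat_numeral)
  also have "\<dots> \<le> D * (C ^ 3 * (48 * \<eta>) + C ^ 3 * (8 * \<eta> + 3 * \<eta>))"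
  proof (rule mult_left_mono[OF add_mono])
    have "K 1 / P \<le> \<eta>" using K_over_P(1)[of 1] \<eta>_ge by simp
    then show "C ^ 3 * (48 * (K 1 / P)) \<le> C ^ 3 * (48 * \<eta>)" using C0 by (intro mult_left_mono) auto
    have k2: "K 2 / P \<le> 1" "0 \<le> K 2 / P" using K_le[of 2] P_ge by simp_all
    have kp: "K 0 / P \<le> \<eta>" "0 \<le> K 0 / P" using K_over_P(1)[of 0] \<eta>_ge by simp_all
    have p1: "1 / P \<le> K 0 / P" "1 / P \<le> 1" using K_ge[of 0] P_ge by (simp_all add: divide_right_mono)
    have "(K 0 / P) * (K 2 / P) \<le> \<eta> * 1" using k2 kp \<eta>_ge by (intro mult_mono) auto
    moreover have "(1 / P) * (1 / P) \<le> \<eta> * 1" using p1 kp P_ge \<eta>_ge by (intro mult_mono) auto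
    ultimately have "8 * (1 / P) * (1 / P) + 3 * (K 0 / P) * (K 2 / P) \<le> 8 * \<eta> + 3 * \<eta>" by simp
    moreover have "C\<^sup>2 \<le> C ^ 3" using C1 by (intro power_increasing) auto
    ultimately show "C\<^sup>2 * (8 * (1 / P) * (1 / P) + 3 * (K 0 / P) * (K 2 / P)) \<le> C ^ 3 * (8 * \<eta> + 3 * \<eta>)"
      using C0 P_ge by (intro mult_mono) auto
  qed (use D0 in simp)
  finally show ?thesis by (simp add: algebra_simps)
qed

text \<open>The blocks 0, 1, 2 are replaced by their means one after the other, as in a martingale
  decomposition, and \<open>tra_variance_le\<close> gives the conditional variance of each
  replacement. In units of C^2 sqrt (K 0 K 1 K 2 P^3) the three contributions are at most 6, 3 and
  2.\<close>

lemma E_H: "(\<integral>w. \<bar>H w\<bar> \<partial>Om) \<le> 11 * C\<^sup>2 * sqrt (K 0 * K 1 * K 2 * P ^ 3)"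
proof -
  interpret O: prob_space Om by (rule Om_prob)
  let ?c = "tra (S 0 \<bowtie> S 1 \<bowtie> S 2 \<bowtie> S 3)"
  define Y1 Y2 where "Y1 = (\<lambda>w. tra (T 1 w \<bowtie> T 2 w \<bowtie> S 3 \<bowtie> S 0))" and "Y2 = (\<lambda>w. tra (T 2 w \<bowtie> S 3 \<bowtie> S 0 \<bowtie> S 1))"
  define Y0 where "Y0 = (\<lambda>w. tra (Mt w \<bowtie> S 3))"
  have amY: "all_moments Om Y0" "all_moments Om Y1" "all_moments Om Y2"
    unfolding Y0_def Y1_def Y2_def Mt_def by (intro am_tra_word am_mm am_T am_S; simp)+
  have h1: "(\<integral>w. \<bar>Y0 w - K 0 * Y1 w\<bar> \<partial>Om) \<le> sqrt (2 * K 0 * (16 * C ^ 3 * K 1 * K 2 * P ^ 3))"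
  proof (rule O.abs_integral_le_sqrt)
    show "all_moments Om (\<lambda>w. Y0 w - K 0 * Y1 w)"
      by (intro O.all_moments_diff all_moments_mult O.all_moments_const amY)
    let ?A = "\<lambda>w. tra (T 1 w \<bowtie> S 0 \<bowtie> T 1 w \<bowtie> T 2 w \<bowtie> (S 3 \<bowtie> S 0 \<bowtie> S 3) \<bowtie> T 2 w)"
    have amB: "all_moments Om ?A" by (intro am_tra_word am_mm am_T am_S; simp)
    have "(\<integral>w. (Y0 w - K 0 * Y1 w)\<^sup>2 \<partial>Om) \<le> (\<integral>w. 2 * K 0 * ?A w \<partial>Om)"
    proof (rule Om_le[where b = 0])
      show "all_moments Om (\<lambda>w. (Y0 w - K 0 * Y1 w)\<^sup>2)"
        by (intro O.all_moments_power O.all_moments_diff all_moments_mult O.all_moments_const amY)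
      show "all_moments Om (\<lambda>w. 2 * K 0 * ?A w)" by (intro all_moments_mult O.all_moments_const amB)
      fix w
      let ?Q = "T 1 w \<bowtie> T 2 w \<bowtie> S 3"
      have "tra (?Q \<bowtie> S 0 \<bowtie> mt ?Q \<bowtie> S 0) = ?A w"
        using tra_comm[of "T 1 w \<bowtie> T 2 w \<bowtie> S 3 \<bowtie> S 0 \<bowtie> S 3 \<bowtie> T 2 w" "T 1 w \<bowtie> S 0"] by simp
      then show "(\<integral>y. (Y0 (w(0 := y)) - K 0 * Y1 (w(0 := y)))\<^sup>2 \<partial>Wb 0) \<le> 2 * K 0 * ?A w"
        using g.tra_variance_le[where b = 0 and k = "k 0" and Q = ?Q] by (simp add: Y0_def Y1_def Mt_def)
    qed simp
    also have "\<dots> = 2 * K 0 * (\<integral>w. ?A w \<partial>Om)" by simp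
    also have "\<dots> \<le> 2 * K 0 * (16 * C ^ 3 * K 1 * K 2 * P ^ 3)"
      by (intro mult_left_mono E_TAT_TBT_le) (simp_all add: tw)
    finally show "(\<integral>w. (Y0 w - K 0 * Y1 w)\<^sup>2 \<partial>Om) \<le> 2 * K 0 * (16 * C ^ 3 * K 1 * K 2 * P ^ 3)" .
  qed
  have h2: "(\<integral>w. \<bar>Y1 w - K 1 * Y2 w\<bar> \<partial>Om) \<le> sqrt (2 * K 1 * (4 * C\<^sup>2 * K 2 * P\<^sup>2))"
  proof (rule O.abs_integral_le_sqrt)
    show "all_moments Om (\<lambda>w. Y1 w - K 1 * Y2 w)"
      by (intro O.all_moments_diff all_moments_mult O.all_moments_const amY)
    let ?A = "\<lambda>w. tra (T 2 w \<bowtie> (S 3 \<bowtie> S 0 \<bowtie> S 1 \<bowtie> S 0 \<bowtie> S 3) \<bowtie> T 2 w \<bowtie> S 1)"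
    have amB: "all_moments Om ?A" by (intro am_tra_word am_mm am_T am_S; simp)
    have "(\<integral>w. (Y1 w - K 1 * Y2 w)\<^sup>2 \<partial>Om) \<le> (\<integral>w. 2 * K 1 * ?A w \<partial>Om)"
    proof (rule Om_le[where b = 1])
      show "all_moments Om (\<lambda>w. (Y1 w - K 1 * Y2 w)\<^sup>2)"
        by (intro O.all_moments_power O.all_moments_diff all_moments_mult O.all_moments_const amY)
      show "all_moments Om (\<lambda>w. 2 * K 1 * ?A w)" by (intro all_moments_mult O.all_moments_const amB)
      fix w
      let ?Q = "T 2 w \<bowtie> S 3 \<bowtie> S 0"
      show "(\<integral>y. (Y1 (w(1 := y)) - K 1 * Y2 (w(1 := y)))\<^sup>2 \<partial>Wb 1) \<le> 2 * K 1 * ?A w"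
        using g.tra_variance_le[where b = 1 and k = "k 1" and Q = ?Q] by (simp add: Y2_def Y1_def)
    qed simp
    also have "\<dots> = 2 * K 1 * (\<integral>w. ?A w \<partial>Om)" by simp
    also have "\<dots> \<le> 2 * K 1 * (4 * C\<^sup>2 * K 2 * P\<^sup>2)"
    proof -
      have g5: "gram (S 3 \<bowtie> (S 0 \<bowtie> S 1 \<bowtie> S 0) \<bowtie> S 3)" by (rule gram_sandwich_sym) simp_all
      show ?thesis
        by (intro mult_left_mono E_TATR_const_le) (use g5 in \<open>simp_all add: tw am_const_mat\<close>)
    qed
    finally show "(\<integral>w. (Y1 w - K 1 * Y2 w)\<^sup>2 \<partial>Om) \<le> 2 * K 1 * (4 * C\<^sup>2 * K 2 * P\<^sup>2)" .
  qed
  have h3: "(\<integral>w. \<bar>Y2 w - K 2 * ?c\<bar> \<partial>Om) \<le> sqrt (2 * K 2 * (C * P))"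
  proof (rule O.abs_integral_le_sqrt)
    show am: "all_moments Om (\<lambda>w. Y2 w - K 2 * ?c)"
      by (intro O.all_moments_diff all_moments_mult O.all_moments_const amY)
    show "(\<integral>w. (Y2 w - K 2 * ?c)\<^sup>2 \<partial>Om) \<le> 2 * K 2 * (C * P)"
    proof (rule Om_le_const[where b = 2])
      show "all_moments Om (\<lambda>w. (Y2 w - K 2 * ?c)\<^sup>2)" by (intro O.all_moments_power am)
      fix w :: "nat \<Rightarrow> nat \<Rightarrow> fvec"
      let ?Q = "S 3 \<bowtie> S 0 \<bowtie> S 1"
      have "tra (?Q \<bowtie> S 2 \<bowtie> mt ?Q \<bowtie> S 2) \<le> C * P" by (simp add: tw)
      then have "2 * K 2 * tra (?Q \<bowtie> S 2 \<bowtie> mt ?Q \<bowtie> S 2) \<le> 2 * K 2 * (C * P)"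
        by (intro mult_left_mono) auto
      moreover have "tra (?Q \<bowtie> S 2) = ?c" using tra_comm[of "S 3" "S 0 \<bowtie> S 1 \<bowtie> S 2"] by simp
      ultimately show "(\<integral>y. (Y2 (w(2 := y)) - K 2 * ?c)\<^sup>2 \<partial>Wb 2) \<le> 2 * K 2 * (C * P)"
        using g.tra_variance_le[where b = 2 and k = "k 2" and Q = ?Q] by (simp add: Y2_def)
    qed simp
  qed
  let ?a = "\<lambda>w. \<bar>Y0 w - K 0 * Y1 w\<bar>" and ?b = "\<lambda>w. \<bar>Y1 w - K 1 * Y2 w\<bar>" and ?d = "\<lambda>w. \<bar>Y2 w - K 2 * ?c\<bar>"
  have i: "integrable Om ?a" "integrable Om ?b" "integrable Om ?d"
    by (intro all_moments_integrable all_moments_abs O.all_moments_diff all_moments_mult O.all_moments_const amY)+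
  have "(\<integral>w. \<bar>H w\<bar> \<partial>Om) \<le> (\<integral>w. ?a w + K 0 * ?b w + K 0 * K 1 * ?d w \<partial>Om)"
  proof (intro integral_mono)
    show "integrable Om (\<lambda>w. \<bar>H w\<bar>)" by (intro all_moments_integrable all_moments_abs am_H)
    show "integrable Om (\<lambda>w. ?a w + K 0 * ?b w + K 0 * K 1 * ?d w)" using i by simp
    fix w
    define b d where "b = Y1 w - K 1 * Y2 w" and "d = Y2 w - K 2 * ?c"
    have e: "H w = (Y0 w - K 0 * Y1 w) + K 0 * b + K 0 * K 1 * d"
      unfolding H_def b_def d_def Y0_def by (simp add: algebra_simps)
    have "\<bar>K 0 * b\<bar> = K 0 * \<bar>b\<bar>" "\<bar>K 0 * K 1 * d\<bar> = K 0 * K 1 * \<bar>d\<bar>"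
      by (simp_all add: abs_mult)
    then show "\<bar>H w\<bar> \<le> ?a w + K 0 * ?b w + K 0 * K 1 * ?d w"
      unfolding e b_def[symmetric] d_def[symmetric] by linarith
  qed
  also have "\<dots> = (\<integral>w. ?a w \<partial>Om) + K 0 * (\<integral>w. ?b w \<partial>Om) + K 0 * K 1 * (\<integral>w. ?d w \<partial>Om)"
    using i by simp
  also have "\<dots> \<le> sqrt (2 * K 0 * (16 * C ^ 3 * K 1 * K 2 * P ^ 3)) + K 0 * sqrt (2 * K 1 * (4 * C\<^sup>2 * K 2 * P\<^sup>2)) + K 0 * K 1 * sqrt (2 * K 2 * (C * P))"
    by (intro add_mono mult_left_mono h1 h2 h3) auto
  also have "\<dots> \<le> 6 * C\<^sup>2 * sqrt (K 0 * K 1 * K 2 * P ^ 3) + 3 * C\<^sup>2 * sqrt (K 0 * K 1 * K 2 * P ^ 3) + 2 * C\<^sup>2 * sqrt (K 0 * K 1 * K 2 * P ^ 3)"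
  proof (intro add_mono)
    define Z where "Z = K 0 * K 1 * K 2 * P ^ 3"
    have Z0: "0 \<le> Z" using P_ge by (simp add: Z_def)
    have c3: "C ^ 3 \<le> C ^ 4" "C\<^sup>2 \<le> C ^ 4" "C \<le> C ^ 4" using C1 power_increasing[of 1 4 C] by (auto intro: power_increasing)
    have gen: "x \<le> c * C\<^sup>2 * sqrt Z" if "x\<^sup>2 \<le> c\<^sup>2 * (C ^ 4 * Z)" "0 \<le> c" for x c
    proof (rule power2_le_imp_le)
      show "x\<^sup>2 \<le> (c * C\<^sup>2 * sqrt Z)\<^sup>2" using that Z0 by (simp add: power_mult_distrib mult.assoc flip: power_mult)
    qed (use that Z0 in simp)
    show "sqrt (2 * K 0 * (16 * C ^ 3 * K 1 * K 2 * P ^ 3)) \<le> 6 * C\<^sup>2 * sqrt (K 0 * K 1 * K 2 * P ^ 3)"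
      unfolding Z_def[symmetric]
    proof (rule gen)
      have "(sqrt (2 * K 0 * (16 * C ^ 3 * K 1 * K 2 * P ^ 3)))\<^sup>2 = 32 * (C ^ 3 * Z)"
        using C0 P_ge by (simp add: Z_def mult_ac)
      also have "\<dots> \<le> 36 * (C ^ 4 * Z)" using c3 Z0 C0 by (intro mult_mono) auto
      finally show "(sqrt (2 * K 0 * (16 * C ^ 3 * K 1 * K 2 * P ^ 3)))\<^sup>2 \<le> 6\<^sup>2 * (C ^ 4 * Z)" by simp
    qed simp
    show "K 0 * sqrt (2 * K 1 * (4 * C\<^sup>2 * K 2 * P\<^sup>2)) \<le> 3 * C\<^sup>2 * sqrt (K 0 * K 1 * K 2 * P ^ 3)"
      unfolding Z_def[symmetric]
    proof (rule gen)
      have "(K 0 * sqrt (2 * K 1 * (4 * C\<^sup>2 * K 2 * P\<^sup>2)))\<^sup>2 = 8 * (C\<^sup>2 * (K 0 * (K 0 * K 1 * K 2 * P\<^sup>2)))"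
        using C0 P_ge by (simp add: power_mult_distrib) (simp add: power2_eq_square mult_ac)
      also have "\<dots> \<le> 9 * (C ^ 4 * (P * (K 0 * K 1 * K 2 * P\<^sup>2)))"
        using c3 C0 P_ge K_le[of 0] by (intro mult_mono) auto
      also have "\<dots> = 3\<^sup>2 * (C ^ 4 * Z)" by (simp add: Z_def power3_eq_cube power2_eq_square mult_ac)
      finally show "(K 0 * sqrt (2 * K 1 * (4 * C\<^sup>2 * K 2 * P\<^sup>2)))\<^sup>2 \<le> 3\<^sup>2 * (C ^ 4 * Z)" .
    qed simp
    show "K 0 * K 1 * sqrt (2 * K 2 * (C * P)) \<le> 2 * C\<^sup>2 * sqrt (K 0 * K 1 * K 2 * P ^ 3)"
      unfolding Z_def[symmetric]
    proof (rule gen)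
      have "(K 0 * K 1 * sqrt (2 * K 2 * (C * P)))\<^sup>2 = 2 * (C * ((K 0 * K 1) * (K 0 * K 1 * K 2 * P)))"
        using C0 P_ge by (simp add: power_mult_distrib) (simp add: power2_eq_square mult_ac)
      also have "\<dots> \<le> 4 * (C ^ 4 * ((P * P) * (K 0 * K 1 * K 2 * P)))"
        using c3 C0 P_ge K_le[of 0] K_le[of 1] by (intro mult_mono) auto
      also have "\<dots> = 2\<^sup>2 * (C ^ 4 * Z)" by (simp add: Z_def power3_eq_cube power2_eq_square mult_ac)
      finally show "(K 0 * K 1 * sqrt (2 * K 2 * (C * P)))\<^sup>2 \<le> 2\<^sup>2 * (C ^ 4 * Z)" .
    qed simp
  qed
  also have "\<dots> = 11 * C\<^sup>2 * sqrt (K 0 * K 1 * K 2 * P ^ 3)" by simp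
  finally show ?thesis .
qed

end

section \<open>Normal approximation for one trace\<close>

lemma cmod_iexp_diff_le: "cmod (iexp a - iexp b) \<le> \<bar>a - b\<bar>"
proof -
  have "iexp a - iexp b = iexp b * (iexp (a - b) - 1)"
    by (simp add: algebra_simps flip: exp_add)
  then have "cmod (iexp a - iexp b) = cmod (iexp (a - b) - 1)"
    by (simp add: norm_mult)
  also have "\<dots> \<le> \<bar>a - b\<bar>" using iexp_approx1[of "a - b" 0] by simp
  finally show ?thesis .
qed

lemma abs_exp_minus_diff_le:
  fixes a b :: real
  assumes "0 \<le> a" "0 \<le> b"
  shows "\<bar>exp (- a) - exp (- b)\<bar> \<le> \<bar>a - b\<bar>"
proof -
  have *: "exp (- x) - exp (- y) \<le> y - x" "exp (- y) \<le> exp (- x)" if "0 \<le> x" "x \<le> y" for x y :: real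
  proof -
    have "exp (- x) - exp (- y) = exp (- x) * (1 - exp (- (y - x)))"
      by (simp add: algebra_simps flip: exp_add)
    also have "\<dots> \<le> 1 * (y - x)"
      using that exp_ge_add_one_self[of "x - y"] by (intro mult_mono) (simp_all add: algebra_simps)
    finally show "exp (- x) - exp (- y) \<le> y - x" by simp
    show "exp (- y) \<le> exp (- x)" using that by simp
  qed
  show ?thesis using *[of a b] *[of b a] assms by (cases "a \<le> b") auto
qed

context blocks
begin

abbreviation "stat_sd \<equiv> sqrt (K 0 * K 1 * K 2 * K 3) * P\<^sup>2"
abbreviation "stat w \<equiv> (tra (T 0 w \<bowtie> T 1 w \<bowtie> T 2 w \<bowtie> T 3 w)
  - K 0 * K 1 * K 2 * K 3 * tra (S 0 \<bowtie> S 1 \<bowtie> S 2 \<bowtie> S 3)) / stat_sd"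

lemma all_moments_stat: "all_moments Om (\<lambda>w. stat w)"
proof -
  interpret O: prob_space Om by (rule Om_prob)
  have "all_moments Om (\<lambda>w. (1 / stat_sd) * (tra (T 0 w \<bowtie> T 1 w \<bowtie> T 2 w \<bowtie> T 3 w)
    - K 0 * K 1 * K 2 * K 3 * tra (S 0 \<bowtie> S 1 \<bowtie> S 2 \<bowtie> S 3)))"
    by (intro all_moments_mult O.all_moments_const O.all_moments_diff am_tra_word am_mm am_T; simp)
  then show ?thesis by simp
qed

text \<open>Three errors, in the order of the bound: dropping the centring error \<open>H\<close>,
  the normal approximation for the columns of block 3 with the other blocks fixed, and the
  replacement of the conditional variance by its leading term. The exponentials involved are
  Lipschitz, so first absolute moments of \<open>H\<close>, \<open>U\<close> and \<open>V\<close>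
  suffice.\<close>

lemma clt_bound:
  "cmod ((\<integral>w. iexp (t * stat w) \<partial>Om) - exp (- (t\<^sup>2 * (sg / P ^ 4) / 2)))
   \<le> 11 * C\<^sup>2 * \<bar>t\<bar> * sqrt \<eta> + 5 * C ^ 4 * t\<^sup>2 * (1 + 288 * \<eta>) * sqrt \<eta> + 174 * C ^ 4 * t\<^sup>2 * \<eta>"
proof -
  interpret O: prob_space Om by (rule Om_prob)
  define s where "s = stat_sd"
  define r where "r = t / s"
  define \<sigma> where "\<sigma> = sg / P ^ 4"
  have s0: "0 < s" using K_ge P_ge by (simp add: s_def)
  have s2: "s\<^sup>2 = D * K 3" using K_ge P_ge by (simp add: s_def D_def power_mult_distrib mult_ac flip: power_mult)
  \<comment> \<open>In units of \<open>D\<close> the number of columns of block 3 disappears, and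
    the conditional exponent is t^2 (U + V) / (2 D).\<close>
  have rK: "r\<^sup>2 * K 3 = t\<^sup>2 / D"
    using s2 s0 K_ge[of 3] D0 by (simp add: r_def power_divide)
  define Z where "Z w = (\<Sum>a<k 3. bil (Mt w) (w 3 a) (w 3 a) - tra (Mt w \<bowtie> S 3))" for w
  have dec: "t * stat w = r * (Z w + K 3 * H w)" for w
  proof -
    have "tra (T 0 w \<bowtie> T 1 w \<bowtie> T 2 w \<bowtie> T 3 w) = tra (T 3 w \<bowtie> Mt w)"
      using tra_comm[of "Mt w" "T 3 w"] by (simp add: Mt_def)
    moreover have "tra (T 3 w \<bowtie> Mt w) - K 3 * tra (Mt w \<bowtie> S 3) = Z w"
      using g.tra_centred[where b = 3 and k = "k 3" and w = "w 3" and Q = "Mt w"] by (simp add: Z_def T_def)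
    ultimately have "tra (T 0 w \<bowtie> T 1 w \<bowtie> T 2 w \<bowtie> T 3 w)
        - K 0 * K 1 * K 2 * K 3 * tra (S 0 \<bowtie> S 1 \<bowtie> S 2 \<bowtie> S 3) = Z w + K 3 * H w"
      by (simp add: H_def algebra_simps)
    then show ?thesis by (simp add: r_def s_def)
  qed
  have amM: "all_moments Om (\<lambda>w. Mt w i j)" if "i < p" "j < p" for i j
    using that unfolding Mt_def by (intro am_mm am_T; simp)
  have am3: "all_moments Om (\<lambda>w. w 3 a i)" if "a < k 3" "i < p" for a i
    using that by (intro all_moments_PiM[where f = "\<lambda>w. w _ _" and M = Wb] g.W_prob g.am_W_coord; simp)
  have amZ: "all_moments Om Z"
    unfolding Z_def
    by (intro O.all_moments_sum O.all_moments_diff all_moments_bil Om_prob amM am3 am_tra_word am_mm am_S; simp)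
  note [measurable] = all_moments_measurable[OF amZ] all_moments_measurable[OF am_H]
    all_moments_measurable[OF am_U] all_moments_measurable[OF am_V]
  have iY: "integrable Om (\<lambda>w. iexp (r * Z w))"
    by (rule O.integrable_const_bound[where B = 1]) auto
  have iX: "integrable Om (\<lambda>w. iexp (r * (Z w + K 3 * H w)))"
    by (rule O.integrable_const_bound[where B = 1]) auto
  note iU = all_moments_integrable[OF am_U] and iV = all_moments_integrable[OF all_moments_abs[OF am_V]]
    and iH = all_moments_integrable[OF all_moments_abs[OF am_H]]
  define e where "e = complex_of_real (exp (- (t\<^sup>2 * \<sigma> / 2)))"
  have step1: "cmod ((\<integral>w. iexp (r * (Z w + K 3 * H w)) \<partial>Om) - (\<integral>w. iexp (r * Z w) \<partial>Om)) \<le> 11 * C\<^sup>2 * \<bar>t\<bar> * sqrt \<eta>"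
  proof -
    have "cmod ((\<integral>w. iexp (r * (Z w + K 3 * H w)) \<partial>Om) - (\<integral>w. iexp (r * Z w) \<partial>Om))
        = cmod (\<integral>w. iexp (r * (Z w + K 3 * H w)) - iexp (r * Z w) \<partial>Om)"
      using iX iY by simp
    also have "\<dots> \<le> (\<integral>w. cmod (iexp (r * (Z w + K 3 * H w)) - iexp (r * Z w)) \<partial>Om)"
      by (rule integral_norm_bound)
    also have "\<dots> \<le> (\<integral>w. (\<bar>r\<bar> * K 3) * \<bar>H w\<bar> \<partial>Om)"
    proof (rule integral_mono)
      show "integrable Om (\<lambda>w. cmod (iexp (r * (Z w + K 3 * H w)) - iexp (r * Z w)))"
        using iX iY by (intro integrable_norm Bochner_Integration.integrable_diff)
      show "integrable Om (\<lambda>w. (\<bar>r\<bar> * K 3) * \<bar>H w\<bar>)" using iH by simp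
      fix w
      have "cmod (iexp (r * (Z w + K 3 * H w)) - iexp (r * Z w)) \<le> \<bar>r * (Z w + K 3 * H w) - r * Z w\<bar>"
        by (rule cmod_iexp_diff_le)
      also have "r * (Z w + K 3 * H w) - r * Z w = r * (K 3 * H w)" by (simp add: algebra_simps)
      finally show "cmod (iexp (r * (Z w + K 3 * H w)) - iexp (r * Z w)) \<le> (\<bar>r\<bar> * K 3) * \<bar>H w\<bar>"
        by (simp add: abs_mult mult.assoc)
    qed
    also have "\<dots> = (\<bar>r\<bar> * K 3) * (\<integral>w. \<bar>H w\<bar> \<partial>Om)" by simp
    also have "\<dots> \<le> (\<bar>r\<bar> * K 3) * (11 * C\<^sup>2 * sqrt (K 0 * K 1 * K 2 * P ^ 3))"
      by (intro mult_left_mono E_H) simp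
    also have "\<dots> = 11 * C\<^sup>2 * \<bar>t\<bar> * (K 3 * sqrt (K 0 * K 1 * K 2 * P ^ 3) / s)"
      using s0 by (simp add: r_def abs_divide)
    \<comment> \<open>The centring error relative to the standard deviation is of order sqrt (K 3 /
      P), small because the subsample size is of smaller order than the dimension.\<close>
    also have "K 3 * sqrt (K 0 * K 1 * K 2 * P ^ 3) / s = sqrt (K 3 / P)"
    proof (rule power2_eq_imp_eq)
      have "(K 3 * sqrt (K 0 * K 1 * K 2 * P ^ 3) / s)\<^sup>2 = (K 3)\<^sup>2 * (K 0 * K 1 * K 2 * P ^ 3) / (D * K 3)"
        using P_ge by (simp add: power_divide power_mult_distrib s2)
      also have "\<dots> = K 3 / P"
        using P_ge K_ge[of 0] K_ge[of 1] K_ge[of 2] K_ge[of 3] by (simp add: D_def field_simps eval_nat_numeral)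
      finally show "(K 3 * sqrt (K 0 * K 1 * K 2 * P ^ 3) / s)\<^sup>2 = (sqrt (K 3 / P))\<^sup>2" using P_ge by simp
    qed (use s0 P_ge in auto)
    also have "11 * C\<^sup>2 * \<bar>t\<bar> * sqrt (K 3 / P) \<le> 11 * C\<^sup>2 * \<bar>t\<bar> * sqrt \<eta>"
      using K_over_P(1)[of 3] \<eta>_ge by (intro mult_left_mono real_sqrt_le_mono) auto
    finally show ?thesis .
  qed
  \<comment> \<open>The conditional characteristic function given the first three blocks, obtained
    by resampling block 3.\<close>
  define \<phi> where "\<phi> w = (\<integral>y. iexp (r * Z (w(3 := y))) \<partial>Wb 3)" for w
  have i\<phi>: "integrable Om \<phi>" and \<phi>Y: "(\<integral>w. \<phi> w \<partial>Om) = (\<integral>w. iexp (r * Z w) \<partial>Om)"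
    unfolding \<phi>_def
    by (rule integrable_PiM_average[where M = Wb and j = 3] integral_PiM_average[where M = Wb and j = 3];
        (rule g.W_prob iY)?; simp)+
  define B where "B w = (5 * t\<^sup>2 / D / sqrt (sqrt (K 3))) * U w + (t\<^sup>2 / (2 * D)) * (\<bar>U w - K 0 * K 1 * K 2 * sg\<bar> + \<bar>V w\<bar>)" for w
  have sg0: "0 \<le> sg" unfolding sg_def by (intro mult_nonneg_nonneg tra2_nonneg)
  have \<sigma>0: "0 \<le> \<sigma>" using sg0 by (simp add: \<sigma>_def)
  have pointwise: "cmod (\<phi> w - e) \<le> B w" for w
  proof -
    define v where "v = (\<integral>x. (bil (Mt w) x x - tra (Mt w \<bowtie> S 3))\<^sup>2 \<partial>N 3)"
    have v: "v = U w + V w" unfolding v_def U_def V_def by (rule g.quad_variance)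
    have v0: "0 \<le> v" unfolding v_def by simp
    have Z3: "Z (w(3 := y)) = (\<Sum>a<k 3. bil (Mt w) (y a) (y a) - tra (Mt w \<bowtie> S 3))" for y
      by (simp add: Z_def Mt_def)
    have "cmod (\<phi> w - exp (- (r\<^sup>2 * K 3 * v / 2))) \<le> 5 * (r\<^sup>2 * K 3 * U w / sqrt (sqrt (K 3)))"
      unfolding \<phi>_def Z3 v_def U_def by (rule g.char_quad_sum[OF k0])
    then have 1: "cmod (\<phi> w - exp (- (t\<^sup>2 / D * v / 2))) \<le> 5 * (t\<^sup>2 / D * U w / sqrt (sqrt (K 3)))"
      unfolding rK .
    have 2: "cmod (complex_of_real (exp (- (t\<^sup>2 / D * v / 2))) - e) \<le> t\<^sup>2 / (2 * D) * (\<bar>U w - K 0 * K 1 * K 2 * sg\<bar> + \<bar>V w\<bar>)"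
    proof -
      have "cmod (complex_of_real (exp (- (t\<^sup>2 / D * v / 2))) - e) = \<bar>exp (- (t\<^sup>2 / D * v / 2)) - exp (- (t\<^sup>2 * \<sigma> / 2))\<bar>"
        unfolding e_def of_real_diff[symmetric] by (rule norm_of_real)
      also have "\<dots> \<le> \<bar>t\<^sup>2 / D * v / 2 - t\<^sup>2 * \<sigma> / 2\<bar>"
        using v0 \<sigma>0 D0 by (intro abs_exp_minus_diff_le) auto
      also have "t\<^sup>2 / D * v / 2 - t\<^sup>2 * \<sigma> / 2 = t\<^sup>2 / (2 * D) * ((U w - K 0 * K 1 * K 2 * sg) + V w)"
      proof -
        have "\<sigma> = K 0 * K 1 * K 2 * sg / D"
          using K_ge[of 0] K_ge[of 1] K_ge[of 2] P_ge by (simp add: \<sigma>_def D_def)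
        then show ?thesis using D0 by (simp add: v field_simps)
      qed
      also have "\<bar>\<dots>\<bar> = t\<^sup>2 / (2 * D) * \<bar>(U w - K 0 * K 1 * K 2 * sg) + V w\<bar>"
        using D0 by (simp add: abs_mult)
      also have "\<dots> \<le> t\<^sup>2 / (2 * D) * (\<bar>U w - K 0 * K 1 * K 2 * sg\<bar> + \<bar>V w\<bar>)"
        using D0 by (intro mult_left_mono) auto
      finally show ?thesis .
    qed
    have "cmod (\<phi> w - e) \<le> cmod (\<phi> w - exp (- (t\<^sup>2 / D * v / 2))) + cmod (complex_of_real (exp (- (t\<^sup>2 / D * v / 2))) - e)"
      using norm_triangle_ineq[of "\<phi> w - complex_of_real (exp (- (t\<^sup>2 / D * v / 2)))" "complex_of_real (exp (- (t\<^sup>2 / D * v / 2))) - e"]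
      by simp
    also have "\<dots> \<le> 5 * (t\<^sup>2 / D * U w / sqrt (sqrt (K 3))) + t\<^sup>2 / (2 * D) * (\<bar>U w - K 0 * K 1 * K 2 * sg\<bar> + \<bar>V w\<bar>)"
      by (intro add_mono 1 2)
    also have "\<dots> = B w" by (simp add: B_def)
    finally show ?thesis .
  qed
  have step2: "cmod ((\<integral>w. iexp (r * Z w) \<partial>Om) - e) \<le> 5 * C ^ 4 * t\<^sup>2 * (1 + 288 * \<eta>) * sqrt \<eta> + 174 * C ^ 4 * t\<^sup>2 * \<eta>"
  proof -
    have iE: "integrable Om (\<lambda>w. \<bar>U w - K 0 * K 1 * K 2 * sg\<bar>)"
      by (intro all_moments_integrable all_moments_abs O.all_moments_diff am_U O.all_moments_const)
    have iB: "integrable Om B" unfolding B_def using iU iV iE by simp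
    have "(\<integral>w. iexp (r * Z w) \<partial>Om) - e = (\<integral>w. \<phi> w - e \<partial>Om)"
      using i\<phi> \<phi>Y by (simp add: O.prob_space)
    then have "cmod ((\<integral>w. iexp (r * Z w) \<partial>Om) - e) \<le> (\<integral>w. cmod (\<phi> w - e) \<partial>Om)"
      using integral_norm_bound[of Om "\<lambda>w. \<phi> w - e"] by simp
    also have "\<dots> \<le> (\<integral>w. B w \<partial>Om)"
      using i\<phi> iB by (intro integral_mono integrable_norm pointwise) auto
    also have "\<dots> = (5 * t\<^sup>2 / D / sqrt (sqrt (K 3))) * (\<integral>w. U w \<partial>Om)
        + (t\<^sup>2 / (2 * D)) * ((\<integral>w. \<bar>U w - K 0 * K 1 * K 2 * sg\<bar> \<partial>Om) + (\<integral>w. \<bar>V w\<bar> \<partial>Om))"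
      unfolding B_def using iU iV iE by simp
    also have "\<dots> \<le> (5 * t\<^sup>2 / D / sqrt (sqrt (K 3))) * (C ^ 4 * D * (1 + 288 * \<eta>)) + (t\<^sup>2 / (2 * D)) * (348 * C ^ 4 * D * \<eta>)"
    proof (intro add_mono mult_left_mono)
      have u1: "(\<integral>w. U w \<partial>Om) = (\<integral>w. U w - K 0 * K 1 * K 2 * sg \<partial>Om) + K 0 * K 1 * K 2 * sg"
        using iU by (simp add: O.prob_space)
      have u2: "(\<integral>w. U w - K 0 * K 1 * K 2 * sg \<partial>Om) \<le> (\<integral>w. \<bar>U w - K 0 * K 1 * K 2 * sg\<bar> \<partial>Om)"
        by (rule integral_mono[OF Bochner_Integration.integrable_diff[OF iU O.integrable_const] iE abs_ge_self])
      have "sg \<le> (C * P) * (C * P) * (C * P) * (C * P)"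
        unfolding sg_def using CP0 C0
        by (intro mult_mono tw mult_nonneg_nonneg tra2_nonneg) auto
      then have "K 0 * K 1 * K 2 * sg \<le> K 0 * K 1 * K 2 * ((C * P) * (C * P) * (C * P) * (C * P))"
        by (intro mult_left_mono) auto
      then have u3: "K 0 * K 1 * K 2 * sg \<le> C ^ 4 * D" by (simp add: D_def eval_nat_numeral mult_ac)
      have "(\<integral>w. U w \<partial>Om) \<le> 288 * C ^ 4 * D * \<eta> + C ^ 4 * D"
        using u1 u2 u3 E_U by linarith
      then show "(\<integral>w. U w \<partial>Om) \<le> C ^ 4 * D * (1 + 288 * \<eta>)" by (simp add: algebra_simps)
      \<comment> \<open>59 C^3 is rounded up to 60 C^4. With 288 this makes 348, halved to 174 by
        the factor 1/2 in the exponent.\<close>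
      have "59 * C ^ 3 * D * \<eta> \<le> 60 * C ^ 4 * D * \<eta>"
        using C1 D0 \<eta>_ge by (intro mult_mono power_increasing) auto
      then show "(\<integral>w. \<bar>U w - K 0 * K 1 * K 2 * sg\<bar> \<partial>Om) + (\<integral>w. \<bar>V w\<bar> \<partial>Om) \<le> 348 * C ^ 4 * D * \<eta>"
        using E_U E_V by linarith
    qed (use D0 in auto)
    also have "\<dots> = 5 * C ^ 4 * t\<^sup>2 * (1 + 288 * \<eta>) * (1 / sqrt (sqrt (K 3))) + 174 * C ^ 4 * t\<^sup>2 * \<eta>"
    proof -
      define q where "q = sqrt (sqrt (K 3))"
      have "0 < q" using K_ge(2)[of 3] by (simp add: q_def)
      then show ?thesis unfolding q_def[symmetric] using D0 by (simp add: field_simps)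
    qed
    also have "\<dots> \<le> 5 * C ^ 4 * t\<^sup>2 * (1 + 288 * \<eta>) * sqrt \<eta> + 174 * C ^ 4 * t\<^sup>2 * \<eta>"
    proof (intro add_right_mono mult_left_mono)
      have "sqrt (1 / sqrt (K 3)) \<le> sqrt \<eta>" using K_over_P(2)[of 3] \<eta>_ge by simp
      then show "1 / sqrt (sqrt (K 3)) \<le> sqrt \<eta>" by (simp add: real_sqrt_divide)
    qed (use C0 \<eta>_ge in auto)
    finally show ?thesis .
  qed
  have "cmod ((\<integral>w. iexp (t * stat w) \<partial>Om) - e) \<le> cmod ((\<integral>w. iexp (r * (Z w + K 3 * H w)) \<partial>Om) - (\<integral>w. iexp (r * Z w) \<partial>Om))
      + cmod ((\<integral>w. iexp (r * Z w) \<partial>Om) - e)"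
    unfolding dec
    using norm_triangle_ineq[of "(\<integral>w. iexp (r * (Z w + K 3 * H w)) \<partial>Om) - (\<integral>w. iexp (r * Z w) \<partial>Om)" "(\<integral>w. iexp (r * Z w) \<partial>Om) - e"]
    by simp
  then show ?thesis using step1 step2 unfolding e_def \<sigma>_def by linarith
qed

end

section \<open>The multivariate normal density\<close>

text \<open>Induction by eliminating the last variable; the Schur complement \<open>A'\<close> is
  again positive definite. The order L'L with \<open>L\<close> lower triangular fits the induction
  in \<open>nn_integral_triangular\<close>, where the last coordinate depends on the earlier
  ones.\<close>

lemma cholesky:
  fixes A :: fmat
  assumes "\<And>i j. i < n \<Longrightarrow> j < n \<Longrightarrow> A i j = A j i"
    and "\<And>x. \<exists>i<n. x i \<noteq> 0 \<Longrightarrow> 0 < (\<Sum>i<n. \<Sum>j<n. A i j * (x i * x j))"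
  shows "\<exists>L. (\<forall>i<n. 0 < L i i) \<and> (\<forall>i j. i < j \<longrightarrow> L i j = 0) \<and> (\<forall>i<n. \<forall>j<n. A i j = (\<Sum>k<n. L k i * L k j))"
  using assms
proof (induction n arbitrary: A)
  case 0
  show ?case by (intro exI[of _ "\<lambda>_ _. 0"]) auto
next
  case (Suc n)
  note sym = Suc.prems(1) and pos = Suc.prems(2)
  define d where "d = A n n"
  have d0: "0 < d"
    using pos[of "\<lambda>i. of_bool (i = n)"] by (simp add: d_def)
  define A' where "A' = (\<lambda>i j. A i j - A n i * A n j / d)"
  have "\<exists>L. (\<forall>i<n. 0 < L i i) \<and> (\<forall>i j. i < j \<longrightarrow> L i j = 0) \<and> (\<forall>i<n. \<forall>j<n. A' i j = (\<Sum>k<n. L k i * L k j))"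
  proof (rule Suc.IH)
    show "A' i j = A' j i" if "i < n" "j < n" for i j
      using sym[of i j] that by (simp add: A'_def)
    fix x :: "nat \<Rightarrow> real" assume x: "\<exists>i<n. x i \<noteq> 0"
    define u where "u = (\<Sum>j<n. A n j * x j)"
    \<comment> \<open>The last coordinate is chosen to minimise the form; the minimum is the form of
      the Schur complement.\<close>
    define y where "y = x(n := - u / d)"
    have "\<exists>i<Suc n. y i \<noteq> 0" using x by (auto simp: y_def less_Suc_eq)
    then have "0 < (\<Sum>i<Suc n. \<Sum>j<Suc n. A i j * (y i * y j))" by (rule pos)
    also have "\<dots> = (\<Sum>i<n. \<Sum>j<n. A i j * (y i * y j)) + (\<Sum>i<n. A i n * (y i * y n)) + (\<Sum>j<n. A n j * (y n * y j)) + d * (y n * y n)"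
      by (simp add: sum.distrib d_def)
    also have "\<dots> = (\<Sum>i<n. \<Sum>j<n. A i j * (x i * x j)) + y n * u + y n * u + d * (y n * y n)"
    proof -
      have yx: "y i = x i" if "i < n" for i using that by (simp add: y_def)
      have "(\<Sum>i<n. A i n * (y i * y n)) = y n * u" "(\<Sum>j<n. A n j * (y n * y j)) = y n * u"
        unfolding u_def sum_distrib_left using sym by (auto intro!: sum.cong simp: yx mult_ac)
      moreover have "(\<Sum>i<n. \<Sum>j<n. A i j * (y i * y j)) = (\<Sum>i<n. \<Sum>j<n. A i j * (x i * x j))"
        by (intro sum.cong refl) (simp add: yx)
      ultimately show ?thesis by simp
    qed
    also have "\<dots> = (\<Sum>i<n. \<Sum>j<n. A i j * (x i * x j)) - u * u / d"
      using d0 by (simp add: y_def field_simps)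
    also have "\<dots> = (\<Sum>i<n. \<Sum>j<n. A' i j * (x i * x j))"
    proof -
      have e: "A' i j * (x i * x j) = A i j * (x i * x j) - (A n i * x i) * (A n j * x j) / d" for i j
        by (simp add: A'_def algebra_simps)
      have e1: "(\<Sum>i<n. \<Sum>j<n. A' i j * (x i * x j))
          = (\<Sum>i<n. \<Sum>j<n. A i j * (x i * x j) - (A n i * x i) * (A n j * x j) / d)"
        by (intro sum.cong refl e)
      have e2: "u * u / d = (\<Sum>i<n. (\<Sum>j<n. (A n i * x i) * (A n j * x j) / d))"
        by (simp only: u_def sum_product sum_divide_distrib)
      show ?thesis by (simp only: e1 e2 sum_subtractf)
    qed
    finally show "0 < (\<Sum>i<n. \<Sum>j<n. A' i j * (x i * x j))" .
  qed
  then obtain L where L0: "(\<forall>i<n. 0 < L i i) \<and> (\<forall>i j. i < j \<longrightarrow> L i j = 0) \<and> (\<forall>i<n. \<forall>j<n. A' i j = (\<Sum>k<n. L k i * L k j))"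
    by (elim exE)
  have L: "0 < L i i" if "i < n" for i
    using L0 that by simp
  have L2: "L i j = 0" if "i < j" for i j
    using L0 that by simp
  have L3: "A' i j = (\<Sum>k<n. L k i * L k j)" if "i < n" "j < n" for i j
    using L0 that by simp
  \<comment> \<open>The new last row is the last row of \<open>A\<close> divided by the root of the
    pivot; the earlier rows vanish in the new column.\<close>
  define L' where "L' = (\<lambda>i j. if i < n then L i j else if i = n \<and> j < n then A n j / sqrt d else if i = n \<and> j = n then sqrt d else 0)"
  show ?case
  proof (intro exI[of _ L'] conjI allI impI)
    show "0 < L' i i" if "i < Suc n" for i
      using that L d0 by (auto simp: L'_def less_Suc_eq)
    show "L' i j = 0" if "i < j" for i j
      using that L2 by (auto simp: L'_def)
    fix i j assume ij: "i < Suc n" "j < Suc n"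
    have "(\<Sum>k<n. L' k i * L' k j) = (if i < n \<and> j < n then A' i j else 0)"
      using ij L2 L3 by (auto simp: L'_def less_Suc_eq)
    moreover have "L' n i * L' n j = (if i < n \<and> j < n then A n i * A n j / d else A i j)"
      using ij d0 sym[of n i] by (auto simp: L'_def less_Suc_eq d_def field_simps real_sqrt_mult_self)
    ultimately show "A i j = (\<Sum>k<Suc n. L' k i * L' k j)"
      by (simp add: A'_def)
  qed
qed

definition affine_map :: "nat \<Rightarrow> fmat \<Rightarrow> fvec \<Rightarrow> fvec \<Rightarrow> fvec" where
  "affine_map n L c x = (\<lambda>i\<in>{..<n}. (\<Sum>j<n. L i j * x j) + c i)"

lemma measurable_affine_map [measurable]: "affine_map n L c \<in> vec_space n \<rightarrow>\<^sub>M vec_space n"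
  unfolding affine_map_def by measurable

interpretation lborel_product: product_sigma_finite "\<lambda>_::nat. lborel :: real measure"
  by standard

text \<open>Induction on the dimension: with the earlier coordinates fixed, the last one undergoes a
  one-dimensional affine map whose shift does not matter and whose slope is the diagonal entry. No
  general change of variables is involved.\<close>

lemma nn_integral_triangular:
  assumes "\<And>i. i < n \<Longrightarrow> 0 < L i i" "\<And>i j. i < j \<Longrightarrow> L i j = 0"
    and "f \<in> borel_measurable (vec_space n)"
  shows "(\<integral>\<^sup>+x. f (affine_map n L c x) \<partial>vec_space n) = ennreal (\<Prod>i<n. 1 / L i i) * (\<integral>\<^sup>+x. f x \<partial>vec_space n)"
  using assms
proof (induction n arbitrary: f)
  case 0
  have "affine_map 0 L c x = x" if "x \<in> space (vec_space 0)" for x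
    using that by (auto simp: affine_map_def space_PiM)
  then have "(\<integral>\<^sup>+x. f (affine_map 0 L c x) \<partial>vec_space 0) = (\<integral>\<^sup>+x. f x \<partial>vec_space 0)"
    by (intro nn_integral_cong) simp
  then show ?case by simp
next
  case (Suc n)
  have I: "{..<Suc n} = insert n {..<n}" by auto
  note [measurable] = Suc.prems(3)
  have fm: "f \<in> borel_measurable (PiM (insert n {..<n}) (\<lambda>_. lborel))" using Suc.prems(3) by (simp add: I)
  have gm: "(\<lambda>x. f (affine_map (Suc n) L c x)) \<in> borel_measurable (PiM (insert n {..<n}) (\<lambda>_. lborel))"
    unfolding I[symmetric] by measurable
  have upd: "affine_map (Suc n) L c (x(n := y)) = (affine_map n L c x)(n := ((\<Sum>j<n. L n j * x j) + c n) + L n n * y)" for x y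
    using Suc.prems(2) by (auto simp: affine_map_def fun_eq_iff less_Suc_eq)
  have m2[measurable]: "(\<lambda>xy. f ((fst xy)(n := snd xy))) \<in> borel_measurable (vec_space n \<Otimes>\<^sub>M lborel)"
  proof -
    have "(\<lambda>xy. (fst xy)(n := snd xy)) \<in> vec_space n \<Otimes>\<^sub>M lborel \<rightarrow>\<^sub>M vec_space (Suc n)"
      by (rule measurable_fun_upd[where J = "{..<n}"]) (auto simp: I)
    from measurable_compose[OF this Suc.prems(3)] show ?thesis .
  qed
  have m3: "(\<lambda>x. \<integral>\<^sup>+y. f (x(n := y)) \<partial>lborel) \<in> borel_measurable (vec_space n)"
    using lborel.borel_measurable_nn_integral_fst[OF m2] by simp
  have m4: "(\<lambda>y. f (x(n := y))) \<in> borel_measurable borel" if "x \<in> space (vec_space n)" for x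
    using measurable_compose[OF measurable_Pair1'[OF that] m2] by simp
  have a: "0 < L n n" using Suc.prems(1) by simp
  have "(\<integral>\<^sup>+x. f (affine_map (Suc n) L c x) \<partial>vec_space (Suc n))
      = (\<integral>\<^sup>+x. \<integral>\<^sup>+y. f ((affine_map n L c x)(n := ((\<Sum>j<n. L n j * x j) + c n) + L n n * y)) \<partial>lborel \<partial>vec_space n)"
    unfolding I by (subst lborel_product.product_nn_integral_insert[OF _ _ gm]) (auto simp: upd[unfolded I] upd)
  also have "\<dots> = (\<integral>\<^sup>+x. ennreal (1 / L n n) * (\<integral>\<^sup>+y. f ((affine_map n L c x)(n := y)) \<partial>lborel) \<partial>vec_space n)"
  proof (rule nn_integral_cong)
    fix x assume x: "x \<in> space (vec_space n)"
    have ax: "affine_map n L c x \<in> space (vec_space n)" using measurable_space[OF measurable_affine_map x] .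
    have "ennreal (1 / L n n) * (\<integral>\<^sup>+y. f ((affine_map n L c x)(n := y)) \<partial>lborel)
        = ennreal (1 / L n n) * (ennreal \<bar>L n n\<bar> * (\<integral>\<^sup>+y. f ((affine_map n L c x)(n := ((\<Sum>j<n. L n j * x j) + c n) + L n n * y)) \<partial>lborel))"
      using a by (subst nn_integral_real_affine[OF m4[OF ax], of "L n n"]) auto
    also have "\<dots> = (\<integral>\<^sup>+y. f ((affine_map n L c x)(n := ((\<Sum>j<n. L n j * x j) + c n) + L n n * y)) \<partial>lborel)"
      using a by (simp add: mult.assoc[symmetric] ennreal_mult[symmetric])
    finally show "(\<integral>\<^sup>+y. f ((affine_map n L c x)(n := ((\<Sum>j<n. L n j * x j) + c n) + L n n * y)) \<partial>lborel)
        = ennreal (1 / L n n) * (\<integral>\<^sup>+y. f ((affine_map n L c x)(n := y)) \<partial>lborel)" by simp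
  qed
  also have "\<dots> = ennreal (1 / L n n) * (\<integral>\<^sup>+x. (\<integral>\<^sup>+y. f ((affine_map n L c x)(n := y)) \<partial>lborel) \<partial>vec_space n)"
    using measurable_compose[OF measurable_affine_map m3] by (intro nn_integral_cmult) simp
  also have "\<dots> = ennreal (1 / L n n) * (ennreal (\<Prod>i<n. 1 / L i i) * (\<integral>\<^sup>+x. \<integral>\<^sup>+y. f (x(n := y)) \<partial>lborel \<partial>vec_space n))"
    using Suc.prems by (subst Suc.IH[OF _ _ m3]) auto
  also have "(\<integral>\<^sup>+x. \<integral>\<^sup>+y. f (x(n := y)) \<partial>lborel \<partial>vec_space n) = (\<integral>\<^sup>+x. f x \<partial>vec_space (Suc n))"
    unfolding I by (subst lborel_product.product_nn_integral_insert[OF _ _ fm]) auto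
  also have "ennreal (1 / L n n) * (ennreal (\<Prod>i<n. 1 / L i i) * (\<integral>\<^sup>+x. f x \<partial>vec_space (Suc n)))
    = ennreal (\<Prod>i<Suc n. 1 / L i i) * (\<integral>\<^sup>+x. f x \<partial>vec_space (Suc n))"
  proof -
    have "0 \<le> (\<Prod>i<n. 1 / L i i)" using Suc.prems(1) by (intro prod_nonneg) (auto intro: less_imp_le)
    then have "ennreal (1 / L n n) * ennreal (\<Prod>i<n. 1 / L i i) = ennreal (\<Prod>i<Suc n. 1 / L i i)"
      using a by (subst ennreal_mult[symmetric]) (auto simp: mult.commute)
    then show ?thesis by (simp only: mult.assoc[symmetric])
  qed
  finally show ?case .
qed

lemma nn_integral_vec_translate:
  assumes "f \<in> borel_measurable (vec_space n)"
  shows "(\<integral>\<^sup>+x. f (\<lambda>i\<in>{..<n}. x i + c i) \<partial>vec_space n) = (\<integral>\<^sup>+x. f x \<partial>vec_space n)"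
proof -
  have "(\<Sum>j<n. of_bool (i = j) * x j) = x i" if "i < n" for i and x :: fvec
    using that by (simp add: of_bool_def if_distrib[of "\<lambda>z. z * _"] cong: if_cong)
  then have "affine_map n (\<lambda>i j. of_bool (i = j)) c x = (\<lambda>i\<in>{..<n}. x i + c i)" for x
    by (auto simp: affine_map_def)
  then show ?thesis
    using nn_integral_triangular[of n "\<lambda>i j. of_bool (i = j)" f c] assms by simp
qed

definition "std_normal_vec n = PiM {..<n::nat} (\<lambda>_. std_normal_distribution)"

lemma prob_space_std_normal: "prob_space std_normal_distribution"
  by (rule prob_space_normal_density) simp

lemma std_normal_vec_density:
  "density (vec_space n) (\<lambda>y. \<Prod>i<n. ennreal (std_normal_density (y i))) = std_normal_vec n"
  unfolding std_normal_vec_def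
proof (rule product_sigma_finite.PiM_eqI)
  show "product_sigma_finite (\<lambda>_::nat. std_normal_distribution)"
    using prob_space_std_normal by (simp add: product_sigma_finite_def prob_space_imp_sigma_finite)
  fix A :: "nat \<Rightarrow> real set" assume A: "\<And>i. i \<in> {..<n} \<Longrightarrow> A i \<in> sets std_normal_distribution"
  have [measurable]: "A i \<in> sets borel" if "i < n" for i using A[of i] that by simp
  have s: "Pi\<^sub>E {..<n} A \<in> sets (vec_space n)" using A by (intro sets_PiM_I_finite) auto
  have "emeasure (density (vec_space n) (\<lambda>y. \<Prod>i<n. ennreal (std_normal_density (y i)))) (Pi\<^sub>E {..<n} A)
      = (\<integral>\<^sup>+y. (\<Prod>i<n. ennreal (std_normal_density (y i))) * indicator (Pi\<^sub>E {..<n} A) y \<partial>vec_space n)"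
    using s by (intro emeasure_density) auto
  also have "\<dots> = (\<integral>\<^sup>+y. (\<Prod>i<n. ennreal (std_normal_density (y i)) * indicator (A i) (y i)) \<partial>vec_space n)"
  proof (intro nn_integral_cong)
    fix y :: fvec assume y: "y \<in> space (vec_space n)"
    have "indicator (Pi\<^sub>E {..<n} A) y = (\<Prod>i<n. indicator (A i) (y i) :: ennreal)"
    proof (cases "\<forall>i<n. y i \<in> A i")
      case True
      then show ?thesis using y by (auto simp: space_PiM PiE_iff)
    next
      case False
      then show ?thesis by (auto simp: PiE_iff indicator_def prod_zero_iff)
    qed
    then show "(\<Prod>i<n. ennreal (std_normal_density (y i))) * indicator (Pi\<^sub>E {..<n} A) y
        = (\<Prod>i<n. ennreal (std_normal_density (y i)) * indicator (A i) (y i))"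
      by (simp add: prod.distrib)
  qed
  also have "\<dots> = (\<Prod>i<n. \<integral>\<^sup>+x. ennreal (std_normal_density x) * indicator (A i) x \<partial>lborel)"
    by (rule lborel_product.product_nn_integral_prod) auto
  also have "\<dots> = (\<Prod>i<n. emeasure std_normal_distribution (A i))"
    by (intro prod.cong refl) (simp add: emeasure_density)
  finally show "emeasure (density (vec_space n) (\<lambda>y. \<Prod>i<n. ennreal (std_normal_density (y i)))) (Pi\<^sub>E {..<n} A)
      = (\<Prod>i<n. emeasure std_normal_distribution (A i))" .
qed (auto intro!: sets_PiM_cong)

lemma all_moments_std_normal: "all_moments std_normal_distribution (\<lambda>x. x)"
  unfolding all_moments_def
  using integrable_std_normal_moment_abs by (auto simp: integrable_density)

lemma std_normal_vec_moments:
  shows "i < n \<Longrightarrow> all_moments (std_normal_vec n) (\<lambda>y. y i)"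
    and "i < n \<Longrightarrow> j < n \<Longrightarrow> (\<integral>y. y i * y j \<partial>std_normal_vec n) = of_bool (i = j)"
proof -
  note am = all_moments_PiM[of "{..<n}" "\<lambda>_. std_normal_distribution", OF prob_space_std_normal _ all_moments_std_normal]
  show "i < n \<Longrightarrow> all_moments (std_normal_vec n) (\<lambda>y. y i)"
    unfolding std_normal_vec_def by (rule am) auto
  assume ij: "i < n" "j < n"
  have m1: "(\<integral>x. x \<partial>std_normal_distribution) = 0"
    using integral_std_normal_moment_odd[of 0] by (simp add: integral_density)
  have m2: "(\<integral>x. x * x \<partial>std_normal_distribution) = 1"
    using integral_std_normal_moment_even[of 1] by (simp add: integral_density power2_eq_square)
  show "(\<integral>y. y i * y j \<partial>std_normal_vec n) = of_bool (i = j)"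
  proof (cases "i = j")
    case True
    then show ?thesis
      using m2 integral_PiM_component[of "{..<n}" "\<lambda>_. std_normal_distribution" i "\<lambda>x. x * x"] ij prob_space_std_normal
      by (simp add: std_normal_vec_def)
  next
    case False
    have "(\<integral>y. y i * y j \<partial>std_normal_vec n) = (\<integral>y. 0 \<partial>std_normal_vec n)"
      unfolding std_normal_vec_def
      using ij False m1
      by (intro integral_PiM_average_eq[where j = j] prob_space_std_normal all_moments_integrable all_moments_mult am) auto
    then show ?thesis using False by simp
  qed
qed

section \<open>Rotation invariance of Lebesgue measure and of Gaussian densities\<close>

context findim
begin

abbreviation "Lam \<equiv> vec_space p \<Otimes>\<^sub>M vec_space p"

definition invariant :: "(fvec \<times> fvec \<Rightarrow> fvec \<times> fvec) \<Rightarrow> bool" where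
  "invariant f \<longleftrightarrow> f \<in> Lam \<rightarrow>\<^sub>M Lam \<and> distr Lam Lam f = Lam"

lemma invariant_comp: "invariant f \<Longrightarrow> invariant h \<Longrightarrow> invariant (\<lambda>x. f (h x))"
  unfolding invariant_def
  by (auto intro: measurable_compose simp: distr_distr[symmetric, of f Lam Lam h Lam, unfolded comp_def])

lemma invariant_cong: "invariant f \<Longrightarrow> (\<And>x. x \<in> space Lam \<Longrightarrow> f x = h x) \<Longrightarrow> invariant h"
  unfolding invariant_def using measurable_cong[of Lam f h Lam] distr_cong[OF refl refl, of Lam f h Lam] by auto

lemma vec_space_sigma_finite: "sigma_finite_measure (vec_space p)"
  by (rule lborel_product.sigma_finite) simp

text \<open>A plane rotation is a product of three shears, and a shear translates one vector by a
  multiple of the other. Rotation invariance is thereby reduced to translation invariance.\<close>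

definition shear1 where "shear1 a x = (rotl 1 a (fst x) (snd x), snd x)"
definition shear2 where "shear2 a x = (fst x, rotl 1 a (snd x) (fst x))"

lemma measurable_rotl [measurable]:
  assumes "sets M1 = sets (vec_space p)" "sets M2 = sets (vec_space p)"
  shows "(\<lambda>x. rotl c s (fst x) (snd x)) \<in> M1 \<Otimes>\<^sub>M M2 \<rightarrow>\<^sub>M vec_space p"
    and "(\<lambda>x. rotl c s (snd x) (fst x)) \<in> M1 \<Otimes>\<^sub>M M2 \<rightarrow>\<^sub>M vec_space p"
proof -
  note [measurable_cong] = assms
  show "(\<lambda>x. rotl c s (fst x) (snd x)) \<in> M1 \<Otimes>\<^sub>M M2 \<rightarrow>\<^sub>M vec_space p"
    "(\<lambda>x. rotl c s (snd x) (fst x)) \<in> M1 \<Otimes>\<^sub>M M2 \<rightarrow>\<^sub>M vec_space p"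
    unfolding rotl_def by measurable
qed

lemma invariant_shear2: "invariant (shear2 a)"
proof -
  interpret V: sigma_finite_measure "vec_space p" by (rule vec_space_sigma_finite)
  interpret pair_sigma_finite "vec_space p" "vec_space p" by unfold_locales
  have m: "shear2 a \<in> Lam \<rightarrow>\<^sub>M Lam"
    unfolding shear2_def[abs_def] by (intro measurable_Pair measurable_fst measurable_rotl refl)
  moreover have "distr Lam Lam (shear2 a) = Lam"
  proof (rule measure_eqI)
    fix A assume "A \<in> sets (distr Lam Lam (shear2 a))"
    then have A[measurable]: "A \<in> sets Lam" by simp
    have "emeasure (distr Lam Lam (shear2 a)) A = (\<integral>\<^sup>+x. indicator A (shear2 a x) \<partial>Lam)"
      using A m by (simp add: nn_integral_distr[symmetric, OF m] flip: nn_integral_indicator)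
    also have "\<dots> = (\<integral>\<^sup>+x. \<integral>\<^sup>+y. indicator A (shear2 a (x, y)) \<partial>vec_space p \<partial>vec_space p)"
      using measurable_compose[OF m, of "indicator A" "borel :: ennreal measure"] by (intro V.nn_integral_fst[symmetric]) simp
    also have "\<dots> = (\<integral>\<^sup>+x. \<integral>\<^sup>+y. indicator A (x, y) \<partial>vec_space p \<partial>vec_space p)"
    proof (rule nn_integral_cong)
      fix x assume x: "x \<in> space (vec_space p)"
      have "(\<lambda>y. indicator A (x, y) :: ennreal) \<in> borel_measurable (vec_space p)"
        using x by measurable
      from nn_integral_vec_translate[OF this, of "\<lambda>i. a * x i"]
      show "(\<integral>\<^sup>+y. indicator A (shear2 a (x, y)) \<partial>vec_space p) = (\<integral>\<^sup>+y. indicator A (x, y) \<partial>vec_space p)"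
        by (simp add: shear2_def rotl_def)
    qed
    also have "\<dots> = (\<integral>\<^sup>+x. indicator A x \<partial>Lam)"
      by (intro V.nn_integral_fst) simp
    finally show "emeasure (distr Lam Lam (shear2 a)) A = emeasure Lam A" by simp
  qed simp
  ultimately show ?thesis by (simp add: invariant_def)
qed

lemma invariant_swap: "invariant (\<lambda>x. (snd x, fst x))"
proof -
  interpret V: sigma_finite_measure "vec_space p" by (rule vec_space_sigma_finite)
  interpret pair_sigma_finite "vec_space p" "vec_space p" by unfold_locales
  show ?thesis using distr_pair_swap by (simp add: invariant_def split_def)
qed

lemma invariant_shear1: "invariant (shear1 a)"
  using invariant_comp[OF invariant_swap invariant_comp[OF invariant_shear2[of a] invariant_swap]]
  by (simp add: shear1_def[abs_def] shear2_def)

definition "rotation c s x = (rotl c s (fst x) (snd x), rotl (- s) c (fst x) (snd x))"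

lemma invariant_rotation:
  assumes cs: "c\<^sup>2 + s\<^sup>2 = 1"
  shows "invariant (rotation c s)"
proof -
  have gen: "invariant (rotation c s)" if cs: "c\<^sup>2 + s\<^sup>2 = 1" and s: "s \<noteq> 0" for c s
  proof -
    \<comment> \<open>The tangent of half the angle of rotation; the case s = 0 has to be treated
      apart.\<close>
    define a where "a = (1 - c) / s"
    have as: "a * s = 1 - c" "a * (1 + c) = s" using cs s by (auto simp: a_def field_simps power2_eq_square)
    have inv: "invariant (\<lambda>x. shear1 a (shear2 (- s) (shear1 a x)))"
      by (rule invariant_comp[OF invariant_shear1 invariant_comp[OF invariant_shear2 invariant_shear1]])
    show ?thesis
    proof (rule invariant_cong[OF inv])
      fix z :: "fvec \<times> fvec"
      obtain x y where z: "z = (x, y)" by (cases z)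
      have 1: "y j + - s * (x j + a * y j) = - s * x j + c * y j" for j
      proof -
        have "y j + - s * (x j + a * y j) = - s * x j + (1 - a * s) * y j" by (simp add: algebra_simps)
        then show ?thesis using as by simp
      qed
      have 2: "(x j + a * y j) + a * (- s * x j + c * y j) = c * x j + s * y j" for j
      proof -
        have "(x j + a * y j) + a * (- s * x j + c * y j) = (1 - a * s) * x j + (a * (1 + c)) * y j"
          by (simp add: algebra_simps)
        then show ?thesis using as by simp
      qed
      show "shear1 a (shear2 (- s) (shear1 a z)) = rotation c s z"
        using 1 2 by (auto simp: z shear1_def shear2_def rotation_def rotl_def fun_eq_iff)
    qed
  qed
  show ?thesis
  proof (cases "s = 0")
    case False
    then show ?thesis using gen cs by blast
  next
    case True
    then have "c = 1 \<or> c = -1" using cs by (simp add: power2_eq_1_iff)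
    then show ?thesis
    proof
      assume c: "c = 1"
      have "invariant (\<lambda>x. x)" by (simp add: invariant_def distr_id2)
      then show ?thesis
      proof (rule invariant_cong)
        fix x assume "x \<in> space Lam"
        then show "x = rotation c s x"
          by (cases x) (auto simp: rotation_def rotl_def c True space_pair_measure space_PiM PiE_iff extensional_def fun_eq_iff)
      qed
    next
      assume c: "c = -1"
      \<comment> \<open>The half turn is the square of the quarter turn, to which the factorisation
        applies.\<close>
      have "invariant (rotation 0 1)" by (rule gen) auto
      then have "invariant (\<lambda>x. rotation 0 1 (rotation 0 1 x))" by (rule invariant_comp[OF _ \<open>invariant (rotation 0 1)\<close>])
      then show ?thesis
        by (rule invariant_cong) (auto simp: rotation_def rotl_def c True fun_eq_iff)
    qed
  qed
qed

text \<open>\<open>A\<close> is the inverse of the covariance \<open>S\<close>, and its Cholesky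
  factor carries the law to the standard normal one, from which moments are pulled back. The joint
  density of two copies depends on \<open>bil A x x + bil A y y\<close> only, which rotations
  preserve.\<close>

lemma gauss_of_density:
  assumes Psym: "\<And>i j. i < p \<Longrightarrow> j < p \<Longrightarrow> A i j = A j i"
    and Ppos: "\<And>x. \<exists>i<p. x i \<noteq> 0 \<Longrightarrow> 0 < bil A x x"
    and inv: "\<And>i j. i < p \<Longrightarrow> j < p \<Longrightarrow> (\<Sum>k<p. S i k * A k j) = of_bool (i = j)"
    and Ssym: "\<And>i j. S i j = S j i" and Sout: "\<And>i j. \<not> (i < p \<and> j < p) \<Longrightarrow> S i j = 0"
    and \<nu>: "\<nu> = density (vec_space p) (\<lambda>x. ennreal (\<kappa> * exp (- bil A x x / 2)))" and \<kappa>: "0 \<le> \<kappa>"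
    and prob: "prob_space \<nu>"
  shows "gauss p \<nu> S"
proof -
  interpret prob_space \<nu> by fact
  have pos': "0 < (\<Sum>i<p. \<Sum>j<p. A i j * (x i * x j))" if "\<exists>i<p. x i \<noteq> 0" for x :: fvec
    using Ppos[OF that] by (simp add: bil_sum)
  obtain L where L0: "(\<forall>i<p. 0 < L i i) \<and> (\<forall>i j. i < j \<longrightarrow> L i j = 0) \<and> (\<forall>i<p. \<forall>j<p. A i j = (\<Sum>k<p. L k i * L k j))"
    by (rule exE[OF cholesky[of p A]]) (use Psym pos' in auto)
  have L: "\<And>i. i < p \<Longrightarrow> 0 < L i i" "\<And>i j. i < j \<Longrightarrow> L i j = 0"
    "\<And>i j. i < p \<Longrightarrow> j < p \<Longrightarrow> A i j = (\<Sum>k<p. L k i * L k j)"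
    using L0 by simp_all
  define f where "f = affine_map p L (\<lambda>_. 0)"
  have f[measurable]: "f \<in> vec_space p \<rightarrow>\<^sub>M vec_space p" unfolding f_def by measurable
  have fi: "f x i = dot (L i) x" if "i < p" for x i
    using that by (simp add: f_def affine_map_def dot_def)
  have bilf: "bil A x x = (\<Sum>i<p. (f x i)\<^sup>2)" for x
  proof -
    have "bil A x x = (\<Sum>i<p. \<Sum>j<p. gm p L i j * (x i * x j))"
      unfolding bil_sum using L(3) by (intro sum.cong refl) (simp add: gm_def)
    also have "\<dots> = bil (gm p L) x x" by (simp add: bil_sum)
    also have "\<dots> = (\<Sum>i<p. (f x i)\<^sup>2)" by (simp add: bil_gm fi power2_eq_square)
    finally show ?thesis .
  qed
  have bm[measurable]: "(\<lambda>x. bil A x x) \<in> borel_measurable (vec_space p)" unfolding bil_sum by measurable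
  define \<kappa>' where "\<kappa>' = \<kappa> * sqrt (2 * pi) ^ p"
  have dens: "\<kappa> * exp (- bil A x x / 2) = \<kappa>' * (\<Prod>i<p. std_normal_density (f x i))" for x
  proof -
    have "exp (- bil A x x / 2) = (\<Prod>i<p. exp (- (f x i)\<^sup>2 / 2))"
      by (simp add: bilf exp_sum[symmetric] sum_negf sum_divide_distrib)
    moreover have "(\<Prod>i<p. std_normal_density (f x i)) = (1 / sqrt (2 * pi)) ^ p * (\<Prod>i<p. exp (- (f x i)\<^sup>2 / 2))"
      by (simp add: std_normal_density_def prod_dividef power_divide)
    ultimately show ?thesis by (simp add: \<kappa>'_def power_divide)
  qed
  have sets_\<nu>: "sets \<nu> = sets (vec_space p)" by (simp add: \<nu>)
  note [measurable_cong] = sets_\<nu>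
  have f\<nu>: "f \<in> \<nu> \<rightarrow>\<^sub>M vec_space p" by measurable
  define c where "c = ennreal (\<Prod>i<p. 1 / L i i) * ennreal \<kappa>'"
  have \<kappa>'0: "0 \<le> \<kappa>'" using \<kappa> by (simp add: \<kappa>'_def)
  have law: "emeasure (distr \<nu> (vec_space p) f) B = c * emeasure (std_normal_vec p) B" if [measurable]: "B \<in> sets (vec_space p)" for B
  proof -
    have pm[measurable]: "(\<lambda>y. (\<Prod>i<p. ennreal (std_normal_density (y i)))) \<in> borel_measurable (vec_space p)"
      by (intro borel_measurable_prod_ennreal) auto
    have "emeasure (distr \<nu> (vec_space p) f) B = (\<integral>\<^sup>+x. indicator B (f x) \<partial>\<nu>)"
      using f\<nu> by (simp add: nn_integral_distr[symmetric, OF f\<nu>] flip: nn_integral_indicator)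
    also have "\<dots> = (\<integral>\<^sup>+x. ennreal (\<kappa> * exp (- bil A x x / 2)) * indicator B (f x) \<partial>vec_space p)"
      unfolding \<nu> by (subst nn_integral_density) auto
    also have "\<dots> = (\<integral>\<^sup>+x. (\<lambda>y. ennreal \<kappa>' * ((\<Prod>i<p. ennreal (std_normal_density (y i))) * indicator B y)) (f x) \<partial>vec_space p)"
      unfolding dens by (simp add: ennreal_mult \<kappa>'0 prod_nonneg prod_ennreal mult.assoc)
    also have "\<dots> = ennreal (\<Prod>i<p. 1 / L i i) * (\<integral>\<^sup>+y. ennreal \<kappa>' * ((\<Prod>i<p. ennreal (std_normal_density (y i))) * indicator B y) \<partial>vec_space p)"
      unfolding f_def using L by (intro nn_integral_triangular) auto
    also have "(\<integral>\<^sup>+y. ennreal \<kappa>' * ((\<Prod>i<p. ennreal (std_normal_density (y i))) * indicator B y) \<partial>vec_space p)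
        = ennreal \<kappa>' * emeasure (std_normal_vec p) B"
      by (simp add: nn_integral_cmult std_normal_vec_density[symmetric] emeasure_density)
    finally show ?thesis by (simp add: c_def mult.assoc)
  qed
  interpret G: prob_space "std_normal_vec p"
    unfolding std_normal_vec_def by (intro prob_space_PiM prob_space_std_normal)
  have sets_G: "sets (std_normal_vec p) = sets (vec_space p)"
    unfolding std_normal_vec_def by (intro sets_PiM_cong) auto
  have space_G: "space (std_normal_vec p) = space (vec_space p)" by (rule sets_eq_imp_space_eq[OF sets_G])
  \<comment> \<open>Both laws have mass one, so the product of all constants is 1 without computing
    \<kappa> or a determinant.\<close>
  have c1: "c = 1"
  proof -
    interpret D: prob_space "distr \<nu> (vec_space p) f" by (rule prob_space_distr[OF f\<nu>])
    have "emeasure (distr \<nu> (vec_space p) f) (space (vec_space p)) = 1" using D.emeasure_space_1 by simp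
    moreover have "emeasure (std_normal_vec p) (space (vec_space p)) = 1" using G.emeasure_space_1 space_G by simp
    ultimately show ?thesis using law[of "space (vec_space p)"] by simp
  qed
  have distr_f: "distr \<nu> (vec_space p) f = std_normal_vec p"
    by (rule measure_eqI) (use law c1 sets_G in auto)
  \<comment> \<open>The inverse of \<open>L\<close>: B L = S L'L = S A = 1 on the index range. In
    the same way B B' = S A S = S.\<close>
  define B where "B = (\<lambda>i j. \<Sum>k<p. S i k * L j k)"
  have x_eq: "x i = (\<Sum>j<p. B i j * f x j)" if "i < p" for x i
  proof -
    have "(\<Sum>j<p. B i j * f x j) = (\<Sum>j<p. \<Sum>k<p. \<Sum>l<p. S i k * L j k * L j l * x l)"
      by (intro sum.cong refl) (simp add: B_def fi dot_def sum_product mult.assoc)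
    also have "\<dots> = (\<Sum>k<p. \<Sum>j<p. \<Sum>l<p. S i k * L j k * L j l * x l)" by (rule sum.swap)
    also have "\<dots> = (\<Sum>k<p. \<Sum>l<p. \<Sum>j<p. S i k * L j k * L j l * x l)" by (rule sum.cong[OF refl], rule sum.swap)
    also have "\<dots> = (\<Sum>l<p. \<Sum>k<p. \<Sum>j<p. S i k * L j k * L j l * x l)" by (rule sum.swap)
    also have "\<dots> = (\<Sum>l<p. (\<Sum>k<p. S i k * A k l) * x l)"
      by (intro sum.cong refl) (simp add: L(3) sum_distrib_left sum_distrib_right mult.assoc)
    also have "\<dots> = (\<Sum>l<p. of_bool (i = l) * x l)" using that by (intro sum.cong refl) (simp add: inv)
    also have "\<dots> = x i" using that by (simp add: of_bool_def if_distrib[of "\<lambda>z. z * _"] cong: if_cong)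
    finally show ?thesis by simp
  qed
  have amf: "all_moments \<nu> (\<lambda>x. f x j)" if "j < p" for j
    using std_normal_vec_moments(1)[OF that] by (intro all_moments_distr[OF f\<nu>]) (simp add: distr_f)
  have S_eq: "(\<Sum>a<p. B i a * B j a) = S i j" if "i < p" "j < p" for i j
  proof -
    have "(\<Sum>a<p. B i a * B j a) = (\<Sum>a<p. \<Sum>k<p. \<Sum>l<p. S i k * L a k * L a l * S l j)"
      using Ssym by (simp add: B_def sum_product mult_ac)
    also have "\<dots> = (\<Sum>k<p. \<Sum>a<p. \<Sum>l<p. S i k * L a k * L a l * S l j)" by (rule sum.swap)
    also have "\<dots> = (\<Sum>k<p. \<Sum>l<p. \<Sum>a<p. S i k * L a k * L a l * S l j)" by (rule sum.cong[OF refl], rule sum.swap)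
    also have "\<dots> = (\<Sum>l<p. \<Sum>k<p. \<Sum>a<p. S i k * L a k * L a l * S l j)" by (rule sum.swap)
    also have "\<dots> = (\<Sum>l<p. (\<Sum>k<p. S i k * A k l) * S l j)"
      by (intro sum.cong refl) (simp add: L(3) sum_distrib_left sum_distrib_right mult.assoc)
    also have "\<dots> = (\<Sum>l<p. of_bool (i = l) * S l j)" using that by (intro sum.cong refl) (simp add: inv)
    also have "\<dots> = S i j" using that by (simp add: of_bool_def if_distrib[of "\<lambda>z. z * _"] cong: if_cong)
    finally show ?thesis .
  qed
  show ?thesis
  proof (intro gauss.intro gauss_axioms.intro)
    show "prob_space \<nu>" by fact
    show "sets \<nu> = sets (vec_space p)" by fact
    show "all_moments \<nu> (\<lambda>x. x j)" if "j < p" for j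
      unfolding x_eq[OF that] by (intro all_moments_sum all_moments_mult all_moments_const amf) auto
    show "(\<integral>x. x i * x j \<partial>\<nu>) = S i j" if ij: "i < p" "j < p" for i j
    proof -
      have ff: "(\<integral>x. f x a * f x b \<partial>\<nu>) = of_bool (a = b)" if "a < p" "b < p" for a b
      proof -
        have m: "(\<lambda>y. y a) \<in> borel_measurable (vec_space p)" if "a < p" for a
          using measurable_component_singleton[of a "{..<p}" "\<lambda>_. lborel :: real measure"] that by simp
        have "(\<lambda>y. y a * y b) \<in> borel_measurable (vec_space p)" using that by (intro borel_measurable_times m)
        then have "(\<integral>x. f x a * f x b \<partial>\<nu>) = (\<integral>y. y a * y b \<partial>distr \<nu> (vec_space p) f)"
          by (intro integral_distr[symmetric] f\<nu>)
        then show ?thesis using std_normal_vec_moments(2)[OF that] by (simp add: distr_f)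
      qed
      have "(\<integral>x. x i * x j \<partial>\<nu>) = (\<integral>x. (\<Sum>a<p. \<Sum>b<p. (B i a * B j b) * (f x a * f x b)) \<partial>\<nu>)"
        unfolding x_eq[OF ij(1)] x_eq[OF ij(2)] by (simp add: sum_product mult_ac)
      also have "\<dots> = (\<Sum>a<p. \<Sum>b<p. (B i a * B j b) * of_bool (a = b))"
        by (intro Bochner_Integration.integral_sum[THEN trans] sum.cong refl Bochner_Integration.integrable_sum
            integrable_mult_right all_moments_integrable all_moments_mult amf) (auto simp: ff)
      also have "\<dots> = (\<Sum>a<p. B i a * B j a)"
        by (intro sum.cong refl) (simp add: of_bool_def if_distrib[of "\<lambda>z. _ * z"] cong: if_cong)
      finally show ?thesis using S_eq[OF ij] by simp
    qed
    show "gram S"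
    proof -
      \<comment> \<open>\<open>S\<close> vanishes outside the index range; cutting the columns off
        there gives an equality of functions.\<close>
      have "S = gm p (\<lambda>a i. if i < p then B i a else 0)"
      proof (intro ext)
        fix i j show "S i j = gm p (\<lambda>a i. if i < p then B i a else 0) i j"
          using S_eq[of i j] Sout[of i j] by (cases "i < p"; cases "j < p") (simp_all add: gm_def)
      qed
      then show ?thesis by (metis gram_gm)
    qed
    fix c s :: real assume cs: "c\<^sup>2 + s\<^sup>2 = 1"
    define g where "g = (\<lambda>x. ennreal (\<kappa> * exp (- bil A x x / 2)))"
    have g[measurable]: "g \<in> borel_measurable (vec_space p)" unfolding g_def by measurable
    interpret V: sigma_finite_measure "vec_space p" by (rule vec_space_sigma_finite)
    have \<nu>g: "\<nu> = density (vec_space p) g" by (simp add: \<nu> g_def)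
    have pair: "\<nu> \<Otimes>\<^sub>M \<nu> = density Lam (\<lambda>(x, y). g x * g y)"
      unfolding \<nu>g by (rule pair_measure_density)
        (use vec_space_sigma_finite prob_space_imp_sigma_finite[OF prob] \<nu>g in auto)
    have R: "rotation c s \<in> Lam \<rightarrow>\<^sub>M Lam" "distr Lam Lam (rotation c s) = Lam"
      using invariant_rotation[OF cs] by (auto simp: invariant_def)
    define h where "h = (\<lambda>z. case z of (x, y) \<Rightarrow> g x * g y)"
    have h[measurable]: "h \<in> borel_measurable Lam" unfolding h_def by measurable
    have hR: "h (rotation c s z) = h z" for z
    proof (cases z)
      case (Pair x y)
      have "bil A (rotl c s x y) (rotl c s x y) + bil A (rotl (- s) c x y) (rotl (- s) c x y) = (c\<^sup>2 + s\<^sup>2) * (bil A x x + bil A y y)"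
        by (simp add: bil_rotl power2_eq_square algebra_simps)
      then have e: "bil A (rotl c s x y) (rotl c s x y) + bil A (rotl (- s) c x y) (rotl (- s) c x y) = bil A x x + bil A y y"
        by (simp add: cs)
      have gg: "g x * g y = ennreal (\<kappa> * \<kappa> * exp (- (bil A x x + bil A y y) / 2))" for x y
        using \<kappa> by (simp add: g_def add_divide_distrib exp_add[symmetric] ennreal_mult[symmetric] mult_ac diff_divide_distrib)
      show ?thesis using e by (simp add: Pair h_def rotation_def gg)
    qed
    have "distr (density Lam h) (density Lam h) (rotation c s) = density Lam h"
    proof (rule measure_eqI)
      fix B assume "B \<in> sets (distr (density Lam h) (density Lam h) (rotation c s))"
      then have B[measurable]: "B \<in> sets Lam" by simp
      have Rd: "rotation c s \<in> density Lam h \<rightarrow>\<^sub>M density Lam h" using R(1) by simp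
      have "emeasure (distr (density Lam h) (density Lam h) (rotation c s)) B = (\<integral>\<^sup>+z. indicator B (rotation c s z) \<partial>density Lam h)"
        using B by (simp add: nn_integral_distr[symmetric, OF Rd] flip: nn_integral_indicator)
      also have "\<dots> = (\<integral>\<^sup>+z. h z * indicator B (rotation c s z) \<partial>Lam)"
        using measurable_compose[OF R(1), of "indicator B" "borel :: ennreal measure"] by (subst nn_integral_density) auto
      also have "\<dots> = (\<integral>\<^sup>+z. h (rotation c s z) * indicator B (rotation c s z) \<partial>Lam)" by (simp add: hR)
      also have "\<dots> = (\<integral>\<^sup>+z. h z * indicator B z \<partial>distr Lam Lam (rotation c s))"
        using R(1) by (subst nn_integral_distr) auto
      also have "\<dots> = emeasure (density Lam h) B" by (simp add: R(2) emeasure_density)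
      finally show "emeasure (distr (density Lam h) (density Lam h) (rotation c s)) B = emeasure (density Lam h) B" .
    qed simp
    then show "distr (\<nu> \<Otimes>\<^sub>M \<nu>) (\<nu> \<Otimes>\<^sub>M \<nu>) (\<lambda>x. (rotl c s (fst x) (snd x), rotl (- s) c (fst x) (snd x))) = \<nu> \<Otimes>\<^sub>M \<nu>"
      unfolding pair h_def rotation_def[abs_def] .
  qed
qed

end

section \<open>Scatter matrices of normal samples\<close>

text \<open>Zero outside the index range, so that products of such matrices are again of this form
  and equations hold between functions.\<close>

definition mat_fun :: "nat \<Rightarrow> real mat \<Rightarrow> fmat" where
  "mat_fun p A = (\<lambda>i j. if i < p \<and> j < p then A $$ (i, j) else 0)"

definition centred_mvn :: "nat \<Rightarrow> real mat \<Rightarrow> fvec measure" where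
  "centred_mvn p A = density (vec_space p) (\<lambda>x. ennreal (mvn_density p (0\<^sub>v p) A x))"

lemma scalar_prod_mat_fun:
  assumes "B \<in> carrier_mat p p"
  shows "scalar_prod (Matrix.vec p x) (B *\<^sub>v Matrix.vec p y) = findim.bil p (mat_fun p B) x y"
proof -
  interpret findim p .
  show ?thesis
    using assms by (simp add: scalar_prod_def bil_def dot_def mv_def mat_fun_def lessThan_atLeast0 row_def)
qed

lemma mvn_density_shift:
  assumes "\<mu> \<in> carrier_vec p"
  shows "mvn_density p \<mu> A x = mvn_density p (0\<^sub>v p) A (\<lambda>j\<in>{..<p}. x j - \<mu> $ j)"
proof -
  have "Matrix.vec p x - \<mu> = Matrix.vec p (\<lambda>j\<in>{..<p}. x j - \<mu> $ j) - 0\<^sub>v p"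
    using assms by (intro eq_vecI) auto
  then show ?thesis by (simp add: mvn_density_def)
qed

text \<open>Positive definiteness makes the matrix invertible, so \<open>the\<close> in
  \<open>mvn_density\<close> yields a genuine inverse and the density has the shape required by
  \<open>gauss_of_density\<close>. That it is normalised is read off from the observation
  \<open>X\<close>.\<close>

lemma centred_mvn:
  assumes A: "pos_def p A" and \<mu>: "\<mu> \<in> carrier_vec p" and M: "prob_space M"
    and X: "distributed M (vec_space p) X (mvn_density p \<mu> A)"
  shows "distr M (vec_space p) (\<lambda>\<omega>. \<lambda>j\<in>{..<p}. X \<omega> j - \<mu> $ j) = centred_mvn p A" (is ?law)
    and "gauss p (centred_mvn p A) (mat_fun p A)" (is ?gauss)
proof -
  interpret prob_space M by fact
  interpret findim p .
  have Xm[measurable]: "X \<in> M \<rightarrow>\<^sub>M vec_space p" using X by (rule distributed_measurable)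
  have fm: "(\<lambda>x. ennreal (mvn_density p \<mu> A x)) \<in> borel_measurable (vec_space p)"
    using distributed_borel_measurable[OF X] .
  let ?sh = "\<lambda>x. \<lambda>j\<in>{..<p}. x j - \<mu> $ j"
  have shm[measurable]: "?sh \<in> vec_space p \<rightarrow>\<^sub>M vec_space p" by measurable
  have Ac: "A \<in> carrier_mat p p" and At: "transpose_mat A = A"
    and Apos: "\<And>v. v \<in> carrier_vec p \<Longrightarrow> v \<noteq> 0\<^sub>v p \<Longrightarrow> 0 < scalar_prod v (A *\<^sub>v v)"
    using A by (auto simp: pos_def_def)
  have "Determinant.det A \<noteq> 0"
  proof
    assume "Determinant.det A = 0"
    then obtain v where v: "v \<in> carrier_vec p" "v \<noteq> 0\<^sub>v p" "A *\<^sub>v v = 0\<^sub>v p"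
      using det_0_iff_vec_prod_zero_field[OF Ac] by auto
    then show False using Apos[OF v(1,2)] by simp
  qed
  then have unit: "A \<in> Units (ring_mat TYPE(real) p ())" by (rule det_non_zero_imp_unit[OF Ac])
  then obtain B where B: "mat_inverse A = Some B"
    using mat_inverse(1)[OF Ac, of "()"] by (cases "mat_inverse A") auto
  have AB: "A * B = 1\<^sub>m p" and BA: "B * A = 1\<^sub>m p" and Bc: "B \<in> carrier_mat p p"
    using mat_inverse(2)[OF Ac B] by auto
  have Bt: "transpose_mat B = B"
  proof -
    have "transpose_mat B * A = 1\<^sub>m p"
      using arg_cong[OF AB, of transpose_mat] Ac Bc At by (simp add: transpose_mult)
    then have "transpose_mat B * A * B = B" using Bc by simp
    moreover have "transpose_mat B * A * B = transpose_mat B * (A * B)"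
      using Ac Bc by (intro assoc_mult_mat[of _ p p _ p _ p]) auto
    ultimately show ?thesis using AB Bc by simp
  qed
  define \<kappa> where "\<kappa> = 1 / sqrt ((2 * pi) ^ p * Determinant.det A)"
  let ?P = "mat_fun p B"
  have dens: "mvn_density p (0\<^sub>v p) A x = \<kappa> * exp (- bil ?P x x / 2)" for x
  proof -
    have "Matrix.vec p x - 0\<^sub>v p = Matrix.vec p x" by (intro eq_vecI) auto
    then show ?thesis
      using scalar_prod_mat_fun[OF Bc, of x x] by (simp add: mvn_density_def B \<kappa>_def Let_def)
  qed
  have bm: "(\<lambda>x. bil ?P x x) \<in> borel_measurable (vec_space p)" unfolding bil_sum by measurable
  have cm[measurable]: "(\<lambda>x. ennreal (mvn_density p (0\<^sub>v p) A x)) \<in> borel_measurable (vec_space p)"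
    unfolding dens using bm by measurable
  show law: ?law
  proof (rule measure_eqI)
    fix D assume "D \<in> sets (distr M (vec_space p) (\<lambda>\<omega>. ?sh (X \<omega>)))"
    then have D[measurable]: "D \<in> sets (vec_space p)" by simp
    let ?h = "\<lambda>x. ennreal (mvn_density p (0\<^sub>v p) A x) * indicator D x"
    have Ym: "(\<lambda>\<omega>. ?sh (X \<omega>)) \<in> M \<rightarrow>\<^sub>M vec_space p" using measurable_compose[OF Xm shm] .
    have "emeasure (distr M (vec_space p) (\<lambda>\<omega>. ?sh (X \<omega>))) D = (\<integral>\<^sup>+\<omega>. indicator D (?sh (X \<omega>)) \<partial>M)"
      using D Ym by (simp add: nn_integral_distr[symmetric, OF Ym] flip: nn_integral_indicator)
    also have "\<dots> = (\<integral>\<^sup>+x. indicator D (?sh x) \<partial>distr M (vec_space p) X)"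
      by (rule nn_integral_distr[symmetric]) measurable
    also have "\<dots> = (\<integral>\<^sup>+x. ennreal (mvn_density p \<mu> A x) * indicator D (?sh x) \<partial>vec_space p)"
      unfolding distributed_distr_eq_density[OF X] by (rule nn_integral_density[OF fm]) measurable
    also have "\<dots> = (\<integral>\<^sup>+x. ?h (\<lambda>j\<in>{..<p}. x j + (- \<mu> $ j)) \<partial>vec_space p)"
      unfolding mvn_density_shift[OF \<mu>] by simp
    also have "\<dots> = (\<integral>\<^sup>+x. ?h x \<partial>vec_space p)"
      by (rule nn_integral_vec_translate) measurable
    also have "\<dots> = emeasure (centred_mvn p A) D"
      unfolding centred_mvn_def by (rule emeasure_density[symmetric]) measurable
    finally show "emeasure (distr M (vec_space p) (\<lambda>\<omega>. ?sh (X \<omega>))) D = emeasure (centred_mvn p A) D" .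
  qed (simp add: centred_mvn_def)
  have pr: "prob_space (centred_mvn p A)"
    unfolding law[symmetric] by (rule prob_space_distr) measurable
  show ?gauss
  proof (rule gauss_of_density)
    show "mat_fun p B i j = mat_fun p B j i" if "i < p" "j < p" for i j
      using that arg_cong[OF Bt, of "\<lambda>M. M $$ (i, j)"] Bc by (simp add: mat_fun_def)
    show "mat_fun p A i j = mat_fun p A j i" for i j
      using arg_cong[OF At, of "\<lambda>M. M $$ (i, j)"] Ac by (auto simp: mat_fun_def)
    show "mat_fun p A i j = 0" if "\<not> (i < p \<and> j < p)" for i j using that by (auto simp: mat_fun_def)
    show "(\<Sum>k<p. mat_fun p A i k * mat_fun p B k j) = of_bool (i = j)" if ij: "i < p" "j < p" for i j
      using ij arg_cong[OF AB, of "\<lambda>M. M $$ (i, j)"] Ac Bc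
      by (simp add: mat_fun_def scalar_prod_def lessThan_atLeast0)
    \<comment> \<open>The inverse is positive definite because for u = B v the value v'Bv equals
      u'Au.\<close>
    show "0 < bil (mat_fun p B) x x" if x: "\<exists>i<p. x i \<noteq> 0" for x
    proof -
      define v where "v = Matrix.vec p x"
      define u where "u = B *\<^sub>v v"
      have vc: "v \<in> carrier_vec p" and uc: "u \<in> carrier_vec p" using Bc by (auto simp: v_def u_def)
      have v0: "v \<noteq> 0\<^sub>v p" using x by (auto simp: v_def vec_eq_iff)
      have Au: "A *\<^sub>v u = v"
        unfolding u_def using Ac Bc vc AB by (simp add: assoc_mult_mat_vec[symmetric])
      have "u \<noteq> 0\<^sub>v p" using Au v0 Ac by auto
      from Apos[OF uc this] have "0 < scalar_prod u v" by (simp add: Au)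
      also have "scalar_prod u v = scalar_prod v u" by (rule comm_scalar_prod[OF uc vc])
      finally show ?thesis using scalar_prod_mat_fun[OF Bc, of x x] by (simp add: u_def v_def)
    qed
    show "centred_mvn p A = density (vec_space p) (\<lambda>x. ennreal (\<kappa> * exp (- bil (mat_fun p B) x x / 2)))"
      unfolding centred_mvn_def dens ..
    \<comment> \<open>A negative factor would be truncated to 0 by \<open>ennreal\<close> and leave
      no mass; this replaces a discussion of the sign of the determinant.\<close>
    show "0 \<le> \<kappa>"
    proof (rule ccontr)
      assume "\<not> 0 \<le> \<kappa>"
      then have "ennreal (mvn_density p (0\<^sub>v p) A x) = 0" for x
        unfolding dens by (intro ennreal_neg) (simp add: mult_le_0_iff)
      then have "emeasure (centred_mvn p A) (space (centred_mvn p A)) = 0"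
        unfolding centred_mvn_def by (subst emeasure_density) auto
      then show False using prob_space.emeasure_space_1[OF pr] by simp
    qed
    show "prob_space (centred_mvn p A)" by (rule pr)
  qed
qed

section \<open>Removing the sample mean by an orthogonal transformation\<close>

context gauss
begin

lemma nu_product: "product_sigma_finite (\<lambda>_::nat. \<nu>)"
  by (simp add: product_sigma_finite_def sigma_finite_measure_axioms)

lemma nn_integral_W_Suc:
  assumes "f \<in> borel_measurable (W (Suc k))"
  shows "(\<integral>\<^sup>+w. f w \<partial>W (Suc k)) = (\<integral>\<^sup>+w. \<integral>\<^sup>+x. f (w(k := x)) \<partial>\<nu> \<partial>W k)"
  using assms product_sigma_finite.product_nn_integral_insert[OF nu_product, of "{..<k}" k f]
  by (simp add: lessThan_Suc)

lemma measurable_W_upd: "(\<lambda>z. (fst z)(k := snd z)) \<in> W k \<Otimes>\<^sub>M \<nu> \<rightarrow>\<^sub>M W (Suc k)"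
  by (rule measurable_fun_upd[where J = "{..<k}"]) (auto simp: lessThan_Suc)

text \<open>Invariance as an identity of nonnegative integrals, so that composing maps and adjoining
  a coordinate become substitutions.\<close>

definition mpres :: "nat \<Rightarrow> ((nat \<Rightarrow> fvec) \<Rightarrow> nat \<Rightarrow> fvec) \<Rightarrow> bool" where
  "mpres k F \<longleftrightarrow> F \<in> W k \<rightarrow>\<^sub>M W k \<and> (\<forall>f \<in> borel_measurable (W k). (\<integral>\<^sup>+w. f (F w) \<partial>W k) = (\<integral>\<^sup>+w. (f w :: ennreal) \<partial>W k))"

lemma mpres_nn_integral:
  "mpres k F \<Longrightarrow> f \<in> borel_measurable (W k) \<Longrightarrow> (\<integral>\<^sup>+w. f (F w) \<partial>W k) = (\<integral>\<^sup>+w. f w \<partial>W k)"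
  by (simp add: mpres_def)

lemma mpres_distr: "mpres k F \<Longrightarrow> distr (W k) (W k) F = W k"
proof (rule measure_eqI)
  assume F: "mpres k F"
  fix A assume "A \<in> sets (distr (W k) (W k) F)"
  then have A: "A \<in> sets (W k)" by simp
  have Fm: "F \<in> W k \<rightarrow>\<^sub>M W k" using F by (simp add: mpres_def)
  have "emeasure (distr (W k) (W k) F) A = (\<integral>\<^sup>+w. indicator A (F w) \<partial>W k)"
    using A Fm by (simp add: nn_integral_distr[symmetric, OF Fm] flip: nn_integral_indicator)
  also have "\<dots> = (\<integral>\<^sup>+w. indicator A w \<partial>W k)" using F A by (simp add: mpres_def)
  finally show "emeasure (distr (W k) (W k) F) A = emeasure (W k) A" using A by simp
qed simp

lemma mpres_comp:
  assumes "mpres k F" "mpres k H" shows "mpres k (\<lambda>w. F (H w))"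
  unfolding mpres_def
proof (intro conjI ballI)
  have m: "F \<in> W k \<rightarrow>\<^sub>M W k" "H \<in> W k \<rightarrow>\<^sub>M W k" using assms by (auto simp: mpres_def)
  show "(\<lambda>w. F (H w)) \<in> W k \<rightarrow>\<^sub>M W k" by (rule measurable_compose[OF m(2) m(1)])
  fix f :: "(nat \<Rightarrow> fvec) \<Rightarrow> ennreal" assume f: "f \<in> borel_measurable (W k)"
  show "(\<integral>\<^sup>+w. f (F (H w)) \<partial>W k) = (\<integral>\<^sup>+w. f w \<partial>W k)"
    using mpres_nn_integral[OF assms(2) measurable_compose[OF m(1) f]] mpres_nn_integral[OF assms(1) f] by simp
qed

lemma mpres_extend:
  assumes "mpres k F"
  shows "mpres (Suc k) (\<lambda>w. (F (restrict w {..<k}))(k := w k))"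
  unfolding mpres_def
proof (intro conjI ballI)
  have Fm: "F \<in> W k \<rightarrow>\<^sub>M W k" using assms by (simp add: mpres_def)
  have r: "(\<lambda>w. restrict w {..<k}) \<in> W (Suc k) \<rightarrow>\<^sub>M W k"
    by (rule measurable_restrict_subset) auto
  have "(\<lambda>w. (F (restrict w {..<k}), w k)) \<in> W (Suc k) \<rightarrow>\<^sub>M W k \<Otimes>\<^sub>M \<nu>"
    by (intro measurable_Pair measurable_compose[OF r Fm] measurable_component_singleton) simp
  from measurable_compose[OF this measurable_W_upd]
  show m: "(\<lambda>w. (F (restrict w {..<k}))(k := w k)) \<in> W (Suc k) \<rightarrow>\<^sub>M W (Suc k)" by simp
  fix f :: "(nat \<Rightarrow> fvec) \<Rightarrow> ennreal" assume f: "f \<in> borel_measurable (W (Suc k))"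
  have g: "(\<lambda>w. \<integral>\<^sup>+x. f (w(k := x)) \<partial>\<nu>) \<in> borel_measurable (W k)"
    using borel_measurable_nn_integral_fst[OF measurable_compose[OF measurable_W_upd f]] by simp
  have "(\<integral>\<^sup>+w. f ((F (restrict w {..<k}))(k := w k)) \<partial>W (Suc k)) = (\<integral>\<^sup>+w. \<integral>\<^sup>+x. f ((F (restrict (w(k := x)) {..<k}))(k := x)) \<partial>\<nu> \<partial>W k)"
    by (subst nn_integral_W_Suc) (use measurable_compose[OF m f] in auto)
  also have "\<dots> = (\<integral>\<^sup>+w. \<integral>\<^sup>+x. f ((F w)(k := x)) \<partial>\<nu> \<partial>W k)"
  proof (rule nn_integral_cong)
    fix w assume "w \<in> space (W k)"
    then have "restrict (w(k := x)) {..<k} = w" for x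
      by (auto simp: space_PiM PiE_iff extensional_def fun_eq_iff)
    then show "(\<integral>\<^sup>+x. f ((F (restrict (w(k := x)) {..<k}))(k := x)) \<partial>\<nu>) = (\<integral>\<^sup>+x. f ((F w)(k := x)) \<partial>\<nu>)" by simp
  qed
  also have "\<dots> = (\<integral>\<^sup>+w. \<integral>\<^sup>+x. f (w(k := x)) \<partial>\<nu> \<partial>W k)"
    by (rule mpres_nn_integral[OF assms g])
  also have "\<dots> = (\<integral>\<^sup>+w. f w \<partial>W (Suc k))" by (rule nn_integral_W_Suc[OF f, symmetric])
  finally show "(\<integral>\<^sup>+w. f ((F (restrict w {..<k}))(k := w k)) \<partial>W (Suc k)) = (\<integral>\<^sup>+w. f w \<partial>W (Suc k))" .
qed

text \<open>The last two vectors are integrated jointly over the pair measure, where the rotation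
  axiom \<open>rot\<close> applies.\<close>

lemma mpres_rot:
  assumes cs: "c\<^sup>2 + s\<^sup>2 = 1"
  shows "mpres (Suc (Suc k)) (\<lambda>w. w(k := rotl c s (w k) (w (Suc k)), Suc k := rotl (- s) c (w k) (w (Suc k))))"
    (is "mpres _ ?R")
  unfolding mpres_def
proof (intro conjI ballI)
  have rot_m: "(\<lambda>z. rotl c s (fst z) (snd z)) \<in> \<nu> \<Otimes>\<^sub>M \<nu> \<rightarrow>\<^sub>M \<nu>" for c s
    using measurable_rotl(1)[OF sets_nu sets_nu, of c s] measurable_cong_sets[OF refl sets_nu] by blast
  have pk: "(\<lambda>w. (w k, w (Suc k))) \<in> W (Suc (Suc k)) \<rightarrow>\<^sub>M \<nu> \<Otimes>\<^sub>M \<nu>"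
    by (intro measurable_Pair measurable_component_singleton) auto
  have rk: "(\<lambda>w. rotl c s (w k) (w (Suc k))) \<in> W (Suc (Suc k)) \<rightarrow>\<^sub>M \<nu>" for c s
    using measurable_compose[OF pk rot_m[of c s]] by simp
  show m: "?R \<in> W (Suc (Suc k)) \<rightarrow>\<^sub>M W (Suc (Suc k))"
  proof (rule measurable_fun_upd[where J = "{..<Suc (Suc k)}"])
    show "(\<lambda>w. w(k := rotl c s (w k) (w (Suc k)))) \<in> W (Suc (Suc k)) \<rightarrow>\<^sub>M W (Suc (Suc k))"
      by (rule measurable_fun_upd[where J = "{..<Suc (Suc k)}"]) (use rk in auto)
  qed (use rk in auto)
  fix f :: "(nat \<Rightarrow> fvec) \<Rightarrow> ennreal" assume f: "f \<in> borel_measurable (W (Suc (Suc k)))"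
  have upd2: "(\<lambda>z. u(k := fst z, Suc k := snd z)) \<in> \<nu> \<Otimes>\<^sub>M \<nu> \<rightarrow>\<^sub>M W (Suc (Suc k))" if u: "u \<in> space (W k)" for u
  proof (rule measurable_fun_upd[where J = "{..<Suc k}"])
    show "(\<lambda>z. u(k := fst z)) \<in> \<nu> \<Otimes>\<^sub>M \<nu> \<rightarrow>\<^sub>M W (Suc k)"
      by (rule measurable_fun_upd[where J = "{..<k}"]) (use u in \<open>auto simp: lessThan_Suc\<close>)
  qed (auto simp: lessThan_Suc)
  have it: "(\<integral>\<^sup>+w. F w \<partial>W (Suc (Suc k))) = (\<integral>\<^sup>+u. \<integral>\<^sup>+z. F (u(k := fst z, Suc k := snd z)) \<partial>(\<nu> \<Otimes>\<^sub>M \<nu>) \<partial>W k)"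
    if F: "F \<in> borel_measurable (W (Suc (Suc k)))" for F :: "(nat \<Rightarrow> fvec) \<Rightarrow> ennreal"
  proof -
    have g: "(\<lambda>w. \<integral>\<^sup>+x. F (w(Suc k := x)) \<partial>\<nu>) \<in> borel_measurable (W (Suc k))"
      using borel_measurable_nn_integral_fst[OF measurable_compose[OF measurable_W_upd F]] by simp
    have "(\<integral>\<^sup>+w. F w \<partial>W (Suc (Suc k))) = (\<integral>\<^sup>+u. \<integral>\<^sup>+x. \<integral>\<^sup>+y. F (u(k := x, Suc k := y)) \<partial>\<nu> \<partial>\<nu> \<partial>W k)"
      by (simp add: nn_integral_W_Suc[OF F] nn_integral_W_Suc[OF g])
    also have "\<dots> = (\<integral>\<^sup>+u. \<integral>\<^sup>+z. F (u(k := fst z, Suc k := snd z)) \<partial>(\<nu> \<Otimes>\<^sub>M \<nu>) \<partial>W k)"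
    proof (rule nn_integral_cong)
      fix u assume "u \<in> space (W k)"
      from nn_integral_fst[OF measurable_compose[OF upd2[OF this] F]]
      show "(\<integral>\<^sup>+x. \<integral>\<^sup>+y. F (u(k := x, Suc k := y)) \<partial>\<nu> \<partial>\<nu>) = (\<integral>\<^sup>+z. F (u(k := fst z, Suc k := snd z)) \<partial>(\<nu> \<Otimes>\<^sub>M \<nu>))"
        by simp
    qed
    finally show ?thesis .
  qed
  have Rm: "(\<lambda>x. (rotl c s (fst x) (snd x), rotl (- s) c (fst x) (snd x))) \<in> \<nu> \<Otimes>\<^sub>M \<nu> \<rightarrow>\<^sub>M \<nu> \<Otimes>\<^sub>M \<nu>"
    by (intro measurable_Pair rot_m)
  have "(\<integral>\<^sup>+w. f (?R w) \<partial>W (Suc (Suc k))) = (\<integral>\<^sup>+u. \<integral>\<^sup>+z. f (?R (u(k := fst z, Suc k := snd z))) \<partial>(\<nu> \<Otimes>\<^sub>M \<nu>) \<partial>W k)"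
    by (rule it[OF measurable_compose[OF m f]])
  also have "\<dots> = (\<integral>\<^sup>+u. \<integral>\<^sup>+z. f (u(k := fst z, Suc k := snd z)) \<partial>(\<nu> \<Otimes>\<^sub>M \<nu>) \<partial>W k)"
  proof (rule nn_integral_cong)
    fix u assume u: "u \<in> space (W k)"
    have "?R (u(k := x, Suc k := y)) = u(k := rotl c s x y, Suc k := rotl (- s) c x y)" for x y
      by (simp add: fun_eq_iff)
    then have "(\<integral>\<^sup>+z. f (?R (u(k := fst z, Suc k := snd z))) \<partial>(\<nu> \<Otimes>\<^sub>M \<nu>))
      = (\<integral>\<^sup>+z. (\<lambda>z. f (u(k := fst z, Suc k := snd z))) (rotl c s (fst z) (snd z), rotl (- s) c (fst z) (snd z)) \<partial>(\<nu> \<Otimes>\<^sub>M \<nu>))"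
      by simp
    also have "\<dots> = (\<integral>\<^sup>+z. f (u(k := fst z, Suc k := snd z)) \<partial>distr (\<nu> \<Otimes>\<^sub>M \<nu>) (\<nu> \<Otimes>\<^sub>M \<nu>) (\<lambda>x. (rotl c s (fst x) (snd x), rotl (- s) c (fst x) (snd x))))"
      by (rule nn_integral_distr[OF Rm, symmetric]) (simp add: measurable_compose[OF upd2[OF u] f])
    finally show "(\<integral>\<^sup>+z. f (?R (u(k := fst z, Suc k := snd z))) \<partial>(\<nu> \<Otimes>\<^sub>M \<nu>)) = (\<integral>\<^sup>+z. f (u(k := fst z, Suc k := snd z)) \<partial>(\<nu> \<Otimes>\<^sub>M \<nu>))"
      by (simp add: rot[OF cs])
  qed
  also have "\<dots> = (\<integral>\<^sup>+w. f w \<partial>W (Suc (Suc k)))" by (rule it[OF f, symmetric])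
  finally show "(\<integral>\<^sup>+w. f (?R w) \<partial>W (Suc (Suc k))) = (\<integral>\<^sup>+w. f w \<partial>W (Suc (Suc k)))" .
qed

text \<open>Helmert transformation, built from plane rotations: the last new vector is the normalised sum,
  and second moments are preserved.\<close>

lemma helmert:
  "\<exists>F. mpres (Suc k) F \<and> (\<forall>w i j. i < p \<longrightarrow> j < p \<longrightarrow>
     F w k i = (\<Sum>a<Suc k. w a i) / sqrt (Suc k) \<and> gm (Suc k) (F w) i j = gm (Suc k) w i j)"
proof (induction k)
  case 0
  have "mpres (Suc 0) (\<lambda>w. w)" by (simp add: mpres_def)
  then show ?case by (intro exI[of _ "\<lambda>w. w"]) simp
next
  case (Suc k)
  then obtain F where F: "mpres (Suc k) F"
    and F1: "\<And>w i. i < p \<Longrightarrow> F w k i = (\<Sum>a<Suc k. w a i) / sqrt (Suc k)"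
    and F2: "\<And>w i j. i < p \<Longrightarrow> j < p \<Longrightarrow> gm (Suc k) (F w) i j = gm (Suc k) w i j" by auto
  \<comment> \<open>The weights that merge the normalised sum of the first k + 1 vectors with the
    next vector. The rotation is taken with \<open>- s\<close>, because it is its second output that
    should have two positive weights.\<close>
  define c s where "c = 1 / sqrt (Suc (Suc k))" and "s = sqrt (Suc k) / sqrt (Suc (Suc k))"
  have cs: "c\<^sup>2 + (- s)\<^sup>2 = 1" by (simp add: c_def s_def power_divide field_simps)
  define E where "E w = (F (restrict w {..<Suc k}))(Suc k := w (Suc k))" for w
  define R where "R w = w(k := rotl c (- s) (w k) (w (Suc k)), Suc k := rotl (- (- s)) c (w k) (w (Suc k)))" for w :: "nat \<Rightarrow> fvec"
  have RE: "mpres (Suc (Suc k)) (\<lambda>w. R (E w))"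
    unfolding R_def[abs_def] E_def[abs_def] by (rule mpres_comp[OF mpres_rot[OF cs] mpres_extend[OF F]])
  have E1: "E w k i = (\<Sum>a<Suc k. w a i) / sqrt (Suc k)" "E w (Suc k) i = w (Suc k) i" if "i < p" for w i
    using F1[OF that, of "restrict w {..<Suc k}"] by (simp_all add: E_def)
  have E2: "gm (Suc (Suc k)) (E w) i j = gm (Suc (Suc k)) w i j" if "i < p" "j < p" for w i j
    using F2[OF that, of "restrict w {..<Suc k}"] by (simp add: E_def gm_def)
  have R2: "gm (Suc (Suc k)) (R w) i j = gm (Suc (Suc k)) w i j" if "i < p" "j < p" for w i j
  proof -
    have "R w k i * R w k j + R w (Suc k) i * R w (Suc k) j = (c\<^sup>2 + s\<^sup>2) * (w k i * w k j + w (Suc k) i * w (Suc k) j)"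
      using that by (simp add: R_def rotl_def power2_eq_square algebra_simps)
    then have "R w k i * R w k j + R w (Suc k) i * R w (Suc k) j = w k i * w k j + w (Suc k) i * w (Suc k) j"
      using cs by simp
    moreover have "(\<Sum>a<k. R w a i * R w a j) = (\<Sum>a<k. w a i * w a j)" by (simp add: R_def)
    ultimately show ?thesis by (simp add: gm_def)
  qed
  have R1: "R (E w) (Suc k) i = (\<Sum>a<Suc (Suc k). w a i) / sqrt (Suc (Suc k))" if "i < p" for w i
  proof -
    have "R (E w) (Suc k) i = s * E w k i + c * E w (Suc k) i" using that by (simp add: R_def rotl_def)
    also have "\<dots> = s * ((\<Sum>a<Suc k. w a i) / sqrt (Suc k)) + c * w (Suc k) i" by (simp only: E1[OF that])
    also have "s * ((\<Sum>a<Suc k. w a i) / sqrt (Suc k)) = (\<Sum>a<Suc k. w a i) / sqrt (Suc (Suc k))"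
      by (simp add: s_def del: sum.lessThan_Suc)
    finally show ?thesis by (simp add: c_def add_divide_distrib)
  qed
  show ?case
    by (intro exI[of _ "\<lambda>w. R (E w)"] conjI allI impI RE) (simp_all only: R1 R2 E2)
qed

text \<open>Centring subtracts exactly the square of the normalised sum, which is the last Helmert
  vector. Discarding it leaves \<open>k - 1\<close> independent vectors: the loss of one degree of
  freedom.\<close>

lemma centred_gram:
  assumes "0 < k"
  shows "\<exists>\<psi>. \<psi> \<in> W k \<rightarrow>\<^sub>M W (k - 1) \<and> distr (W k) (W (k - 1)) \<psi> = W (k - 1) \<and>
    (\<forall>w i j. i < p \<longrightarrow> j < p \<longrightarrow>
      (\<Sum>a<k. (w a i - (\<Sum>b<k. w b i) / k) * (w a j - (\<Sum>b<k. w b j) / k)) = gm (k - 1) (\<psi> w) i j)"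
proof -
  obtain n where k: "k = Suc n" using assms by (cases k) auto
  obtain F where F: "mpres (Suc n) F"
    and F1: "\<And>w i. i < p \<Longrightarrow> F w n i = (\<Sum>a<Suc n. w a i) / sqrt (Suc n)"
    and F2: "\<And>w i j. i < p \<Longrightarrow> j < p \<Longrightarrow> gm (Suc n) (F w) i j = gm (Suc n) w i j"
    using helmert[of n] by auto
  have Fm: "F \<in> W (Suc n) \<rightarrow>\<^sub>M W (Suc n)" using F by (simp add: mpres_def)
  have r: "(\<lambda>w. restrict w {..<n}) \<in> W (Suc n) \<rightarrow>\<^sub>M W n"
    by (rule measurable_restrict_subset) auto
  have dr: "distr (W (Suc n)) (W n) (\<lambda>w. restrict w {..<n}) = W n"
    using distr_PiM_reindex[of "{..<Suc n}" "\<lambda>_. \<nu>" "\<lambda>a. a" "{..<n}"] prob_space_axioms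
    by (simp add: restrict_def Pi_def)
  define \<psi> where "\<psi> = (\<lambda>w. restrict (F w) {..<n})"
  have \<psi>m: "\<psi> \<in> W (Suc n) \<rightarrow>\<^sub>M W n" unfolding \<psi>_def by (rule measurable_compose[OF Fm r])
  moreover have "distr (W (Suc n)) (W n) \<psi> = W n"
  proof -
    have "distr (W (Suc n)) (W n) \<psi> = distr (distr (W (Suc n)) (W (Suc n)) F) (W n) (\<lambda>w. restrict w {..<n})"
      by (subst distr_distr[OF r Fm]) (simp add: \<psi>_def comp_def)
    then show ?thesis by (simp add: mpres_distr[OF F] dr)
  qed
  moreover have "(\<Sum>a<Suc n. (w a i - (\<Sum>b<Suc n. w b i) / Suc n) * (w a j - (\<Sum>b<Suc n. w b j) / Suc n)) = gm n (\<psi> w) i j"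
    if ij: "i < p" "j < p" for w :: "nat \<Rightarrow> fvec" and i j
  proof -
    define si sj where "si = (\<Sum>b<Suc n. w b i)" and "sj = (\<Sum>b<Suc n. w b j)"
    have e1: "(\<Sum>a<Suc n. w a i * (sj / Suc n)) = si * (sj / Suc n)" "(\<Sum>a<Suc n. (si / Suc n) * w a j) = (si / Suc n) * sj"
      by (simp_all only: si_def sj_def sum_distrib_right sum_distrib_left)
    have e2: "(\<Sum>a<Suc n. (si / Suc n) * (sj / Suc n)) = si * (sj / Suc n)"
      by (simp only: sum_constant card_lessThan) (simp del: of_nat_Suc)
    have "(\<Sum>a<Suc n. (w a i - si / Suc n) * (w a j - sj / Suc n))
       = (\<Sum>a<Suc n. w a i * w a j - w a i * (sj / Suc n) - (si / Suc n) * w a j + (si / Suc n) * (sj / Suc n))"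
      by (intro sum.cong refl) (simp add: algebra_simps)
    also have "\<dots> = gm (Suc n) w i j - si * (sj / Suc n) - (si / Suc n) * sj + si * (sj / Suc n)"
      unfolding gm_def by (simp only: sum.distrib sum_subtractf e1 e2)
    finally have e3: "(\<Sum>a<Suc n. (w a i - si / Suc n) * (w a j - sj / Suc n)) = gm (Suc n) w i j - si * sj / Suc n"
      by simp
    have e4: "si * sj / Suc n = F w n i * F w n j"
      unfolding F1[OF ij(1)] F1[OF ij(2)] si_def[symmetric] sj_def[symmetric] by simp
    have e5: "gm (Suc n) (F w) i j = gm n (\<psi> w) i j + F w n i * F w n j" by (simp add: gm_def \<psi>_def)
    have "(\<Sum>a<Suc n. (w a i - si / Suc n) * (w a j - sj / Suc n)) = gm n (\<psi> w) i j"
      using e3 e4 e5 F2[OF ij, of w] by linarith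
    then show ?thesis unfolding si_def sj_def .
  qed
  ultimately show ?thesis unfolding k diff_Suc_1 by (intro exI[of _ \<psi>] conjI allI impI)
qed

end

text \<open>\<open>e b\<close> enumerates the observations of block \<open>b\<close>, and
  \<open>\<phi> b\<close> will be the Helmert map. Independence of the blocks comes from disjoint
  index sets, the law of each block from reindexing a product measure; together they give the joint
  law as a product.\<close>

lemma (in prob_space) joint_blocks:
  fixes Z :: "'s \<Rightarrow> 'a \<Rightarrow> 'v" and e :: "'b \<Rightarrow> nat \<Rightarrow> 's" and N :: "'b \<Rightarrow> 'v measure" and Q :: "'b \<Rightarrow> 'w measure"
  assumes ind: "indep_vars (\<lambda>_. V) Z I" and B: "finite B" "B \<noteq> {}"
    and inj: "\<And>b. b \<in> B \<Longrightarrow> inj_on (e b) {..<k b}" and k: "\<And>b. b \<in> B \<Longrightarrow> 0 < k b"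
    and sub: "\<And>b. b \<in> B \<Longrightarrow> e b ` {..<k b} \<subseteq> I"
    and disj: "disjoint_family_on (\<lambda>b. e b ` {..<k b}) B"
    and law: "\<And>b a. b \<in> B \<Longrightarrow> a < k b \<Longrightarrow> distr M V (Z (e b a)) = N b"
    and sets_N: "\<And>b. b \<in> B \<Longrightarrow> sets (N b) = sets V" and pN: "\<And>b. b \<in> B \<Longrightarrow> prob_space (N b)"
    and \<phi>: "\<And>b. b \<in> B \<Longrightarrow> \<phi> b \<in> PiM {..<k b} (\<lambda>_. N b) \<rightarrow>\<^sub>M Q b"
    and \<phi>d: "\<And>b. b \<in> B \<Longrightarrow> distr (PiM {..<k b} (\<lambda>_. N b)) (Q b) (\<phi> b) = Q b"
  defines "G \<equiv> \<lambda>b \<omega>. \<phi> b (\<lambda>a\<in>{..<k b}. Z (e b a) \<omega>)"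
  shows "indep_vars Q G B"
    and "(\<lambda>\<omega>. \<lambda>b\<in>B. G b \<omega>) \<in> M \<rightarrow>\<^sub>M PiM B Q"
    and "distr M (PiM B Q) (\<lambda>\<omega>. \<lambda>b\<in>B. G b \<omega>) = PiM B Q"
    and "\<And>b. b \<in> B \<Longrightarrow> distr M (Q b) (G b) = Q b"
proof -
  let ?K = "\<lambda>b. e b ` {..<k b}"
  have rvZ: "random_variable V (Z s)" if "s \<in> I" for s
    using ind that by (auto simp: indep_vars_def)
  have re: "(\<lambda>w. \<lambda>a\<in>{..<k b}. w (e b a)) \<in> PiM (?K b) (\<lambda>_. V) \<rightarrow>\<^sub>M PiM {..<k b} (\<lambda>_. N b)" if b: "b \<in> B" for b
  proof (rule measurable_restrict)
    fix a assume "a \<in> {..<k b}"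
    then have "(\<lambda>w. w (e b a)) \<in> PiM (?K b) (\<lambda>_. V) \<rightarrow>\<^sub>M V" by (intro measurable_component_singleton) auto
    then show "(\<lambda>w. w (e b a)) \<in> PiM (?K b) (\<lambda>_. V) \<rightarrow>\<^sub>M N b"
      using measurable_cong_sets[OF refl sets_N[OF b]] by blast
  qed
  have G_eq: "G b \<omega> = \<phi> b ((\<lambda>w. \<lambda>a\<in>{..<k b}. w (e b a)) (restrict (\<lambda>s. Z s \<omega>) (?K b)))" for b \<omega>
    unfolding G_def by (intro arg_cong[where f = "\<phi> b"]) auto
  show ind_G: "indep_vars Q G B"
    unfolding G_eq
  proof (rule indep_vars_compose2[OF indep_vars_restrict[OF ind sub disj]])
    fix b assume "b \<in> B"
    then show "(\<lambda>w. \<phi> b (\<lambda>a\<in>{..<k b}. w (e b a))) \<in> PiM (?K b) (\<lambda>_. V) \<rightarrow>\<^sub>M Q b"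
      by (intro measurable_compose[OF re \<phi>])
  qed
  have rvG: "random_variable (Q b) (G b)" if "b \<in> B" for b
    using ind_G that by (auto simp: indep_vars_def)
  show Gm: "(\<lambda>\<omega>. \<lambda>b\<in>B. G b \<omega>) \<in> M \<rightarrow>\<^sub>M PiM B Q"
    by (rule measurable_restrict) (rule rvG)
  show lawG: "distr M (Q b) (G b) = Q b" if b: "b \<in> B" for b
  proof -
    have Kne: "?K b \<noteq> {}" using k[OF b] by auto
    have rm: "(\<lambda>\<omega>. restrict (\<lambda>s. Z s \<omega>) (?K b)) \<in> M \<rightarrow>\<^sub>M PiM (?K b) (\<lambda>_. V)"
      by (rule measurable_restrict) (use sub[OF b] rvZ in auto)
    have 1: "distr M (PiM (?K b) (\<lambda>_. V)) (\<lambda>\<omega>. restrict (\<lambda>s. Z s \<omega>) (?K b)) = PiM (?K b) (\<lambda>s. N b)"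
    proof -
      have "distr M (PiM (?K b) (\<lambda>_. V)) (\<lambda>\<omega>. restrict (\<lambda>s. Z s \<omega>) (?K b)) = PiM (?K b) (\<lambda>s. distr M V (Z s))"
        using indep_vars_subset[OF ind sub[OF b]] sub[OF b] rvZ
        by (subst indep_vars_iff_distr_eq_PiM'[symmetric, OF Kne]) auto
      also have "\<dots> = PiM (?K b) (\<lambda>s. N b)"
        using law[OF b] by (intro PiM_cong) auto
      finally show ?thesis .
    qed
    have "distr M (Q b) (G b) = distr (distr M (PiM {..<k b} (\<lambda>_. N b)) (\<lambda>\<omega>. (\<lambda>w. \<lambda>a\<in>{..<k b}. w (e b a)) (restrict (\<lambda>s. Z s \<omega>) (?K b)))) (Q b) (\<phi> b)"
    proof -
      have "G b = \<phi> b \<circ> (\<lambda>\<omega>. (\<lambda>w. \<lambda>a\<in>{..<k b}. w (e b a)) (restrict (\<lambda>s. Z s \<omega>) (?K b)))"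
        by (rule ext) (simp only: comp_def G_eq)
      then show ?thesis by (subst distr_distr[OF \<phi>[OF b] measurable_compose[OF rm re[OF b]]]) simp
    qed
    also have "distr M (PiM {..<k b} (\<lambda>_. N b)) (\<lambda>\<omega>. (\<lambda>w. \<lambda>a\<in>{..<k b}. w (e b a)) (restrict (\<lambda>s. Z s \<omega>) (?K b)))
       = distr (PiM (?K b) (\<lambda>s. N b)) (PiM {..<k b} (\<lambda>_. N b)) (\<lambda>w. \<lambda>a\<in>{..<k b}. w (e b a))"
      unfolding 1[symmetric] by (subst distr_distr[OF re[OF b] rm]) (simp add: comp_def)
    also have "\<dots> = PiM {..<k b} (\<lambda>_. N b)"
      using distr_PiM_reindex[of "?K b" "\<lambda>_. N b" "e b" "{..<k b}"] pN[OF b] inj[OF b] by auto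
    finally show ?thesis by (simp add: \<phi>d[OF b])
  qed
  have "distr M (PiM B Q) (\<lambda>\<omega>. \<lambda>b\<in>B. G b \<omega>) = PiM B (\<lambda>b. distr M (Q b) (G b))"
    using ind_G rvG by (subst indep_vars_iff_distr_eq_PiM'[symmetric, OF B(2)]) auto
  also have "\<dots> = PiM B Q" using lawG by (intro PiM_cong) auto
  finally show "distr M (PiM B Q) (\<lambda>\<omega>. \<lambda>b\<in>B. G b \<omega>) = PiM B Q" .
qed

section \<open>Slutsky's argument and the variance estimators\<close>

interpretation std_normal: real_distribution std_normal_distribution
  by (rule real_dist_normal_dist)

lemma isCont_std_normal_cdf: "isCont (cdf std_normal_distribution) x"
proof -
  have "emeasure std_normal_distribution {x} = 0"
    by (subst emeasure_density) (auto intro!: nn_integral_0_iff_AE[THEN iffD2] AE_I[where N = "{x}"] simp: indicator_def)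
  then show ?thesis by (simp add: std_normal.isCont_cdf measure_def)
qed

text \<open>The tails of the distribution function make the set nonempty and bounded below;
  continuity then keeps its value at the infimum from lying above or below \<open>u\<close>.\<close>

lemma std_normal_cdf_quantile:
  assumes "0 < u" "u < 1"
  shows "cdf std_normal_distribution (std_normal_quantile u) = u"
proof -
  let ?F = "cdf std_normal_distribution"
  define A where "A = {z. u \<le> ?F z}"
  define q where "q = Inf A"
  have mono: "?F x \<le> ?F y" if "x \<le> y" for x y using std_normal.cdf_nondecreasing[OF that] .
  obtain b where b: "u < ?F b"
    using order_tendstoD(1)[OF std_normal.cdf_lim_at_top_prob assms(2)] by (auto simp: eventually_at_top_linorder)
  obtain a where a: "?F a < u"
    using order_tendstoD(2)[OF std_normal.cdf_lim_at_bot assms(1)] by (auto simp: eventually_at_bot_linorder)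
  have ne: "A \<noteq> {}" using b by (auto simp: A_def intro: less_imp_le)
  have bb: "bdd_below A"
  proof (rule bdd_belowI)
    fix z assume "z \<in> A"
    then show "a \<le> z" using a mono[of z a] by (force simp: A_def)
  qed
  have c: "continuous (at q) ?F" by (rule isCont_std_normal_cdf)
  have "?F q = u"
  proof (rule antisym)
    show "?F q \<le> u"
    proof (rule ccontr)
      assume "\<not> ?F q \<le> u"
      then have "eventually (\<lambda>z. u < ?F z) (at q)"
        using order_tendstoD(1)[OF c[unfolded isCont_def]] by simp
      then obtain d where d: "0 < d" "\<And>z. z \<noteq> q \<Longrightarrow> dist z q < d \<Longrightarrow> u < ?F z"
        by (auto simp: eventually_at)
      have "q - d / 2 \<in> A" using d(2)[of "q - d / 2"] d(1) by (auto simp: A_def dist_real_def)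
      then have "q \<le> q - d / 2" unfolding q_def by (intro cInf_lower bb)
      then show False using d(1) by simp
    qed
    show "u \<le> ?F q"
    proof (rule ccontr)
      assume "\<not> u \<le> ?F q"
      then have "eventually (\<lambda>z. ?F z < u) (at q)"
        using order_tendstoD(2)[OF c[unfolded isCont_def]] by simp
      then obtain d where d: "0 < d" "\<And>z. z \<noteq> q \<Longrightarrow> dist z q < d \<Longrightarrow> ?F z < u"
        by (auto simp: eventually_at)
      have "q + d / 2 \<le> z" if "z \<in> A" for z
      proof (rule ccontr)
        assume "\<not> q + d / 2 \<le> z"
        then have "?F z \<le> ?F (q + d / 2)" by (intro mono) simp
        moreover have "?F (q + d / 2) < u" using d by (intro d(2)) (auto simp: dist_real_def)
        ultimately show False using that by (simp add: A_def)
      qed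
      then have "q + d / 2 \<le> q" unfolding q_def by (intro cInf_greatest ne)
      then show False using d(1) by simp
    qed
  qed
  then show ?thesis by (simp add: std_normal_quantile_def q_def A_def)
qed

text \<open>The spaces vary with n, so convergence in probability is expressed by measures of
  deviations. Where |D - 1| is at most e, the event z < N / D lies between N > z + |z| e and N > z -
  |z| e, so the joint law of N and D never enters.\<close>

lemma slutsky_quotient:
  fixes M :: "nat \<Rightarrow> 'a measure" and N D :: "nat \<Rightarrow> 'a \<Rightarrow> real"
  assumes M: "\<And>n. prob_space (M n)"
    and N[measurable]: "\<And>n. N n \<in> borel_measurable (M n)" and D[measurable]: "\<And>n. D n \<in> borel_measurable (M n)"
    and char: "\<And>t. (\<lambda>n. char (distr (M n) borel (N n)) t) \<longlonglongrightarrow> char std_normal_distribution t"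
    and Dlim: "\<And>\<epsilon>. 0 < \<epsilon> \<Longrightarrow> (\<lambda>n. measure (M n) {w \<in> space (M n). \<epsilon> < \<bar>D n w - 1\<bar>}) \<longlonglongrightarrow> 0"
  shows "(\<lambda>n. measure (M n) {w \<in> space (M n). z < N n w / D n w}) \<longlonglongrightarrow> 1 - cdf std_normal_distribution z"
proof -
  let ?F = "cdf std_normal_distribution"
  have rd: "real_distribution (distr (M n) borel (N n))" for n
    using M[of n] by (intro prob_space.real_distribution_distr) auto
  have wc: "weak_conv_m (\<lambda>n. distr (M n) borel (N n)) std_normal_distribution"
    by (rule levy_continuity[OF rd std_normal.real_distribution_axioms char])
  have cdf: "(\<lambda>n. cdf (distr (M n) borel (N n)) x) \<longlonglongrightarrow> ?F x" for x
    using wc isCont_std_normal_cdf[of x] by (simp add: weak_conv_m_def weak_conv_def)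
  have tail: "(\<lambda>n. measure (M n) {w \<in> space (M n). x < N n w}) \<longlonglongrightarrow> 1 - ?F x" for x
  proof -
    have "measure (M n) {w \<in> space (M n). x < N n w} = 1 - cdf (distr (M n) borel (N n)) x" for n
    proof -
      interpret prob_space "M n" by (rule M)
      have "cdf (distr (M n) borel (N n)) x = measure (M n) {w \<in> space (M n). N n w \<le> x}"
        unfolding cdf_def by (subst measure_distr) (auto intro!: arg_cong[where f = "measure (M n)"])
      moreover have "measure (M n) {w \<in> space (M n). x < N n w} = 1 - measure (M n) {w \<in> space (M n). N n w \<le> x}"
        by (subst prob_compl[symmetric]) (auto intro!: arg_cong[where f = "measure (M n)"])
      ultimately show ?thesis by simp
    qed
    then show ?thesis by (auto intro!: tendsto_diff cdf)
  qed
  show ?thesis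
  proof (rule LIMSEQ_I)
    fix r :: real assume r: "0 < r"
    have "?F \<midarrow>z\<rightarrow> ?F z" using isCont_std_normal_cdf[of z] by (simp add: isCont_def)
    from LIM_D[OF this, of "r / 3"] r obtain d where d: "0 < d" "\<And>x. x \<noteq> z \<Longrightarrow> \<bar>x - z\<bar> < d \<Longrightarrow> \<bar>?F x - ?F z\<bar> < r / 3"
      by auto
    have d': "\<bar>?F x - ?F z\<bar> < r / 3" if "\<bar>x - z\<bar> < d" for x
      using d(2)[of x] that r by (cases "x = z") auto
    \<comment> \<open>At most 1/2, to keep the denominator positive; the added 1 admits z =
      0.\<close>
    define e where "e = min (1 / 2) (d / (2 * (\<bar>z\<bar> + 1)))"
    have e: "0 < e" "e < 1" using d by (auto simp: e_def)
    have ze: "\<bar>z\<bar> * e < d"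
    proof -
      have "\<bar>z\<bar> * e \<le> (\<bar>z\<bar> + 1) * (d / (2 * (\<bar>z\<bar> + 1)))" using d by (intro mult_mono) (auto simp: e_def)
      also have "\<dots> = d / 2" by (simp add: field_simps)
      finally show ?thesis using d by linarith
    qed
    let ?lo = "z - \<bar>z\<bar> * e" and ?hi = "z + \<bar>z\<bar> * e"
    have Flo: "\<bar>?F ?lo - ?F z\<bar> < r / 3"
      by (rule d') (use ze e in \<open>simp add: abs_mult\<close>)
    have Fhi: "\<bar>?F ?hi - ?F z\<bar> < r / 3"
      by (rule d') (use ze e in \<open>simp add: abs_mult\<close>)
    obtain n1 where n1: "\<And>n. n \<ge> n1 \<Longrightarrow> \<bar>measure (M n) {w \<in> space (M n). ?lo < N n w} - (1 - ?F ?lo)\<bar> < r / 3"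
      using LIMSEQ_D[OF tail[of ?lo], of "r / 3"] r by auto
    obtain n2 where n2: "\<And>n. n \<ge> n2 \<Longrightarrow> \<bar>measure (M n) {w \<in> space (M n). ?hi < N n w} - (1 - ?F ?hi)\<bar> < r / 3"
      using LIMSEQ_D[OF tail[of ?hi], of "r / 3"] r by auto
    obtain n3 where n3: "\<And>n. n \<ge> n3 \<Longrightarrow> measure (M n) {w \<in> space (M n). e < \<bar>D n w - 1\<bar>} < r / 3"
      using LIMSEQ_D[OF Dlim[OF e(1)], of "r / 3"] r by auto
    show "\<exists>no. \<forall>n\<ge>no. norm (measure (M n) {w \<in> space (M n). z < N n w / D n w} - (1 - ?F z)) < r"
    proof (intro exI[of _ "max n1 (max n2 n3)"] allI impI)
      fix n assume n: "max n1 (max n2 n3) \<le> n"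
      interpret prob_space "M n" by (rule M)
      let ?E = "{w \<in> space (M n). z < N n w / D n w}" and ?B = "{w \<in> space (M n). e < \<bar>D n w - 1\<bar>}"
      have good: "\<bar>z * D n w - z\<bar> \<le> \<bar>z\<bar> * e" "0 < D n w" if "\<not> e < \<bar>D n w - 1\<bar>" for w
      proof -
        have "z * D n w - z = z * (D n w - 1)" by (simp add: algebra_simps)
        then show "\<bar>z * D n w - z\<bar> \<le> \<bar>z\<bar> * e" using that by (simp add: abs_mult mult_left_mono)
        show "0 < D n w" using that e by linarith
      qed
      have "measure (M n) ?E \<le> measure (M n) ({w \<in> space (M n). ?lo < N n w} \<union> ?B)"
      proof (rule finite_measure_mono)
        show "?E \<subseteq> {w \<in> space (M n). ?lo < N n w} \<union> ?B"
        proof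
          fix w assume w: "w \<in> ?E"
          show "w \<in> {w \<in> space (M n). ?lo < N n w} \<union> ?B"
          proof (cases "e < \<bar>D n w - 1\<bar>")
            case False
            from good[OF this] w have "z * D n w < N n w" by (simp add: pos_less_divide_eq)
            then show ?thesis using good(1)[OF False] w by (auto simp: abs_le_iff)
          qed (use w in auto)
        qed
      qed simp
      also have "\<dots> \<le> measure (M n) {w \<in> space (M n). ?lo < N n w} + measure (M n) ?B"
        by (rule measure_Un_le) auto
      finally have up: "measure (M n) ?E \<le> measure (M n) {w \<in> space (M n). ?lo < N n w} + measure (M n) ?B" .
      have "measure (M n) {w \<in> space (M n). ?hi < N n w} \<le> measure (M n) (?E \<union> ?B)"
      proof (rule finite_measure_mono)
        show "{w \<in> space (M n). ?hi < N n w} \<subseteq> ?E \<union> ?B"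
        proof
          fix w assume w: "w \<in> {w \<in> space (M n). ?hi < N n w}"
          show "w \<in> ?E \<union> ?B"
          proof (cases "e < \<bar>D n w - 1\<bar>")
            case False
            have "z * D n w < N n w" using good(1)[OF False] w by (auto simp: abs_le_iff)
            then show ?thesis using good(2)[OF False] w by (simp add: pos_less_divide_eq)
          qed (use w in auto)
        qed
      qed simp
      also have "\<dots> \<le> measure (M n) ?E + measure (M n) ?B"
        by (rule measure_Un_le) auto
      finally have lo: "measure (M n) {w \<in> space (M n). ?hi < N n w} \<le> measure (M n) ?E + measure (M n) ?B" .
      have "\<bar>measure (M n) ?E - (1 - ?F z)\<bar> < r"
      proof -
        have "n1 \<le> n" "n2 \<le> n" "n3 \<le> n" using n by auto
        note b = n1[OF this(1)] n2[OF this(2)] n3[OF this(3)]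
        show ?thesis using up lo b Flo Fhi unfolding abs_less_iff by linarith
      qed
      then show "norm (measure (M n) ?E - (1 - ?F z)) < r" by simp
    qed
  qed
qed

section \<open>Consistency of the variance estimators\<close>

lemma (in findim) tra_gm_self: "tra (gm k w) = (\<Sum>a<k. dot (w a) (w a))"
  unfolding tra_def gm_def dot_def by (rule sum.swap)

lemma (in findim) tra_gm_gm_self: "tra (gm k v \<bowtie> gm l w) = (\<Sum>a<k. \<Sum>b<l. (dot (v a) (w b))\<^sup>2)"
  by (simp add: tra_gm bil_gm power2_eq_square dot_comm)

context findim
begin

text \<open>Serves to write the identity as the Gram matrix \<open>gm p unit_vec\<close>, so that
  inner products are covered by the lemmas on \<open>bil\<close>; the matrix is used as a unit only
  inside \<open>bil\<close> and \<open>tra\<close>.\<close>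

definition unit_vec :: "nat \<Rightarrow> fvec" where "unit_vec a = (\<lambda>i. of_bool (a = i))"

lemma dot_unit: "a < p \<Longrightarrow> dot (unit_vec a) y = y a"
  by (simp add: dot_def unit_vec_def of_bool_def if_distrib[of "\<lambda>z. z * _"] cong: if_cong)

lemma bil_gm_unit: "bil (gm p unit_vec) x y = dot x y"
proof -
  have "bil (gm p unit_vec) x y = (\<Sum>a<p. dot (unit_vec a) x * dot (unit_vec a) y)"
    by (simp add: bil_gm dot_comm)
  also have "\<dots> = dot x y" unfolding dot_def[of x y] by (intro sum.cong refl) (simp add: dot_unit)
  finally show ?thesis .
qed

lemma tra_gm_unit: "tra (gm p unit_vec \<bowtie> A) = tra A"
proof -
  have "mv A (unit_vec a) i = A i a" if "a < p" for a i
    using that by (simp add: mv_def dot_comm[of _ "unit_vec a"] dot_unit)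
  then show ?thesis
    unfolding tra_gm bil_def tra_def[of A] by (intro sum.cong refl) (simp add: dot_unit)
qed

end

context gauss
begin

text \<open>This is \<open>sigma_hat_same\<close> with k = K - 1 columns, since (K - 2)(K + 1) = (k
  - 1)(k + 2). The latter is k^2 + k - 2, the factor that makes the estimator unbiased.\<close>

definition sigma_est :: "nat \<Rightarrow> (nat \<Rightarrow> fvec) \<Rightarrow> real" where
  "sigma_est k w = (tra (gm k w \<bowtie> gm k w) - (tra (gm k w))\<^sup>2 / k) / (real p * (real k - 1) * (real k + 2))"

lemma all_moments_sigma_est: "all_moments (W k) (sigma_est k)"
proof -
  interpret W: prob_space "W k" by (rule W_prob)
  have "all_moments (W k) (\<lambda>w. (1 / (real p * (real k - 1) * (real k + 2))) * (tra (gm k w \<bowtie> gm k w) - (1 / k) * (tra (gm k w))\<^sup>2))"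
    by (intro all_moments_mult W.all_moments_const W.all_moments_diff W.all_moments_power all_moments_tra
        all_moments_mm all_moments_gm W_prob am_W_coord; simp)
  then show ?thesis by (simp add: sigma_est_def[abs_def] divide_inverse mult_ac)
qed

text \<open>The kernel is centred, so the k^4 term of the U-statistic bound disappears. Its
  projection is the centred form \<open>cquad S\<close>, whose variance is a trace of four
  letters.\<close>

lemma offdiag_sq_deviation:
  "(\<integral>w. (\<Sum>a<k. \<Sum>b\<in>{..<k} - {a}. (dot (w a) (w b))\<^sup>2 - tra (S \<bowtie> S))\<^sup>2 \<partial>W k)
    \<le> 8 * real k ^ 3 * tra (S \<bowtie> S \<bowtie> S \<bowtie> S) + 18 * (real k)\<^sup>2 * (tra (S \<bowtie> S))\<^sup>2"
proof -
  let ?t = "tra (S \<bowtie> S)"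
  define idm where "idm = gm p unit_vec"
  have dot_id: "dot x y = bil idm x y" for x y by (simp add: idm_def bil_gm_unit)
  have tra_id: "tra (idm \<bowtie> A) = tra A" for A by (simp add: idm_def tra_gm_unit)
  have id2: "tra (idm \<bowtie> S \<bowtie> idm \<bowtie> S) = ?t"
    using tra_comm[of S "idm \<bowtie> S"] by (simp add: tra_id)
  have dm: "(\<integral>y. (dot x y)\<^sup>2 \<partial>\<nu>) = bil S x x" for x
    using E_dot_dot[of x x] by (simp add: power2_eq_square)
  have am2: "all_moments (W k) (\<lambda>w. dot (w i) (w j))" if "i < k" "j < k" for i j
    using that by (intro all_moments_dot W_prob am_W_coord)
  interpret W: prob_space "W k" by (rule W_prob)
  have "(\<integral>w. (\<Sum>a<k. \<Sum>b\<in>{..<k} - {a}. (dot (w a) (w b))\<^sup>2 - ?t)\<^sup>2 \<partial>W k)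
     \<le> real k ^ 4 * 0\<^sup>2 + 4 * real k ^ 3 * (2 * tra (S \<bowtie> S \<bowtie> S \<bowtie> S)) + 2 * real k ^ 2 * (9 * ?t\<^sup>2)"
  proof (rule second_moment_offdiag[where g = "\<lambda>x y. (dot x y)\<^sup>2 - ?t" and h = "\<lambda>x. cquad S x"])
    show "prob_space \<nu>" by (rule prob_space_axioms)
    show "all_moments (W k) (\<lambda>w. (dot (w i) (w j))\<^sup>2 - ?t)" if "i < k" "j < k" for i j
      using that by (intro W.all_moments_diff W.all_moments_power W.all_moments_const am2)
    show "(dot x y)\<^sup>2 - ?t = (dot y x)\<^sup>2 - ?t" for x y by (simp add: dot_comm)
    show "all_moments \<nu> (\<lambda>x. cquad S x)" by (rule am_cquad)
    show "(\<integral>y. (dot x y)\<^sup>2 - ?t \<partial>\<nu>) = cquad S x" for x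
      using all_moments_integrable[OF am_dot_power[of x 2]] by (simp add: dm prob_space)
    show "(\<integral>x. cquad S x \<partial>\<nu>) = 0" by (rule E_cquad)
    show "(\<integral>x. (cquad S x)\<^sup>2 \<partial>\<nu>) \<le> 2 * tra (S \<bowtie> S \<bowtie> S \<bowtie> S)" using quad_variance_le[of S] by simp
    show "0 \<le> 9 * ?t\<^sup>2" by simp
    fix i j assume ij: "i < k" "j < k" "i \<noteq> j"
    have m1: "(\<integral>w. (dot (w i) (w j))\<^sup>2 \<partial>W k) = ?t"
      using E_bil_bil_pair[OF ij, of idm idm] by (simp add: id2 power2_eq_square flip: dot_id) (simp add: dot_comm)
    have m2: "(\<integral>w. dot (w i) (w j) ^ 4 \<partial>W k) \<le> 9 * ?t\<^sup>2"
      using E_bil4_pair[OF ij, of idm] mt_gm[of p unit_vec] by (simp add: id2 flip: dot_id idm_def)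
    have "(\<integral>w. ((dot (w i) (w j))\<^sup>2 - ?t)\<^sup>2 \<partial>W k) \<le> (\<integral>w. ((dot (w i) (w j))\<^sup>2)\<^sup>2 \<partial>W k)"
      using W.variance_eq[OF all_moments_integrable[OF W.all_moments_power[OF am2[OF ij(1,2)], of 2]]
        all_moments_integrable[OF W.all_moments_power[OF W.all_moments_power[OF am2[OF ij(1,2)], of 2]]]] m1 by simp
    also have "\<dots> = (\<integral>w. dot (w i) (w j) ^ 4 \<partial>W k)" by (simp flip: power_mult)
    finally show "(\<integral>w. ((dot (w i) (w j))\<^sup>2 - ?t)\<^sup>2 \<partial>W k) \<le> 9 * ?t\<^sup>2" using m2 by simp
  qed
  then show ?thesis by simp
qed

text \<open>The trace of a single covariance matrix is not bounded, yet its square enters both terms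
  of the estimator. It cancels: the diagonal pairs minus \<open>(tra (gm k w))\<^sup>2 / k\<close>
  form the sum \<open>Rw\<close> of squared deviations of the squared lengths from their average, so
  only the variance of a squared length matters.\<close>

lemma E_sigma_est:
  fixes C :: real
  assumes k: "2 \<le> k" and p: "0 < p" and C: "1 \<le> C"
    and t2: "tra (S \<bowtie> S) \<le> C * p" and t4: "tra (S \<bowtie> S \<bowtie> S \<bowtie> S) \<le> C * p"
  shows "(\<integral>w. \<bar>sigma_est k w - tra (S \<bowtie> S) / p\<bar> \<partial>W k) \<le> 12 * C / sqrt k"
proof -
  interpret W: prob_space "W k" by (rule W_prob)
  let ?t = "tra (S \<bowtie> S)"
  define Q where "Q w = (\<Sum>a<k. \<Sum>b\<in>{..<k} - {a}. (dot (w a) (w b))\<^sup>2 - ?t)" for w :: "nat \<Rightarrow> fvec"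
  define q where "q x = dot x x" for x
  define Rw where "Rw w = (\<Sum>a<k. (q (w a))\<^sup>2) - (\<Sum>a<k. q (w a))\<^sup>2 / k" for w :: "nat \<Rightarrow> fvec"
  have t0: "0 \<le> ?t" by (rule tra_gram_nonneg[OF gram_S gram_S])
  have u0: "0 \<le> tra (S \<bowtie> S \<bowtie> S \<bowtie> S)"
    using tra_gram_nonneg[OF gram_sandwich_sym[OF gram_S gram_S] gram_S] by simp
  define idm where "idm = gm p unit_vec"
  have dot_id: "dot x y = bil idm x y" for x y by (simp add: idm_def bil_gm_unit)
  have tra_id: "tra (idm \<bowtie> A) = tra A" for A by (simp add: idm_def tra_gm_unit)
  have id2: "tra (idm \<bowtie> S \<bowtie> idm \<bowtie> S) = ?t"
    using tra_comm[of S "idm \<bowtie> S"] by (simp add: tra_id)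
  have mt_id: "mt idm = idm" by (simp add: idm_def)
  define \<tau> where "\<tau> = tra (idm \<bowtie> S)"
  have q_id: "q x - \<tau> = cquad idm x" for x by (simp add: q_def \<tau>_def dot_id)
  have am_q: "all_moments (W k) (\<lambda>w. q (w a))" if "a < k" for a
    unfolding q_def using that by (intro all_moments_dot W_prob am_W_coord)
  have am_Q: "all_moments (W k) Q"
    unfolding Q_def[abs_def]
    by (intro W.all_moments_sum W.all_moments_diff W.all_moments_power W.all_moments_const all_moments_dot W_prob am_W_coord) auto
  have am_R: "all_moments (W k) Rw"
  proof -
    have "all_moments (W k) (\<lambda>w. (\<Sum>a<k. (q (w a))\<^sup>2) - (1 / k) * (\<Sum>a<k. q (w a))\<^sup>2)"
      by (intro W.all_moments_sum W.all_moments_diff W.all_moments_power W.all_moments_const all_moments_mult am_q) auto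
    then show ?thesis by (simp add: Rw_def[abs_def])
  qed
  have kr: "0 < real k" using k by simp
  have R_eq: "Rw w = (\<Sum>a<k. (q (w a) - (\<Sum>b<k. q (w b)) / k)\<^sup>2)" for w
  proof -
    define s where "s = (\<Sum>b<k. q (w b))"
    have "(\<Sum>a<k. (q (w a) - c)\<^sup>2) = (\<Sum>a<k. (q (w a))\<^sup>2) - 2 * c * s + k * c\<^sup>2" for c :: real
      unfolding s_def by (simp add: power2_diff sum.distrib sum_subtractf sum_distrib_left mult_ac)
    then have "(\<Sum>a<k. (q (w a) - s / k)\<^sup>2) = (\<Sum>a<k. (q (w a))\<^sup>2) - 2 * (s / k) * s + k * (s / k)\<^sup>2" .
    also have "\<dots> = Rw w" using kr by (simp add: Rw_def s_def power2_eq_square field_simps)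
    finally show ?thesis by (simp add: s_def)
  qed
  have R0: "0 \<le> Rw w" for w unfolding R_eq by (intro sum_nonneg) simp
  \<comment> \<open>A sum of squared deviations is smallest about the sample average, so the true
    mean \<tau> may replace it.\<close>
  have R_le: "Rw w \<le> (\<Sum>a<k. (cquad idm (w a))\<^sup>2)" for w
  proof -
    define s where "s = (\<Sum>b<k. q (w b))"
    have "(\<Sum>a<k. (cquad idm (w a))\<^sup>2) = (\<Sum>a<k. (q (w a))\<^sup>2) - 2 * \<tau> * s + k * \<tau>\<^sup>2"
      unfolding q_id[symmetric] s_def by (simp add: power2_diff sum.distrib sum_subtractf sum_distrib_left mult_ac)
    also have "\<dots> = Rw w + (s - k * \<tau>)\<^sup>2 / k"
      using kr by (simp add: Rw_def s_def power2_eq_square field_simps)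
    finally show ?thesis using kr by simp
  qed
  have ER: "(\<integral>w. Rw w \<partial>W k) \<le> 2 * k * ?t"
  proof -
    have am: "all_moments (W k) (\<lambda>w. (cquad idm (w a))\<^sup>2)" if "a < k" for a
      by (rule am_W[OF all_moments_power[OF am_cquad] that])
    have "(\<integral>w. Rw w \<partial>W k) \<le> (\<integral>w. (\<Sum>a<k. (cquad idm (w a))\<^sup>2) \<partial>W k)"
      by (intro integral_mono all_moments_integrable am_R R_le W.all_moments_sum am) auto
    also have "\<dots> = (\<Sum>a<k. \<integral>w. (cquad idm (w a))\<^sup>2 \<partial>W k)"
      by (intro Bochner_Integration.integral_sum all_moments_integrable am) auto
    also have "\<dots> = (\<Sum>a<k. \<integral>x. (cquad idm x)\<^sup>2 \<partial>\<nu>)"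
      by (intro sum.cong refl E_W[OF all_moments_power[OF am_cquad]]) auto
    also have "\<dots> \<le> (\<Sum>a<k. 2 * ?t)"
      using quad_variance_le[of idm] by (intro sum_mono) (simp add: mt_id id2)
    finally show ?thesis by simp
  qed
  have EQ: "(\<integral>w. \<bar>Q w\<bar> \<partial>W k) \<le> 3 * (k * sqrt k * sqrt (C * p)) + 5 * (k * ?t)"
  proof -
    have "(\<integral>w. \<bar>Q w\<bar> \<partial>W k) \<le> sqrt (8 * real k ^ 3 * tra (S \<bowtie> S \<bowtie> S \<bowtie> S) + 18 * (real k)\<^sup>2 * ?t\<^sup>2)"
      by (rule W.abs_integral_le_sqrt[OF am_Q]) (simp add: Q_def offdiag_sq_deviation)
    also have "\<dots> \<le> sqrt ((3 * (k * sqrt k * sqrt (C * p)))\<^sup>2 + (5 * (k * ?t))\<^sup>2)"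
    proof (rule real_sqrt_le_mono, rule add_mono)
      have "8 * real k ^ 3 * tra (S \<bowtie> S \<bowtie> S \<bowtie> S) \<le> 9 * real k ^ 3 * (C * p)"
        using t4 u0 by (intro mult_mono) auto
      also have "\<dots> = (3 * (k * sqrt k * sqrt (C * p)))\<^sup>2"
      proof -
        define r u where "r = sqrt k" and "u = sqrt (C * p)"
        have "r * r = k" "u * u = C * p" using C by (auto simp: r_def u_def)
        moreover have "(3 * (k * r * u))\<^sup>2 = 9 * (real k * real k * (r * r)) * (u * u)"
          by (simp add: power2_eq_square)
        ultimately show ?thesis unfolding r_def[symmetric] u_def[symmetric] by (simp add: power3_eq_cube)
      qed
      finally show "8 * real k ^ 3 * tra (S \<bowtie> S \<bowtie> S \<bowtie> S) \<le> (3 * (k * sqrt k * sqrt (C * p)))\<^sup>2" .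
      show "18 * (real k)\<^sup>2 * ?t\<^sup>2 \<le> (5 * (k * ?t))\<^sup>2"
        using mult_right_mono[of 18 25 "(real k)\<^sup>2 * ?t\<^sup>2"] by (simp add: power_mult_distrib)
    qed
    also have "\<dots> \<le> sqrt ((3 * (k * sqrt k * sqrt (C * p)))\<^sup>2) + sqrt ((5 * (k * ?t))\<^sup>2)"
      by (rule sqrt_add_le_add_sqrt) auto
    also have "\<dots> = 3 * (k * sqrt k * sqrt (C * p)) + 5 * (k * ?t)"
      using t0 C by (simp only: real_sqrt_abs) simp
    finally show ?thesis .
  qed
  define d where "d = real p * (real k - 1) * (real k + 2)"
  have d: "real p * (real k * real k) \<le> d"
  proof -
    have "real k * real k \<le> (real k - 1) * (real k + 2)" using k by (simp add: algebra_simps)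
    then show ?thesis unfolding d_def mult.assoc by (intro mult_left_mono) auto
  qed
  have pk: "0 < real p * (real k * real k)" using p kr by simp
  have d0: "0 < d" using pk d by linarith
  \<comment> \<open>There are k (k - 1) off-diagonal pairs, which gives the factor k / (k + 2) = 1 -
    2 / (k + 2); the deficit is bounded separately.\<close>
  have dev: "sigma_est k w - ?t / p = (Q w + Rw w) / d - 2 * ?t / (p * (real k + 2))" for w
  proof -
    have "(\<Sum>a<k. \<Sum>b\<in>{..<k} - {a}. ?t) = (\<Sum>a<k. (real k - 1) * ?t)"
      using k by (intro sum.cong refl) (auto simp: of_nat_diff)
    then have c: "(\<Sum>a<k. \<Sum>b\<in>{..<k} - {a}. ?t) = real k * (real k - 1) * ?t" by simp
    have "tra (gm k w \<bowtie> gm k w) - (tra (gm k w))\<^sup>2 / k = Q w + Rw w + real k * (real k - 1) * ?t"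
      unfolding tra_gm_gm_self tra_gm_self split_diag Q_def Rw_def q_def by (simp add: sum_subtractf c[symmetric])
    then have "sigma_est k w = (Q w + Rw w) / d + real k * (real k - 1) * ?t / d"
      by (simp add: sigma_est_def d_def[symmetric] add_divide_distrib)
    moreover have "real k * (real k - 1) * ?t / d = ?t / p - 2 * ?t / (p * (real k + 2))"
    proof -
      have nz: "real k - 1 \<noteq> 0" "real k + 2 \<noteq> 0" "real p \<noteq> 0" using k p by auto
      have "real k * (real k - 1) * ?t / d = real k * ?t / (p * (real k + 2))"
        using nz(1) by (simp add: d_def)
      also have "\<dots> = ?t / p - 2 * ?t / (p * (real k + 2))"
      proof -
        have "?t / p = ?t * (real k + 2) / (p * (real k + 2))" using nz by simp
        then show ?thesis by (simp add: diff_divide_distrib[symmetric] algebra_simps)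
      qed
      finally show ?thesis .
    qed
    ultimately show ?thesis by simp
  qed
  have iQ: "integrable (W k) (\<lambda>w. \<bar>Q w\<bar>)" and iR: "integrable (W k) Rw"
    by (intro all_moments_integrable all_moments_abs am_Q am_R)+
  have "(\<integral>w. \<bar>sigma_est k w - ?t / p\<bar> \<partial>W k) \<le> (\<integral>w. \<bar>Q w\<bar> / d + Rw w / d + 2 * ?t / (p * (real k + 2)) \<partial>W k)"
  proof (rule integral_mono)
    show "integrable (W k) (\<lambda>w. \<bar>sigma_est k w - ?t / p\<bar>)"
      by (intro all_moments_integrable all_moments_abs W.all_moments_diff all_moments_sigma_est W.all_moments_const)
    show "integrable (W k) (\<lambda>w. \<bar>Q w\<bar> / d + Rw w / d + 2 * ?t / (p * (real k + 2)))" using iQ iR by simp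
    fix w
    have "\<bar>(Q w + Rw w) / d\<bar> \<le> \<bar>Q w\<bar> / d + Rw w / d"
    proof -
      have "\<bar>Q w + Rw w\<bar> \<le> \<bar>Q w\<bar> + Rw w" using R0[of w] by linarith
      then show ?thesis using d0 by (simp add: abs_divide add_divide_distrib[symmetric] divide_right_mono)
    qed
    moreover have "0 \<le> 2 * ?t / (p * (real k + 2))" using t0 by simp
    ultimately show "\<bar>sigma_est k w - ?t / p\<bar> \<le> \<bar>Q w\<bar> / d + Rw w / d + 2 * ?t / (p * (real k + 2))"
      unfolding dev by linarith
  qed
  also have "\<dots> = (\<integral>w. \<bar>Q w\<bar> \<partial>W k) / d + (\<integral>w. Rw w \<partial>W k) / d + 2 * ?t / (p * (real k + 2))"
    using iQ iR by (simp add: W.prob_space)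
  also have "\<dots> \<le> (3 * (k * sqrt k * sqrt (C * p)) + 5 * (k * (C * p))) / (real p * (real k * real k))
      + (2 * k * (C * p)) / (real p * (real k * real k)) + 2 * (C * p) / (p * real k)"
  proof (rule add_mono, rule add_mono)
    have Cp: "0 \<le> C * p" using C by simp
    have a: "(\<integral>w. \<bar>Q w\<bar> \<partial>W k) \<le> 3 * (k * sqrt k * sqrt (C * p)) + 5 * (k * (C * p))"
      using EQ mult_left_mono[OF t2, of "real k"] by simp
    show "(\<integral>w. \<bar>Q w\<bar> \<partial>W k) / d \<le> (3 * (k * sqrt k * sqrt (C * p)) + 5 * (k * (C * p))) / (real p * (real k * real k))"
      by (rule frac_le[OF _ a pk d]) (use Cp C in simp)
    have b: "(\<integral>w. Rw w \<partial>W k) \<le> 2 * k * (C * p)"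
      using ER mult_left_mono[OF t2, of "real k"] by simp
    show "(\<integral>w. Rw w \<partial>W k) / d \<le> (2 * k * (C * p)) / (real p * (real k * real k))"
      by (rule frac_le[OF _ b pk d]) (use Cp in simp)
    show "2 * ?t / (p * (real k + 2)) \<le> 2 * (C * p) / (p * real k)"
      by (rule frac_le) (use t2 Cp p kr in auto)
  qed
  also have "\<dots> = 3 * (sqrt (C * p) / p) / sqrt k + 9 * C / k"
  proof -
    define r where "r = sqrt k"
    have r: "0 < r" "real k = r * r" using kr by (auto simp: r_def)
    show ?thesis unfolding r_def[symmetric] r(2) using r p by (simp add: field_simps)
  qed
  also have "\<dots> \<le> 3 * C / sqrt k + 9 * C / sqrt k"
  proof (intro add_mono divide_right_mono)
    have "sqrt (C * p) \<le> C * p"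
    proof (rule real_le_lsqrt)
      have "1 \<le> C * p" using C p mult_mono[of 1 C 1 "real p"] by simp
      then show "C * p \<le> (C * p)\<^sup>2" unfolding power2_eq_square using mult_left_mono[of 1 "C * p" "C * p"] by simp
    qed (use C in auto)
    then show "3 * (sqrt (C * p) / p) \<le> 3 * C" using p by (simp add: field_simps)
    have "sqrt k \<le> k" using k by (intro real_le_lsqrt) (auto simp: power2_eq_square)
    then show "9 * C / k \<le> 9 * C / sqrt k" using C kr by (intro divide_left_mono) auto
  qed simp
  finally show ?thesis by (simp add: add_divide_distrib[symmetric])
qed

end

text \<open>Two telescoping rounds: first the x-columns are averaged out, then the y-columns. The
  two samples are coordinates of one product measure so that the averaging lemma applies to each.
  Only the rate 1 / sqrt l is kept, with constants 3 and 2.\<close>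

lemma E_sigma_cross:
  fixes C :: real
  assumes g: "gauss p \<nu> S" "gauss p \<nu>' S'" and kl: "0 < k" "0 < l" "k \<le> p" "l \<le> p" and C: "1 \<le> C"
    and t: "findim.tra p (findim.mm p S S') \<le> C * p"
      "findim.tra p (findim.mm p S' (findim.mm p S (findim.mm p S' S))) \<le> C * p"
  defines "PP \<equiv> PiM {..<2::nat} (\<lambda>b. PiM {..<(if b = 0 then k else l)} (\<lambda>_. if b = 0 then \<nu> else \<nu>'))"
    and "est \<equiv> \<lambda>w. findim.tra p (findim.mm p (findim.gm k (w 0)) (findim.gm l (w 1))) / (real k * real l * real p)"
  shows "all_moments PP est"
    and "(\<integral>w. \<bar>est w - findim.tra p (findim.mm p S S') / p\<bar> \<partial>PP) \<le> 5 * C / sqrt l"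
proof -
  interpret x: gauss p \<nu> S by fact
  interpret y: gauss p \<nu>' S' by fact
  let ?M = "\<lambda>b::nat. PiM {..<(if b = 0 then k else l)} (\<lambda>_. if b = 0 then \<nu> else \<nu>')"
  have pM: "prob_space (?M b)" for b
    by (intro prob_space_PiM) (auto intro: x.prob_space_axioms y.prob_space_axioms)
  interpret P: prob_space PP unfolding PP_def by (intro prob_space_PiM pM)
  have am0: "all_moments PP (\<lambda>w. w 0 a i)" if "a < k" "i < p" for a i
    unfolding PP_def using x.am_W_coord[OF that]
    by (intro all_moments_PiM[where f = "\<lambda>w. w _ _" and M = ?M] pM) auto
  have am1: "all_moments PP (\<lambda>w. w 1 a i)" if "a < l" "i < p" for a i
    unfolding PP_def using y.am_W_coord[OF that]
    by (intro all_moments_PiM[where f = "\<lambda>w. w _ _" and M = ?M] pM) auto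
  define A where "A w = x.gm k (w 0)" for w :: "nat \<Rightarrow> nat \<Rightarrow> fvec"
  define B where "B w = x.gm l (w 1)" for w :: "nat \<Rightarrow> nat \<Rightarrow> fvec"
  have amA: "all_moments PP (\<lambda>w. A w i j)" if "i < p" "j < p" for i j
    unfolding A_def using that by (intro x.all_moments_gm P.prob_space_axioms am0)
  have amB: "all_moments PP (\<lambda>w. B w i j)" if "i < p" "j < p" for i j
    unfolding B_def using that by (intro x.all_moments_gm P.prob_space_axioms am1)
  have amS: "all_moments PP (\<lambda>w. S i j)" for i j by (rule P.all_moments_const)
  have amAB: "all_moments PP (\<lambda>w. x.tra (x.mm (A w) (B w)))"
    and amBS: "all_moments PP (\<lambda>w. x.tra (x.mm (B w) S))"
    by (intro x.all_moments_tra x.all_moments_mm P.prob_space_axioms amA amB amS; assumption)+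
  show "all_moments PP est"
  proof -
    have "all_moments PP (\<lambda>w. (1 / (real k * real l * real p)) * x.tra (x.mm (A w) (B w)))"
      by (intro all_moments_mult P.all_moments_const amAB)
    then show ?thesis by (simp add: est_def A_def B_def)
  qed
  let ?t = "x.tra (x.mm S S')"
  have P0: "0 < real p" using kl by simp
  have "0 \<le> ?t" by (rule x.tra_gram_nonneg[OF x.gram_S y.gram_S])
  have tc: "x.tra (x.mm S S') = x.tra (x.mm S' S)" by (rule x.tra_comm)
  have e1: "(\<integral>w. \<bar>x.tra (x.mm (A w) (B w)) - real k * x.tra (x.mm (B w) S)\<bar> \<partial>PP) \<le> sqrt (2 * k * (4 * C\<^sup>2 * l * (real p)\<^sup>2))"
  proof (rule P.abs_integral_le_sqrt)
    show "all_moments PP (\<lambda>w. x.tra (x.mm (A w) (B w)) - real k * x.tra (x.mm (B w) S))"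
      by (intro P.all_moments_diff all_moments_mult P.all_moments_const amAB amBS)
    have amF: "all_moments PP (\<lambda>w. x.tra (x.mm (B w) (x.mm S (x.mm (B w) S))))"
      by (intro x.all_moments_tra x.all_moments_mm P.prob_space_axioms amB amS; assumption)
    have "(\<integral>w. (x.tra (x.mm (A w) (B w)) - real k * x.tra (x.mm (B w) S))\<^sup>2 \<partial>PP)
        \<le> (\<integral>w. 2 * real k * x.tra (x.mm (B w) (x.mm S (x.mm (B w) S))) \<partial>PP)"
      unfolding PP_def
    proof (rule integral_PiM_average_le[where j = 0])
      show "integrable (PiM {..<2} ?M) (\<lambda>w. (x.tra (x.mm (A w) (B w)) - real k * x.tra (x.mm (B w) S))\<^sup>2)"
        unfolding PP_def[symmetric]
        by (intro all_moments_integrable P.all_moments_power P.all_moments_diff all_moments_mult P.all_moments_const amAB amBS)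
      show "integrable (PiM {..<2} ?M) (\<lambda>w. 2 * real k * x.tra (x.mm (B w) (x.mm S (x.mm (B w) S))))"
        unfolding PP_def[symmetric] by (intro integrable_mult_right all_moments_integrable amF)
      show "(\<integral>y. (x.tra (x.mm (A (w(0 := y))) (B (w(0 := y)))) - real k * x.tra (x.mm (B (w(0 := y))) S))\<^sup>2 \<partial>?M 0)
          \<le> 2 * real k * x.tra (x.mm (B w) (x.mm S (x.mm (B w) S)))" for w
        using x.tra_variance_le[of k "B w"] by (simp add: A_def B_def)
    qed (use pM in auto)
    also have "\<dots> = 2 * real k * (\<integral>w. x.tra (x.mm (B w) (x.mm S (x.mm (B w) S))) \<partial>PP)" by simp
    also have "\<dots> \<le> 2 * real k * (4 * C\<^sup>2 * l * (real p)\<^sup>2)"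
    proof (rule mult_left_mono)
      have bound: "(\<integral>y. x.tra (x.mm (x.gm l y) (x.mm S (x.mm (x.gm l y) S))) \<partial>y.W l) \<le> 4 * C\<^sup>2 * l * (real p)\<^sup>2"
      proof -
        have "(\<integral>y. x.tra (x.mm (x.gm l y) (x.mm S (x.mm (x.gm l y) S))) \<partial>y.W l)
            \<le> (real l)\<^sup>2 * x.tra (x.mm S (x.mm S' (x.mm S S'))) + 3 * real l * (?t * ?t)"
          by (rule y.E_tra_tra_le[OF x.gram_S x.gram_S])
        also have "\<dots> \<le> (real l * real p) * (C\<^sup>2 * p) + 3 * real l * ((C * p) * (C * p))"
        proof (rule add_mono; (rule mult_mono)?)
          show "(real l)\<^sup>2 \<le> real l * real p" using kl by (simp add: power2_eq_square)
          have "x.tra (x.mm S (x.mm S' (x.mm S S'))) = x.tra (x.mm S' (x.mm S (x.mm S' S)))"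
            using x.tra_comm[of S "x.mm S' (x.mm S S')"] by simp
          also have "\<dots> \<le> C * p" by (rule t(2))
          also have "\<dots> \<le> C\<^sup>2 * p" using C by (simp add: power2_eq_square mult_right_mono)
          finally show "x.tra (x.mm S (x.mm S' (x.mm S S'))) \<le> C\<^sup>2 * p" .
          show "0 \<le> x.tra (x.mm S (x.mm S' (x.mm S S')))"
            using y.tra_gram_SS_nonneg[OF x.gram_S x.gram_S] .
          show "?t * ?t \<le> (C * p) * (C * p)" using t(1) \<open>0 \<le> ?t\<close> C by (intro mult_mono) auto
        qed (use \<open>0 \<le> ?t\<close> C in auto)
        also have "\<dots> = 4 * C\<^sup>2 * l * (real p)\<^sup>2" by (simp add: power2_eq_square algebra_simps)
        finally show ?thesis .
      qed
      have "(\<integral>w. x.tra (x.mm (B w) (x.mm S (x.mm (B w) S))) \<partial>PP) \<le> (\<integral>w. 4 * C\<^sup>2 * l * (real p)\<^sup>2 \<partial>PP)"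
        unfolding PP_def
      proof (rule integral_PiM_average_le[where j = 1])
        show "integrable (PiM {..<2} ?M) (\<lambda>w. x.tra (x.mm (B w) (x.mm S (x.mm (B w) S))))"
          unfolding PP_def[symmetric] by (intro all_moments_integrable amF)
        show "(\<integral>y. x.tra (x.mm (B (w(1 := y))) (x.mm S (x.mm (B (w(1 := y))) S))) \<partial>?M 1) \<le> 4 * C\<^sup>2 * l * (real p)\<^sup>2" for w
          using bound by (simp add: B_def)
      qed (use pM P.integrable_const in \<open>auto simp: PP_def\<close>)
      then show "(\<integral>w. x.tra (x.mm (B w) (x.mm S (x.mm (B w) S))) \<partial>PP) \<le> 4 * C\<^sup>2 * l * (real p)\<^sup>2"
        by (simp add: P.prob_space)
    qed simp
    finally show "(\<integral>w. (x.tra (x.mm (A w) (B w)) - real k * x.tra (x.mm (B w) S))\<^sup>2 \<partial>PP) \<le> 2 * k * (4 * C\<^sup>2 * l * (real p)\<^sup>2)" by simp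
  qed
  have e2: "(\<integral>w. \<bar>x.tra (x.mm (B w) S) - real l * ?t\<bar> \<partial>PP) \<le> sqrt (2 * l * (C * p))"
  proof -
    have "(\<integral>w. \<bar>x.tra (x.mm (B w) S) - real l * ?t\<bar> \<partial>PP) \<le> (\<integral>w. sqrt (2 * l * (C * p)) \<partial>PP)"
      unfolding PP_def
    proof (rule integral_PiM_average_le[where j = 1])
      show "integrable (PiM {..<2} ?M) (\<lambda>w. \<bar>x.tra (x.mm (B w) S) - real l * ?t\<bar>)"
        unfolding PP_def[symmetric] by (intro all_moments_integrable all_moments_abs P.all_moments_diff P.all_moments_const amBS)
      have "(\<integral>y. \<bar>x.tra (x.mm (x.gm l y) S) - real l * ?t\<bar> \<partial>y.W l) \<le> sqrt (2 * real l * x.tra (x.mm S (x.mm S' (x.mm S S'))))"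
        using y.E_abs_tra_le[of l S] by simp
      also have "\<dots> \<le> sqrt (2 * l * (C * p))"
        using t(2) x.tra_comm[of S "x.mm S' (x.mm S S')"]
        by (intro real_sqrt_le_mono) (simp add: mult.assoc mult_left_mono)
      finally show "(\<integral>y. \<bar>x.tra (x.mm (B (w(1 := y))) S) - real l * ?t\<bar> \<partial>?M 1) \<le> sqrt (2 * l * (C * p))" for w
        by (simp add: B_def)
    qed (use pM P.integrable_const in \<open>auto simp: PP_def\<close>)
    then show ?thesis by (simp add: P.prob_space)
  qed
  define d where "d = real k * real l * real p"
  have d0: "0 < d" using kl P0 by (simp add: d_def)
  have iAB: "integrable PP (\<lambda>w. \<bar>x.tra (x.mm (A w) (B w)) - real k * x.tra (x.mm (B w) S)\<bar>)"
    and iBS: "integrable PP (\<lambda>w. \<bar>x.tra (x.mm (B w) S) - real l * ?t\<bar>)"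
    by (intro all_moments_integrable all_moments_abs P.all_moments_diff all_moments_mult P.all_moments_const amAB amBS)+
  have "(\<integral>w. \<bar>est w - ?t / p\<bar> \<partial>PP)
      \<le> (\<integral>w. (\<bar>x.tra (x.mm (A w) (B w)) - real k * x.tra (x.mm (B w) S)\<bar> + real k * \<bar>x.tra (x.mm (B w) S) - real l * ?t\<bar>) / d \<partial>PP)"
  proof (rule integral_mono)
    show "integrable PP (\<lambda>w. \<bar>est w - ?t / p\<bar>)"
      by (intro all_moments_integrable all_moments_abs P.all_moments_diff P.all_moments_const \<open>all_moments PP est\<close>)
    show "integrable PP (\<lambda>w. (\<bar>x.tra (x.mm (A w) (B w)) - real k * x.tra (x.mm (B w) S)\<bar> + real k * \<bar>x.tra (x.mm (B w) S) - real l * ?t\<bar>) / d)"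
      using iAB iBS by simp
    fix w
    define a b where "a = x.tra (x.mm (A w) (B w)) - real k * x.tra (x.mm (B w) S)" and "b = x.tra (x.mm (B w) S) - real l * ?t"
    have "est w - ?t / p = (a + real k * b) / d"
      using kl P0 unfolding est_def A_def[symmetric] B_def[symmetric] d_def a_def b_def by (simp add: field_simps)
    then have "\<bar>est w - ?t / p\<bar> = \<bar>a + real k * b\<bar> / d" using d0 by (simp add: abs_divide)
    also have "\<dots> \<le> (\<bar>a\<bar> + real k * \<bar>b\<bar>) / d"
      using d0 abs_triangle_ineq[of a "real k * b"] by (intro divide_right_mono) (auto simp: abs_mult)
    finally show "\<bar>est w - ?t / p\<bar> \<le> (\<bar>x.tra (x.mm (A w) (B w)) - real k * x.tra (x.mm (B w) S)\<bar> + real k * \<bar>x.tra (x.mm (B w) S) - real l * ?t\<bar>) / d"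
      unfolding a_def b_def .
  qed
  also have "\<dots> = ((\<integral>w. \<bar>x.tra (x.mm (A w) (B w)) - real k * x.tra (x.mm (B w) S)\<bar> \<partial>PP) + real k * (\<integral>w. \<bar>x.tra (x.mm (B w) S) - real l * ?t\<bar> \<partial>PP)) / d"
    using iAB iBS by simp
  also have "\<dots> \<le> (sqrt (2 * k * (4 * C\<^sup>2 * l * (real p)\<^sup>2)) + real k * sqrt (2 * l * (C * p))) / d"
    using d0 e1 e2 by (intro divide_right_mono add_mono mult_left_mono) auto
  also have "\<dots> \<le> (3 * C * (k * p * sqrt l) + 2 * C * (k * p * sqrt l)) / d"
  proof (intro divide_right_mono add_mono)
    have gen: "x \<le> y" if "x\<^sup>2 \<le> y\<^sup>2" "0 \<le> y" for x y :: real using that by (rule power2_le_imp_le)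
    show "sqrt (2 * k * (4 * C\<^sup>2 * l * (real p)\<^sup>2)) \<le> 3 * C * (k * p * sqrt l)"
    proof (rule gen)
      have "(sqrt (2 * k * (4 * C\<^sup>2 * l * (real p)\<^sup>2)))\<^sup>2 = 8 * (real k * (C\<^sup>2 * l * (real p)\<^sup>2))" by simp
      also have "\<dots> \<le> 9 * ((real k * real k) * (C\<^sup>2 * l * (real p)\<^sup>2))"
        using kl by (intro mult_mono) auto
      also have "\<dots> = (3 * C * (k * p * sqrt l))\<^sup>2" by (simp add: power_mult_distrib) (simp add: power2_eq_square)
      finally show "(sqrt (2 * k * (4 * C\<^sup>2 * l * (real p)\<^sup>2)))\<^sup>2 \<le> (3 * C * (k * p * sqrt l))\<^sup>2" .
    qed (use C in simp)
    show "real k * sqrt (2 * l * (C * p)) \<le> 2 * C * (k * p * sqrt l)"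
    proof (rule gen)
      have "(real k * sqrt (2 * l * (C * p)))\<^sup>2 = 2 * ((real k)\<^sup>2 * l * (C * p))" using C by (simp add: power_mult_distrib)
      also have "\<dots> \<le> 4 * ((real k)\<^sup>2 * l * ((C * C) * (real p * real p)))"
        using C kl by (intro mult_mono mult_left_mono) auto
      also have "\<dots> = (2 * C * (k * p * sqrt l))\<^sup>2" by (simp add: power_mult_distrib) (simp add: power2_eq_square)
      finally show "(real k * sqrt (2 * l * (C * p)))\<^sup>2 \<le> (2 * C * (k * p * sqrt l))\<^sup>2" .
    qed (use C in simp)
  qed (use d0 in simp)
  also have "\<dots> = 5 * C / sqrt l"
  proof -
    define r where "r = sqrt l"
    have r: "0 < r" "real l = r * r" using kl by (auto simp: r_def)
    show ?thesis unfolding d_def r_def[symmetric] r(2) using r kl P0 by (simp add: field_simps)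
  qed
  finally show "(\<integral>w. \<bar>est w - ?t / p\<bar> \<partial>PP) \<le> 5 * C / sqrt l" .
qed

section \<open>The two-sample experiment\<close>

context findim
begin

lemma mat_fun_mult:
  "A \<in> carrier_mat p p \<Longrightarrow> B \<in> carrier_mat p p \<Longrightarrow> mat_fun p (A * B) = mat_fun p A \<bowtie> mat_fun p B"
  by (intro ext) (auto simp: mat_fun_def mm_def scalar_prod_def lessThan_atLeast0 intro!: sum.cong)

lemma tr_mat_fun: "A \<in> carrier_mat p p \<Longrightarrow> tr A = tra (mat_fun p A)"
  by (auto simp: tr_def tra_def mat_fun_def)

lemma word_mat_carrier: "(\<And>x. A x \<in> carrier_mat p p) \<Longrightarrow> word_mat p A w \<in> carrier_mat p p"
  by (induction w) (auto simp: word_mat_def intro!: mult_carrier_mat[where n = p])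

lemma mat_fun_word:
  assumes A: "\<And>x. A x \<in> carrier_mat p p" and "w \<noteq> []"
  shows "mat_fun p (word_mat p A (map \<tau> w)) = wmat (\<lambda>b. mat_fun p (A (\<tau> b))) w"
  using \<open>w \<noteq> []\<close>
proof (induction w rule: list_nonempty_induct)
  case (single x)
  then show ?case using A[of "\<tau> x"] by (simp add: word_mat_def)
next
  case (cons x xs)
  then obtain y ys where xs: "xs = y # ys" by (cases xs) auto
  have "word_mat p A (map \<tau> (x # xs)) = A (\<tau> x) * word_mat p A (map \<tau> xs)" by (simp add: word_mat_def)
  then show ?case using cons.IH mat_fun_mult[OF A word_mat_carrier[OF A]] xs by simp
qed

text \<open>The Helmert images are uncontrolled beyond \<open>p\<close>, whereas
  \<open>mat_fun\<close> is zero there; traces of products do not see the difference.\<close>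

definition agree :: "fmat \<Rightarrow> fmat \<Rightarrow> bool" where
  "agree A B \<longleftrightarrow> (\<forall>i<p. \<forall>j<p. A i j = B i j)"

lemma agree_mm: "agree A A' \<Longrightarrow> agree B B' \<Longrightarrow> agree (A \<bowtie> B) (A' \<bowtie> B')"
  by (simp add: agree_def mm_def)

lemma agree_tra: "agree A B \<Longrightarrow> tra A = tra B"
  by (simp add: agree_def tra_def)

end

section \<open>Scatter matrices and estimators as traces; measurability\<close>

lemma scatter_carrier [simp]: "scatter p I v \<in> carrier_mat p p"
  by (simp add: scatter_def)

text \<open>Centring cancels the shift \<open>c\<close>, and \<open>h\<close> turns the subsample
  into an initial segment, the form in which \<open>centred_gram\<close> applies.\<close>

lemma scatter_translate:
  fixes k :: nat
  assumes h: "bij_betw h {..<k} I" and k: "0 < k"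
    and v: "\<And>i j. i \<in> I \<Longrightarrow> j < p \<Longrightarrow> v i j = z i j + c j" and ij: "i < p" "j < p"
  shows "scatter p I v $$ (i, j) =
    (\<Sum>a<k. (z (h a) i - (\<Sum>b<k. z (h b) i) / k) * (z (h a) j - (\<Sum>b<k. z (h b) j) / k))"
proof -
  have card: "card I = k" using bij_betw_same_card[OF h] by simp
  have mean: "sample_mean I v j = (\<Sum>b<k. z (h b) j) / k + c j" if "j < p" for j
  proof -
    have "(\<Sum>i\<in>I. v i j) = (\<Sum>i\<in>I. z i j + c j)" using that by (intro sum.cong refl v)
    also have "\<dots> = (\<Sum>b<k. z (h b) j + c j)" by (rule sum.reindex_bij_betw[OF h, symmetric])
    finally show ?thesis using k by (simp add: sample_mean_def card sum.distrib add_divide_distrib)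
  qed
  have "scatter p I v $$ (i, j) = (\<Sum>x\<in>I. (z x i - (\<Sum>b<k. z (h b) i) / k) * (z x j - (\<Sum>b<k. z (h b) j) / k))"
    using ij by (simp add: scatter_def mean v)
  then show ?thesis by (simp add: sum.reindex_bij_betw[OF h, symmetric])
qed

lemma sigma_hat_same_tr:
  assumes "scatter p {1..K} v = A" "2 \<le> K" "A \<in> carrier_mat p p"
  shows "sigma_hat_same p K v = (tr (A * A) - (tr A)\<^sup>2 / (real K - 1)) / (real p * (real K - 2) * (real K + 1))"
proof -
  interpret findim p .
  define s e d where "s = 1 / (real K - 1)" and "e = real K - 1" and "d = real p * (real K - 2) * (real K + 1)"
  have "tr ((s \<cdot>\<^sub>m A) * (s \<cdot>\<^sub>m A)) = s\<^sup>2 * tr (A * A)"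
    using assms(3) by (simp add: tr_def scalar_prod_def sum_distrib_left power2_eq_square mult_ac)
  moreover have "tr (s \<cdot>\<^sub>m A) = s * tr A"
    using assms(3) by (simp add: tr_def sum_distrib_left)
  ultimately have "sigma_hat_same p K v = e\<^sup>2 / d * (s\<^sup>2 * tr (A * A) - s\<^sup>2 * (tr A)\<^sup>2 / e)"
    unfolding sigma_hat_same_def Let_def sample_cov_def assms(1) unfolding s_def[symmetric] d_def[symmetric]
    by (simp only: power_mult_distrib e_def)
  also have "\<dots> = (e\<^sup>2 * s\<^sup>2) * ((tr (A * A) - (tr A)\<^sup>2 / e) / d)"
    by (simp add: right_diff_distrib diff_divide_distrib mult_ac)
  also have "e\<^sup>2 * s\<^sup>2 = 1" using assms(2) by (simp add: s_def e_def power_divide)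
  finally show ?thesis by (simp add: e_def d_def)
qed

lemma sigma_hat_cross_tr:
  assumes "scatter p {1..K} x = A" "scatter p {1..L} y = B" "A \<in> carrier_mat p p" "B \<in> carrier_mat p p"
  shows "sigma_hat_cross p K L x y = tr (A * B) / ((real K - 1) * (real L - 1) * real p)"
proof -
  define s r where "s = 1 / (real K - 1)" and "r = 1 / (real L - 1)"
  have "tr ((s \<cdot>\<^sub>m A) * (r \<cdot>\<^sub>m B)) = s * r * tr (A * B)"
    using assms(3,4) by (simp add: tr_def scalar_prod_def sum_distrib_left mult_ac)
  then show ?thesis
    unfolding sigma_hat_cross_def sample_cov_def assms(1,2) s_def[symmetric] r_def[symmetric]
    by (simp add: s_def r_def)
qed

lemma borel_measurable_scatter:
  assumes "\<And>i j. i \<in> I \<Longrightarrow> j < p \<Longrightarrow> (\<lambda>\<omega>. x \<omega> i j) \<in> borel_measurable F" "i < p" "j < p"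
  shows "(\<lambda>\<omega>. scatter p I (x \<omega>) $$ (i, j)) \<in> borel_measurable F"
  using assms(2,3)
  by (auto simp: scatter_def sample_mean_def intro!: borel_measurable_sum borel_measurable_times borel_measurable_diff
      borel_measurable_divide borel_measurable_const assms(1))

lemma borel_measurable_mult_mat:
  fixes A B :: "'a \<Rightarrow> real mat"
  assumes "\<And>\<omega>. A \<omega> \<in> carrier_mat p p" "\<And>\<omega>. B \<omega> \<in> carrier_mat p p"
    and "\<And>i j. i < p \<Longrightarrow> j < p \<Longrightarrow> (\<lambda>\<omega>. A \<omega> $$ (i, j)) \<in> borel_measurable F"
    and "\<And>i j. i < p \<Longrightarrow> j < p \<Longrightarrow> (\<lambda>\<omega>. B \<omega> $$ (i, j)) \<in> borel_measurable F"
    and "i < p" "j < p"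
  shows "(\<lambda>\<omega>. (A \<omega> * B \<omega>) $$ (i, j)) \<in> borel_measurable F"
proof -
  have "(A \<omega> * B \<omega>) $$ (i, j) = (\<Sum>k<p. A \<omega> $$ (i, k) * B \<omega> $$ (k, j))" for \<omega>
    using assms(1)[of \<omega>] assms(2)[of \<omega>] assms(5,6) by (simp add: scalar_prod_def lessThan_atLeast0)
  note eq = this
  show ?thesis unfolding eq
    by (rule borel_measurable_sum, rule borel_measurable_times)
      (use assms(3)[OF \<open>i < p\<close>] assms(4)[OF _ \<open>j < p\<close>] in auto)
qed

lemma borel_measurable_tr:
  assumes "\<And>\<omega>. A \<omega> \<in> carrier_mat p p" "\<And>i j. i < p \<Longrightarrow> j < p \<Longrightarrow> (\<lambda>\<omega>. A \<omega> $$ (i, j)) \<in> borel_measurable F"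
  shows "(\<lambda>\<omega>. tr (A \<omega>)) \<in> borel_measurable F"
proof -
  have "tr (A \<omega>) = (\<Sum>i<p. A \<omega> $$ (i, i))" for \<omega> using assms(1)[of \<omega>] by (simp add: tr_def)
  then show ?thesis using assms(2) by (auto intro!: borel_measurable_sum)
qed

text \<open>\<open>F\<close> is arbitrary because it will be the sigma-algebra generated by the
  observations alone, which is what independence from the splits calls for.\<close>

lemma borel_measurable_T_stat:
  assumes x: "\<And>i j. i \<in> {1..4 * m} \<Longrightarrow> j < p \<Longrightarrow> (\<lambda>\<omega>. x \<omega> i j) \<in> borel_measurable F"
    and y: "\<And>i j. i \<in> {1..4 * n} \<Longrightarrow> j < p \<Longrightarrow> (\<lambda>\<omega>. y \<omega> i j) \<in> borel_measurable F"
  shows "(\<lambda>\<omega>. T_stat p m n a b (x \<omega>) (y \<omega>)) \<in> borel_measurable F"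
proof -
  have sub[simp]: "sub_scatter p k c v l \<in> carrier_mat p p" for k c v l by (simp add: sub_scatter_def)
  have cov[simp]: "sample_cov p K v \<in> carrier_mat p p" for K v by (simp add: sample_cov_def)
  have prod[simp]: "A * B \<in> carrier_mat p p" if "A \<in> carrier_mat p p" "B \<in> carrier_mat p p" for A B :: "real mat"
    using that by simp
  have mx: "(\<lambda>\<omega>. sub_scatter p m a (x \<omega>) l $$ (i, j)) \<in> borel_measurable F"
    and my: "(\<lambda>\<omega>. sub_scatter p n b (y \<omega>) l $$ (i, j)) \<in> borel_measurable F"
    and cx: "(\<lambda>\<omega>. sample_cov p (4 * m) (x \<omega>) $$ (i, j)) \<in> borel_measurable F"
    and cy: "(\<lambda>\<omega>. sample_cov p (4 * n) (y \<omega>) $$ (i, j)) \<in> borel_measurable F" if "i < p" "j < p" for i j l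
  proof -
    have s: "sample_cov p K v $$ (i, j) = (1 / (real K - 1)) * scatter p {1..K} v $$ (i, j)" for K v
      using that by (simp add: sample_cov_def scatter_def)
    show "(\<lambda>\<omega>. sub_scatter p m a (x \<omega>) l $$ (i, j)) \<in> borel_measurable F"
      "(\<lambda>\<omega>. sub_scatter p n b (y \<omega>) l $$ (i, j)) \<in> borel_measurable F"
      unfolding sub_scatter_def by (rule borel_measurable_scatter; use x y that in simp)+
    show "(\<lambda>\<omega>. sample_cov p (4 * m) (x \<omega>) $$ (i, j)) \<in> borel_measurable F"
      "(\<lambda>\<omega>. sample_cov p (4 * n) (y \<omega>) $$ (i, j)) \<in> borel_measurable F"
      unfolding s by (intro borel_measurable_times borel_measurable_const borel_measurable_scatter; use x y that in simp)+
  qed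
  have m4: "(\<lambda>\<omega>. tr (A \<omega> * B \<omega> * C \<omega> * D \<omega>)) \<in> borel_measurable F"
    if "\<And>\<omega>. A \<omega> \<in> carrier_mat p p" "\<And>\<omega>. B \<omega> \<in> carrier_mat p p" "\<And>\<omega>. C \<omega> \<in> carrier_mat p p" "\<And>\<omega>. D \<omega> \<in> carrier_mat p p"
      "\<And>i j. i < p \<Longrightarrow> j < p \<Longrightarrow> (\<lambda>\<omega>. A \<omega> $$ (i, j)) \<in> borel_measurable F"
      "\<And>i j. i < p \<Longrightarrow> j < p \<Longrightarrow> (\<lambda>\<omega>. B \<omega> $$ (i, j)) \<in> borel_measurable F"
      "\<And>i j. i < p \<Longrightarrow> j < p \<Longrightarrow> (\<lambda>\<omega>. C \<omega> $$ (i, j)) \<in> borel_measurable F"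
      "\<And>i j. i < p \<Longrightarrow> j < p \<Longrightarrow> (\<lambda>\<omega>. D \<omega> $$ (i, j)) \<in> borel_measurable F" for A B C D
    using that
    by (intro borel_measurable_tr[where p = p] borel_measurable_mult_mat[where p = p and A = "\<lambda>\<omega>. A \<omega> * B \<omega> * C \<omega>" and B = D]
        borel_measurable_mult_mat[where p = p and A = "\<lambda>\<omega>. A \<omega> * B \<omega>" and B = C]
        borel_measurable_mult_mat[where p = p and A = A and B = B]) auto
  have m2: "(\<lambda>\<omega>. tr (A \<omega> * B \<omega>)) \<in> borel_measurable F"
    if "\<And>\<omega>. A \<omega> \<in> carrier_mat p p" "\<And>\<omega>. B \<omega> \<in> carrier_mat p p"
      "\<And>i j. i < p \<Longrightarrow> j < p \<Longrightarrow> (\<lambda>\<omega>. A \<omega> $$ (i, j)) \<in> borel_measurable F"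
      "\<And>i j. i < p \<Longrightarrow> j < p \<Longrightarrow> (\<lambda>\<omega>. B \<omega> $$ (i, j)) \<in> borel_measurable F" for A B
    using that by (intro borel_measurable_tr[where p = p] borel_measurable_mult_mat[where p = p and A = A and B = B]) auto
  have [measurable]: "(\<lambda>\<omega>. theta_hat p m n a b (x \<omega>) (y \<omega>)) \<in> borel_measurable F"
    unfolding theta_hat_def Let_def
    by (intro borel_measurable_divide borel_measurable_diff borel_measurable_const m4 sub mx my)
  have [measurable]: "(\<lambda>\<omega>. tr (sample_cov p (4 * m) (x \<omega>))) \<in> borel_measurable F"
    "(\<lambda>\<omega>. tr (sample_cov p (4 * n) (y \<omega>))) \<in> borel_measurable F"
    "(\<lambda>\<omega>. tr (sample_cov p (4 * m) (x \<omega>) * sample_cov p (4 * m) (x \<omega>))) \<in> borel_measurable F"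
    "(\<lambda>\<omega>. tr (sample_cov p (4 * n) (y \<omega>) * sample_cov p (4 * n) (y \<omega>))) \<in> borel_measurable F"
    "(\<lambda>\<omega>. tr (sample_cov p (4 * m) (x \<omega>) * sample_cov p (4 * n) (y \<omega>))) \<in> borel_measurable F"
    by (rule borel_measurable_tr[OF cov cx] borel_measurable_tr[OF cov cy] m2[OF cov cov cx cx]
        m2[OF cov cov cy cy] m2[OF cov cov cx cy]; assumption)+
  have [measurable]: "(\<lambda>\<omega>. sigma_hat_same p (4 * m) (x \<omega>)) \<in> borel_measurable F"
    "(\<lambda>\<omega>. sigma_hat_same p (4 * n) (y \<omega>)) \<in> borel_measurable F"
    "(\<lambda>\<omega>. sigma_hat_cross p (4 * m) (4 * n) (x \<omega>) (y \<omega>)) \<in> borel_measurable F"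
    unfolding sigma_hat_same_def sigma_hat_cross_def Let_def by measurable
  show ?thesis unfolding T_stat_def Let_def by measurable
qed

section \<open>One experiment: independent Gram representations of scatter matrices\<close>

locale two_samples =
  fixes M :: "'a measure" and p m n :: nat and \<mu>x \<mu>y :: "real Matrix.vec" and Sx Sy :: "real mat"
    and X Y :: "nat \<Rightarrow> 'a \<Rightarrow> nat \<Rightarrow> real" and cx cy :: "'a \<Rightarrow> nat \<Rightarrow> nat"
  assumes two_sample: "two_sample_experiment M p m n \<mu>x Sx \<mu>y Sy X Y cx cy"
    and p0: "0 < p" and m1: "1 \<le> m" and n1: "1 \<le> n"
    and \<mu>x: "\<mu>x \<in> carrier_vec p" and \<mu>y: "\<mu>y \<in> carrier_vec p"
    and posx: "pos_def p Sx" and posy: "pos_def p Sy"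
begin

sublocale prob_space M using two_sample by (simp add: two_sample_experiment_def)
sublocale findim p .

text \<open>A population label \<open>q\<close> lets both samples share one set of lemmas;
  \<open>src\<close> translates back to the labels of the experiment.\<close>

definition size :: "pop \<Rightarrow> nat" where "size q = (case q of PX \<Rightarrow> m | PY \<Rightarrow> n)"
definition mean :: "pop \<Rightarrow> real Matrix.vec" where "mean q = (case q of PX \<Rightarrow> \<mu>x | PY \<Rightarrow> \<mu>y)"
definition src :: "pop \<Rightarrow> nat \<Rightarrow> source" where "src q i = (case q of PX \<Rightarrow> XObs i | PY \<Rightarrow> YObs i)"
definition obs :: "pop \<Rightarrow> nat \<Rightarrow> 'a \<Rightarrow> fvec" where "obs q i = (case q of PX \<Rightarrow> X i | PY \<Rightarrow> Y i)"
abbreviation "Sig q \<equiv> pop_cov Sx Sy q"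
abbreviation "Np q \<equiv> centred_mvn p (Sig q)"
abbreviation "Sf q \<equiv> mat_fun p (Sig q)"
definition srcs :: "source set" where "srcs = XObs ` {1..4 * m} \<union> YObs ` {1..4 * n}"

text \<open>The value at the split labels is a default; only labels in \<open>srcs\<close> are
  used.\<close>

definition Zc :: "source \<Rightarrow> 'a \<Rightarrow> fvec" where
  "Zc s \<omega> = (\<lambda>j\<in>{..<p}. case s of XObs i \<Rightarrow> X i \<omega> j - \<mu>x $ j | YObs i \<Rightarrow> Y i \<omega> j - \<mu>y $ j | _ \<Rightarrow> 0)"

lemma pos_Sig: "pos_def p (Sig q)" and mean_carrier: "mean q \<in> carrier_vec p"
  using posx posy \<mu>x \<mu>y by (cases q; simp add: pop_cov_def mean_def)+

lemma Sig_carrier: "Sig q \<in> carrier_mat p p"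
  using pos_Sig by (simp add: pos_def_def)

lemma size_ge: "1 \<le> size q" using m1 n1 by (cases q) (auto simp: size_def)

lemma src_inj: "src q i = src q' i' \<longleftrightarrow> q = q' \<and> i = i'"
  by (cases q; cases q') (auto simp: src_def)

lemma src_srcs: "src q i \<in> srcs \<longleftrightarrow> i \<in> {1..4 * size q}"
  by (cases q) (auto simp: src_def srcs_def size_def)

lemma Zc_src: "Zc (src q i) \<omega> = (\<lambda>j\<in>{..<p}. obs q i \<omega> j - mean q $ j)"
  by (cases q) (simp_all add: Zc_def src_def obs_def mean_def)

lemma obs_distributed:
  assumes "i \<in> {1..4 * size q}"
  shows "distributed M (vec_space p) (obs q i) (mvn_density p (mean q) (Sig q))"
  using two_sample assms
  by (cases q) (auto simp: two_sample_experiment_def obs_def mean_def pop_cov_def size_def)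

lemma obs_measurable: "i \<in> {1..4 * size q} \<Longrightarrow> obs q i \<in> M \<rightarrow>\<^sub>M vec_space p"
  using obs_distributed by (rule distributed_measurable)

lemma law_Zc: "i \<in> {1..4 * size q} \<Longrightarrow> distr M (vec_space p) (Zc (src q i)) = Np q"
  using centred_mvn(1)[OF pos_Sig mean_carrier prob_space_axioms obs_distributed, of i q]
  by (simp add: Zc_src[abs_def])

text \<open>The first observation of the sample witnesses that the density is normalised, so the
  sample must not be empty.\<close>

lemma gauss_pop: "gauss p (Np q) (Sf q)"
  using centred_mvn(2)[OF pos_Sig mean_carrier prob_space_axioms obs_distributed[of 1 q]] size_ge[of q] by auto

definition gen :: "source \<Rightarrow> 'a set set" where
  "gen s = (case s of
     XObs i \<Rightarrow> sets (vimage_algebra (space M) (X i) (vec_space p))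
   | YObs i \<Rightarrow> sets (vimage_algebra (space M) (Y i) (vec_space p))
   | XSplit \<Rightarrow> sets (vimage_algebra (space M) cx (count_space (splits m)))
   | YSplit \<Rightarrow> sets (vimage_algebra (space M) cy (count_space (splits n))))"

lemma indep_gen: "indep_sets gen (srcs \<union> {XSplit, YSplit})"
  using two_sample unfolding two_sample_experiment_def gen_def[abs_def] srcs_def by blast

lemma gen_src: "i \<in> {1..4 * size q} \<Longrightarrow> gen (src q i) = {obs q i -` A \<inter> space M |A. A \<in> sets (vec_space p)}"
  using obs_measurable[of i q, THEN measurable_space]
  by (cases q) (simp_all add: gen_def src_def obs_def sets_vimage_algebra2 Pi_def)

lemma srcs_cases:
  assumes "s \<in> srcs" obtains q i where "s = src q i" "i \<in> {1..4 * size q}"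
proof -
  from assms consider i where "s = XObs i" "i \<in> {1..4 * m}" | i where "s = YObs i" "i \<in> {1..4 * n}"
    by (auto simp: srcs_def)
  then show ?thesis
  proof cases
    case 1 then show ?thesis using that[of PX i] by (simp add: src_def size_def)
  next
    case 2 then show ?thesis using that[of PY i] by (simp add: src_def size_def)
  qed
qed

lemma indep_Zc: "indep_vars (\<lambda>_. vec_space p) Zc srcs"
proof -
  define R where "R s = (case s of XObs i \<Rightarrow> X i | YObs i \<Rightarrow> Y i | _ \<Rightarrow> undefined)" for s
  define mu where "mu s = (case s of XObs i \<Rightarrow> \<mu>x | YObs i \<Rightarrow> \<mu>y | _ \<Rightarrow> 0\<^sub>v p)" for s
  have R: "R (src q i) = obs q i" "mu (src q i) = mean q" for q i
    by (cases q; simp add: R_def src_def obs_def mu_def mean_def)+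
  have "indep_sets (\<lambda>s. {R s -` A \<inter> space M |A. A \<in> sets (vec_space p)}) srcs"
  proof (rule indep_sets_mono[OF indep_gen])
    fix s assume "s \<in> srcs"
    then obtain q i where "s = src q i" "i \<in> {1..4 * size q}" by (rule srcs_cases)
    then show "{R s -` A \<inter> space M |A. A \<in> sets (vec_space p)} \<subseteq> gen s" by (simp add: gen_src R)
  qed auto
  then have ind: "indep_vars (\<lambda>_. vec_space p) R srcs"
    unfolding indep_vars_def2 by (auto elim!: srcs_cases simp: R obs_measurable)
  have "indep_vars (\<lambda>_. vec_space p) (\<lambda>s \<omega>. (\<lambda>x. \<lambda>j\<in>{..<p}. x j - mu s $ j) (R s \<omega>)) srcs"
    by (rule indep_vars_compose2[OF ind]) measurable
  moreover have "Zc s = (\<lambda>\<omega>. (\<lambda>x. \<lambda>j\<in>{..<p}. x j - mu s $ j) (R s \<omega>))" if s: "s \<in> srcs" for s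
    using s by (rule srcs_cases) (simp add: Zc_src[abs_def] R)
  ultimately show ?thesis
    by (subst indep_vars_cong[OF refl _ refl]) auto
qed

definition Wp :: "pop \<Rightarrow> nat \<Rightarrow> (nat \<Rightarrow> fvec) measure" where "Wp q k = PiM {..<k} (\<lambda>_. Np q)"

text \<open>The common interface between data and blocks, for any nonempty subsamples that are
  disjoint within each population. It serves the eight subsamples of the numerator, one whole
  sample, and the two whole samples together.\<close>

lemma scatter_blocks:
  fixes \<tau> :: "'b \<Rightarrow> pop" and I :: "'b \<Rightarrow> nat set"
  assumes B: "finite B" "B \<noteq> {}"
    and sub: "\<And>b. b \<in> B \<Longrightarrow> I b \<subseteq> {1..4 * size (\<tau> b)}" and ne: "\<And>b. b \<in> B \<Longrightarrow> I b \<noteq> {}"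
    and disj: "\<And>b b'. b \<in> B \<Longrightarrow> b' \<in> B \<Longrightarrow> b \<noteq> b' \<Longrightarrow> \<tau> b = \<tau> b' \<Longrightarrow> I b \<inter> I b' = {}"
  obtains G where "indep_vars (\<lambda>b. Wp (\<tau> b) (card (I b) - 1)) G B"
    and "distr M (PiM B (\<lambda>b. Wp (\<tau> b) (card (I b) - 1))) (\<lambda>\<omega>. \<lambda>b\<in>B. G b \<omega>) = PiM B (\<lambda>b. Wp (\<tau> b) (card (I b) - 1))"
    and "\<And>b. b \<in> B \<Longrightarrow> distr M (Wp (\<tau> b) (card (I b) - 1)) (G b) = Wp (\<tau> b) (card (I b) - 1)"
    and "\<And>b \<omega>. b \<in> B \<Longrightarrow>
      agree (mat_fun p (scatter p (I b) (\<lambda>i. obs (\<tau> b) i \<omega>))) (gm (card (I b) - 1) (G b \<omega>))"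
proof -
  define k where "k b = card (I b)" for b
  define Q where "Q = (\<lambda>b. Wp (\<tau> b) (card (I b) - 1))"
  have fin: "finite (I b)" if "b \<in> B" for b using sub[OF that] finite_subset by blast
  have k0: "0 < k b" if "b \<in> B" for b using ne[OF that] fin[OF that] by (simp add: k_def card_gt_0_iff)
  have "\<exists>h. bij_betw h {..<k b} (I b)" if "b \<in> B" for b
    using ex_bij_betw_nat_finite[OF fin[OF that]] by (simp add: k_def lessThan_atLeast0)
  then obtain h where h: "\<And>b. b \<in> B \<Longrightarrow> bij_betw (h b) {..<k b} (I b)" by metis
  define Pr where "Pr b \<psi> \<longleftrightarrow> \<psi> \<in> PiM {..<k b} (\<lambda>_. Np (\<tau> b)) \<rightarrow>\<^sub>M Q b \<and> distr (PiM {..<k b} (\<lambda>_. Np (\<tau> b))) (Q b) \<psi> = Q b \<and>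
    (\<forall>w i j. i < p \<longrightarrow> j < p \<longrightarrow>
      (\<Sum>a<k b. (w a i - (\<Sum>b'<k b. w b' i) / k b) * (w a j - (\<Sum>b'<k b. w b' j) / k b)) = gm (k b - 1) (\<psi> w) i j)"
    for b \<psi>
  have "\<forall>b\<in>B. \<exists>\<psi>. Pr b \<psi>"
  proof
    fix b assume "b \<in> B"
    from gauss.centred_gram[OF gauss_pop k0[OF this], of "\<tau> b"]
    show "\<exists>\<psi>. Pr b \<psi>" unfolding Pr_def Q_def Wp_def k_def[symmetric] .
  qed
  from bchoice[OF this] obtain \<psi> where \<psi>: "\<forall>b\<in>B. Pr b (\<psi> b)" ..
  have \<psi>1: "\<psi> b \<in> PiM {..<k b} (\<lambda>_. Np (\<tau> b)) \<rightarrow>\<^sub>M Q b"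
    and \<psi>2: "distr (PiM {..<k b} (\<lambda>_. Np (\<tau> b))) (Q b) (\<psi> b) = Q b" if "b \<in> B" for b
    using \<psi>[rule_format, OF that] unfolding Pr_def by simp_all
  have \<psi>3: "(\<Sum>a<k b. (w a i - (\<Sum>b'<k b. w b' i) / k b) * (w a j - (\<Sum>b'<k b. w b' j) / k b)) = gm (k b - 1) (\<psi> b w) i j"
    if "b \<in> B" "i < p" "j < p" for b w i j
    using \<psi>[rule_format, OF that(1)] that(2,3) unfolding Pr_def by simp
  define e where "e b a = src (\<tau> b) (h b a)" for b a
  define G where "G b \<omega> = \<psi> b (\<lambda>a\<in>{..<k b}. Zc (e b a) \<omega>)" for b \<omega>
  have hin: "h b a \<in> I b" if "b \<in> B" "a < k b" for b a using h[OF that(1)] that(2) by (auto simp: bij_betw_def)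
  have inj: "inj_on (e b) {..<k b}" if "b \<in> B" for b
    using h[OF that] by (auto simp: inj_on_def e_def src_inj bij_betw_def)
  have sube: "e b ` {..<k b} \<subseteq> srcs" if "b \<in> B" for b
  proof
    fix s assume "s \<in> e b ` {..<k b}"
    then obtain a where "a < k b" "s = src (\<tau> b) (h b a)" by (auto simp: e_def)
    with hin[OF that] sub[OF that] show "s \<in> srcs" by (simp only: src_srcs) blast
  qed
  have dis: "disjoint_family_on (\<lambda>b. e b ` {..<k b}) B"
    unfolding disjoint_family_on_def
  proof (intro ballI impI)
    fix b b' assume b: "b \<in> B" "b' \<in> B" "b \<noteq> b'"
    show "e b ` {..<k b} \<inter> e b' ` {..<k b'} = {}"
      using disj[OF b] hin[OF b(1)] hin[OF b(2)] by (fastforce simp: e_def src_inj)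
  qed
  have law: "distr M (vec_space p) (Zc (e b a)) = Np (\<tau> b)" if "b \<in> B" "a < k b" for b a
    unfolding e_def using hin[OF that] sub[OF that(1)] by (intro law_Zc) auto
  have sN: "sets (Np (\<tau> b)) = sets (vec_space p)" and pN: "prob_space (Np (\<tau> b))" if "b \<in> B" for b
    using gauss.axioms[OF gauss_pop] by (auto simp: centred_mvn_def)
  have J: "indep_vars Q G B"
    "distr M (PiM B Q) (\<lambda>\<omega>. \<lambda>b\<in>B. G b \<omega>) = PiM B Q"
    "\<And>b. b \<in> B \<Longrightarrow> distr M (Q b) (G b) = Q b"
  proof -
    note JB = joint_blocks[where Z = Zc and e = e and k = k and \<phi> = \<psi> and Q = Q and N = "\<lambda>b. Np (\<tau> b)"
        and V = "vec_space p" and I = srcs and B = B, folded G_def]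
    show "indep_vars Q G B" by (rule JB(1)) (fact indep_Zc B inj k0 sube dis law sN pN \<psi>1 \<psi>2)+
    show "distr M (PiM B Q) (\<lambda>\<omega>. \<lambda>b\<in>B. G b \<omega>) = PiM B Q"
      by (rule JB(3)) (fact indep_Zc B inj k0 sube dis law sN pN \<psi>1 \<psi>2)+
    show "distr M (Q b) (G b) = Q b" if "b \<in> B" for b
      by (rule JB(4)[OF _ _ _ _ _ _ _ _ _ _ _ _ that]) (fact indep_Zc B inj k0 sube dis law sN pN \<psi>1 \<psi>2)+
  qed
  have ag: "agree (mat_fun p (scatter p (I b) (\<lambda>i. obs (\<tau> b) i \<omega>))) (gm (card (I b) - 1) (G b \<omega>))"
    if b: "b \<in> B" for b \<omega>
    unfolding agree_def
  proof (intro allI impI)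
      fix i j assume ij: "i < p" "j < p"
      let ?w = "\<lambda>a\<in>{..<k b}. Zc (e b a) \<omega>"
      have v: "obs (\<tau> b) x \<omega> y = Zc (src (\<tau> b) x) \<omega> y + mean (\<tau> b) $ y" if "y < p" for x y
        using that by (simp add: Zc_src)
      have "scatter p (I b) (\<lambda>i. obs (\<tau> b) i \<omega>) $$ (i, j) =
        (\<Sum>a<k b. (Zc (e b a) \<omega> i - (\<Sum>c<k b. Zc (e b c) \<omega> i) / k b) * (Zc (e b a) \<omega> j - (\<Sum>c<k b. Zc (e b c) \<omega> j) / k b))"
        unfolding e_def by (rule scatter_translate[where z = "\<lambda>x y. Zc (src (\<tau> b) x) \<omega> y" and c = "\<lambda>y. mean (\<tau> b) $ y"
            and v = "\<lambda>i. obs (\<tau> b) i \<omega>" and h = "h b" and I = "I b", OF h[OF b] k0[OF b] v ij])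
      also have "\<dots> = (\<Sum>a<k b. (?w a i - (\<Sum>c<k b. ?w c i) / k b) * (?w a j - (\<Sum>c<k b. ?w c j) / k b))"
        by simp
      also have "\<dots> = gm (k b - 1) (G b \<omega>) i j" unfolding G_def by (rule \<psi>3[OF b ij])
      finally show "mat_fun p (scatter p (I b) (\<lambda>i. obs (\<tau> b) i \<omega>)) i j = gm (card (I b) - 1) (G b \<omega>) i j"
        using ij by (simp add: mat_fun_def k_def)
  qed
  show thesis
  proof (rule that[of G])
    show "indep_vars (\<lambda>b. Wp (\<tau> b) (card (I b) - 1)) G B" using J(1) by (simp add: Q_def)
    show "distr M (PiM B (\<lambda>b. Wp (\<tau> b) (card (I b) - 1))) (\<lambda>\<omega>. \<lambda>b\<in>B. G b \<omega>) = PiM B (\<lambda>b. Wp (\<tau> b) (card (I b) - 1))"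
      using J(2) unfolding Q_def .
    show "distr M (Wp (\<tau> b) (card (I b) - 1)) (G b) = Wp (\<tau> b) (card (I b) - 1)" if "b \<in> B" for b
      using J(3)[OF that] by (simp add: Q_def)
  qed (rule ag)
qed

end

section \<open>The numerator for fixed splits\<close>

lemma (in findim) tr_mult2:
  assumes "A \<in> carrier_mat p p" "B \<in> carrier_mat p p" "agree (mat_fun p A) A'" "agree (mat_fun p B) B'"
  shows "tr (A * B) = tra (A' \<bowtie> B')"
proof -
  have "tr (A * B) = tra (mat_fun p A \<bowtie> mat_fun p B)" using assms by (simp add: tr_mat_fun mat_fun_mult)
  then show ?thesis using agree_tra[OF agree_mm[OF assms(3,4)]] by simp
qed

lemma (in findim) tr_mult4:
  assumes c: "A \<in> carrier_mat p p" "B \<in> carrier_mat p p" "C \<in> carrier_mat p p" "D \<in> carrier_mat p p"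
    and a: "agree (mat_fun p A) A'" "agree (mat_fun p B) B'" "agree (mat_fun p C) C'" "agree (mat_fun p D) D'"
  shows "tr (A * B * C * D) = tra (A' \<bowtie> B' \<bowtie> C' \<bowtie> D')"
proof -
  have c2: "A * B \<in> carrier_mat p p" "A * B * C \<in> carrier_mat p p" using c by simp_all
  have "agree (mat_fun p (A * B * C)) (A' \<bowtie> B' \<bowtie> C')"
    using c c2 agree_mm[OF agree_mm[OF a(1,2)] a(3)] by (simp add: mat_fun_mult)
  from tr_mult2[OF c2(2) c(4) this a(4)] show ?thesis by simp
qed

lemma (in prob_space) prob_abs_ge_le:
  assumes "integrable M f" "0 < \<epsilon>" "(\<integral>\<omega>. \<bar>f \<omega>\<bar> \<partial>M) \<le> c"
  shows "prob {\<omega> \<in> space M. \<epsilon> \<le> \<bar>f \<omega>\<bar>} \<le> c / \<epsilon>"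
proof -
  have "prob {\<omega> \<in> space M. \<epsilon> \<le> \<bar>f \<omega>\<bar>} \<le> (\<integral>\<omega>. \<bar>f \<omega>\<bar> \<partial>M) / \<epsilon>"
    using integral_Markov_inequality_measure[of M "\<lambda>\<omega>. \<bar>f \<omega>\<bar>" "space M" \<epsilon>] assms by simp
  also have "\<dots> \<le> c / \<epsilon>" using assms by (intro divide_right_mono) auto
  finally show ?thesis .
qed

lemma (in prob_space) char_distr_transform:
  fixes f :: "'b \<Rightarrow> real"
  assumes W[measurable]: "W \<in> M \<rightarrow>\<^sub>M \<Omega>" and f[measurable]: "f \<in> borel_measurable \<Omega>" and "distr M \<Omega> W = \<Omega>"
  shows "char (distr M borel (\<lambda>\<omega>. u * f (W \<omega>))) t = (CLINT w|\<Omega>. iexp (t * u * f w))"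
proof -
  have "char (distr M borel (\<lambda>\<omega>. u * f (W \<omega>))) t = (CLINT \<omega>|M. iexp (t * (u * f (W \<omega>))))"
    unfolding char_def by (rule integral_distr) measurable
  also have "\<dots> = (CLINT w|distr M \<Omega> W. iexp (t * (u * f w)))"
    by (rule integral_distr[symmetric]) measurable
  finally show ?thesis by (simp only: assms(3) mult.assoc)
qed

text \<open>The orders x, x, y, y and x, y, x, y of the two traces in \<open>theta_hat\<close>, and
  the list of all eight blocks. \<open>tag2\<close> is used there without a shift, since b and b - 4
  have the same parity.\<close>

definition tag1 :: "nat \<Rightarrow> pop" where "tag1 b = (if b < 2 then PX else PY)"
definition tag2 :: "nat \<Rightarrow> pop" where "tag2 b = (if even b then PX else PY)"
definition tag8 :: "nat \<Rightarrow> pop" where "tag8 b = (if b < 4 then tag1 b else tag2 b)"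

text \<open>Block \<open>b\<close> of the numerator carries the subsample with label \<open>lab b\<close> of population \<open>tag8 b\<close>.\<close>

definition lab :: "nat \<Rightarrow> nat" where "lab b = [1, 2, 1, 2, 3, 3, 4, 4] ! b"

lemma lab_distinct:
  assumes "b < 8" "b' < 8" "b \<noteq> b'" "tag8 b = tag8 b'" shows "lab b \<noteq> lab b'"
proof -
  have "b \<in> {0, 1, 2, 3, 4, 5, 6, 7}" "b' \<in> {0, 1, 2, 3, 4, 5, 6, 7}" using assms by auto
  then show ?thesis using assms(3,4)
    by (elim insertE emptyE) (simp_all add: tag8_def tag1_def tag2_def lab_def)
qed

lemma lab_range: "b < 8 \<Longrightarrow> lab b \<in> {1..4}"
proof -
  assume "b < 8"
  then have "b \<in> {0, 1, 2, 3, 4, 5, 6, 7}" by auto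
  then show ?thesis by (elim insertE emptyE) (simp_all add: lab_def)
qed

text \<open>The bound of \<open>blocks.clt_bound\<close> and, below, the error \<open>err\<close>,
  restated outside the locale so that limits in \<open>p\<close> can be taken.\<close>

definition clt_err :: "real \<Rightarrow> real \<Rightarrow> real \<Rightarrow> real" where
  "clt_err C \<eta> t = 11 * C\<^sup>2 * \<bar>t\<bar> * sqrt \<eta> + 5 * C ^ 4 * t\<^sup>2 * (1 + 288 * \<eta>) * sqrt \<eta> + 174 * C ^ 4 * t\<^sup>2 * \<eta>"

definition block_err :: "nat \<Rightarrow> nat \<Rightarrow> real" where "block_err p k = 1 / sqrt k + real k / real p"

text \<open>What holds for all large \<open>p\<close>. Two observations per subsample leave at least
  one column after centring, and the factor 4 in 4 m \<le> p is there because whole samples enter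
  the estimators as single blocks.\<close>

locale large_two_samples = two_samples M p m n \<mu>x \<mu>y Sx Sy X Y cx cy
  for M :: "'a measure" and p m n :: nat and \<mu>x \<mu>y :: "real Matrix.vec" and Sx Sy :: "real mat"
    and X Y :: "nat \<Rightarrow> 'a \<Rightarrow> nat \<Rightarrow> real" and cx cy :: "'a \<Rightarrow> nat \<Rightarrow> nat" +
  fixes C :: real
  assumes m2: "2 \<le> m" and n2: "2 \<le> n" and m4: "4 * m \<le> p" and n4: "4 * n \<le> p" and C1: "1 \<le> C"
    and word_traces: "\<And>w. 2 \<le> length w \<Longrightarrow> length w \<le> 16 \<Longrightarrow> \<bar>tr (word_mat p (pop_cov Sx Sy) w)\<bar> \<le> C * real p"
    and commute: "Sx * Sy = Sy * Sx"
begin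

lemma size_2: "2 \<le> size q" and size_4: "4 * size q \<le> p"
  using m2 n2 m4 n4 by (cases q; simp add: size_def)+

lemma tra_wmat_le:
  assumes "2 \<le> length w" "length w \<le> 16"
  shows "\<bar>tra (wmat (\<lambda>b. Sf (\<tau> b)) w)\<bar> \<le> C * real p"
proof -
  have "w \<noteq> []" using assms(1) by auto
  then have "tra (wmat (\<lambda>b. Sf (\<tau> b)) w) = tr (word_mat p (pop_cov Sx Sy) (map \<tau> w))"
    using mat_fun_word[of "pop_cov Sx Sy" w \<tau>, OF Sig_carrier]
    by (simp add: tr_mat_fun[OF word_mat_carrier[OF Sig_carrier]])
  then show ?thesis using word_traces[of "map \<tau> w"] assms by simp
qed

lemma blocks_tag: "blocks p (\<lambda>b. Np (\<tau> b)) (\<lambda>b. Sf (\<tau> b)) (\<lambda>b. size (\<tau> b) - 1) C"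
proof (rule blocks.intro)
  show "size (\<tau> b) - 1 \<le> p" "0 < size (\<tau> b) - 1" for b using size_2[of "\<tau> b"] size_4[of "\<tau> b"] by simp_all
qed (use gauss_pop p0 C1 tra_wmat_le in auto)

definition v :: "pop \<Rightarrow> pop \<Rightarrow> real" where "v q r = tr (Sig q * Sig r) / p"

lemma v_tra: "v q r = tra (Sf q \<bowtie> Sf r) / p"
  by (simp add: v_def tr_mult2[OF Sig_carrier Sig_carrier] agree_def)

lemma Sf_commute: "Sf PX \<bowtie> Sf PY = Sf PY \<bowtie> Sf PX"
  using commute mat_fun_mult[OF Sig_carrier Sig_carrier, of PX PY] mat_fun_mult[OF Sig_carrier Sig_carrier, of PY PX]
  by (simp add: pop_cov_def)

definition num :: "(nat \<Rightarrow> nat) \<Rightarrow> (nat \<Rightarrow> nat) \<Rightarrow> 'a \<Rightarrow> real" where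
  "num a b \<omega> = (real m - 1) * (real n - 1) / p * theta_hat p m n a b (\<lambda>i. X i \<omega>) (\<lambda>i. Y i \<omega>)"

text \<open>The two traces use disjoint subsamples and are independent, so their characteristic
  functions multiply and the variances \<open>V1\<close> and \<open>V2\<close> add up to the
  expression under the root. The error \<open>\<eta>\<close> counts two x-blocks and two y-blocks in
  each trace.\<close>

lemma char_num:
  assumes a: "a \<in> splits m" and b: "b \<in> splits n"
  defines "\<eta> \<equiv> 2 * (block_err p (m - 1) + block_err p (n - 1))"
  shows "num a b \<in> borel_measurable M"
    and "cmod (char (distr M borel (\<lambda>\<omega>. u * num a b \<omega>)) t
      - complex_of_real (exp (- ((t * u)\<^sup>2 * (v PX PX * v PY PY * (v PX PY)\<^sup>2 + v PX PY ^ 4) / 2))))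
      \<le> 2 * clt_err C \<eta> (t * u)"
proof -
  interpret A: blocks p "\<lambda>b. Np (tag1 b)" "\<lambda>b. Sf (tag1 b)" "\<lambda>b. size (tag1 b) - 1" C by (rule blocks_tag)
  interpret B: blocks p "\<lambda>b. Np (tag2 b)" "\<lambda>b. Sf (tag2 b)" "\<lambda>b. size (tag2 b) - 1" C by (rule blocks_tag)
  have tag1: "tag1 0 = PX" "tag1 1 = PX" "tag1 2 = PY" "tag1 3 = PY" by (simp_all add: tag1_def)
  have tag2: "tag2 0 = PX" "tag2 1 = PY" "tag2 2 = PX" "tag2 3 = PY" by (simp_all add: tag2_def)
  have s: "size PX = m" "size PY = n" by (simp_all add: size_def)
  define spl where "spl q = (case q of PX \<Rightarrow> a | PY \<Rightarrow> b)" for q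
  have spl: "spl q \<in> splits (size q)" for q using a b by (cases q) (auto simp: spl_def size_def)
  define I where "I i = {x \<in> {1..4 * size (tag8 i)}. spl (tag8 i) x = lab i}" for i
  have card_I: "card (I i) = size (tag8 i)" if "i < 8" for i
    using spl[of "tag8 i"] lab_range[OF that] by (simp add: I_def splits_def)
  have I1: "I i \<subseteq> {1..4 * size (tag8 i)}" for i by (auto simp: I_def)
  have I2: "I i \<noteq> {}" if "i \<in> {..<8}" for i using card_I[of i] that size_ge[of "tag8 i"] by auto
  have I3: "I i \<inter> I j = {}" if "i \<in> {..<8}" "j \<in> {..<8}" "i \<noteq> j" "tag8 i = tag8 j" for i j
    using lab_distinct[of i j] that by (auto simp: I_def)
  have fin8: "finite {..<8::nat}" "{..<8::nat} \<noteq> {}" by (auto simp: lessThan_empty_iff)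
  define Q where "Q i = Wp (tag8 i) (card (I i) - 1)" for i
  have "\<exists>G. indep_vars Q G {..<8} \<and> distr M (PiM {..<8} Q) (\<lambda>\<omega>. \<lambda>i\<in>{..<8}. G i \<omega>) = PiM {..<8} Q \<and>
    (\<forall>i<8. \<forall>\<omega>. agree (mat_fun p (scatter p (I i) (\<lambda>x. obs (tag8 i) x \<omega>))) (gm (card (I i) - 1) (G i \<omega>)))"
  proof (rule scatter_blocks[where \<tau> = tag8 and I = I, OF fin8 I1 I2 I3, folded Q_def])
    fix G assume "indep_vars Q G {..<8}" "distr M (PiM {..<8} Q) (\<lambda>\<omega>. \<lambda>i\<in>{..<8}. G i \<omega>) = PiM {..<8} Q"
      "\<And>i \<omega>. i \<in> {..<8} \<Longrightarrow> agree (mat_fun p (scatter p (I i) (\<lambda>x. obs (tag8 i) x \<omega>))) (gm (card (I i) - 1) (G i \<omega>))"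
    then show ?thesis by (intro exI[of _ G] conjI allI impI) auto
  qed
  then obtain G where G1: "indep_vars Q G {..<8}"
    and G2: "distr M (PiM {..<8} Q) (\<lambda>\<omega>. \<lambda>i\<in>{..<8}. G i \<omega>) = PiM {..<8} Q"
    and G3': "\<forall>i<8. \<forall>\<omega>. agree (mat_fun p (scatter p (I i) (\<lambda>x. obs (tag8 i) x \<omega>))) (gm (card (I i) - 1) (G i \<omega>))"
    by (elim exE conjE) (rule that)
  note G3 = G3'[rule_format]
  have rvG: "random_variable (Q i) (G i)" if "i < 8" for i using G1 that by (auto simp: indep_vars_def)
  have pQ: "prob_space (Q i)" for i unfolding Q_def Wp_def
    by (intro prob_space_PiM gauss.axioms(1)[OF gauss_pop])
  have OmA: "PiM {..<4} Q = A.Om"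
    by (intro PiM_cong refl) (auto simp: Q_def Wp_def card_I tag8_def)
  have OmB: "PiM {..<4} (\<lambda>i. Q (i + 4)) = B.Om"
    by (intro PiM_cong refl) (auto simp: Q_def Wp_def card_I tag8_def tag2_def)
  have Gall: "(\<lambda>\<omega>. \<lambda>i\<in>{..<8}. G i \<omega>) \<in> M \<rightarrow>\<^sub>M PiM {..<8} Q"
    by (rule measurable_restrict) (simp add: rvG)
  define W1 where "W1 \<omega> = (\<lambda>i\<in>{..<4}. G i \<omega>)" for \<omega>
  define W2 where "W2 \<omega> = (\<lambda>i\<in>{..<4}. G (i + 4) \<omega>)" for \<omega>
  \<comment> \<open>Blocks 0 to 3 and blocks 4 to 7 of the same family, selected by the shift
    \<open>z\<close>.\<close>
  have law: "distr M (PiM {..<4} (\<lambda>i. Q (i + z))) (\<lambda>\<omega>. \<lambda>i\<in>{..<4}. G (i + z) \<omega>) = PiM {..<4} (\<lambda>i. Q (i + z))"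
    if z: "z \<le> 4" for z :: nat
  proof -
    have re: "(\<lambda>w. \<lambda>i\<in>{..<4}. w (i + z)) \<in> PiM {..<8} Q \<rightarrow>\<^sub>M PiM {..<4} (\<lambda>i. Q (i + z))"
      using z by (intro measurable_restrict measurable_component_singleton) auto
    have "distr M (PiM {..<4} (\<lambda>i. Q (i + z))) (\<lambda>\<omega>. \<lambda>i\<in>{..<4}. G (i + z) \<omega>)
      = distr (distr M (PiM {..<8} Q) (\<lambda>\<omega>. \<lambda>i\<in>{..<8}. G i \<omega>)) (PiM {..<4} (\<lambda>i. Q (i + z))) (\<lambda>w. \<lambda>i\<in>{..<4}. w (i + z))"
      unfolding distr_distr[OF re Gall] using z by (intro distr_cong refl) (auto simp: comp_def)
    also have "\<dots> = PiM {..<4} (\<lambda>i. Q (i + z))"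
      unfolding G2 using z pQ by (intro distr_PiM_reindex) auto
    finally show ?thesis .
  qed
  have L1: "distr M A.Om W1 = A.Om" using law[of 0] by (simp add: OmA W1_def[abs_def])
  have L2: "distr M B.Om W2 = B.Om" using law[of 4] by (simp add: OmB W2_def[abs_def])
  have W1m: "W1 \<in> M \<rightarrow>\<^sub>M A.Om" unfolding OmA[symmetric] W1_def by (rule measurable_restrict) (simp add: rvG)
  have W2m: "W2 \<in> M \<rightarrow>\<^sub>M B.Om" unfolding OmB[symmetric] W2_def by (rule measurable_restrict) (simp add: rvG)
  define f1 where "f1 w = A.stat w" for w
  define f2 where "f2 w = B.stat w" for w
  have f1m[measurable]: "f1 \<in> borel_measurable A.Om" and f2m[measurable]: "f2 \<in> borel_measurable B.Om"
    unfolding f1_def[abs_def] f2_def[abs_def] by (rule all_moments_measurable, rule A.all_moments_stat)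
      (rule all_moments_measurable, rule B.all_moments_stat)
  have TX: "agree (mat_fun p (sub_scatter p m a (\<lambda>x. X x \<omega>) (lab i))) (gm (m - 1) (G i \<omega>))"
    if "i < 8" "tag8 i = PX" for i \<omega>
    using G3[OF that(1), of \<omega>] that(2) card_I[OF that(1)]
    by (simp add: I_def sub_scatter_def obs_def spl_def size_def)
  have TY: "agree (mat_fun p (sub_scatter p n b (\<lambda>x. Y x \<omega>) (lab i))) (gm (n - 1) (G i \<omega>))"
    if "i < 8" "tag8 i = PY" for i \<omega>
    using G3[OF that(1), of \<omega>] that(2) card_I[OF that(1)]
    by (simp add: I_def sub_scatter_def obs_def spl_def size_def)
  have subc: "sub_scatter p k c x l \<in> carrier_mat p p" for k c x l by (simp add: sub_scatter_def)
  have num_eq: "num a b \<omega> = f1 (W1 \<omega>) - f2 (W2 \<omega>)" for \<omega>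
  proof -
    define Km Kn where "Km = real (m - 1)" and "Kn = real (n - 1)"
    have K: "real m - 1 = Km" "real n - 1 = Kn" "0 < Km" "0 < Kn" using m2 n2 by (auto simp: Km_def Kn_def)
    define t1 where "t1 = tra (gm (m - 1) (G 0 \<omega>) \<bowtie> gm (m - 1) (G 1 \<omega>) \<bowtie> gm (n - 1) (G 2 \<omega>) \<bowtie> gm (n - 1) (G 3 \<omega>))"
    define t2 where "t2 = tra (gm (m - 1) (G 4 \<omega>) \<bowtie> gm (n - 1) (G 5 \<omega>) \<bowtie> gm (m - 1) (G 6 \<omega>) \<bowtie> gm (n - 1) (G 7 \<omega>))"
    define th where "th = tra (Sf PX \<bowtie> Sf PX \<bowtie> Sf PY \<bowtie> Sf PY)"
    \<comment> \<open>The null hypothesis enters here: exchanging the two middle factors gives both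
      traces the same centring, which then cancels in the difference.\<close>
    have th2: "tra (Sf PX \<bowtie> Sf PY \<bowtie> Sf PX \<bowtie> Sf PY) = th"
    proof -
      have "Sf PX \<bowtie> Sf PY \<bowtie> Sf PX \<bowtie> Sf PY = Sf PX \<bowtie> (Sf PY \<bowtie> Sf PX) \<bowtie> Sf PY" by simp
      also have "\<dots> = Sf PX \<bowtie> (Sf PX \<bowtie> Sf PY) \<bowtie> Sf PY" by (simp only: Sf_commute)
      finally show ?thesis by (simp add: th_def)
    qed
    have x1: "tr (sub_scatter p m a (\<lambda>x. X x \<omega>) 1 * sub_scatter p m a (\<lambda>x. X x \<omega>) 2
        * sub_scatter p n b (\<lambda>x. Y x \<omega>) 1 * sub_scatter p n b (\<lambda>x. Y x \<omega>) 2) = t1"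
      unfolding t1_def
      using TX[of 0] TX[of 1] TY[of 2] TY[of 3]
      by (intro tr_mult4 subc) (simp_all add: lab_def tag8_def tag1_def tag2_def numeral_2_eq_2 numeral_3_eq_3)
    have x2: "tr (sub_scatter p m a (\<lambda>x. X x \<omega>) 3 * sub_scatter p n b (\<lambda>x. Y x \<omega>) 3
        * sub_scatter p m a (\<lambda>x. X x \<omega>) 4 * sub_scatter p n b (\<lambda>x. Y x \<omega>) 4) = t2"
      unfolding t2_def
      using TX[of 4] TY[of 5] TX[of 6] TY[of 7]
      by (intro tr_mult4 subc) (simp_all add: lab_def tag8_def tag1_def tag2_def)
    \<comment> \<open>The factor (m - 1)(n - 1) / p of the statistic turns the normalisation of
      \<open>theta_hat\<close> into the one used in \<open>stat\<close>, since sqrt (Km Km Kn Kn) =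
      Km Kn.\<close>
    have n: "num a b \<omega> = (t1 - t2) / (Km * Kn * (real p)\<^sup>2)"
      unfolding num_def theta_hat_def Let_def x1 x2 K(1,2) using K(3,4) p0 by (simp add: power2_eq_square field_simps)
    have W: "W1 \<omega> 0 = G 0 \<omega>" "W1 \<omega> 1 = G 1 \<omega>" "W1 \<omega> 2 = G 2 \<omega>" "W1 \<omega> 3 = G 3 \<omega>"
      "W2 \<omega> 0 = G 4 \<omega>" "W2 \<omega> 1 = G 5 \<omega>" "W2 \<omega> 2 = G 6 \<omega>" "W2 \<omega> 3 = G 7 \<omega>"
      by (simp_all add: W1_def W2_def)
    have sq: "sqrt (Km * Km * Kn * Kn) = Km * Kn" "sqrt (Km * Kn * Km * Kn) = Km * Kn"
    proof -
      have "Km * Km * Kn * Kn = (Km * Kn)\<^sup>2" "Km * Kn * Km * Kn = (Km * Kn)\<^sup>2" by (simp_all add: power2_eq_square mult_ac)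
      then show "sqrt (Km * Km * Kn * Kn) = Km * Kn" "sqrt (Km * Kn * Km * Kn) = Km * Kn"
        using K by (simp_all only: real_sqrt_abs) simp_all
    qed
    have f1: "f1 (W1 \<omega>) = (t1 - Km * Km * Kn * Kn * th) / (Km * Kn * (real p)\<^sup>2)"
      unfolding f1_def A.T_def W tag1 s Km_def[symmetric] Kn_def[symmetric] sq t1_def[symmetric] th_def[symmetric] ..
    have f2: "f2 (W2 \<omega>) = (t2 - Km * Kn * Km * Kn * th) / (Km * Kn * (real p)\<^sup>2)"
      unfolding f2_def B.T_def W tag2 s Km_def[symmetric] Kn_def[symmetric] sq t2_def[symmetric] th2 ..
    show ?thesis unfolding n f1 f2 by (simp add: diff_divide_distrib[symmetric])
  qed
  show "num a b \<in> borel_measurable M"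
    unfolding num_eq[abs_def] using measurable_compose[OF W1m f1m] measurable_compose[OF W2m f2m] by simp
  have ind: "indep_var borel (\<lambda>\<omega>. u * f1 (W1 \<omega>)) borel (\<lambda>\<omega>. - u * f2 (W2 \<omega>))"
  proof -
    have "indep_var (PiM {..<4} Q) (\<lambda>\<omega>. restrict (\<lambda>i. G i \<omega>) {..<4}) (PiM {4..<8} Q) (\<lambda>\<omega>. restrict (\<lambda>i. G i \<omega>) {4..<8})"
      by (rule indep_var_restrict[OF G1]) auto
    moreover have "(\<lambda>w. u * f1 w) \<in> borel_measurable (PiM {..<4} Q)" unfolding OmA by measurable
    moreover have "(\<lambda>w. - u * f2 (\<lambda>i\<in>{..<4}. w (i + 4))) \<in> borel_measurable (PiM {4..<8} Q)"
    proof -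
      have "(\<lambda>w. \<lambda>i\<in>{..<4}. w (i + 4)) \<in> PiM {4..<8} Q \<rightarrow>\<^sub>M PiM {..<4} (\<lambda>i. Q (i + 4))"
        by (intro measurable_restrict measurable_component_singleton) auto
      from measurable_compose[OF this[unfolded OmB] f2m] show ?thesis by simp
    qed
    ultimately have "indep_var borel ((\<lambda>w. u * f1 w) \<circ> (\<lambda>\<omega>. restrict (\<lambda>i. G i \<omega>) {..<4}))
        borel ((\<lambda>w. - u * f2 (\<lambda>i\<in>{..<4}. w (i + 4))) \<circ> (\<lambda>\<omega>. restrict (\<lambda>i. G i \<omega>) {4..<8}))"
      by (rule indep_var_compose)
    moreover have "(\<lambda>i\<in>{..<4}. (restrict (\<lambda>i. G i \<omega>) {4..<8}) (i + 4)) = W2 \<omega>" for \<omega>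
      by (auto simp: W2_def)
    ultimately show ?thesis by (simp only: comp_def W1_def)
  qed
  define V1 V2 where "V1 = v PX PX * v PY PY * (v PX PY)\<^sup>2" and "V2 = v PX PY ^ 4"
  define c1 where "c1 = char (distr M borel (\<lambda>\<omega>. u * f1 (W1 \<omega>))) t"
  define c2 where "c2 = char (distr M borel (\<lambda>\<omega>. - u * f2 (W2 \<omega>))) t"
  define e1 where "e1 = complex_of_real (exp (- ((t * u)\<^sup>2 * V1 / 2)))"
  define e2 where "e2 = complex_of_real (exp (- ((t * u)\<^sup>2 * V2 / 2)))"
  have P0: "0 < real p" using p0 by simp
  have sgA: "A.sg / real p ^ 4 = V1"
    unfolding A.sg_def tag1 V1_def v_tra tra_comm[of "Sf PY" "Sf PX"] using P0 by (simp add: power4_eq_xxxx power2_eq_square field_simps)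
  have sgB: "B.sg / real p ^ 4 = V2"
    unfolding B.sg_def tag2 V2_def v_tra tra_comm[of "Sf PY" "Sf PX"] using P0 by (simp add: power4_eq_xxxx field_simps)
  have etaA: "A.\<eta> = \<eta>" and etaB: "B.\<eta> = \<eta>"
    unfolding A.\<eta>_def B.\<eta>_def A.err_def B.err_def tag1 tag2 s \<eta>_def block_err_def by simp_all
  have c1: "cmod (c1 - e1) \<le> clt_err C \<eta> (t * u)"
  proof -
    have "c1 = (CLINT w|A.Om. iexp (t * u * f1 w))"
      unfolding c1_def by (rule char_distr_transform[OF W1m f1m L1])
    then show ?thesis using A.clt_bound[of "t * u"]
      unfolding f1_def e1_def clt_err_def etaA sgA by simp
  qed
  have c2: "cmod (c2 - e2) \<le> clt_err C \<eta> (t * u)"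
  proof -
    have "c2 = (CLINT w|B.Om. iexp (t * (- u) * f2 w))"
      unfolding c2_def by (rule char_distr_transform[OF W2m f2m L2])
    then show ?thesis using B.clt_bound[of "t * (- u)"]
      unfolding f2_def e2_def clt_err_def etaB sgB by simp
  qed
  have "(\<lambda>\<omega>. u * num a b \<omega>) = (\<lambda>\<omega>. u * f1 (W1 \<omega>) + - u * f2 (W2 \<omega>))"
    by (simp add: num_eq right_diff_distrib)
  then have prod: "char (distr M borel (\<lambda>\<omega>. u * num a b \<omega>)) t = c1 * c2"
    using char_distr_add[OF ind, of t] by (simp only: c1_def c2_def)
  have n1: "cmod c2 \<le> 1"
  proof -
    have "random_variable borel (\<lambda>\<omega>. - u * f2 (W2 \<omega>))" using measurable_compose[OF W2m f2m] by simp
    from prob_space.real_distribution_distr[OF prob_space_axioms this] show ?thesis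
      unfolding c2_def by (rule real_distribution.cmod_char_le_1)
  qed
  have n2: "cmod e1 \<le> 1"
  proof -
    have "0 \<le> V1" using A.tra2_nonneg[of 0 0] A.tra2_nonneg[of 2 2] by (simp add: V1_def v_tra tag1)
    then show ?thesis by (simp add: e1_def)
  qed
  \<comment> \<open>The product rule for differences; \<open>c2\<close> and \<open>e1\<close> have
    modulus at most one, so the errors just add.\<close>
  have "c1 * c2 - e1 * e2 = (c1 - e1) * c2 + e1 * (c2 - e2)" by (simp add: algebra_simps)
  then have "cmod (c1 * c2 - e1 * e2) \<le> cmod (c1 - e1) * cmod c2 + cmod e1 * cmod (c2 - e2)"
    using norm_triangle_ineq[of "(c1 - e1) * c2" "e1 * (c2 - e2)"] by (simp add: norm_mult)
  also have "\<dots> \<le> clt_err C \<eta> (t * u) + clt_err C \<eta> (t * u)"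
    using mult_left_mono[OF n1, of "cmod (c1 - e1)"] mult_right_mono[OF n2, of "cmod (c2 - e2)"] c1 c2 by simp
  finally have "cmod (c1 * c2 - e1 * e2) \<le> 2 * clt_err C \<eta> (t * u)" by simp
  moreover have "e1 * e2 = complex_of_real (exp (- ((t * u)\<^sup>2 * (V1 + V2) / 2)))"
    by (simp add: e1_def e2_def distrib_left add_divide_distrib flip: of_real_mult exp_add)
  ultimately show "cmod (char (distr M borel (\<lambda>\<omega>. u * num a b \<omega>)) t
      - complex_of_real (exp (- ((t * u)\<^sup>2 * (v PX PX * v PY PY * (v PX PY)\<^sup>2 + v PX PY ^ 4) / 2))))
      \<le> 2 * clt_err C \<eta> (t * u)"
    by (simp only: prod V1_def V2_def)
qed

end

section \<open>Averaging over the random splits\<close>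

context two_samples
begin

lemma obs_split: "cx \<in> M \<rightarrow>\<^sub>M count_space (splits m)" "cy \<in> M \<rightarrow>\<^sub>M count_space (splits n)"
  using two_sample by (auto simp: two_sample_experiment_def uniform_split_def)

lemma gen_split:
  "gen XSplit = {cx -` A \<inter> space M |A. A \<in> Pow (splits m)}" "gen YSplit = {cy -` A \<inter> space M |A. A \<in> Pow (splits n)}"
  using obs_split[THEN measurable_space] by (simp_all add: gen_def sets_vimage_algebra2 Pi_def)

lemma gen_Pow: "gen s \<subseteq> Pow (space M)"
  unfolding gen_def by (cases s) (simp_all, (rule order_trans[OF sets.space_closed], simp)+)

lemma Int_stable_gen: "Int_stable (gen s)"
  unfolding gen_def by (cases s) (simp_all add: sets.Int_stable)

definition event :: "real \<Rightarrow> (nat \<Rightarrow> nat) \<Rightarrow> (nat \<Rightarrow> nat) \<Rightarrow> 'a set" where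
  "event z a b = {\<omega> \<in> space M. z < T_stat p m n a b (\<lambda>i. X i \<omega>) (\<lambda>i. Y i \<omega>)}"

text \<open>With the splits held fixed the statistic is a function of the observations alone; hence
  the smaller measurable space \<open>F\<close> in place of \<open>M\<close>.\<close>

lemma event_gen: "event z a b \<in> sigma_sets (space M) (\<Union>s\<in>srcs. gen s)"
proof -
  define F where "F = sigma (space M) (\<Union>s\<in>srcs. gen s)"
  have sF: "sets F = sigma_sets (space M) (\<Union>s\<in>srcs. gen s)" and spF: "space F = space M"
    unfolding F_def using gen_Pow by (simp_all add: sets_measure_of space_measure_of UN_least)
  have m: "(\<lambda>\<omega>. obs q i \<omega> j) \<in> borel_measurable F" if i: "i \<in> {1..4 * size q}" and j: "j < p" for q i j
  proof -
    have mo: "obs q i \<in> F \<rightarrow>\<^sub>M vec_space p"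
    proof (rule measurableI)
      fix A assume A: "A \<in> sets (vec_space p)"
      have "obs q i -` A \<inter> space M \<in> gen (src q i)" using A by (auto simp: gen_src[OF i])
      moreover have "src q i \<in> srcs" using i by (simp only: src_srcs)
      ultimately show "obs q i -` A \<inter> space F \<in> sets F" unfolding sF spF by blast
    qed (use measurable_space[OF obs_measurable[OF i]] spF in simp)
    have "(\<lambda>x. x j) \<in> vec_space p \<rightarrow>\<^sub>M lborel" using j by (intro measurable_component_singleton) simp
    from measurable_compose[OF mo this] show ?thesis by simp
  qed
  have "(\<lambda>\<omega>. T_stat p m n a b (\<lambda>i. X i \<omega>) (\<lambda>i. Y i \<omega>)) \<in> borel_measurable F"
    using m[of _ PX] m[of _ PY] by (intro borel_measurable_T_stat) (auto simp: obs_def size_def)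
  then have "{\<omega> \<in> space F. z < T_stat p m n a b (\<lambda>i. X i \<omega>) (\<lambda>i. Y i \<omega>)} \<in> sets F" by measurable
  then show ?thesis by (simp add: event_def sF spF)
qed

lemma event_sets: "event z a b \<in> events"
proof -
  have "(\<Union>s\<in>srcs. gen s) \<subseteq> events"
  proof (intro UN_least)
    fix s assume "s \<in> srcs"
    then obtain q i where "s = src q i" "i \<in> {1..4 * size q}" by (rule srcs_cases)
    then show "gen s \<subseteq> events" using obs_measurable[of i q] by (auto simp: gen_src intro: measurable_sets)
  qed
  from sets.sigma_sets_subset[OF this] event_gen show ?thesis by blast
qed

text \<open>The observations and the two splits are three disjoint groups of generators, so the
  sigma-algebras they generate are independent.\<close>

lemma prob_event_split:
  assumes a: "a \<in> splits m" and b: "b \<in> splits n"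
  shows "prob (event z a b \<inter> (cx -` {a} \<inter> space M) \<inter> (cy -` {b} \<inter> space M))
    = prob (event z a b) * (prob (cx -` {a} \<inter> space M) * prob (cy -` {b} \<inter> space M))"
proof -
  define I where "I j = (if j = 0 then srcs else if j = 1 then {XSplit} else {YSplit})" for j :: nat
  define A where "A j = (if j = 0 then event z a b else if j = 1 then cx -` {a} \<inter> space M else cy -` {b} \<inter> space M)" for j :: nat
  have U: "(\<Union>j\<in>{0, 1, 2}. I j) = srcs \<union> {XSplit, YSplit}" by (auto simp: I_def)
  have d: "disjoint_family_on I {0, 1, 2}" by (auto simp: disjoint_family_on_def I_def srcs_def)
  have "indep_sets (\<lambda>j. sigma_sets (space M) (\<Union>i\<in>I j. gen i)) {0, 1, 2}"
    by (rule indep_sets_collect_sigma) (use indep_gen U Int_stable_gen d in auto)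
  moreover have "\<forall>j\<in>{0, 1, 2}. A j \<in> sigma_sets (space M) (\<Union>i\<in>I j. gen i)"
  proof
    fix j :: nat assume "j \<in> {0, 1, 2}"
    moreover have "cx -` {a} \<inter> space M \<in> gen XSplit" "cy -` {b} \<inter> space M \<in> gen YSplit"
      unfolding gen_split using a b by blast+
    ultimately show "A j \<in> sigma_sets (space M) (\<Union>i\<in>I j. gen i)"
      using event_gen[of z a b] by (auto simp: A_def I_def)
  qed
  ultimately have "prob (\<Inter>j\<in>{0, 1, 2}. A j) = (\<Prod>j\<in>{0, 1, 2}. prob (A j))"
    by (intro indep_setsD) auto
  moreover have "(\<Inter>j\<in>{0, 1, 2}. A j) = event z a b \<inter> (cx -` {a} \<inter> space M) \<inter> (cy -` {b} \<inter> space M)"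
    by (auto simp: A_def)
  moreover have "(\<Prod>j\<in>{0, 1, 2}. prob (A j)) = prob (event z a b) * (prob (cx -` {a} \<inter> space M) * prob (cy -` {b} \<inter> space M))"
    by (simp add: A_def)
  ultimately show ?thesis by simp
qed

lemma finite_splits: "finite (splits k)"
  by (rule finite_subset[of _ "{1..4 * k} \<rightarrow>\<^sub>E {1..4}"]) (auto simp: splits_def intro: finite_PiE)

lemma sum_prob_vimage:
  assumes "f \<in> M \<rightarrow>\<^sub>M count_space S" "finite S"
  shows "(\<Sum>a\<in>S. prob (f -` {a} \<inter> space M)) = 1"
proof -
  have "(\<Sum>a\<in>S. prob (f -` {a} \<inter> space M)) = prob (\<Union>a\<in>S. f -` {a} \<inter> space M)"
    using assms by (intro finite_measure_finite_Union[symmetric])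
      (auto simp: disjoint_family_on_def intro!: measurable_sets[OF assms(1)])
  also have "(\<Union>a\<in>S. f -` {a} \<inter> space M) = space M" using measurable_space[OF assms(1)] by auto
  finally show ?thesis by (simp add: prob_space)
qed

text \<open>Since the splits are independent of the observations, the probability is an average of the
  probabilities for fixed splits, so the worst fixed split controls the deviation.\<close>

lemma worst_split:
  "\<exists>a\<in>splits m. \<exists>b\<in>splits n.
    \<bar>prob {\<omega> \<in> space M. z < T_stat p m n (cx \<omega>) (cy \<omega>) (\<lambda>i. X i \<omega>) (\<lambda>i. Y i \<omega>)} - \<alpha>\<bar> \<le> \<bar>prob (event z a b) - \<alpha>\<bar>"
proof -
  let ?S = "splits m \<times> splits n"
  define px where "px a = prob (cx -` {a} \<inter> space M)" for a
  define py where "py b = prob (cy -` {b} \<inter> space M)" for b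
  define D where "D c = event z (fst c) (snd c) \<inter> (cx -` {fst c} \<inter> space M) \<inter> (cy -` {snd c} \<inter> space M)" for c
  define g where "g c = \<bar>prob (event z (fst c) (snd c)) - \<alpha>\<bar>" for c
  have fin: "finite ?S" using finite_splits by blast
  have w1: "(\<Sum>c\<in>?S. px (fst c) * py (snd c)) = 1"
    using sum_product[of px "splits m" py "splits n"] sum_prob_vimage[OF obs_split(1) finite_splits] sum_prob_vimage[OF obs_split(2) finite_splits]
    by (simp add: sum.cartesian_product px_def py_def case_prod_beta)
  then have ne: "?S \<noteq> {}" by auto
  have "{\<omega> \<in> space M. z < T_stat p m n (cx \<omega>) (cy \<omega>) (\<lambda>i. X i \<omega>) (\<lambda>i. Y i \<omega>)} = (\<Union>c\<in>?S. D c)"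
    using obs_split[THEN measurable_space] by (auto simp: D_def event_def)
  moreover have "prob (\<Union>c\<in>?S. D c) = (\<Sum>c\<in>?S. prob (D c))"
  proof (rule finite_measure_finite_Union[OF fin])
    show "D ` ?S \<subseteq> events"
      using event_sets obs_split by (auto simp: D_def intro!: sets.Int measurable_sets[OF obs_split(1)] measurable_sets[OF obs_split(2)])
    show "disjoint_family_on D ?S" by (auto simp: disjoint_family_on_def D_def)
  qed
  moreover have "prob (D c) = prob (event z (fst c) (snd c)) * (px (fst c) * py (snd c))" if "c \<in> ?S" for c
    using prob_event_split[of "fst c" "snd c" z] that by (auto simp: D_def px_def py_def)
  ultimately have "prob {\<omega> \<in> space M. z < T_stat p m n (cx \<omega>) (cy \<omega>) (\<lambda>i. X i \<omega>) (\<lambda>i. Y i \<omega>)} - \<alpha>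
      = (\<Sum>c\<in>?S. prob (event z (fst c) (snd c)) * (px (fst c) * py (snd c))) - (\<Sum>c\<in>?S. \<alpha> * (px (fst c) * py (snd c)))"
    using w1 by (simp flip: sum_distrib_left)
  also have "\<dots> = (\<Sum>c\<in>?S. (prob (event z (fst c) (snd c)) - \<alpha>) * (px (fst c) * py (snd c)))"
    by (simp add: left_diff_distrib sum_subtractf)
  finally have eq: "prob {\<omega> \<in> space M. z < T_stat p m n (cx \<omega>) (cy \<omega>) (\<lambda>i. X i \<omega>) (\<lambda>i. Y i \<omega>)} - \<alpha>
      = (\<Sum>c\<in>?S. (prob (event z (fst c) (snd c)) - \<alpha>) * (px (fst c) * py (snd c)))" .
  \<comment> \<open>There are finitely many pairs of splits, and at least one because the weights
    sum to 1; so the worst pair is attained.\<close>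
  have "Max (g ` ?S) \<in> g ` ?S" using fin ne by (intro Max_in) auto
  then obtain c where c: "Max (g ` ?S) = g c" "c \<in> ?S" by (rule imageE)
  have gc: "g d \<le> g c" if "d \<in> ?S" for d unfolding c(1)[symmetric] using fin that by (intro Max_ge) auto
  have "\<bar>\<Sum>c\<in>?S. (prob (event z (fst c) (snd c)) - \<alpha>) * (px (fst c) * py (snd c))\<bar>
      \<le> (\<Sum>d\<in>?S. \<bar>(prob (event z (fst d) (snd d)) - \<alpha>) * (px (fst d) * py (snd d))\<bar>)" by (rule sum_abs)
  also have "\<dots> \<le> (\<Sum>d\<in>?S. g c * (px (fst d) * py (snd d)))"
  proof (rule sum_mono)
    fix d assume "d \<in> ?S"
    have "0 \<le> px (fst d) * py (snd d)" by (simp add: px_def py_def)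
    then show "\<bar>(prob (event z (fst d) (snd d)) - \<alpha>) * (px (fst d) * py (snd d))\<bar> \<le> g c * (px (fst d) * py (snd d))"
      using mult_right_mono[OF gc[OF \<open>d \<in> ?S\<close>], of "px (fst d) * py (snd d)"]
      by (simp only: g_def abs_mult[of _ "px (fst d) * py (snd d)"] abs_of_nonneg)
  qed
  also have "\<dots> = g c" using w1 by (simp flip: sum_distrib_left)
  finally show ?thesis using c(2) unfolding eq g_def by (intro bexI[of _ "fst c"] bexI[of _ "snd c"]) auto
qed

end

section \<open>The denominator\<close>

context large_two_samples
begin

definition ds :: "pop \<Rightarrow> 'a \<Rightarrow> real" where "ds q \<omega> = sigma_hat_same p (4 * size q) (\<lambda>i. obs q i \<omega>)"
definition dx :: "'a \<Rightarrow> real" where "dx \<omega> = sigma_hat_cross p (4 * m) (4 * n) (\<lambda>i. X i \<omega>) (\<lambda>i. Y i \<omega>)"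

lemma T_stat_eq:
  "T_stat p m n a b (\<lambda>i. X i \<omega>) (\<lambda>i. Y i \<omega>) = num a b \<omega> / sqrt (ds PX \<omega> * ds PY \<omega> * (dx \<omega>)\<^sup>2 + dx \<omega> ^ 4)"
  by (simp add: T_stat_def Let_def num_def ds_def dx_def size_def obs_def)

text \<open>Markov's inequality for the mean deviation in \<open>E_sigma_est\<close>, carried over
  to the experiment by the representation with a single block.\<close>

lemma same_concentration:
  shows "ds q \<in> borel_measurable M"
    and "0 < \<epsilon> \<Longrightarrow> prob {\<omega> \<in> space M. \<epsilon> \<le> \<bar>ds q \<omega> - v q q\<bar>} \<le> 12 * C / sqrt (4 * size q - 1) / \<epsilon>"
proof -
  interpret g: gauss p "Np q" "Sf q" by (rule gauss_pop)
  define k where "k = 4 * size q - 1"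
  have k: "2 \<le> k" "real k = 4 * real (size q) - 1" using size_2[of q] by (auto simp: k_def)
  have ne: "finite {..<1::nat}" "{..<1::nat} \<noteq> {}" by auto
  have sub: "{1..4 * size q} \<subseteq> {1..4 * size q}" "{1..4 * size q} \<noteq> {}" using size_ge[of q] by auto
  have "\<exists>G. distr M (g.W k) G = g.W k \<and> G \<in> M \<rightarrow>\<^sub>M g.W k \<and>
    (\<forall>\<omega>. agree (mat_fun p (scatter p {1..4 * size q} (\<lambda>i. obs q i \<omega>))) (gm k (G \<omega>)))"
  proof (rule scatter_blocks[of "{..<1::nat}" "\<lambda>_. {1..4 * size q}" "\<lambda>_. q", OF ne])
    fix G :: "nat \<Rightarrow> 'a \<Rightarrow> nat \<Rightarrow> fvec"
    assume a: "indep_vars (\<lambda>b. Wp q (card {1..4 * size q} - 1)) G {..<1}"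
      and b: "\<And>b. b \<in> {..<1} \<Longrightarrow> distr M (Wp q (card {1..4 * size q} - 1)) (G b) = Wp q (card {1..4 * size q} - 1)"
      and c: "\<And>b \<omega>. b \<in> {..<1} \<Longrightarrow> agree (mat_fun p (scatter p {1..4 * size q} (\<lambda>i. obs q i \<omega>))) (gm (card {1..4 * size q} - 1) (G b \<omega>))"
    have "random_variable (Wp q k) (G 0)" using a by (auto simp: indep_vars_def k_def)
    then show ?thesis using b[of 0] c[of 0] by (intro exI[of _ "G 0"]) (simp add: k_def Wp_def)
  qed (use sub in auto)
  then obtain G where G1: "distr M (g.W k) G = g.W k" and Gm: "G \<in> M \<rightarrow>\<^sub>M g.W k"
    and G2: "\<forall>\<omega>. agree (mat_fun p (scatter p {1..4 * size q} (\<lambda>i. obs q i \<omega>))) (gm k (G \<omega>))"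
    by (elim exE conjE) (rule that)
  have eq: "ds q \<omega> = g.sigma_est k (G \<omega>)" for \<omega>
  proof -
    let ?A = "scatter p {1..4 * size q} (\<lambda>i. obs q i \<omega>)"
    have "tr (?A * ?A) = tra (gm k (G \<omega>) \<bowtie> gm k (G \<omega>))"
      by (rule tr_mult2[OF scatter_carrier scatter_carrier G2[rule_format] G2[rule_format]])
    moreover have "tr ?A = tra (gm k (G \<omega>))"
      using agree_tra[OF G2[rule_format]] by (simp add: tr_mat_fun)
    moreover have "2 \<le> 4 * size q" using size_2[of q] by simp
    ultimately show ?thesis
      unfolding ds_def by (subst sigma_hat_same_tr[OF refl]) (simp_all add: g.sigma_est_def k(2))
  qed
  have mom: "all_moments (g.W k) (\<lambda>w. g.sigma_est k w - v q q)"
    by (intro prob_space.all_moments_diff[OF g.W_prob] g.all_moments_sigma_est prob_space.all_moments_const[OF g.W_prob])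
  show "ds q \<in> borel_measurable M"
    unfolding eq[abs_def] by (rule measurable_compose[OF Gm all_moments_measurable[OF g.all_moments_sigma_est]])
  assume e: "0 < \<epsilon>"
  show "prob {\<omega> \<in> space M. \<epsilon> \<le> \<bar>ds q \<omega> - v q q\<bar>} \<le> 12 * C / sqrt (4 * size q - 1) / \<epsilon>"
  proof (rule prob_abs_ge_le[OF _ e])
    have i: "integrable (g.W k) (\<lambda>w. g.sigma_est k w - v q q)" by (rule all_moments_integrable[OF mom])
    have mm: "(\<lambda>w. g.sigma_est k w - v q q) \<in> borel_measurable (g.W k)" by (rule all_moments_measurable[OF mom])
    have i': "integrable (distr M (g.W k) G) (\<lambda>w. g.sigma_est k w - v q q)" using i by (simp only: G1)
    show "integrable M (\<lambda>\<omega>. ds q \<omega> - v q q)"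
      unfolding eq by (rule integrable_distr[OF Gm i'])
    have "(\<integral>\<omega>. \<bar>ds q \<omega> - v q q\<bar> \<partial>M) = (\<integral>w. \<bar>g.sigma_est k w - v q q\<bar> \<partial>distr M (g.W k) G)"
      unfolding eq using mm by (intro integral_distr[symmetric] Gm) auto
    also have "\<dots> \<le> 12 * C / sqrt k"
      unfolding G1 v_tra
      using tra_wmat_le[of "[0, 0]" "\<lambda>_. q"] tra_wmat_le[of "[0, 0, 0, 0]" "\<lambda>_. q"] k p0 C1
      by (intro g.E_sigma_est) auto
    finally show "(\<integral>\<omega>. \<bar>ds q \<omega> - v q q\<bar> \<partial>M) \<le> 12 * C / sqrt (4 * size q - 1)" by (simp only: k_def)
  qed
qed

lemma cross_concentration:
  shows "dx \<in> borel_measurable M"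
    and "0 < \<epsilon> \<Longrightarrow> prob {\<omega> \<in> space M. \<epsilon> \<le> \<bar>dx \<omega> - v PX PY\<bar>} \<le> 12 * C / sqrt (4 * n - 1) / \<epsilon>"
proof -
  define k l where "k = 4 * m - 1" and "l = 4 * n - 1"
  have k: "0 < k" "0 < l" "k \<le> p" "l \<le> p" "real k = 4 * real m - 1" "real l = 4 * real n - 1"
    using m2 n2 m4 n4 by (auto simp: k_def l_def)
  define PP where "PP = PiM {..<2::nat} (\<lambda>b. PiM {..<(if b = 0 then k else l)} (\<lambda>_. if b = 0 then Np PX else Np PY))"
  define est where "est w = tra (gm k (w 0) \<bowtie> gm l (w 1)) / (real k * real l * real p)" for w :: "nat \<Rightarrow> nat \<Rightarrow> fvec"
  define \<tau> where "\<tau> b = (if b = 0 then PX else PY)" for b :: nat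
  have am: "all_moments PP est"
    and bd: "(\<integral>w. \<bar>est w - tra (Sf PX \<bowtie> Sf PY) / p\<bar> \<partial>PP) \<le> 5 * C / sqrt l"
    unfolding PP_def est_def[abs_def]
    using E_sigma_cross[OF gauss_pop gauss_pop k(1-4) C1, of PX PY]
      tra_wmat_le[of "[0, 1]" \<tau>] tra_wmat_le[of "[1, 0, 1, 0]" \<tau>] by (simp_all add: \<tau>_def)
  define I where "I b = {1..4 * size (\<tau> b)}" for b
  have s: "size PX = m" "size PY = n" by (simp_all add: size_def)
  have card_I: "card (I 0) - 1 = k" "card (I 1) - 1 = l" "b \<noteq> 0 \<Longrightarrow> card (I b) - 1 = l" for b
    by (simp_all add: I_def \<tau>_def s k_def l_def)
  have Q: "PiM {..<2} (\<lambda>b. Wp (\<tau> b) (card (I b) - 1)) = PP"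
    unfolding PP_def by (intro PiM_cong refl) (auto simp: Wp_def \<tau>_def card_I simp del: One_nat_def)
  have ne: "finite {..<2::nat}" "{..<2::nat} \<noteq> {}" by (auto simp: lessThan_empty_iff)
  have dj: "I b \<inter> I b' = {}" if "b \<in> {..<2}" "b' \<in> {..<2}" "b \<noteq> b'" "\<tau> b = \<tau> b'" for b b'
    using that by (auto simp: \<tau>_def less_2_cases_iff split: if_splits)
  have I1: "I b \<subseteq> {1..4 * size (\<tau> b)}" "I b \<noteq> {}" for b using size_ge[of "\<tau> b"] by (auto simp: I_def)
  have "\<exists>G. distr M PP G = PP \<and> G \<in> M \<rightarrow>\<^sub>M PP \<and>
    (\<forall>\<omega>. agree (mat_fun p (scatter p {1..4 * m} (\<lambda>i. X i \<omega>))) (gm k (G \<omega> 0)) \<and>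
         agree (mat_fun p (scatter p {1..4 * n} (\<lambda>i. Y i \<omega>))) (gm l (G \<omega> 1)))"
  proof (rule scatter_blocks[of "{..<2::nat}" I \<tau>, OF ne])
    fix G :: "nat \<Rightarrow> 'a \<Rightarrow> nat \<Rightarrow> fvec"
    assume a: "indep_vars (\<lambda>b. Wp (\<tau> b) (card (I b) - 1)) G {..<2}"
      and b: "distr M (PiM {..<2} (\<lambda>b. Wp (\<tau> b) (card (I b) - 1))) (\<lambda>\<omega>. \<lambda>b\<in>{..<2}. G b \<omega>) = PiM {..<2} (\<lambda>b. Wp (\<tau> b) (card (I b) - 1))"
      and c: "\<And>b \<omega>. b \<in> {..<2} \<Longrightarrow> agree (mat_fun p (scatter p (I b) (\<lambda>i. obs (\<tau> b) i \<omega>))) (gm (card (I b) - 1) (G b \<omega>))"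
    have "(\<lambda>\<omega>. \<lambda>b\<in>{..<2}. G b \<omega>) \<in> M \<rightarrow>\<^sub>M PP"
      unfolding Q[symmetric] by (rule measurable_restrict) (use a in \<open>auto simp: indep_vars_def\<close>)
    moreover have "agree (mat_fun p (scatter p {1..4 * m} (\<lambda>i. X i \<omega>))) (gm k (G 0 \<omega>))" for \<omega>
      using c[of 0 \<omega>] card_I(1) by (simp add: I_def \<tau>_def s obs_def)
    moreover have "agree (mat_fun p (scatter p {1..4 * n} (\<lambda>i. Y i \<omega>))) (gm l (G 1 \<omega>))" for \<omega>
      using c[of 1 \<omega>] card_I(2) by (simp add: I_def \<tau>_def s obs_def)
    ultimately show ?thesis using b unfolding Q by (intro exI[of _ "\<lambda>\<omega>. \<lambda>b\<in>{..<2}. G b \<omega>"]) simp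
  qed (use I1 dj in auto)
  then obtain G where G1: "distr M PP G = PP" and Gm: "G \<in> M \<rightarrow>\<^sub>M PP"
    and G2: "\<forall>\<omega>. agree (mat_fun p (scatter p {1..4 * m} (\<lambda>i. X i \<omega>))) (gm k (G \<omega> 0)) \<and>
         agree (mat_fun p (scatter p {1..4 * n} (\<lambda>i. Y i \<omega>))) (gm l (G \<omega> 1))"
    by (elim exE conjE) (rule that)
  have eq: "dx \<omega> = est (G \<omega>)" for \<omega>
    unfolding dx_def sigma_hat_cross_tr[OF refl refl scatter_carrier scatter_carrier] est_def
    using tr_mult2[OF scatter_carrier scatter_carrier G2[rule_format, THEN conjunct1] G2[rule_format, THEN conjunct2], of \<omega> \<omega>]
    by (simp add: k(5,6))
  interpret PP: prob_space PP
    unfolding PP_def by (intro prob_space_PiM) (auto intro: gauss.axioms(1)[OF gauss_pop])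
  have mom: "all_moments PP (\<lambda>w. est w - v PX PY)"
    by (intro PP.all_moments_diff am PP.all_moments_const)
  show "dx \<in> borel_measurable M"
    unfolding eq[abs_def] by (rule measurable_compose[OF Gm all_moments_measurable[OF am]])
  assume e: "0 < \<epsilon>"
  show "prob {\<omega> \<in> space M. \<epsilon> \<le> \<bar>dx \<omega> - v PX PY\<bar>} \<le> 12 * C / sqrt (4 * n - 1) / \<epsilon>"
  proof (rule prob_abs_ge_le[OF _ e])
    have i': "integrable (distr M PP G) (\<lambda>w. est w - v PX PY)" using all_moments_integrable[OF mom] by (simp only: G1)
    show "integrable M (\<lambda>\<omega>. dx \<omega> - v PX PY)"
      unfolding eq by (rule integrable_distr[OF Gm i'])
    have "(\<integral>\<omega>. \<bar>dx \<omega> - v PX PY\<bar> \<partial>M) = (\<integral>w. \<bar>est w - v PX PY\<bar> \<partial>distr M PP G)"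
      unfolding eq using all_moments_measurable[OF mom] by (intro integral_distr[symmetric] Gm) auto
    also have "\<dots> \<le> 5 * C / sqrt l" unfolding G1 v_tra by (rule bd)
    \<comment> \<open>5 is enlarged to 12 so that all three estimators share one form of
      bound.\<close>
    also have "\<dots> \<le> 12 * C / sqrt l" using C1 by (intro divide_right_mono) auto
    finally show "(\<integral>\<omega>. \<bar>dx \<omega> - v PX PY\<bar> \<partial>M) \<le> 12 * C / sqrt (4 * n - 1)" by (simp only: l_def)
  qed
qed

end

section \<open>Asymptotics\<close>

text \<open>The lower half of the comparison with \<delta> > 0 gives growth, the upper half with
  \<delta> < 1 gives smaller order than \<open>p\<close>.\<close>

lemma bigtheta_powr_limits:
  assumes f: "(\<lambda>p. real (f p)) \<in> \<Theta>(\<lambda>p. real p powr \<delta>)" and \<delta>: "0 < \<delta>" "\<delta> < 1"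
  shows "filterlim (\<lambda>p. real (f p)) at_top sequentially" and "(\<lambda>p. real (f p) / real p) \<longlonglongrightarrow> 0"
proof -
  have "(\<lambda>p. real p powr \<delta>) \<in> O(\<lambda>p. real (f p))" "(\<lambda>p. real (f p)) \<in> O(\<lambda>p. real p powr \<delta>)"
    using bigthetaD1[OF f] bigthetaD1[OF bigtheta_sym[THEN iffD1, OF f]] by simp_all
  then obtain c d where c: "0 < c" "\<forall>\<^sub>F p in sequentially. norm (real p powr \<delta>) \<le> c * norm (real (f p))"
    and d: "0 < d" "\<forall>\<^sub>F p in sequentially. norm (real (f p)) \<le> d * norm (real p powr \<delta>)"
    by (elim landau_o.bigE)
  have "filterlim (\<lambda>p. (1 / c) * (real p powr \<delta>)) at_top sequentially"
    using c(1) \<delta> by (intro filterlim_tendsto_pos_mult_at_top[OF tendsto_const]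
        filterlim_compose[OF real_powr_at_top filterlim_real_sequentially]) auto
  then show "filterlim (\<lambda>p. real (f p)) at_top sequentially"
    by (rule filterlim_at_top_mono) (use c in \<open>auto elim!: eventually_mono simp: field_simps\<close>)
  have "(\<lambda>p. real p powr (\<delta> - 1)) \<longlonglongrightarrow> 0"
    using \<delta> by (intro tendsto_neg_powr filterlim_real_sequentially) auto
  then have lim: "(\<lambda>p. d * real p powr (\<delta> - 1)) \<longlonglongrightarrow> 0" by (rule tendsto_mult_right_zero)
  show "(\<lambda>p. real (f p) / real p) \<longlonglongrightarrow> 0"
  proof (rule tendsto_sandwich[OF _ _ tendsto_const lim])
    show "\<forall>\<^sub>F p in sequentially. real (f p) / real p \<le> d * real p powr (\<delta> - 1)"
      using d(2) eventually_gt_at_top[of 0]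
      by eventually_elim (simp add: powr_diff divide_right_mono)
  qed simp
qed

lemma block_err_tendsto:
  assumes "filterlim (\<lambda>p. real (f p)) at_top sequentially" "(\<lambda>p. real (f p) / real p) \<longlonglongrightarrow> 0"
  shows "(\<lambda>p. block_err p (f p - 1)) \<longlonglongrightarrow> 0"
proof -
  have "filterlim (\<lambda>p. - 1 + real (f p)) at_top sequentially"
    by (rule filterlim_tendsto_add_at_top[OF tendsto_const assms(1)])
  then have g: "filterlim (\<lambda>p. real (f p - 1)) at_top sequentially"
    by (rule filterlim_at_top_mono) (auto intro!: always_eventually)
  have "(\<lambda>p. inverse (sqrt (real (f p - 1)))) \<longlonglongrightarrow> 0"
    by (intro tendsto_inverse_0_at_top filterlim_compose[OF sqrt_at_top g])
  from tendsto_add[OF this assms(2)]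
  have lim: "(\<lambda>p. inverse (sqrt (real (f p - 1))) + real (f p) / real p) \<longlonglongrightarrow> 0" by simp
  show ?thesis
    by (rule tendsto_sandwich[OF _ _ tendsto_const lim])
      (auto intro!: always_eventually divide_right_mono simp: block_err_def inverse_eq_divide)
qed

lemma inverse_sqrt_tendsto:
  assumes "filterlim (\<lambda>p. real (f p)) at_top sequentially"
  shows "(\<lambda>p. 1 / sqrt (real (4 * f p - 1))) \<longlonglongrightarrow> 0"
proof -
  have "filterlim (\<lambda>p. - 1 + real (f p)) at_top sequentially"
    by (rule filterlim_tendsto_add_at_top[OF tendsto_const assms])
  then have "filterlim (\<lambda>p. real (4 * f p - 1)) at_top sequentially"
    by (rule filterlim_at_top_mono) (auto intro!: always_eventually)
  from tendsto_inverse_0_at_top[OF filterlim_compose[OF sqrt_at_top this]] show ?thesis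
    by (simp add: inverse_eq_divide)
qed

lemma clt_err_tendsto:
  assumes "(\<eta> \<longlongrightarrow> 0) F"
  shows "((\<lambda>x. clt_err C (\<eta> x) t) \<longlongrightarrow> 0) F"
proof -
  have "((\<lambda>x. clt_err C (\<eta> x) t) \<longlongrightarrow> clt_err C 0 t) F"
    unfolding clt_err_def by (intro tendsto_intros assms)
  then show ?thesis by (simp add: clt_err_def)
qed

text \<open>The radius is \<open>2 * d\<close> because it is spent twice: the estimators are within
  \<open>d\<close> of the traces in dimension \<open>p\<close>, and those are within
  \<open>d\<close> of their limits.\<close>

lemma denominator_continuity:
  fixes s1 s2 s3 D \<epsilon> :: real
  assumes D: "D = sqrt (s1 * s2 * s3\<^sup>2 + s3 ^ 4)" "0 < D" and \<epsilon>: "0 < \<epsilon>"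
  shows "\<exists>d>0. \<forall>x y w. \<bar>x - s1\<bar> < 2 * d \<longrightarrow> \<bar>y - s2\<bar> < 2 * d \<longrightarrow> \<bar>w - s3\<bar> < 2 * d \<longrightarrow>
    \<bar>sqrt (x * y * w\<^sup>2 + w ^ 4) / D - 1\<bar> \<le> \<epsilon>"
proof -
  define g where "g = (\<lambda>q :: real \<times> real \<times> real. sqrt (fst q * fst (snd q) * (snd (snd q))\<^sup>2 + (snd (snd q)) ^ 4) / D)"
  have "isCont g (s1, s2, s3)" unfolding g_def using D(2) by (intro continuous_intros) auto
  moreover have "g (s1, s2, s3) = 1" using D by (simp add: g_def)
  ultimately obtain e where e: "0 < e" "\<And>q. dist q (s1, s2, s3) < e \<Longrightarrow> dist (g q) 1 < \<epsilon>"
    using \<epsilon> unfolding continuous_at_eps_delta by metis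
  show ?thesis
  \<comment> \<open>With d = e / 6 each of the three coordinates is off by less than e / 3, and the
    distance of triples is at most the sum.\<close>
  proof (intro exI[of _ "e / 6"] conjI allI impI)
    fix x y w assume a: "\<bar>x - s1\<bar> < 2 * (e / 6)" "\<bar>y - s2\<bar> < 2 * (e / 6)" "\<bar>w - s3\<bar> < 2 * (e / 6)"
    have "dist (x, y, w) (s1, s2, s3) \<le> dist x s1 + dist (y, w) (s2, s3)"
      unfolding dist_Pair_Pair[of x _ s1] by (rule sqrt_sum_squares_le_sum) auto
    also have "dist (y, w) (s2, s3) \<le> dist y s2 + dist w s3"
      unfolding dist_Pair_Pair[of y] by (rule sqrt_sum_squares_le_sum) auto
    finally have "dist (x, y, w) (s1, s2, s3) < e" using a by (simp add: dist_real_def)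
    from e(2)[OF this] show "\<bar>sqrt (x * y * w\<^sup>2 + w ^ 4) / D - 1\<bar> \<le> \<epsilon>" by (simp add: g_def dist_real_def)
  qed (use e in simp)
qed

lemma finite_pop: "finite (UNIV :: pop set)"
proof (rule finite_subset)
  show "(UNIV :: pop set) \<subseteq> {PX, PY}"
  proof
    fix x :: pop show "x \<in> {PX, PY}" by (cases x) auto
  qed
qed simp

text \<open>There are finitely many words of bounded length over two letters, and a convergent
  sequence is bounded. One constant thus serves all words and all \<open>p\<close>, not only large
  ones.\<close>

lemma uniform_trace_bound:
  fixes f :: "pop list \<Rightarrow> nat \<Rightarrow> real"
  assumes "\<And>w. length w \<in> {2..16} \<Longrightarrow> f w \<longlonglongrightarrow> \<sigma> w"
  shows "\<exists>C\<ge>1. \<forall>w p. length w \<in> {2..16} \<longrightarrow> \<bar>f w p\<bar> \<le> C"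
proof -
  define U where "U = {w :: pop list. length w \<in> {2..16}}"
  have "finite {w :: pop list. set w \<subseteq> UNIV \<and> length w \<le> 16}" by (rule finite_lists_length_le[OF finite_pop])
  then have fin: "finite U" by (rule rev_finite_subset) (auto simp: U_def)
  have "\<forall>w\<in>U. \<exists>K. 0 \<le> K \<and> (\<forall>p. \<bar>f w p\<bar> \<le> K)"
  proof
    fix w assume "w \<in> U"
    then have "Bseq (f w)" using assms by (intro convergent_imp_Bseq convergentI) (simp add: U_def)
    then show "\<exists>K. 0 \<le> K \<and> (\<forall>p. \<bar>f w p\<bar> \<le> K)" by (elim BseqE) (auto intro!: less_imp_le)
  qed
  from bchoice[OF this] obtain K where K: "\<forall>w\<in>U. 0 \<le> K w \<and> (\<forall>p. \<bar>f w p\<bar> \<le> K w)" ..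
  show ?thesis
  proof (intro exI[of _ "1 + sum K U"] conjI allI impI)
    show "1 \<le> 1 + sum K U" using K by (simp add: sum_nonneg)
    fix w :: "pop list" and p assume "length w \<in> {2..16}"
    then have w: "w \<in> U" by (simp add: U_def)
    have "K w \<le> sum K U" using K by (intro member_le_sum[OF w _ fin]) auto
    moreover have "\<bar>f w p\<bar> \<le> K w" using K w by blast
    ultimately show "\<bar>f w p\<bar> \<le> 1 + sum K U" by linarith
  qed
qed

section \<open>From one dimension to the limit\<close>

context large_two_samples
begin

lemma v_word: "v q r = tr (word_mat p (pop_cov Sx Sy) [q, r]) / p"
  using Sig_carrier[of q] Sig_carrier[of r] by (simp add: v_def word_mat_def)

text \<open>Everything the limit needs from one dimension, free of the locale's constants. Numerator
  and denominator for the worst split are existential, so that a choice over \<open>p\<close> yields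
  sequences. \<open>d\<close> and \<open>s1\<close>, \<open>s2\<close>, \<open>s3\<close> stay
  arbitrary because the neighbourhood of the limits is fixed only later, depending on
  \<epsilon>.\<close>

lemma fixed_split_summary:
  assumes D: "0 < D"
  defines "V \<equiv> \<lambda>q r. tr (word_mat p (pop_cov Sx Sy) [q, r]) / p"
    and "\<eta> \<equiv> 2 * (block_err p (m - 1) + block_err p (n - 1))"
  shows "\<exists>N De. N \<in> borel_measurable M \<and> De \<in> borel_measurable M \<and>
    \<bar>prob {\<omega> \<in> space M. z < T_stat p m n (cx \<omega>) (cy \<omega>) (\<lambda>i. X i \<omega>) (\<lambda>i. Y i \<omega>)} - \<alpha>\<bar>
      \<le> \<bar>prob {\<omega> \<in> space M. z < N \<omega> / De \<omega>} - \<alpha>\<bar> \<and>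
    (\<forall>t. cmod (char (distr M borel N) t
      - complex_of_real (exp (- ((t / D)\<^sup>2 * (V PX PX * V PY PY * (V PX PY)\<^sup>2 + V PX PY ^ 4) / 2)))) \<le> 2 * clt_err C \<eta> (t / D)) \<and>
    (\<forall>\<epsilon> d s1 s2 s3. 0 < d \<longrightarrow> \<bar>V PX PX - s1\<bar> < d \<longrightarrow> \<bar>V PY PY - s2\<bar> < d \<longrightarrow> \<bar>V PX PY - s3\<bar> < d \<longrightarrow>
      (\<forall>x y w. \<bar>x - s1\<bar> < 2 * d \<longrightarrow> \<bar>y - s2\<bar> < 2 * d \<longrightarrow> \<bar>w - s3\<bar> < 2 * d \<longrightarrow> \<bar>sqrt (x * y * w\<^sup>2 + w ^ 4) / D - 1\<bar> \<le> \<epsilon>) \<longrightarrow>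
      prob {\<omega> \<in> space M. \<epsilon> < \<bar>De \<omega> - 1\<bar>} \<le> 12 * C / d * (1 / sqrt (real (4 * m - 1)) + 2 * (1 / sqrt (real (4 * n - 1)))))"
proof -
  have Vv: "V q r = v q r" for q r by (simp add: V_def v_word)
  obtain a b where a: "a \<in> splits m" and b: "b \<in> splits n"
    and w: "\<bar>prob {\<omega> \<in> space M. z < T_stat p m n (cx \<omega>) (cy \<omega>) (\<lambda>i. X i \<omega>) (\<lambda>i. Y i \<omega>)} - \<alpha>\<bar> \<le> \<bar>prob (event z a b) - \<alpha>\<bar>"
    using worst_split[of z \<alpha>] by (elim bexE) (rule that)
  define N where "N \<omega> = (1 / D) * num a b \<omega>" for \<omega>
  define De where "De \<omega> = sqrt (ds PX \<omega> * ds PY \<omega> * (dx \<omega>)\<^sup>2 + dx \<omega> ^ 4) / D" for \<omega>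
  note [measurable] = char_num(1)[OF a b] same_concentration(1) cross_concentration(1)
  have m1: "N \<in> borel_measurable M" "De \<in> borel_measurable M" unfolding N_def[abs_def] De_def[abs_def] by measurable
  have "N \<omega> / De \<omega> = T_stat p m n a b (\<lambda>i. X i \<omega>) (\<lambda>i. Y i \<omega>)" for \<omega>
    unfolding T_stat_eq N_def De_def using D by simp
  then have ev: "event z a b = {\<omega> \<in> space M. z < N \<omega> / De \<omega>}" by (simp add: event_def)
  have ch: "cmod (char (distr M borel N) t
      - complex_of_real (exp (- ((t / D)\<^sup>2 * (V PX PX * V PY PY * (V PX PY)\<^sup>2 + V PX PY ^ 4) / 2)))) \<le> 2 * clt_err C \<eta> (t / D)" for t
    using char_num(2)[OF a b, of "1 / D" t] by (simp add: N_def[abs_def] Vv \<eta>_def)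
  have den: "prob {\<omega> \<in> space M. \<epsilon> < \<bar>De \<omega> - 1\<bar>} \<le> 12 * C / d * (1 / sqrt (real (4 * m - 1)) + 2 * (1 / sqrt (real (4 * n - 1))))"
    if d: "0 < d" and s: "\<bar>V PX PX - s1\<bar> < d" "\<bar>V PY PY - s2\<bar> < d" "\<bar>V PX PY - s3\<bar> < d"
      and cont: "\<forall>x y w. \<bar>x - s1\<bar> < 2 * d \<longrightarrow> \<bar>y - s2\<bar> < 2 * d \<longrightarrow> \<bar>w - s3\<bar> < 2 * d \<longrightarrow> \<bar>sqrt (x * y * w\<^sup>2 + w ^ 4) / D - 1\<bar> \<le> \<epsilon>"
    for \<epsilon> d s1 s2 s3
  proof -
    let ?A = "{\<omega> \<in> space M. d \<le> \<bar>ds PX \<omega> - v PX PX\<bar>}" and ?B = "{\<omega> \<in> space M. d \<le> \<bar>ds PY \<omega> - v PY PY\<bar>}"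
      and ?E = "{\<omega> \<in> space M. d \<le> \<bar>dx \<omega> - v PX PY\<bar>}"
    have sub: "{\<omega> \<in> space M. \<epsilon> < \<bar>De \<omega> - 1\<bar>} \<subseteq> ?A \<union> (?B \<union> ?E)"
    proof
      fix \<omega> assume \<omega>: "\<omega> \<in> {\<omega> \<in> space M. \<epsilon> < \<bar>De \<omega> - 1\<bar>}"
      show "\<omega> \<in> ?A \<union> (?B \<union> ?E)"
      proof (rule ccontr)
        assume "\<omega> \<notin> ?A \<union> (?B \<union> ?E)"
        then have "\<bar>ds PX \<omega> - v PX PX\<bar> < d" "\<bar>ds PY \<omega> - v PY PY\<bar> < d" "\<bar>dx \<omega> - v PX PY\<bar> < d"
          using \<omega> by (auto simp: not_le)
        then have "\<bar>ds PX \<omega> - s1\<bar> < 2 * d" "\<bar>ds PY \<omega> - s2\<bar> < 2 * d" "\<bar>dx \<omega> - s3\<bar> < 2 * d"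
          using s unfolding Vv by linarith+
        then have "\<bar>De \<omega> - 1\<bar> \<le> \<epsilon>" unfolding De_def using cont by blast
        then show False using \<omega> by simp
      qed
    qed
    have "prob {\<omega> \<in> space M. \<epsilon> < \<bar>De \<omega> - 1\<bar>} \<le> prob (?A \<union> (?B \<union> ?E))"
      by (rule finite_measure_mono[OF sub]) measurable
    also have "\<dots> \<le> prob ?A + prob (?B \<union> ?E)" by (rule measure_Un_le) measurable
    also have "prob (?B \<union> ?E) \<le> prob ?B + prob ?E" by (rule measure_Un_le) measurable
    finally have "prob {\<omega> \<in> space M. \<epsilon> < \<bar>De \<omega> - 1\<bar>} \<le> prob ?A + (prob ?B + prob ?E)" by simp
    moreover have "prob ?A \<le> 12 * C / d * (1 / sqrt (real (4 * m - 1)))"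
      using same_concentration(2)[OF d, of PX] by (simp add: size_def mult.commute)
    moreover have "prob ?B \<le> 12 * C / d * (1 / sqrt (real (4 * n - 1)))"
      using same_concentration(2)[OF d, of PY] by (simp add: size_def mult.commute)
    moreover have "prob ?E \<le> 12 * C / d * (1 / sqrt (real (4 * n - 1)))"
      using cross_concentration(2)[OF d] by (simp add: mult.commute)
    ultimately show ?thesis by (simp add: distrib_left)
  qed
  show ?thesis
    by (rule exI[of _ N], rule exI[of _ De]) (intro conjI allI impI m1 ch w[unfolded ev] den; blast)
qed

end

theorem corollary3p2:
  fixes M :: "nat \<Rightarrow> 'a measure"
    and m n :: "nat \<Rightarrow> nat"
    and \<mu>x \<mu>y :: "nat \<Rightarrow> real Matrix.vec"
    and \<Sigma>x \<Sigma>y :: "nat \<Rightarrow> real mat"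
    and X Y :: "nat \<Rightarrow> nat \<Rightarrow> 'a \<Rightarrow> nat \<Rightarrow> real"
    and cx cy :: "nat \<Rightarrow> 'a \<Rightarrow> nat \<Rightarrow> nat"
    and \<sigma> :: "pop list \<Rightarrow> real"
    and \<delta> \<alpha> :: real
  assumes "0 < \<alpha>" "\<alpha> < 1" "0 < \<delta>" "\<delta> < 1"
    and "\<And>p. 1 \<le> p \<Longrightarrow> 1 \<le> m p" "\<And>p. 1 \<le> p \<Longrightarrow> 1 \<le> n p"
    and "\<And>p. 1 \<le> p \<Longrightarrow> \<mu>x p \<in> carrier_vec p" "\<And>p. 1 \<le> p \<Longrightarrow> \<mu>y p \<in> carrier_vec p"
    and "\<And>p. 1 \<le> p \<Longrightarrow> pos_def p (\<Sigma>x p)" "\<And>p. 1 \<le> p \<Longrightarrow> pos_def p (\<Sigma>y p)"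
    and sampling: "\<And>p. 1 \<le> p \<Longrightarrow>
          two_sample_experiment (M p) p (m p) (n p) (\<mu>x p) (\<Sigma>x p) (\<mu>y p) (\<Sigma>y p)
            (X p) (Y p) (cx p) (cy p)"
    and "(\<lambda>p. real (m p)) \<in> \<Theta>(\<lambda>p. real p powr \<delta>)"
    and "(\<lambda>p. real (n p)) \<in> \<Theta>(\<lambda>p. real p powr \<delta>)"
    and moments: "\<And>w. length w \<in> {2..16} \<Longrightarrow>
          (\<lambda>p. tr (word_mat p (pop_cov (\<Sigma>x p) (\<Sigma>y p)) w) / real p) \<longlonglongrightarrow> \<sigma> w"
    and moments_pos: "\<And>w. length w \<in> {2..5} \<Longrightarrow> 0 < \<sigma> w"
    and H0: "\<And>p. 1 \<le> p \<Longrightarrow> \<Sigma>x p * \<Sigma>y p = \<Sigma>y p * \<Sigma>x p"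
  shows "(\<lambda>p. measure (M p)
            {\<omega> \<in> space (M p).
               T_stat p (m p) (n p) (cx p \<omega>) (cy p \<omega>) (\<lambda>i. X p i \<omega>) (\<lambda>i. Y p i \<omega>)
                 > std_normal_quantile (1 - \<alpha>)}) \<longlonglongrightarrow> \<alpha>"
proof -
  note hyps = assms
  define z where "z = std_normal_quantile (1 - \<alpha>)"
  define W where "W w p = tr (word_mat p (pop_cov (\<Sigma>x p) (\<Sigma>y p)) w) / real p" for w p
  have Wlim: "W w \<longlonglongrightarrow> \<sigma> w" if "length w \<in> {2..16}" for w
    using moments[OF that] by (simp add: W_def[abs_def])
  obtain C where C: "1 \<le> C" and C': "\<forall>w p. length w \<in> {2..16} \<longrightarrow> \<bar>W w p\<bar> \<le> C"
  proof -
    have "\<exists>C\<ge>1. \<forall>w p. length w \<in> {2..16} \<longrightarrow> \<bar>W w p\<bar> \<le> C"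
      by (rule uniform_trace_bound[of W \<sigma>]) (rule Wlim)
    then show thesis by (elim exE conjE) (rule that)
  qed
  note mlim = bigtheta_powr_limits[OF hyps(12,3,4)] and nlim = bigtheta_powr_limits[OF hyps(13,3,4)]
  \<comment> \<open>From some dimension on the sizes satisfy the locale: m, n \<ge> 2 by growth, and
    4 m, 4 n \<le> p because the ratios tend to 0.\<close>
  have "\<forall>\<^sub>F p in sequentially. 1 \<le> p \<and> 2 \<le> m p \<and> 2 \<le> n p \<and> 4 * m p \<le> p \<and> 4 * n p \<le> p"
  proof -
    have "\<forall>\<^sub>F p in sequentially. real (m p) / real p < 1 / 4" "\<forall>\<^sub>F p in sequentially. real (n p) / real p < 1 / 4"
      by (rule order_tendstoD(2)[OF mlim(2)] order_tendstoD(2)[OF nlim(2)], simp)+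
    moreover have "\<forall>\<^sub>F p in sequentially. 2 \<le> real (m p)" "\<forall>\<^sub>F p in sequentially. 2 \<le> real (n p)"
      using mlim(1)[unfolded filterlim_at_top] nlim(1)[unfolded filterlim_at_top] by blast+
    ultimately show ?thesis using eventually_ge_at_top[of 1]
      by eventually_elim (simp add: field_simps)
  qed
  then obtain p1 where p1: "\<And>p. p1 \<le> p \<Longrightarrow> 1 \<le> p \<and> 2 \<le> m p \<and> 2 \<le> n p \<and> 4 * m p \<le> p \<and> 4 * n p \<le> p"
    by (auto simp: eventually_sequentially)
  have large: "large_two_samples (M p) p (m p) (n p) (\<mu>x p) (\<mu>y p) (\<Sigma>x p) (\<Sigma>y p) (X p) (Y p) (cx p) (cy p) C"
    if "p1 \<le> p" for p
  proof -
    have g: "1 \<le> p" "2 \<le> m p" "2 \<le> n p" "4 * m p \<le> p" "4 * n p \<le> p" using p1[OF that] by auto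
    show ?thesis
    proof (intro large_two_samples.intro two_samples.intro large_two_samples_axioms.intro)
      fix w :: "pop list" assume "2 \<le> length w" "length w \<le> 16"
      then have "\<bar>W w p\<bar> \<le> C" using C' by simp
      then show "\<bar>tr (word_mat p (pop_cov (\<Sigma>x p) (\<Sigma>y p)) w)\<bar> \<le> C * real p"
        using g(1) by (simp add: W_def abs_divide field_simps)
    qed (use g C hyps(5-10)[of p] sampling[OF g(1)] H0[OF g(1)] in auto)
  qed
  \<comment> \<open>Only limits of two-letter words enter the variance; their positivity makes the
    limiting denominator \<open>D\<close> positive.\<close>
  define s1 s2 s3 where "s1 = \<sigma> [PX, PX]" and "s2 = \<sigma> [PY, PY]" and "s3 = \<sigma> [PX, PY]"
  have s0: "0 < s1" "0 < s2" "0 < s3" unfolding s1_def s2_def s3_def by (rule moments_pos, simp)+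
  define D2 where "D2 = s1 * s2 * s3\<^sup>2 + s3 ^ 4"
  define D where "D = sqrt D2"
  have "0 < D2" unfolding D2_def using s0 by (intro add_pos_pos mult_pos_pos zero_less_power)
  then have D: "0 < D" "D\<^sup>2 = D2" by (simp_all add: D_def)
  define \<eta> where "\<eta> p = 2 * (block_err p (m p - 1) + block_err p (n p - 1))" for p
  define Pr where "Pr p = measure (M p) {\<omega> \<in> space (M p). z < T_stat p (m p) (n p) (cx p \<omega>) (cy p \<omega>) (\<lambda>i. X p i \<omega>) (\<lambda>i. Y p i \<omega>)}" for p
  define V where "V p = W [PX, PX] p * W [PY, PY] p * (W [PX, PY] p)\<^sup>2 + W [PX, PY] p ^ 4" for p
  define rate where "rate p = 1 / sqrt (real (4 * m p - 1)) + 2 * (1 / sqrt (real (4 * n p - 1)))" for p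
  \<comment> \<open>\<open>Pr\<close> is the probability with random splits, not that of N / De; its
    distance from \<alpha> is dominated by the distance for the worst fixed split in the same
    dimension.\<close>
  define ok where "ok p N De \<longleftrightarrow> N \<in> borel_measurable (M p) \<and> De \<in> borel_measurable (M p) \<and>
    \<bar>Pr p - \<alpha>\<bar> \<le> \<bar>measure (M p) {\<omega> \<in> space (M p). z < N \<omega> / De \<omega>} - \<alpha>\<bar> \<and>
    (\<forall>t. cmod (char (distr (M p) borel N) t - complex_of_real (exp (- ((t / D)\<^sup>2 * V p / 2)))) \<le> 2 * clt_err C (\<eta> p) (t / D)) \<and>
    (\<forall>\<epsilon> d s1 s2 s3. 0 < d \<longrightarrow> \<bar>W [PX, PX] p - s1\<bar> < d \<longrightarrow> \<bar>W [PY, PY] p - s2\<bar> < d \<longrightarrow> \<bar>W [PX, PY] p - s3\<bar> < d \<longrightarrow>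
      (\<forall>x y w. \<bar>x - s1\<bar> < 2 * d \<longrightarrow> \<bar>y - s2\<bar> < 2 * d \<longrightarrow> \<bar>w - s3\<bar> < 2 * d \<longrightarrow> \<bar>sqrt (x * y * w\<^sup>2 + w ^ 4) / D - 1\<bar> \<le> \<epsilon>) \<longrightarrow>
      measure (M p) {\<omega> \<in> space (M p). \<epsilon> < \<bar>De \<omega> - 1\<bar>} \<le> 12 * C / d * rate p)"
    for p and N De :: "'a \<Rightarrow> real"
  have "\<forall>i. \<exists>q. ok (i + p1) (fst q) (snd q)"
  proof
    fix i
    have "\<exists>N De. ok (i + p1) N De"
      unfolding ok_def Pr_def V_def W_def \<eta>_def rate_def
      by (rule large_two_samples.fixed_split_summary[OF large D(1)]) simp
    then obtain N De where "ok (i + p1) N De" by (elim exE) (rule that)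
    then show "\<exists>q. ok (i + p1) (fst q) (snd q)" by (intro exI[of _ "(N, De)"]) simp
  qed
  from choice[OF this] obtain q where q: "\<forall>i. ok (i + p1) (fst (q i)) (snd (q i))" ..
  \<comment> \<open>The worst split depends on the dimension, so it is picked by choice for every
    \<open>p\<close> from \<open>p1\<close> on; the shift makes the sequences start at 0.\<close>
  define Mi Ni Di where "Mi i = M (i + p1)" and "Ni i = fst (q i)" and "Di i = snd (q i)" for i
  note ok = q[rule_format, unfolded ok_def, folded Ni_def Di_def Mi_def]
  have shift: "filterlim (\<lambda>i. i + p1) sequentially sequentially" by (rule filterlim_add_const_nat_at_top)
  have Wi: "(\<lambda>i. W w (i + p1)) \<longlonglongrightarrow> \<sigma> w" if "length w = 2" for w
    using filterlim_compose[OF Wlim shift] that by simp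
  have \<eta>0: "\<eta> \<longlonglongrightarrow> 0"
  proof -
    have "(\<lambda>p. 2 * (block_err p (m p - 1) + block_err p (n p - 1))) \<longlonglongrightarrow> 2 * (0 + 0)"
      by (intro tendsto_intros block_err_tendsto mlim nlim)
    then show ?thesis by (simp add: \<eta>_def[abs_def])
  qed
  have rate0: "rate \<longlonglongrightarrow> 0"
  proof -
    have "(\<lambda>p. 1 / sqrt (real (4 * m p - 1)) + 2 * (1 / sqrt (real (4 * n p - 1)))) \<longlonglongrightarrow> 0 + 2 * 0"
      by (intro tendsto_add tendsto_mult tendsto_const inverse_sqrt_tendsto mlim nlim)
    then show ?thesis by (simp add: rate_def[abs_def])
  qed
  have "(\<lambda>i. measure (Mi i) {\<omega> \<in> space (Mi i). z < Ni i \<omega> / Di i \<omega>}) \<longlonglongrightarrow> 1 - cdf std_normal_distribution z"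
  proof (rule slutsky_quotient)
    show "prob_space (Mi i)" for i
      using sampling[of "i + p1"] p1[of "i + p1"] by (simp add: two_sample_experiment_def Mi_def)
    show "Ni i \<in> borel_measurable (Mi i)" "Di i \<in> borel_measurable (Mi i)" for i
      using ok[of i] by blast+
    show "(\<lambda>i. char (distr (Mi i) borel (Ni i)) t) \<longlonglongrightarrow> char std_normal_distribution t" for t
    proof -
      have "V \<longlonglongrightarrow> D2" unfolding V_def[abs_def] D2_def s1_def s2_def s3_def
        by (intro tendsto_intros Wlim) simp_all
      then have "(\<lambda>i. exp (- ((t / D)\<^sup>2 * V (i + p1) / 2))) \<longlonglongrightarrow> exp (- ((t / D)\<^sup>2 * D2 / 2))"
        by (intro tendsto_intros filterlim_compose[OF _ shift]) simp_all
      \<comment> \<open>Divided by the limiting denominator, the numerator has limiting variance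
        1.\<close>
      moreover have "(t / D)\<^sup>2 * D2 = t\<^sup>2" using D by (simp add: power_divide flip: D(2))
      ultimately have l1: "(\<lambda>i. complex_of_real (exp (- ((t / D)\<^sup>2 * V (i + p1) / 2)))) \<longlonglongrightarrow> char std_normal_distribution t"
        by (simp add: char_std_normal_distribution tendsto_of_real_iff)
      have l2: "(\<lambda>i. 2 * clt_err C (\<eta> (i + p1)) (t / D)) \<longlonglongrightarrow> 0"
        by (intro tendsto_mult_right_zero clt_err_tendsto filterlim_compose[OF \<eta>0 shift])
      have "(\<lambda>i. char (distr (Mi i) borel (Ni i)) t - complex_of_real (exp (- ((t / D)\<^sup>2 * V (i + p1) / 2)))) \<longlonglongrightarrow> 0"
        by (rule Lim_null_comparison[OF always_eventually l2]) (use ok in blast)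
      from tendsto_add[OF this l1] show ?thesis by simp
    qed
    fix \<epsilon> :: real assume "0 < \<epsilon>"
    obtain d where d: "0 < d" "\<forall>x y w. \<bar>x - s1\<bar> < 2 * d \<longrightarrow> \<bar>y - s2\<bar> < 2 * d \<longrightarrow> \<bar>w - s3\<bar> < 2 * d \<longrightarrow>
        \<bar>sqrt (x * y * w\<^sup>2 + w ^ 4) / D - 1\<bar> \<le> \<epsilon>"
      using denominator_continuity[OF D_def[unfolded D2_def] D(1) \<open>0 < \<epsilon>\<close>] by (elim exE conjE) (rule that)
    have l: "(\<lambda>i. 12 * C / d * rate (i + p1)) \<longlonglongrightarrow> 0"
      by (intro tendsto_mult_right_zero filterlim_compose[OF rate0 shift])
    have near: "\<forall>\<^sub>F i in sequentially. \<bar>W w (i + p1) - \<sigma> w\<bar> < d" if "length w = 2" for w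
      using tendstoD[OF Wi[OF that] d(1)] by (simp add: dist_real_def)
    show "(\<lambda>i. measure (Mi i) {\<omega> \<in> space (Mi i). \<epsilon> < \<bar>Di i \<omega> - 1\<bar>}) \<longlonglongrightarrow> 0"
    proof (rule tendsto_sandwich[OF always_eventually _ tendsto_const l])
      have "\<forall>\<^sub>F i in sequentially. \<bar>W [PX, PX] (i + p1) - s1\<bar> < d" "\<forall>\<^sub>F i in sequentially. \<bar>W [PY, PY] (i + p1) - s2\<bar> < d"
        "\<forall>\<^sub>F i in sequentially. \<bar>W [PX, PY] (i + p1) - s3\<bar> < d"
        unfolding s1_def s2_def s3_def by (rule near, simp)+
      then show "\<forall>\<^sub>F i in sequentially. measure (Mi i) {\<omega> \<in> space (Mi i). \<epsilon> < \<bar>Di i \<omega> - 1\<bar>} \<le> 12 * C / d * rate (i + p1)"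
      proof eventually_elim
        case (elim i)
        show ?case
          by (rule ok[of i, THEN conjunct2, THEN conjunct2, THEN conjunct2, THEN conjunct2, rule_format, of d s1 s2 s3 \<epsilon>])
            (use d elim in auto)
      qed
    qed simp
  qed
  moreover have "1 - cdf std_normal_distribution z = \<alpha>"
    unfolding z_def using hyps(1,2) by (subst std_normal_cdf_quantile) auto
  ultimately have "(\<lambda>i. measure (Mi i) {\<omega> \<in> space (Mi i). z < Ni i \<omega> / Di i \<omega>} - \<alpha>) \<longlonglongrightarrow> 0"
    by (simp add: LIM_zero_iff)
  then have "(\<lambda>i. \<bar>measure (Mi i) {\<omega> \<in> space (Mi i). z < Ni i \<omega> / Di i \<omega>} - \<alpha>\<bar>) \<longlonglongrightarrow> 0"
    by (rule tendsto_rabs_zero)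
  \<comment> \<open>Domination by the worst fixed split carries the limit over to the random
    splits.\<close>
  then have "(\<lambda>i. Pr (i + p1) - \<alpha>) \<longlonglongrightarrow> 0"
    by (rule Lim_null_comparison[rotated]) (use ok in \<open>auto intro!: always_eventually\<close>)
  then have "(\<lambda>i. Pr (i + p1)) \<longlonglongrightarrow> \<alpha>" by (simp add: LIM_zero_iff)
  then have "Pr \<longlonglongrightarrow> \<alpha>" by (rule LIMSEQ_offset)
  then show ?thesis by (simp add: Pr_def[abs_def] z_def)
qed


end
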